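(* Let $A$ be a compactly generated locally compact abelian group. Every sheer LC $A$-module $M$ has a unique decomposition as a topological direct sum of closed submodules $M=P\oplus E\oplus V$ with $P$ polycontractable, $E$ amorphic and $V$ distal Euclidean.
   Context: An LC $A$-module is an LCA group $M$ with a continuous action of the LCA group $A$ by topological automorphisms. Compact parafinite: compact with no nonzero finite quotient module; purely discrete: discrete with no nonzero finite submodule. $\mathrm{W}^\flat(M)$ is the sum of all compact parafinite submodules; $\Omega^\sharp(M)$ is the intersection of all open submodules $U$ with $M/U$ purely discrete; $M$ is sheer if $\mathrm{W}^\flat(M)=0$ and $\Omega^\sharp(M)=M$. An automorphism $\phi$ of an LC group is contracting if $\phi^n(x)\to 0$ as $n\to+\infty$ for every $x$ (uniformly on compact sets). $M$ is contractable if some $a\in A$ acts on $M$ as a contracting automorphism; polycontractable if it is a finite topological direct sum of closed contractable submodules (possibly contracted by different elements). $M$ is amorphic if it is sheer and has a compact open submodule. $M$ is Euclidean if its underlying group is isomorphic to $\mathbf{R}^d$ for some $d$, and distal Euclidean if moreover every element of $A$ acts by a linear map all of whose complex eigenvalues have modulus $1$. *)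

theory Defs
  imports "HOL-Analysis.Analysis"
begin

definition add_subgroup :: "'m::ab_group_add set \<Rightarrow> bool" where
  "add_subgroup H \<longleftrightarrow> 0 \<in> H \<and> (\<forall>x\<in>H. \<forall>y\<in>H. x + y \<in> H) \<and> (\<forall>x\<in>H. - x \<in> H)"

definition generated_subgroup :: "'m::ab_group_add set \<Rightarrow> 'm set" where
  "generated_subgroup K = \<Inter>{H. add_subgroup H \<and> K \<subseteq> H}"

definition LCA_group :: "'a::{topological_ab_group_add, t2_space} itself \<Rightarrow> bool" where
  "LCA_group _ \<longleftrightarrow> locally compact (UNIV :: 'a set)"

definition compactly_generated :: "'a::{topological_ab_group_add, t2_space} itself \<Rightarrow> bool" where
  "compactly_generated _ \<longleftrightarrow> (\<exists>K::'a set. compact K \<and> generated_subgroup K = UNIV)"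

definition LC_module ::
  "('a::{topological_ab_group_add, t2_space} \<Rightarrow> 'm::{topological_ab_group_add, t2_space} \<Rightarrow> 'm) \<Rightarrow> bool" where
  "LC_module act \<longleftrightarrow>
     LCA_group TYPE('a) \<and> LCA_group TYPE('m) \<and>
     continuous_on UNIV (\<lambda>(a, x). act a x) \<and>
     (\<forall>a x y. act a (x + y) = act a x + act a y) \<and>
     (\<forall>x. act 0 x = x) \<and>
     (\<forall>a b x. act (a + b) x = act a (act b x))"

text \<open>Submodules of a submodule S (everything relative to a carrier S with the subspace topology).\<close>
definition submodule :: "('a \<Rightarrow> 'm::ab_group_add \<Rightarrow> 'm) \<Rightarrow> 'm set \<Rightarrow> 'm set \<Rightarrow> bool" where
  "submodule act S N \<longleftrightarrow> N \<subseteq> S \<and> add_subgroup N \<and> (\<forall>a. \<forall>x\<in>N. act a x \<in> N)"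

definition closed_submodule :: "('a \<Rightarrow> 'm::{ab_group_add,topological_space} \<Rightarrow> 'm) \<Rightarrow> 'm set \<Rightarrow> 'm set \<Rightarrow> bool" where
  "closed_submodule act S N \<longleftrightarrow> submodule act S N \<and> closedin (top_of_set S) N"

definition open_submodule :: "('a \<Rightarrow> 'm::{ab_group_add,topological_space} \<Rightarrow> 'm) \<Rightarrow> 'm set \<Rightarrow> 'm set \<Rightarrow> bool" where
  "open_submodule act S N \<longleftrightarrow> submodule act S N \<and> openin (top_of_set S) N"

definition cosets :: "'m::ab_group_add set \<Rightarrow> 'm set \<Rightarrow> 'm set set" where
  "cosets K L = (\<lambda>x. (+) x ` L) ` K"

text \<open>Compact parafinite: compact with no nonzero finite quotient module
  (quotients by closed submodules L, so that the quotient is Hausdorff).\<close>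
definition compact_parafinite :: "('a \<Rightarrow> 'm::{ab_group_add,topological_space} \<Rightarrow> 'm) \<Rightarrow> 'm set \<Rightarrow> bool" where
  "compact_parafinite act K \<longleftrightarrow> compact K \<and>
     (\<forall>L. closed_submodule act K L \<and> finite (cosets K L) \<longrightarrow> L = K)"

text \<open>Purely discrete quotient S/U (U an open submodule of S, so S/U is discrete):
  no nonzero finite submodule, i.e. every submodule F of S containing U with F/U finite equals U.\<close>
definition purely_discrete_quotient :: "('a \<Rightarrow> 'm::ab_group_add \<Rightarrow> 'm) \<Rightarrow> 'm set \<Rightarrow> 'm set \<Rightarrow> bool" where
  "purely_discrete_quotient act S U \<longleftrightarrow>
     (\<forall>F. submodule act S F \<and> U \<subseteq> F \<and> finite (cosets F U) \<longrightarrow> F = U)"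

definition W_flat :: "('a \<Rightarrow> 'm::{ab_group_add,topological_space} \<Rightarrow> 'm) \<Rightarrow> 'm set \<Rightarrow> 'm set" where
  "W_flat act S = generated_subgroup (\<Union>{K. submodule act S K \<and> compact_parafinite act K})"

definition Omega_sharp :: "('a \<Rightarrow> 'm::{ab_group_add,topological_space} \<Rightarrow> 'm) \<Rightarrow> 'm set \<Rightarrow> 'm set" where
  "Omega_sharp act S = \<Inter>{U. open_submodule act S U \<and> purely_discrete_quotient act S U}"

definition sheer :: "('a \<Rightarrow> 'm::{ab_group_add,topological_space} \<Rightarrow> 'm) \<Rightarrow> 'm set \<Rightarrow> bool" where
  "sheer act S \<longleftrightarrow> W_flat act S = {0} \<and> Omega_sharp act S = S"

definition contracting_on :: "'m::{zero,topological_space} set \<Rightarrow> ('m \<Rightarrow> 'm) \<Rightarrow> bool" where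
  "contracting_on N phi \<longleftrightarrow>
     (\<forall>K. K \<subseteq> N \<and> compact K \<longrightarrow>
        (\<forall>W. open W \<and> 0 \<in> W \<longrightarrow> (\<forall>\<^sub>F n in sequentially. (phi ^^ n) ` K \<subseteq> W)))"

definition contractable :: "('a \<Rightarrow> 'm::{ab_group_add,topological_space} \<Rightarrow> 'm) \<Rightarrow> 'm set \<Rightarrow> bool" where
  "contractable act N \<longleftrightarrow> (\<exists>a. contracting_on N (act a))"

definition polycontractable :: "('a \<Rightarrow> 'm::{ab_group_add,topological_space} \<Rightarrow> 'm) \<Rightarrow> 'm set \<Rightarrow> bool" where
  "polycontractable act P \<longleftrightarrow>
     (\<exists>(k::nat) (Ns :: nat \<Rightarrow> 'm set).
        (\<forall>i<k. closed_submodule act P (Ns i) \<and> contractable act (Ns i)) \<and>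
        (\<exists>g. homeomorphism (PiE {..<k} Ns) P (\<lambda>x. \<Sum>i<k. x i) g))"

definition amorphic :: "('a \<Rightarrow> 'm::{ab_group_add,topological_space} \<Rightarrow> 'm) \<Rightarrow> 'm set \<Rightarrow> bool" where
  "amorphic act E \<longleftrightarrow> sheer act E \<and>
     (\<exists>U. submodule act E U \<and> compact U \<and> openin (top_of_set E) U)"

text \<open>R^d, modelled as the real sequences supported in {..<d} with the product topology.\<close>
definition Rd :: "nat \<Rightarrow> (nat \<Rightarrow> real) set" where
  "Rd d = {x. \<forall>i\<ge>d. x i = 0}"

definition Euclidean_iso :: "'m::{ab_group_add,topological_space} set \<Rightarrow> nat \<Rightarrow> ('m \<Rightarrow> nat \<Rightarrow> real) \<Rightarrow> ((nat \<Rightarrow> real) \<Rightarrow> 'm) \<Rightarrow> bool" where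
  "Euclidean_iso V d f g \<longleftrightarrow> homeomorphism V (Rd d) f g \<and> (\<forall>x\<in>V. \<forall>y\<in>V. f (x + y) = (\<lambda>i. f x i + f y i))"

definition Euclidean :: "'m::{ab_group_add,topological_space} set \<Rightarrow> bool" where
  "Euclidean V \<longleftrightarrow> (\<exists>d f g. Euclidean_iso V d f g)"

definition complex_eigenvalue :: "nat \<Rightarrow> ((nat \<Rightarrow> real) \<Rightarrow> (nat \<Rightarrow> real)) \<Rightarrow> complex \<Rightarrow> bool" where
  "complex_eigenvalue d T lam \<longleftrightarrow>
     (\<exists>z :: nat \<Rightarrow> complex. (\<exists>i<d. z i \<noteq> 0) \<and>
        (\<forall>i<d. (\<Sum>j<d. complex_of_real (T (\<lambda>l. if l = j then 1 else 0) i) * z j) = lam * z i))"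

definition linear_on_Rd :: "nat \<Rightarrow> ((nat \<Rightarrow> real) \<Rightarrow> (nat \<Rightarrow> real)) \<Rightarrow> bool" where
  "linear_on_Rd d T \<longleftrightarrow> (\<forall>x\<in>Rd d. T x \<in> Rd d) \<and>
     (\<forall>x\<in>Rd d. \<forall>y\<in>Rd d. T (\<lambda>i. x i + y i) = (\<lambda>i. T x i + T y i)) \<and>
     (\<forall>c. \<forall>x\<in>Rd d. T (\<lambda>i. c * x i) = (\<lambda>i. c * T x i))"

definition distal_Euclidean :: "('a \<Rightarrow> 'm::{ab_group_add,topological_space} \<Rightarrow> 'm) \<Rightarrow> 'm set \<Rightarrow> bool" where
  "distal_Euclidean act V \<longleftrightarrow>
     (\<exists>d f g. Euclidean_iso V d f g \<and>
        (\<forall>a. let T = (\<lambda>x. f (act a (g x))) in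
               linear_on_Rd d T \<and> (\<forall>lam. complex_eigenvalue d T lam \<longrightarrow> cmod lam = 1)))"

definition top_direct_sum3 :: "'m::{ab_group_add,topological_space} set \<Rightarrow> 'm set \<Rightarrow> 'm set \<Rightarrow> bool" where
  "top_direct_sum3 P E V \<longleftrightarrow> (\<exists>g. homeomorphism (P \<times> E \<times> V) UNIV (\<lambda>(p, e, v). p + e + v) g)"

end

theory Submission
  imports Defs "HOL-Computational_Algebra.Fundamental_Theorem_Algebra"
begin

text \<open>
  Let \<open>V\<^sub>0\<close> be the union of the one-parameter subgroups of \<open>M\<close> and \<open>M\<^sub>e\<close> the set of elements lying in a compact
  subgroup. Real characters of a compactly generated open subgroup, together with the absence of compact
  parafinite submodules (which makes \<open>M\<^sub>e\<close> totally disconnected), show that \<open>V\<^sub>0\<close> is Euclidean and that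
  \<open>V\<^sub>0 \<oplus> M\<^sub>e\<close> is open; since \<open>M\<close> has no proper open submodule with purely discrete quotient, \<open>M = V\<^sub>0 \<oplus> M\<^sub>e\<close>.

  For a single \<open>a\<close>, Willis' tidying procedure splits \<open>M\<^sub>e\<close> into the subgroup contracted by \<open>a\<close>, the one
  contracted by \<open>-a\<close>, and the elements with relatively compact \<open>a\<close>-orbit. As \<open>A\<close> is compactly generated, it is
  generated by a neighbourhood of \<open>0\<close> stabilising a compact open subgroup and finitely many further elements; splitting along
  these leaves a summand with a compact open submodule, the amorphic part. On \<open>V\<^sub>0\<close>, Fitting's
  lemma for the real quadratic polynomial of an eigenvalue of modulus different from \<open>1\<close> splits off a contractable
  summand, until only a distal one remains.

  For uniqueness, every equivariant continuous homomorphism between summands of different kinds is zero.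
\<close>

subsection \<open>Topological abelian groups\<close>

text \<open>Sheerness speaks only of submodules for all of \<open>A\<close>, while the structure
  theory has to exclude compact subgroups invariant under one element, or under nothing. As
  \<open>A\<close> is commutative, its action permutes the compact subgroups that are parafinite
  relative to a fixed \<open>B\<close>; once all of these lie in one compact subgroup, the closure
  of their sum is a parafinite submodule and vanishes. Every use of \<open>W_flat\<close> is thereby
  reduced to a uniform bound: the compact kernel of the real characters for empty \<open>B\<close>,
  and a bound on points that end in a compact open subgroup in both time directions for
  \<open>B = {a, - a}\<close>. The condition on \<open>Omega_sharp\<close> enters by showing that a
  suitable open submodule has no proper finite extension. The groups need not be sigma-compact, so
  algebraic complements are not automatically topological; summands are therefore carried as
  continuous equivariant idempotents, whose continuity is proved at 0 from local splittings. These
  idempotents commute since each dynamical piece is preserved by every such map, and this lets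
  splittings for several elements be composed.\<close>

definition zm :: "int => 'm::ab_group_add => 'm" where
  "zm k x = (if 0 \<le> k then (\<Sum>i<nat k. x) else - (\<Sum>i<nat (-k). x))"

lemma zm_0 [simp]: "zm 0 x = 0" and zm_1 [simp]: "zm 1 x = x"
  by (auto simp: zm_def)

lemma zm_succ: "zm (k + 1) x = zm k x + x"
proof (cases "0 \<le> k")
  case True
  then have "nat (k + 1) = Suc (nat k)" by simp
  then show ?thesis using True by (simp add: zm_def)
next
  case False
  then have "nat (- k) = Suc (nat (- (k + 1)))" by simp
  then show ?thesis using False by (auto simp: zm_def)
qed

lemma zm_pred: "zm (k - 1) x = zm k x - x"
  using zm_succ[of "k - 1" x] by (simp add: algebra_simps)

lemma zm_add: "zm (k + l) x = zm k x + zm l x"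
proof (induction l rule: int_induct[where k = 0])
  case (step1 i)
  then show ?case using zm_succ[of "k + i" x] zm_succ[of i x] by (simp add: add.assoc)
next
  case (step2 i)
  then show ?case using zm_pred[of "k + i" x] zm_pred[of i x] by (simp add: add_diff_eq)
qed simp

lemma zm_add_right: "zm k (x + y) = zm k x + zm k y"
  by (induction k rule: int_induct[where k = 0]) (simp_all add: zm_succ zm_pred algebra_simps)

lemma zm_minus [simp]: "zm (- k) x = - zm k x"
  using zm_add[of "-k" k x] by (simp add: eq_neg_iff_add_eq_0)

lemma zm_diff: "zm (k - l) x = zm k x - zm l x"
  using zm_add[of k "-l" x] by simp

lemma zm_mult: "zm (k * l) x = zm k (zm l x)"
  by (induction k rule: int_induct[where k = 0])
    (simp_all add: zm_succ zm_pred zm_add zm_diff algebra_simps)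

lemma zm_zero [simp]: "zm k 0 = 0"
  using zm_add_right[of k 0 0] by simp

lemma zm_neg_right [simp]: "zm k (- x) = - zm k x"
  using zm_add_right[of k "-x" x] by (simp add: eq_neg_iff_add_eq_0)

lemma zm_diff_right: "zm k (x - y) = zm k x - zm k y"
  using zm_add_right[of k x "-y"] by simp

lemma zm_hom:
  assumes "!!x y. h (x + y) = h x + h y"
  shows "h (zm k x) = zm k (h x)"
proof -
  have "h 0 = 0" using assms[of 0 0] by simp
  moreover have "h (x - y) = h x - h y" for x y using assms[of "x - y" y] by (simp add: algebra_simps)
  ultimately show ?thesis
    by (induction k rule: int_induct[where k = 0]) (simp_all add: zm_succ zm_pred assms)
qed

lemma zm_real: "zm k (r::real) = real_of_int k * r"
  by (induction k rule: int_induct[where k = 0]) (simp_all add: zm_succ zm_pred algebra_simps)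

lemma continuous_zm: "continuous_on S (%x::'m::topological_ab_group_add. zm k x)"
  by (cases "0 \<le> k") (auto simp: zm_def intro!: continuous_intros)

section \<open>Subgroups, their sums and generated subgroups\<close>

lemma add_subgroupD:
  assumes "add_subgroup H"
  shows "0 \<in> H" "x \<in> H ==> y \<in> H ==> x + y \<in> H" "x \<in> H ==> - x \<in> H"
    "x \<in> H ==> y \<in> H ==> x - y \<in> H"
  using assms unfolding add_subgroup_def by (auto, metis diff_conv_add_uminus)

lemma add_subgroup_sum: "add_subgroup H ==> (!!i. i \<in> I ==> f i \<in> H) ==> sum f I \<in> H"
  by (induction I rule: infinite_finite_induct) (auto simp: add_subgroupD)

lemma add_subgroup_zm: "add_subgroup H ==> x \<in> H ==> zm k x \<in> H"
  unfolding zm_def by (auto intro!: add_subgroup_sum add_subgroupD)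

lemma add_subgroup_absorb:
  assumes "add_subgroup H" "y \<in> H"
  shows "x + y \<in> H \<longleftrightarrow> x \<in> H" "y + x \<in> H \<longleftrightarrow> x \<in> H" "x - y \<in> H \<longleftrightarrow> x \<in> H"
  using add_subgroupD[OF assms(1)] assms(2)
  by (metis add_diff_cancel_right' add_diff_cancel_left' diff_add_cancel)+

lemma add_subgroup_Int: "add_subgroup H ==> add_subgroup K ==> add_subgroup (H Int K)"
  unfolding add_subgroup_def by auto

lemma add_subgroup_Inter: "(!!H. H \<in> C ==> add_subgroup H) ==> add_subgroup (\<Inter>C)"
  unfolding add_subgroup_def by auto

lemma add_subgroup_singleton [simp]: "add_subgroup {0}"
  unfolding add_subgroup_def by auto

lemma add_subgroup_UNIV [simp]: "add_subgroup UNIV"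
  unfolding add_subgroup_def by auto

lemma add_subgroup_plus: "add_subgroup H ==> add_subgroup K ==> add_subgroup (H + K)"
  unfolding add_subgroup_def
proof (intro conjI ballI; elim conjE)
  assume "0 \<in> H" "0 \<in> K" then show "0 \<in> H + K" using set_plus_intro[of 0 H 0 K] by simp
next
  fix x y assume H: "\<forall>x\<in>H. \<forall>y\<in>H. x + y \<in> H" "\<forall>x\<in>K. \<forall>y\<in>K. x + y \<in> K" and "x \<in> H + K" "y \<in> H + K"
  then obtain a b c d where "x = a + b" "a \<in> H" "b \<in> K" "y = c + d" "c \<in> H" "d \<in> K"
    by (auto elim!: set_plus_elim)
  then show "x + y \<in> H + K" using H set_plus_intro[of "a + c" H "b + d" K] by (simp add: algebra_simps)
next
  fix x assume H: "\<forall>x\<in>H. - x \<in> H" "\<forall>x\<in>K. - x \<in> K" and "x \<in> H + K"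
  then obtain a b where "x = a + b" "a \<in> H" "b \<in> K" by (auto elim!: set_plus_elim)
  then show "- x \<in> H + K" using H set_plus_intro[of "-a" H "-b" K] by (simp add: algebra_simps)
qed

lemma set_plus_sub: "add_subgroup H ==> A <= H ==> B <= H ==> A + B <= H"
  by (auto elim!: set_plus_elim intro!: add_subgroupD)

lemma set_plus_left: "0 \<in> B ==> A <= A + (B::'a::monoid_add set)"
  by (metis add.right_neutral set_plus_intro subsetI)

lemma set_plus_right: "0 \<in> A ==> B <= A + (B::'a::monoid_add set)"
  by (metis add.left_neutral set_plus_intro subsetI)

lemma add_subgroup_generated: "add_subgroup (generated_subgroup K)"
  unfolding generated_subgroup_def by (rule add_subgroup_Inter) auto

lemma generated_subset: "K <= generated_subgroup K"
  unfolding generated_subgroup_def by auto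

lemma generated_least: "add_subgroup H ==> K <= H ==> generated_subgroup K <= H"
  unfolding generated_subgroup_def by auto

section \<open>Translates, neighbourhoods and closures\<close>

lemma continuous_translation: "continuous_on S (%x. x + c)" "continuous_on S (%x. c + x)"
  "continuous_on S (%x. x - c)" "continuous_on S (%x. c - x)"
  for c :: "'m::topological_ab_group_add"
  by (intro continuous_intros)+

lemma open_vimage_UNIV: "continuous_on UNIV f ==> open S ==> open {x. f x \<in> S}"
  using open_vimage[of S f] by (simp add: vimage_def)

lemma closed_vimage_UNIV: "continuous_on UNIV f ==> closed S ==> closed {x. f x \<in> S}"
  using closed_vimage[of S f] by (simp add: vimage_def)

lemma translate_eq: "(+) c ` S = {x. x - c \<in> S}" for c :: "'m::ab_group_add"
  by (auto simp: image_iff) (metis add.commute diff_add_cancel)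

lemma open_translate: "open S ==> open ((+) c ` S)" for c :: "'m::topological_ab_group_add"
  unfolding translate_eq by (rule open_vimage_UNIV[OF continuous_translation(3)])

lemma closed_translate: "closed S ==> closed ((+) c ` S)" for c :: "'m::topological_ab_group_add"
  unfolding translate_eq by (rule closed_vimage_UNIV[OF continuous_translation(3)])

lemma compact_translate: "compact S ==> compact ((+) c ` S)" for c :: "'m::topological_ab_group_add"
  by (rule compact_continuous_image[OF continuous_translation(2)])

lemma compact_plus: "compact A ==> compact B ==> compact (A + B)"
  for A :: "'m::topological_ab_group_add set"
proof -
  assume "compact A" "compact B"
  then have "compact ((%(x, y). x + y) ` (A \<times> B))"
    by (intro compact_continuous_image compact_Times)
      (auto simp: case_prod_beta intro!: continuous_intros)
  moreover have "(%(x, y). x + y) ` (A \<times> B) = A + B" by (auto simp: set_plus_def)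
  ultimately show ?thesis by simp
qed

lemma compact_uminus: "compact A ==> compact (uminus ` A)"
  for A :: "'m::topological_ab_group_add set"
  by (rule compact_continuous_image) (intro continuous_intros)

lemma open_plus: "open B ==> open (A + B)" for A :: "'m::topological_ab_group_add set"
proof -
  assume "open B"
  moreover have "A + B = (\<Union>a\<in>A. (+) a ` B)" by (auto simp: set_plus_def)
  ultimately show ?thesis using open_translate[of B] by (simp add: open_UN)
qed

lemma nbhd_halve:
  fixes U :: "'m::topological_ab_group_add set"
  assumes "open U" "0 \<in> U"
  obtains W where "open W" "0 \<in> W" "!!x. x \<in> W ==> - x \<in> W" "!!x y. x \<in> W ==> y \<in> W ==> x + y \<in> U" "W <= U"
proof -
  have "open {p::'m \<times> 'm. fst p + snd p \<in> U}"
    by (rule open_vimage_UNIV[OF _ assms(1)]) (intro continuous_intros)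
  moreover have "(0, 0) \<in> {p. fst p + snd p \<in> U}" using assms(2) by simp
  ultimately obtain A B where AB: "open A" "open B" "(0, 0) \<in> A \<times> B" "A \<times> B <= {p. fst p + snd p \<in> U}"
    by (rule open_prod_elim)
  define C where "C = A Int B Int U"
  have C: "open C" "0 \<in> C" using AB assms unfolding C_def by auto
  have "open {x. - x \<in> C}" by (rule open_vimage_UNIV[OF _ C(1)]) (intro continuous_intros)
  then show ?thesis
    using AB C by (intro that[of "C Int {x. - x \<in> C}"]) (auto simp: C_def)
qed

lemma closure_translate_meet:
  fixes S :: "'m::topological_ab_group_add set"
  assumes "x \<in> closure S" "open W" "0 \<in> W"
  obtains s w where "s \<in> S" "w \<in> W" "s = x + w"
proof -
  have "open ((+) x ` W)" "x \<in> (+) x ` W" using open_translate[OF assms(2)] assms(3) by force+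
  then have "(+) x ` W Int S ~= {}"
    using assms(1) open_Int_closure_eq_empty by blast
  then show ?thesis using that by blast
qed

lemma nbhd_closure:
  fixes U :: "'m::topological_ab_group_add set"
  assumes "open U" "0 \<in> U"
  obtains W where "open W" "0 \<in> W" "!!x. x \<in> W ==> - x \<in> W" "closure W <= U"
proof -
  obtain W where W: "open W" "0 \<in> W" "!!x. x \<in> W ==> - x \<in> W" "!!x y. x \<in> W ==> y \<in> W ==> x + y \<in> U"
    using nbhd_halve[OF assms] by metis
  have "x \<in> U" if x: "x \<in> closure W" for x
  proof -
    obtain s w where sw: "s \<in> W" "w \<in> W" "s = x + w"
      by (rule closure_translate_meet[OF x W(1,2)])
    then have "x = s + - w" by simp
    then show ?thesis using W(3)[OF sw(2)] W(4)[OF sw(1)] by metis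
  qed
  then show ?thesis using that W by blast
qed

lemma nbhd_compact:
  fixes U :: "'m::{topological_ab_group_add,t2_space} set"
  assumes "LCA_group TYPE('m)" "open U" "0 \<in> U"
  obtains W C where "open W" "0 \<in> W" "W <= C" "compact C" "C <= U" "!!x. x \<in> C ==> - x \<in> C"
proof -
  obtain W0 C0 where w: "open W0" "0 \<in> W0" "W0 <= C0" "compact C0" "C0 <= U"
    using assms unfolding LCA_group_def locally_def
    by (metis UNIV_I inf_top.left_neutral openin_open subtopology_UNIV open_openin)
  obtain W where W: "open W" "0 \<in> W" "!!x. x \<in> W ==> - x \<in> W" "closure W <= W0"
    using nbhd_closure[OF w(1,2)] by metis
  have cpt: "compact (closure W)"
    using compact_Int_closed[OF w(4) closed_closure, of W] W(4) w(3) by (simp add: Int_absorb1 subset_trans)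
  have "- x \<in> closure W" if "x \<in> closure W" for x
  proof -
    have "uminus ` closure W <= closure (uminus ` W)"
      by (rule continuous_image_closure_subset[of UNIV]) (auto intro!: continuous_intros)
    moreover have "uminus ` W <= W" using W(3) by auto
    ultimately show ?thesis using that closure_mono by blast
  qed
  then show ?thesis using that[of W "closure W"] W w cpt closure_subset by (meson subset_trans)
qed

lemma additive_continuous:
  fixes h :: "'m::topological_ab_group_add => 'n::topological_ab_group_add"
  assumes H: "add_subgroup H" and add: "!!x y. x \<in> H ==> y \<in> H ==> h (x + y) = h x + h y"
    and at0: "!!U. open U ==> 0 \<in> U ==> \<exists>W. open W & 0 \<in> W & (\<forall>y\<in>W Int H. h y \<in> U)"
  shows "continuous_on H h"
proof (rule iffD2[OF continuous_on_topological], intro ballI allI impI)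
  fix x B assume x: "x \<in> H" and B: "open B" "h x \<in> B"
  have "open {u. h x + u \<in> B}" by (rule open_vimage_UNIV[OF continuous_translation(2) B(1)])
  then obtain W where W: "open W" "0 \<in> W" "\<forall>y\<in>W Int H. h y \<in> {u. h x + u \<in> B}"
    using at0[of "{u. h x + u \<in> B}"] B by auto
  have "open ((+) x ` W)" "x \<in> (+) x ` W" using open_translate[OF W(1)] W(2) by force+
  moreover have "h y \<in> B" if "y \<in> H" "y \<in> (+) x ` W" for y
  proof -
    have "y - x \<in> W" using that by auto
    moreover have "y - x \<in> H" using add_subgroupD(4)[OF H] that(1) x by blast
    moreover have "h y = h x + h (y - x)" using add[of x "y - x"] x \<open>y - x \<in> H\<close> by simp
    ultimately show ?thesis using W(3) by simp
  qed
  ultimately show "\<exists>A. open A & x \<in> A & (\<forall>y\<in>H. y \<in> A --> h y \<in> B)" by blast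
qed

lemma add_subgroup_closure:
  fixes H :: "'m::topological_ab_group_add set"
  assumes "add_subgroup H" shows "add_subgroup (closure H)"
  unfolding add_subgroup_def
proof (intro conjI ballI)
  show "0 \<in> closure H" using add_subgroupD(1)[OF assms] closure_subset by blast
next
  fix x y assume xy: "x \<in> closure H" "y \<in> closure H"
  have "(%p. fst p + snd p) ` closure (H \<times> H) <= closure ((%p. fst p + snd p) ` (H \<times> H))"
    by (rule continuous_image_closure_subset[of UNIV]) (auto intro!: continuous_intros)
  also have "\<dots> <= closure H" by (rule closure_mono) (auto simp: add_subgroupD(2)[OF assms])
  finally show "x + y \<in> closure H" using xy by (auto simp: closure_Times image_subset_iff)
next
  fix x assume x: "x \<in> closure H"
  have "uminus ` closure H <= closure (uminus ` H)"
    by (rule continuous_image_closure_subset[of UNIV]) (auto intro!: continuous_intros)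
  also have "\<dots> <= closure H" by (rule closure_mono) (auto simp: add_subgroupD(3)[OF assms])
  finally show "- x \<in> closure H" using x by auto
qed

lemma open_subgroup:
  fixes H :: "'m::topological_ab_group_add set"
  assumes "add_subgroup H" "open W" "0 \<in> W" "W <= H" shows "open H"
proof -
  have "H + W = H" using assms set_plus_left[OF assms(3), of H]
    set_plus_sub[OF assms(1), of H W] by blast
  then show ?thesis using open_plus[OF assms(2), of H] by simp
qed

lemma relatively_open_subgroup:
  fixes X :: "'m::topological_ab_group_add set"
  assumes E: "add_subgroup E" and X: "add_subgroup X" "X <= E" and W: "open W" "0 \<in> W" "W Int E <= X"
  shows "openin (top_of_set E) X"
proof -
  have "X = E Int (X + W)"
  proof
    show "X <= E Int (X + W)" using X(2) set_plus_left[OF W(2), of X] by blast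
    show "E Int (X + W) <= X"
    proof
      fix y assume y: "y \<in> E Int (X + W)"
      then have "y \<in> X + W" by blast
      then obtain x w where xw: "x \<in> X" "w \<in> W" "y = x + w" by (rule set_plus_elim)
      have "w = y - x" using xw(3) by simp
      then have "w \<in> E" using add_subgroupD(4)[OF E] y xw(1) X(2) by blast
      then have "w \<in> X" using W(3) xw(2) by blast
      then show "y \<in> X" unfolding xw(3) by (rule add_subgroupD(2)[OF X(1) xw(1)])
    qed
  qed
  then show ?thesis unfolding openin_open using open_plus[OF W(1)] by blast
qed

lemma closed_open_subgroup:
  fixes H :: "'m::topological_ab_group_add set"
  assumes "add_subgroup H" "open H" shows "closed H"
proof -
  have "x \<in> H" if x: "x \<in> closure H" for x
  proof -
    obtain s w where "s \<in> H" "w \<in> H" "s = x + w"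
      by (rule closure_translate_meet[OF x assms(2) add_subgroupD(1)[OF assms(1)]])
    then show ?thesis using add_subgroup_absorb[OF assms(1)] by blast
  qed
  then show ?thesis using closure_subset_eq by blast
qed

text \<open>The compact set \<open>A0 - U\<close> misses the intersection of the family, so it
  misses a finite subintersection; directedness puts a single member below these finitely many sets
  and below \<open>A0\<close>.\<close>

lemma directed_compact:
  fixes C :: "'m::t2_space set set"
  assumes "C ~= {}" "!!A. A \<in> C ==> compact A"
    and dir: "!!A B. A \<in> C ==> B \<in> C ==> \<exists>D\<in>C. D <= A Int B"
    and "open U" "\<Inter>C <= U"
  shows "\<exists>A\<in>C. A <= U"
proof -
  obtain A0 where A0: "A0 \<in> C" using assms(1) by blast
  have cl: "closed T" if "T \<in> C" for T using assms(2)[OF that] by (rule compact_imp_closed)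
  have 1: "compact (A0 - U)" using assms(2)[OF A0] assms(4) by (rule compact_diff)
  have 2: "(A0 - U) Int \<Inter>C = {}" using assms(5) by auto
  have "\<not> (\<forall>F'. finite F' --> F' <= C --> (A0 - U) Int \<Inter>F' ~= {})"
  proof
    assume "\<forall>F'. finite F' --> F' <= C --> (A0 - U) Int \<Inter>F' ~= {}"
    then have "(A0 - U) Int \<Inter>C ~= {}" by (rule_tac compact_imp_fip[OF 1 cl]) simp_all
    then show False using 2 by (rule notE)
  qed
  then obtain F where F: "finite F" "F <= C" "(A0 - U) Int \<Inter>F = {}" by auto
  have "\<exists>D\<in>C. D <= A0 & D <= \<Inter>F" using F(1,2)
  proof (induction F rule: finite_induct)
    case empty then show ?case using A0 by auto
  next
    case (insert T F)
    then obtain D where D: "D \<in> C" "D <= A0" "D <= \<Inter>F" by blast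
    have "T \<in> C" using insert.prems by simp
    from dir[OF D(1) this] obtain D' where D': "D' \<in> C" "D' <= D Int T" by (elim bexE)
    have "D' <= A0" "D' <= T" "D' <= \<Inter>F" using D(2,3) D'(2) by (meson subset_trans Int_lower1 Int_lower2)+
    then have "D' <= A0 & D' <= \<Inter>(insert T F)" by simp
    then show ?case using D'(1) by (rule bexI)
  qed
  then obtain D where D: "D \<in> C" "D <= A0" "D <= \<Inter>F" by blast
  have "D - U <= (A0 - U) Int \<Inter>F" using D(2,3) by (intro Int_greatest) auto
  then have "D - U = {}" unfolding F(3) by simp
  then show ?thesis using D(1) by auto
qed

lemma decseq_compact:
  fixes C :: "nat => 'm::t2_space set"
  assumes C: "!!n. compact (C n)" and dec: "!!n. C (Suc n) <= C n" and U: "open U" "(\<Inter>n. C n) <= U"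
  shows "\<exists>n. C n <= U"
proof -
  have le: "C n <= C m" if "m \<le> n" for m n using dec that by (rule lift_Suc_antimono_le)
  have "\<exists>A\<in>range C. A <= U"
  proof (rule directed_compact[OF _ _ _ U])
    fix A B assume "A \<in> range C" "B \<in> range C"
    then obtain i j where "A = C i" "B = C j" by blast
    then show "\<exists>D\<in>range C. D <= A Int B" using le[of i "max i j"] le[of j "max i j"] by auto
  next
    show "range C ~= {}" by blast
    show "compact B" if "B \<in> range C" for B using that C by blast
  qed
  then show ?thesis by blast
qed

text \<open>The sets of those \<open>y\<close> in \<open>A\<close> with \<open>x - y\<close> in
  \<open>B\<close> are compact, nonempty and directed in \<open>B\<close>, so they have a common
  point. This exchange of a sum with an intersection serves tidying, Zorn's lemma and telescoping
  sums alike.\<close>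

lemma directed_compact_plus:
  fixes C :: "'m::{topological_ab_group_add,t2_space} set set"
  assumes A: "compact A" and ne: "C ~= {}" and cpt: "!!B. B \<in> C ==> compact B"
    and dir: "!!A B. A \<in> C ==> B \<in> C ==> \<exists>D\<in>C. D <= A Int B"
    and x: "!!B. B \<in> C ==> x \<in> A + B"
  shows "x \<in> A + \<Inter>C"
proof -
  define f where "f B = A Int {y. x - y \<in> B}" for B
  have fmono: "f B <= f B'" if "B <= B'" for B B' using that unfolding f_def by blast
  have fcpt: "compact (f B)" if "B \<in> C" for B
  proof -
    have "closed {y. x - y \<in> B}"
      by (rule closed_vimage_UNIV[OF continuous_translation(4) compact_imp_closed[OF cpt[OF that]]])
    then show ?thesis unfolding f_def by (rule compact_Int_closed[OF A])
  qed
  have fne: "f B ~= {}" if B: "B \<in> C" for B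
  proof -
    obtain y z where "y \<in> A" "z \<in> B" "x = y + z" using x[OF B] by (auto elim: set_plus_elim)
    then show ?thesis unfolding f_def by auto
  qed
  have "\<Inter>(f ` C) ~= {}"
  proof
    assume e: "\<Inter>(f ` C) = {}"
    have "\<exists>D\<in>f ` C. D <= {}"
    proof (rule directed_compact)
      show "f ` C ~= {}" using ne by blast
      show "compact B" if "B \<in> f ` C" for B using that fcpt by blast
      show "open ({}::'m set)" "\<Inter>(f ` C) <= {}" using e by auto
    next
      fix D E assume "D \<in> f ` C" "E \<in> f ` C"
      then obtain B1 B2 where B: "B1 \<in> C" "B2 \<in> C" "D = f B1" "E = f B2" by blast
      obtain B3 where B3: "B3 \<in> C" "B3 <= B1 Int B2" using dir[OF B(1,2)] by blast
      then have "f B3 <= D Int E" using fmono B by blast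
      then show "\<exists>F\<in>f ` C. F <= D Int E" using B3 by blast
    qed
    then show False using fne by blast
  qed
  then obtain y where y: "y \<in> f B" if "B \<in> C" for B by blast
  obtain B where "B \<in> C" using ne by blast
  then have "y \<in> A" "x - y \<in> \<Inter>C" using y unfolding f_def by blast+
  then have "y + (x - y) \<in> A + \<Inter>C" by (rule set_plus_intro)
  then show ?thesis by simp
qed

lemma decseq_compact_plus:
  fixes C :: "nat => 'm::{topological_ab_group_add,t2_space} set"
  assumes A: "compact A" and C: "!!n. compact (C n)" and dec: "!!n. C (Suc n) <= C n" and x: "!!n. x \<in> A + C n"
  shows "x \<in> A + (\<Inter>n. C n)"
proof (rule directed_compact_plus[OF A])
  have le: "C n <= C m" if "m \<le> n" for m n using dec that by (rule lift_Suc_antimono_le)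
  fix A B assume "A \<in> range C" "B \<in> range C"
  then obtain i j where "A = C i" "B = C j" by blast
  then show "\<exists>D\<in>range C. D <= A Int B" using le[of i "max i j"] le[of j "max i j"] by auto
next
  show "range C ~= {}" by blast
  show "compact B" if "B \<in> range C" for B using that C by blast
  show "x \<in> A + B" if "B \<in> range C" for B using that x by blast
qed

section \<open>Cosets and finite index\<close>

lemma coset_eq: "add_subgroup U ==> x - y \<in> U ==> (+) x ` U = (+) y ` U"
proof -
  assume U: "add_subgroup U" "x - y \<in> U"
  have "z - x \<in> U \<longleftrightarrow> z - y \<in> U" for z
    using add_subgroup_absorb(1)[OF U, of "z - x"] by simp
  then show ?thesis unfolding translate_eq by simp
qed

lemma coset_self: "0 \<in> U ==> x \<in> (+) x ` U" for x :: "'m::ab_group_add"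
  by (simp add: translate_eq)

lemma finite_cosets_pigeonhole:
  assumes "finite (cosets F U)" "add_subgroup U" "!!n::nat. x n \<in> F"
  shows "\<exists>i j. i < j & x j - x i \<in> U"
proof -
  have "range (%n. (+) (x n) ` U) <= cosets F U" using assms(3) by (auto simp: cosets_def)
  then have "\<not> inj (%n. (+) (x n) ` U)"
    using assms(1) finite_subset[of "range (%n. (+) (x n) ` U)"] finite_imageD[of "%n. (+) (x n) ` U" UNIV] infinite_UNIV_nat by blast
  then obtain i j where ij: "i ~= j" "(+) (x i) ` U = (+) (x j) ` U" unfolding inj_def by blast
  have "x i \<in> (+) (x i) ` U" "x j \<in> (+) (x j) ` U" using coset_self[OF add_subgroupD(1)[OF assms(2)]] by blast+
  then have "x j - x i \<in> U" "x i - x j \<in> U" using ij(2) unfolding translate_eq by blast+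
  then show ?thesis using ij(1) by (metis linorder_neqE_nat)
qed

lemma compact_finite_translates:
  fixes C :: "'m::topological_ab_group_add set"
  assumes "compact C" "open W" "0 \<in> W"
  obtains F where "finite F" "F <= C" "C <= F + W"
proof -
  have "C <= (\<Union>c\<in>C. (+) c ` W)" using coset_self[OF assms(3)] by blast
  then obtain F where F: "F <= C" "finite F" "C <= (\<Union>c\<in>F. (+) c ` W)"
    using compactE_image[OF assms(1), of C "%c. (+) c ` W"] open_translate[OF assms(2)] by blast
  moreover have "(\<Union>c\<in>F. (+) c ` W) = F + W" by (auto simp: set_plus_def)
  ultimately show ?thesis using that by simp
qed

lemma finite_cosets_compact:
  fixes K :: "'m::topological_ab_group_add set"
  assumes "compact K" "add_subgroup K" "add_subgroup U" "open W" "0 \<in> W" "W Int K <= U"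
  shows "finite (cosets K U)"
proof -
  obtain F where F: "finite F" "F <= K" "K <= F + W" using compact_finite_translates assms by metis
  have "(+) x ` U \<in> (%f. (+) f ` U) ` F" if x: "x \<in> K" for x
  proof -
    have "x \<in> F + W" using F(3) x by blast
    then obtain f w where fw: "f \<in> F" "w \<in> W" "x = f + w" by (rule set_plus_elim)
    have "w \<in> K" using fw x F(2) add_subgroup_absorb[OF assms(2)] by blast
    then have "x - f \<in> U" using fw assms(6) by auto
    then show ?thesis using coset_eq[OF assms(3)] fw(1) by blast
  qed
  then have "cosets K U <= (%f. (+) f ` U) ` F" by (auto simp: cosets_def)
  then show ?thesis using F(1) finite_surj by blast
qed

text \<open>The cosets other than \<open>L\<close> itself form a finite union of closed sets that
  avoids 0, and its complement is the neighbourhood sought.\<close>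

lemma finite_cosets_open:
  fixes K :: "'m::{topological_ab_group_add,t2_space} set"
  assumes "add_subgroup L" "closed L" "finite (cosets K L)"
  obtains W where "open W" "0 \<in> W" "W Int K <= L"
proof -
  define X where "X = \<Union>{C \<in> cosets K L. C ~= L}"
  have "closed X" unfolding X_def
    using assms(2,3) by (intro closed_Union) (auto simp: cosets_def closed_translate)
  moreover have "0 \<notin> X"
  proof
    assume "0 \<in> X"
    then obtain x where x: "0 \<in> (+) x ` L" "(+) x ` L ~= L" unfolding X_def cosets_def by auto
    then have "- x \<in> L" unfolding translate_eq by simp
    from add_subgroupD(3)[OF assms(1) this] have "x - 0 \<in> L" by simp
    from coset_eq[OF assms(1) this] x(2) show False by simp
  qed
  moreover have "K <= X \<union> L"
  proof
    fix x assume "x \<in> K"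
    then have "(+) x ` L \<in> cosets K L" "x \<in> (+) x ` L"
      using coset_self[OF add_subgroupD(1)[OF assms(1)]] by (auto simp: cosets_def)
    then show "x \<in> X \<union> L" unfolding X_def by blast
  qed
  ultimately show ?thesis using that[of "- X"] by auto
qed

lemma finite_cosets_Int:
  assumes "finite (cosets Z L)" "add_subgroup K" "K <= Z" shows "finite (cosets K (K Int L))"
proof -
  have "(+) x ` (K Int L) = (+) x ` L Int K" if "x \<in> K" for x
    unfolding translate_eq using add_subgroup_absorb(3)[OF assms(2) that] by blast
  then have "cosets K (K Int L) = (%C. C Int K) ` (%x. (+) x ` L) ` K" unfolding cosets_def image_image
    by (intro image_cong) simp_all
  also have "\<dots> <= (%C. C Int K) ` cosets Z L" unfolding cosets_def by (intro image_mono assms(3))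
  finally show ?thesis using assms(1) by (meson finite_imageI finite_subset)
qed

subsection \<open>Locally compact modules\<close>

locale lc_module =
  fixes act :: "'a::{topological_ab_group_add, t2_space} => 'm::{topological_ab_group_add, t2_space} => 'm"
  assumes LC: "LC_module act"
begin

lemma act_add: "act a (x + y) = act a x + act a y" using LC unfolding LC_module_def by blast
lemma act_zero [simp]: "act 0 x = x" using LC unfolding LC_module_def by blast
lemma act_act: "act a (act b x) = act (a + b) x" using LC unfolding LC_module_def by metis
lemma act_0 [simp]: "act a 0 = 0" using act_add[of a 0 0] by simp
lemma act_uminus: "act a (- x) = - act a x" using act_add[of a x "-x"] by (simp add: eq_neg_iff_add_eq_0 add.commute)
lemma act_diff: "act a (x - y) = act a x - act a y" using act_add[of a x "-y"] act_uminus by simp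
lemma act_sum: "act a (sum f I) = (\<Sum>i\<in>I. act a (f i))"
  by (induction I rule: infinite_finite_induct) (auto simp: act_add)
lemma act_inv [simp]: "act (- a) (act a x) = x" "act a (act (- a) x) = x" by (simp_all add: act_act)
lemma act_commute: "act a (act b x) = act b (act a x)" by (simp add: act_act add.commute)
lemma LCM: "LCA_group TYPE('m)" using LC unfolding LC_module_def by blast

lemma act_joint: "continuous_on UNIV (%p. act (fst p) (snd p))"
  using LC unfolding LC_module_def by (simp add: case_prod_beta)

lemma act_continuous: "continuous_on S (act a)"
proof -
  have "continuous_on S (%x. act (fst (a, x)) (snd (a, x)))"
    by (rule continuous_on_compose2[OF act_joint]) (auto intro!: continuous_intros)
  then show ?thesis by simp
qed

lemma act_continuous2: "continuous_on S (%a. act a x)"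
proof -
  have "continuous_on S (%a. act (fst (a, x)) (snd (a, x)))"
    by (rule continuous_on_compose2[OF act_joint]) (auto intro!: continuous_intros)
  then show ?thesis by simp
qed

lemma act_image_eq: "act a ` S = {x. act (- a) x \<in> S}"
  by (auto simp: image_iff) (metis act_inv(2))

lemma act_image_inv [simp]: "act a ` act (- a) ` S = S" "act (- a) ` act a ` S = S"
  by (simp_all add: image_image)

lemma act_image_invariant:
  assumes "!!x. x \<in> S ==> act b x \<in> S" "x \<in> act c ` S" shows "act b x \<in> act c ` S"
proof -
  obtain y where "y \<in> S" "x = act c y" using assms(2) by blast
  then have "act b x = act c (act b y)" "act b y \<in> S" using assms(1) act_commute by auto
  then show ?thesis by (metis imageI)
qed

lemma act_image_subgroup: "add_subgroup H ==> add_subgroup (act a ` H)"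
  unfolding act_image_eq add_subgroup_def by (auto simp: act_add act_uminus)

lemma act_image_compact: "compact C ==> compact (act a ` C)"
  by (rule compact_continuous_image[OF act_continuous])

lemma act_image_closed: "closed C ==> closed (act a ` C)"
  unfolding act_image_eq by (rule closed_vimage_UNIV[OF act_continuous])

lemma act_closure:
  assumes "!!x. x \<in> H ==> act a x \<in> H" "x \<in> closure H" shows "act a x \<in> closure H"
proof -
  have "act a ` closure H <= closure (act a ` H)"
    by (rule continuous_image_closure_subset[of UNIV]) (auto intro!: act_continuous)
  also have "\<dots> <= closure H" by (rule closure_mono) (use assms in auto)
  finally show ?thesis using assms(2) by blast
qed

text \<open>Parafiniteness for the action of a subset \<open>B\<close> only. Two choices occur:
  \<open>B = {}\<close>, where the condition on closed subgroups of finite index amounts to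
  connectedness, and \<open>B = {a, - a}\<close>, invariance under one element and its
  inverse.\<close>

definition pfin :: "'a set => 'm set => bool" where
  "pfin B K \<longleftrightarrow> compact K & add_subgroup K & (\<forall>b\<in>B. \<forall>x\<in>K. act b x \<in> K) &
     (\<forall>L. add_subgroup L & closed L & L <= K & (\<forall>b\<in>B. \<forall>x\<in>L. act b x \<in> L) & finite (cosets K L) --> L = K)"

text \<open>Commutativity of \<open>A\<close> is what matters: \<open>act c\<close> carries
  \<open>B\<close>-invariant subgroups to \<open>B\<close>-invariant ones, and
  \<open>act (- c)\<close> pulls a subgroup of finite index back into \<open>K\<close>.\<close>

lemma pfin_act: assumes "pfin B K" shows "pfin B (act c ` K)"
  unfolding pfin_def
proof (intro conjI allI impI ballI)
  show "compact (act c ` K)" "add_subgroup (act c ` K)"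
    using assms act_image_compact act_image_subgroup unfolding pfin_def by blast+
  show "act b x \<in> act c ` K" if "b \<in> B" "x \<in> act c ` K" for b x
    using assms that(1) by (intro act_image_invariant[OF _ that(2)]) (auto simp: pfin_def)
  fix L assume L: "add_subgroup L & closed L & L <= act c ` K & (\<forall>b\<in>B. \<forall>x\<in>L. act b x \<in> L) & finite (cosets (act c ` K) L)"
  define L' where "L' = act (- c) ` L"
  have "cosets K L' <= (%C. act (- c) ` C) ` cosets (act c ` K) L"
  proof
    fix X assume "X \<in> cosets K L'"
    then obtain k where k: "k \<in> K" "X = (+) k ` L'" by (auto simp: cosets_def)
    have "X = act (- c) ` ((+) (act c k) ` L)" unfolding k(2) L'_def image_image by (rule image_cong) (simp_all add: act_add)
    then show "X \<in> (%C. act (- c) ` C) ` cosets (act c ` K) L" using k(1) unfolding cosets_def by blast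
  qed
  then have "finite (cosets K L')" using L by (meson finite_imageI finite_subset)
  moreover have "\<forall>b\<in>B. \<forall>x\<in>L'. act b x \<in> L'" unfolding L'_def using L by (intro ballI act_image_invariant) auto
  moreover have "add_subgroup L'" "closed L'" "L' <= K"
    using L act_image_subgroup act_image_closed image_mono[of L "act c ` K" "act (- c)"] unfolding L'_def by simp_all
  ultimately have "L' = K" using assms unfolding pfin_def by blast
  then show "L = act c ` K" unfolding L'_def using act_image_inv(1)[of c L] by simp
qed

end

locale pfree_module = lc_module +
  assumes W: "!!K. submodule act UNIV K ==> compact_parafinite act K ==> K = {0}"
begin

text \<open>A closed submodule \<open>L\<close> of finite index in the closed sum \<open>Z\<close>
  meets each \<open>B\<close>-parafinite \<open>K\<close> in a closed \<open>B\<close>-invariant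
  subgroup of finite index, so it contains \<open>K\<close>, hence all of \<open>Z\<close>. Thus
  \<open>Z\<close> is a compact parafinite submodule; the bound \<open>C\<close> supplies its
  compactness.\<close>

lemma pfin_trivial:
  assumes C: "compact C" and sub: "!!K. pfin B K ==> K <= C" "add_subgroup C" and K: "pfin B K"
  shows "K = {0}"
proof -
  define G where "G = generated_subgroup (\<Union>{K. pfin B K})"
  define Z where "Z = closure G"
  have G: "add_subgroup G" unfolding G_def by (rule add_subgroup_generated)
  have KG: "K <= G" if "pfin B K" for K unfolding G_def using generated_subset[of "\<Union>{K. pfin B K}"] that by blast
  have Z: "add_subgroup Z" unfolding Z_def by (rule add_subgroup_closure[OF G])
  have "G <= C" unfolding G_def by (intro generated_least[OF sub(2)] Union_least) (simp add: sub(1))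
  then have "Z <= C" unfolding Z_def using compact_imp_closed[OF C] by (rule closure_minimal)
  then have "Z = C Int closure G" unfolding Z_def by (simp add: Int_absorb1)
  then have cZ: "compact Z" using compact_Int_closed[OF C closed_closure] by simp
  have actG: "act a x \<in> G" if "x \<in> G" for a x
  proof -
    have "add_subgroup {x. act a x \<in> G}" using G unfolding add_subgroup_def by (auto simp: act_add act_uminus)
    moreover have "\<Union>{K. pfin B K} <= {x. act a x \<in> G}"
    proof
      fix x assume "x \<in> \<Union>{K. pfin B K}"
      then obtain K where K: "pfin B K" "x \<in> K" by blast
      show "x \<in> {x. act a x \<in> G}" using KG[OF pfin_act[OF K(1), of a]] K(2) by blast
    qed
    ultimately have "generated_subgroup (\<Union>{K. pfin B K}) <= {x. act a x \<in> G}" by (rule generated_least)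
    then have "G <= {x. act a x \<in> G}" unfolding G_def[symmetric] .
    then show ?thesis using that by blast
  qed
  have "act a x \<in> Z" if "x \<in> Z" for a x using act_closure[OF actG] that unfolding Z_def by blast
  then have sZ: "submodule act UNIV Z" unfolding submodule_def using Z by simp
  have "compact_parafinite act Z" unfolding compact_parafinite_def
  proof (intro conjI allI impI, rule cZ)
    fix L assume L: "closed_submodule act Z L & finite (cosets Z L)"
    then have L': "add_subgroup L" "L <= Z" "!!a x. x \<in> L ==> act a x \<in> L" "closed L"
      using closedin_closed_trans[of Z L, OF _ compact_imp_closed[OF cZ]] unfolding closed_submodule_def submodule_def by simp_all
    have "K <= L" if K: "pfin B K" for K
    proof -
      have KZ: "K <= Z" using KG[OF K] closure_subset unfolding Z_def by (rule subset_trans)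
      have aK: "add_subgroup K" "closed K" "\<forall>b\<in>B. \<forall>x\<in>K. act b x \<in> K"
        using K compact_imp_closed[of K] unfolding pfin_def by simp_all
      have 1: "finite (cosets K (K Int L))" by (rule finite_cosets_Int[OF _ aK(1) KZ]) (use L in simp)
      have 2: "add_subgroup (K Int L)" "closed (K Int L)" using aK L' by (simp_all add: add_subgroup_Int closed_Int)
      have 3: "\<forall>b\<in>B. \<forall>x\<in>K Int L. act b x \<in> K Int L" using aK L' by simp
      have "\<forall>L. add_subgroup L & closed L & L <= K & (\<forall>b\<in>B. \<forall>x\<in>L. act b x \<in> L) & finite (cosets K L) --> L = K"
        using K unfolding pfin_def by simp
      from this[rule_format, of "K Int L"] have "K Int L = K" using 1 2 3 by simp
      then show ?thesis by (rule inf.orderI[OF sym])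
    qed
    then have "G <= L" unfolding G_def by (intro generated_least[OF L'(1)] Union_least) simp
    then have "Z <= L" unfolding Z_def using L'(4) by (rule closure_minimal)
    then show "L = Z" using L'(2) by simp
  qed
  then have "Z = {0}" by (rule W[OF sZ])
  moreover have "K <= Z" using KG[OF K] closure_subset unfolding Z_def by (rule subset_trans)
  moreover have "0 \<in> K" using K unfolding pfin_def by (simp add: add_subgroupD)
  ultimately show ?thesis by blast
qed

end

subsection \<open>Proper characters on a compactly generated open subgroup\<close>

lemma plus_absorb:
  assumes T: "add_subgroup T" and x: "x \<in> T + U" and t: "t \<in> T" shows "x + t \<in> T + U" "x - t \<in> T + U"
proof -
  obtain s u where su: "s \<in> T" "u \<in> U" "x = s + u" using x by (rule set_plus_elim)
  have "(s + t) + u \<in> T + U" "(s - t) + u \<in> T + U"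
    using su(1,2) t T by (auto intro!: set_plus_intro add_subgroupD)
  then show "x + t \<in> T + U" "x - t \<in> T + U" using su(3) by (simp_all add: algebra_simps)
qed

lemma additive_on_zm:
  assumes H: "add_subgroup H" and add: "!!x y. x \<in> H ==> y \<in> H ==> h (x + y) = h x + h y"
  shows "h 0 = 0" "x \<in> H ==> h (- x) = - h x" "x \<in> H ==> y \<in> H ==> h (x - y) = h x - h y"
    "x \<in> H ==> h (zm k x) = zm k (h x)"
proof -
  show 0: "h 0 = 0" using add[of 0 0] add_subgroupD(1)[OF H] by simp
  show 1: "h (- x) = - h x" if "x \<in> H" for x
    using add[of x "- x"] add_subgroupD(3)[OF H] that 0 by (simp add: eq_neg_iff_add_eq_0 add.commute)
  show 2: "h (x - y) = h x - h y" if "x \<in> H" "y \<in> H" for x y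
    using add[of x "- y"] 1[of y] add_subgroupD(3)[OF H] that by simp
  show "h (zm k x) = zm k (h x)" if "x \<in> H"
    using add_subgroup_zm[OF H that] that
    by (induction k rule: int_induct[where k = 0]) (simp_all add: zm_succ zm_pred add 0 2)
qed

text \<open>Weil's lemma on monothetic groups, relative to a subgroup \<open>T\<close>: the multiples of an element that
  returns arbitrarily close to \<open>T\<close> arbitrarily late are uniformly close to \<open>T\<close>.\<close>

lemma recurrent_bounded:
  fixes T U C0 :: "'m::{topological_ab_group_add,t2_space} set"
  assumes U: "open U" "0 \<in> U" "U <= C0" "compact C0" and sym: "!!x. x \<in> U ==> - x \<in> U"
    and T: "add_subgroup T"
    and ret: "!!W n. open W ==> 0 \<in> W ==> \<exists>c>n. zm c f \<in> T + W"
  obtains C where "compact C" "!!n. zm n f \<in> C + T"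
proof -
  define A where "A = C0 Int closure (range (%k. zm k f) + T)"
  have cA: "compact A" unfolding A_def using U(4) by (rule compact_Int_closed) simp
  have TU: "open (T + U)" by (rule open_plus[OF U(1)])
  have neg: "- y \<in> T + U" if y: "y \<in> T + U" for y
  proof -
    obtain t u where "t \<in> T" "u \<in> U" "y = t + u" using y by (rule set_plus_elim)
    then have "- t + - u \<in> T + U" by (intro set_plus_intro add_subgroupD(3)[OF T] sym)
    then show ?thesis using \<open>y = t + u\<close> by simp
  qed
  have cover: "\<exists>n>0. x - zm n f \<in> T + U" if x: "x \<in> A" for x
  proof -
    have "x \<in> closure (range (%k. zm k f) + T)" using x unfolding A_def by simp
    then obtain s u where su: "s \<in> range (%k. zm k f) + T" "u \<in> U" "s = x + u"
      by (rule closure_translate_meet[OF _ U(1,2)])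
    obtain k t where kt: "t \<in> T" "s = zm k f + t" using su(1) by (auto elim!: set_plus_elim)
    have "t + - u \<in> T + U" using kt(1) sym[OF su(2)] by (rule set_plus_intro)
    moreover have "t + - u = x - zm k f" using kt su by (simp add: algebra_simps)
    ultimately have xk: "x - zm k f \<in> T + U" by simp
    \<comment> \<open>\<open>X\<close> is a neighbourhood of 0 by which \<open>x - zm k f\<close>
      may be moved within \<open>T + U\<close>; a return \<open>c\<close> into \<open>T + X\<close>
      later than \<open>- k\<close> turns the exponent \<open>k\<close> into a positive one.\<close>
    define X where "X = {w. x - zm k f - w \<in> T + U}"
    have "open X" "0 \<in> X" using open_vimage_UNIV[OF continuous_translation(4) TU, of "x - zm k f"] xk
      unfolding X_def by simp_all
    then obtain c where c: "c > max 0 (- k)" "zm c f \<in> T + X" using ret[of X "max 0 (- k)"] by auto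
    obtain t' w where tw: "t' \<in> T" "w \<in> X" "zm c f = t' + w" using c(2) by (rule set_plus_elim)
    have "x - zm (k + c) f = x - zm k f - w - t'" using tw(3) by (simp add: zm_add algebra_simps)
    moreover have "x - zm k f - w - t' \<in> T + U" using plus_absorb(2)[OF T _ tw(1)] tw(2) unfolding X_def by simp
    ultimately have "x - zm (k + c) f \<in> T + U" by (simp only:)
    moreover have "k + c > 0" using c(1) by simp
    ultimately show ?thesis by blast
  qed
  define G where "G n = {x. x - zm n f \<in> T + U}" for n
  have "open (G n)" for n unfolding G_def by (rule open_vimage_UNIV[OF continuous_translation(3) TU])
  moreover have "A <= (\<Union>n\<in>{0<..}. G n)" using cover unfolding G_def by auto
  ultimately obtain Ns where Ns: "Ns <= {0<..}" "finite Ns" "A <= (\<Union>n\<in>Ns. G n)"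
    by (rule compactE_image[OF cA, of "{0<..}" G])
  define N where "N = Max (insert 0 Ns)"
  have N: "n \<le> N" if "n \<in> Ns" for n unfolding N_def using Ns(2) that by simp
  have "\<exists>j. 0 \<le> j & j \<le> N & zm (n - j) f \<in> T + U" for n
  proof -
    \<comment> \<open>The least admissible \<open>j\<close> is at most \<open>N\<close>: otherwise
      the error \<open>- u\<close> at time \<open>n - j\<close> lies in \<open>A\<close>, and the
      positive \<open>m\<close> covering it makes \<open>j - m\<close> admissible as well. So gaps
      between returns are bounded.\<close>
    define J where "J = {j::nat. zm (n - int j) f \<in> T + U}"
    obtain c where c: "c > max 0 (- n)" "zm c f \<in> T + U" using ret[OF U(1,2), of "max 0 (-n)"] by auto
    have "zm (- c) f \<in> T + U" using neg[OF c(2)] by simp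
    then have "nat (n + c) \<in> J" unfolding J_def using c(1) by simp
    define j where "j = (LEAST j. j \<in> J)"
    have jJ: "j \<in> J" unfolding j_def using \<open>nat (n + c) \<in> J\<close> by (rule LeastI)
    have least: "j \<le> i" if "i \<in> J" for i unfolding j_def using that by (rule Least_le)
    have "int j \<le> N"
    proof (rule ccontr)
      assume jN: "\<not> int j \<le> N"
      have "zm (n - int j) f \<in> T + U" using jJ unfolding J_def by simp
      then obtain t u where tu: "t \<in> T" "u \<in> U" "zm (n - int j) f = t + u" by (rule set_plus_elim)
      have "zm (int j - n) f + t \<in> range (%k. zm k f) + T" using tu(1) by (intro set_plus_intro) auto
      moreover have "zm (int j - n) f + t = - u" using tu(3) by (simp add: zm_diff algebra_simps)
      ultimately have "- u \<in> closure (range (%k. zm k f) + T)"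
        using subsetD[OF closure_subset, of "- u" "range (%k. zm k f) + T"] by simp
      then have "- u \<in> A" unfolding A_def using subsetD[OF U(3) sym[OF tu(2)]] by blast
      then obtain m where m: "m \<in> Ns" "- u - zm m f \<in> T + U" using Ns(3) unfolding G_def by auto
      have "u + zm m f \<in> T + U" using neg[OF m(2)] by (simp add: algebra_simps)
      from plus_absorb(1)[OF T this tu(1)] have "zm (n - int j) f + zm m f \<in> T + U" using tu(3) by (simp add: algebra_simps)
      then have "zm (n - (int j - m)) f \<in> T + U" by (simp add: zm_diff zm_add algebra_simps)
      moreover have "m > 0" "m \<le> N" using m(1) Ns(1) N by auto
      ultimately have "nat (int j - m) \<in> J" unfolding J_def using jN by simp
      then have "j \<le> nat (int j - m)" by (rule least)
      then show False using \<open>m > 0\<close> jN \<open>m \<le> N\<close> by simp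
    qed
    then show ?thesis using jJ unfolding J_def by (intro exI[of _ "int j"]) simp
  qed
  note near = this
  define C where "C = (%j. zm j f) ` {0..N} + C0"
  have "compact C" unfolding C_def by (rule compact_plus[OF finite_imp_compact U(4)]) simp
  moreover have "zm n f \<in> C + T" for n
  proof -
    obtain j where j: "0 \<le> j" "j \<le> N" "zm (n - j) f \<in> T + U" using near by blast
    obtain t u where tu: "t \<in> T" "u \<in> U" "zm (n - j) f = t + u" using j(3) by (rule set_plus_elim)
    have "zm n f = (zm j f + u) + t" using tu(3) by (simp add: zm_diff algebra_simps)
    moreover have "zm j f + u \<in> C" unfolding C_def using j(1,2) tu(2) U(3) by (intro set_plus_intro) auto
    ultimately show ?thesis using set_plus_intro[OF _ tu(1)] by (simp only:)
  qed
  ultimately show ?thesis by (rule that)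
qed

section \<open>Integer combinations and cocompact lattices\<close>

definition rho :: "'m::ab_group_add set => ('m => int) => 'm" where
  "rho I c = (\<Sum>f\<in>I. zm (c f) f)"

definition zfun :: "'m set => ('m => int) set" where
  "zfun I = {c. \<forall>f. f \<notin> I --> c f = 0}"

text \<open>Properness of the homomorphism from integer vectors supported on \<open>I\<close>. Its
  kernel is then a finite subgroup of a free abelian group, so the elements of \<open>I\<close> are
  independent, and in a locally compact group they generate a discrete subgroup.\<close>

definition lattice_proper :: "'m::{ab_group_add,topological_space} set => bool" where
  "lattice_proper I \<longleftrightarrow> (\<forall>C. compact C --> finite {c \<in> zfun I. rho I c \<in> C})"

lemma rho_cong: "(!!f. f \<in> I ==> c f = d f) ==> rho I c = rho I d"
  unfolding rho_def by (rule sum.cong) auto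

lemma rho_restrict: "rho I (%f. if f \<in> I then c f else 0) = rho I c"
  by (rule rho_cong) simp

lemma rho_range: "range (rho I) = rho I ` zfun I"
proof -
  have "rho I c \<in> rho I ` zfun I" for c
    by (rule image_eqI[of _ _ "%f. if f \<in> I then c f else 0"]) (simp_all add: rho_restrict zfun_def)
  then show ?thesis by blast
qed

lemma rho_add: "rho I (%f. c f + d f) = rho I c + rho I d"
  by (simp add: rho_def zm_add sum.distrib)

lemma rho_minus: "rho I (%f. - c f) = - rho I c"
  by (simp add: rho_def sum_negf)

lemma rho_subgroup: "add_subgroup (range (rho I))"
  unfolding add_subgroup_def
proof (intro conjI ballI)
  show "0 \<in> range (rho I)" by (rule range_eqI[of _ _ "%_. 0"]) (simp add: rho_def)
  show "x + y \<in> range (rho I)" if xy: "x \<in> range (rho I)" "y \<in> range (rho I)" for x y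
  proof -
    obtain c d where "x = rho I c" "y = rho I d" using xy by fast
    then have "x + y = rho I (%f. c f + d f)" by (simp only: rho_add)
    then show ?thesis by (simp only: rangeI)
  qed
  show "- x \<in> range (rho I)" if x: "x \<in> range (rho I)" for x
  proof -
    obtain c where "x = rho I c" using x by fast
    then have "- x = rho I (%f. - c f)" by (simp only: rho_minus)
    then show ?thesis by (simp only: rangeI)
  qed
qed

lemma rho_generator:
  assumes "finite I" "f \<in> I" shows "zm k f \<in> range (rho I)"
proof (rule range_eqI[of _ _ "%g. if g = f then k else 0"])
  have "rho I (%g. if g = f then k else 0) = (\<Sum>g\<in>I. if g = f then zm k f else 0)"
    unfolding rho_def by (rule sum.cong) auto
  then show "zm k f = rho I (%g. if g = f then k else 0)" using assms by simp
qed

text \<open>Infinitely many coefficient vectors land in one compact set. Properness for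
  \<open>I\<close> allows only finitely many with a given coefficient at \<open>f\<close>, so
  infinitely many coefficients at \<open>f\<close> occur. Finitely many small translates cover the
  compact set; the difference of two such coefficients sharing a translate is an exponent that
  brings \<open>f\<close> close to the span of \<open>I\<close>.\<close>

lemma nonproper_recurrent:
  fixes f :: "'m::{topological_ab_group_add,t2_space}"
  assumes I: "finite I" "f \<notin> I" "lattice_proper I" "\<not> lattice_proper (insert f I)"
    and W: "open W" "0 \<in> W"
  shows "\<exists>c>n. zm c f \<in> range (rho I) + W"
proof -
  let ?T = "range (rho I)"
  obtain C where C: "compact C" "infinite {c \<in> zfun (insert f I). rho (insert f I) c \<in> C}"
    using I(4) unfolding lattice_proper_def by blast
  define S where "S = {c \<in> zfun (insert f I). rho (insert f I) c \<in> C}"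
  have rho_ins: "rho (insert f I) c = zm (c f) f + rho I c" for c
    unfolding rho_def using I(1,2) by simp
  have fib: "finite {c \<in> S. c f = m}" for m
  proof -
    define Y where "Y = {c \<in> zfun I. rho I c \<in> (+) (- zm m f) ` C}"
    have "finite Y" unfolding Y_def using I(3) compact_translate[OF C(1)] unfolding lattice_proper_def by blast
    moreover have "(%c. c(f := 0)) ` {c \<in> S. c f = m} <= Y"
    proof
      fix d assume "d \<in> (%c. c(f := 0)) ` {c \<in> S. c f = m}"
      then obtain c where c: "d = c(f := 0)" "c \<in> S" "c f = m" by blast
      have "rho I d = rho I c" using I(2) unfolding c(1) by (intro rho_cong) auto
      moreover have "zm m f + rho I c \<in> C" using c rho_ins[of c] unfolding S_def by simp
      moreover have "d \<in> zfun I" using c unfolding S_def zfun_def by auto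
      ultimately show "d \<in> Y" unfolding Y_def translate_eq by (simp add: add.commute)
    qed
    ultimately have "finite ((%c. c(f := 0)) ` {c \<in> S. c f = m})" using finite_subset by blast
    moreover have "inj_on (%c. c(f := 0)) {c \<in> S. c f = m}"
      by (rule inj_onI) (metis (mono_tags, lifting) fun_upd_idem_iff fun_upd_upd mem_Collect_eq)
    ultimately show ?thesis using finite_imageD by blast
  qed
  have Z: "infinite ((%c. c f) ` S)"
  proof
    assume fin: "finite ((%c. c f) ` S)"
    have "finite (\<Union>m\<in>(%c. c f) ` S. {c \<in> S. c f = m})" using fin fib by (rule finite_UN_I)
    moreover have "(\<Union>m\<in>(%c. c f) ` S. {c \<in> S. c f = m}) = S" unfolding UN_simps by auto
    ultimately have "finite S" by (simp only:)
    then show False using C(2) unfolding S_def by simp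
  qed
  obtain W' where W': "open W'" "0 \<in> W'" "!!x. x \<in> W' ==> - x \<in> W'" "!!x y. x \<in> W' ==> y \<in> W' ==> x + y \<in> W"
    using nbhd_halve[OF W] by metis
  obtain F where F: "finite F" "C <= F + W'" using compact_finite_translates[OF C(1) W'(1,2)] by metis
  have ex: "\<exists>g\<in>F. zm m f - g \<in> ?T + W'" if m: "m \<in> (%c. c f) ` S" for m
  proof -
    obtain c where c: "c \<in> S" "m = c f" using m by blast
    have "zm m f + rho I c \<in> F + W'" using c rho_ins[of c] F(2) unfolding S_def by auto
    then obtain g w where gw: "g \<in> F" "w \<in> W'" "zm m f + rho I c = g + w" by (rule set_plus_elim)
    have "zm m f - g = rho I (%f. - c f) + w" using gw(3) unfolding rho_minus by (simp add: algebra_simps)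
    then have "zm m f - g \<in> ?T + W'" using gw(2) by (simp only: set_plus_intro rangeI)
    then show ?thesis using gw(1) by blast
  qed
  then obtain g where g: "!!m. m \<in> (%c. c f) ` S ==> g m \<in> F & zm m f - g m \<in> ?T + W'" by metis
  have "finite (g ` (%c. c f) ` S)" using F(1) g by (meson finite_subset image_subsetI)
  then obtain m0 where m0: "m0 \<in> (%c. c f) ` S" "infinite {m \<in> (%c. c f) ` S. g m = g m0}"
    using pigeonhole_infinite[OF Z] by blast
  define Z' where "Z' = {m \<in> (%c. c f) ` S. g m = g m0}"
  \<comment> \<open>Excluding a whole interval around \<open>m0\<close> makes the difference exceed
    \<open>n\<close> whichever of \<open>m\<close> and \<open>m0\<close> is the larger.\<close>
  have "\<not> Z' <= {m0 - \<bar>n\<bar> .. m0 + \<bar>n\<bar>}" using m0(2) finite_subset unfolding Z'_def by blast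
  then obtain m where m0': "m \<in> Z'" "m \<notin> {m0 - \<bar>n\<bar> .. m0 + \<bar>n\<bar>}" by blast
  then have m: "m \<in> Z'" "\<bar>m - m0\<bar> > \<bar>n\<bar>" unfolding atLeastAtMost_iff by linarith+
  have diff: "zm (k - l) f \<in> ?T + W" if "k \<in> Z'" "l \<in> Z'" for k l
  proof -
    have "zm k f - g m0 \<in> ?T + W'" "zm l f - g m0 \<in> ?T + W'" using g[of k] g[of l] that unfolding Z'_def by auto
    then obtain t w t' w' where tw: "t \<in> ?T" "w \<in> W'" "t' \<in> ?T" "w' \<in> W'" "zm k f - g m0 = t + w" "zm l f - g m0 = t' + w'"
      unfolding set_plus_def by blast
    have "zm (k - l) f = (t - t') + (w + - w')" unfolding zm_diff using tw(5,6) by (simp add: algebra_simps)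
    then show ?thesis using set_plus_intro[OF add_subgroupD(4)[OF rho_subgroup tw(1,3)] W'(4)[OF tw(2) W'(3)[OF tw(4)]]] by (simp only:)
  qed
  have "m0 \<in> Z'" using m0(1) unfolding Z'_def by simp
  show ?thesis
  proof (cases "m > m0")
    case True
    then show ?thesis using diff[OF m(1) \<open>m0 \<in> Z'\<close>] m(2) by (intro exI[of _ "m - m0"]) auto
  next
    case False
    then show ?thesis using diff[OF \<open>m0 \<in> Z'\<close> m(1)] m(2) by (intro exI[of _ "m0 - m"]) auto
  qed
qed

text \<open>Covering \<open>V + V\<close> by finitely many translates of \<open>W\<close> yields a
  finite set \<open>F\<close> whose integer combinations together with \<open>V\<close> exhaust the
  group. Among the subsets of \<open>F\<close> that span a proper lattice one of largest size is
  taken: adjoining any other element of \<open>F\<close> destroys properness, so by recurrence its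
  multiples stay within a compact set of the lattice.\<close>

lemma cocompact_lattice:
  fixes V :: "'m::{topological_ab_group_add,t2_space} set"
  assumes W: "open W" "0 \<in> W" "W <= V" "compact V" and sym: "!!x. x \<in> V ==> - x \<in> V"
  obtains I D where "finite I" "lattice_proper I" "compact D" "generated_subgroup V <= D + range (rho I)"
    "range (rho I) <= generated_subgroup V"
proof -
  let ?H = "generated_subgroup V"
  have H: "add_subgroup ?H" by (rule add_subgroup_generated)
  obtain F where F: "finite F" "F <= V + V" "V + V <= F + W"
    using compact_finite_translates[OF compact_plus[OF W(4) W(4)] W(1,2)] by metis
  have FH: "F <= ?H" using F(2) set_plus_sub[OF H generated_subset generated_subset] by blast
  let ?R = "range (rho F)"
  have "add_subgroup (V + ?R)" unfolding add_subgroup_def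
  proof (intro conjI ballI)
    have "0 + 0 \<in> V + ?R" using W rho_subgroup[of F] by (intro set_plus_intro) (auto simp: add_subgroupD)
    then show "0 \<in> V + ?R" by simp
  next
    fix x y assume "x \<in> V + ?R" "y \<in> V + ?R"
    then obtain v r v' r' where vr: "v \<in> V" "r \<in> ?R" "v' \<in> V" "r' \<in> ?R" "x = v + r" "y = v' + r'"
      unfolding set_plus_def by blast
    have "v + v' \<in> F + W" using F(3) vr(1,3) by blast
    then obtain g w where gw: "g \<in> F" "w \<in> W" "v + v' = g + w" by (rule set_plus_elim)
    have "g \<in> ?R" using rho_generator[OF F(1) gw(1), of 1] by simp
    then have "g + (r + r') \<in> ?R" using vr by (intro add_subgroupD(2)[OF rho_subgroup])
    moreover have "w \<in> V" using gw(2) W(3) by blast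
    moreover have "x + y = w + (g + (r + r'))"
    proof -
      have "x + y = (v + v') + (r + r')" using vr by (simp add: algebra_simps)
      then show ?thesis unfolding gw(3) by (simp add: algebra_simps)
    qed
    ultimately show "x + y \<in> V + ?R" by (simp only: set_plus_intro)
  next
    fix x assume "x \<in> V + ?R"
    then obtain v r where vr: "v \<in> V" "r \<in> ?R" "x = v + r" by (rule set_plus_elim)
    have "- v + - r \<in> V + ?R" using vr sym by (intro set_plus_intro add_subgroupD(3)[OF rho_subgroup])
    then show "- x \<in> V + ?R" using vr(3) by simp
  qed
  then have HV: "?H <= V + ?R"
    by (rule generated_least) (rule set_plus_left, rule add_subgroupD(1)[OF rho_subgroup])
  define P where "P n \<longleftrightarrow> (\<exists>I. I <= F & lattice_proper I & card I = n)" for n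
  have "lattice_proper ({}::'m set)"
  proof -
    have "zfun ({}::'m set) = {%_. 0}" unfolding zfun_def by auto
    then show ?thesis unfolding lattice_proper_def by simp
  qed
  then have "P 0" unfolding P_def by auto
  moreover have "n \<le> card F" if "P n" for n using that F(1) card_mono unfolding P_def by blast
  ultimately obtain n where n: "P n" "!!m. P m ==> m \<le> n"
    using Nat.ex_has_greatest_nat[of P 0 "card F"] by blast
  then obtain I where I: "I <= F" "lattice_proper I" "card I = n" unfolding P_def by blast
  have fI: "finite I" using I(1) F(1) finite_subset by blast
  let ?T = "range (rho I)"
  have T: "add_subgroup ?T" by (rule rho_subgroup)
  obtain U where U: "open U" "0 \<in> U" "!!x. x \<in> U ==> - x \<in> U" "closure U <= W"
    using nbhd_closure[OF W(1,2)] by metis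
  have UV: "U <= V" using U(4) closure_subset[of U] W(3) by blast
  have ex: "\<exists>C. compact C & (\<forall>n. zm n f \<in> C + ?T)" if f: "f \<in> F" for f
  proof (cases "f \<in> I")
    case True
    have "0 + zm n f \<in> {0} + ?T" for n using rho_generator[OF fI True] by (intro set_plus_intro) auto
    then show ?thesis by (intro exI[of _ "{0}"]) simp
  next
    case False
    have np: "\<not> lattice_proper (insert f I)"
    proof
      assume "lattice_proper (insert f I)"
      then have "P (Suc n)" unfolding P_def using f I False fI by (intro exI[of _ "insert f I"]) auto
      then show False using n(2) by fastforce
    qed
    obtain C where "compact C" "!!n. zm n f \<in> C + ?T"
      using recurrent_bounded[OF U(1,2) UV W(4) U(3) T nonproper_recurrent[OF fI False I(2) np]] by blast
    then show ?thesis by blast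
  qed
  have "\<exists>D. compact D & (\<forall>c. rho G c \<in> D + ?T)" if "G <= F" for G
    using finite_subset[OF that F(1)] that
  proof (induction G rule: finite_induct)
    case empty
    have "0 + 0 \<in> {0} + ?T" using add_subgroupD(1)[OF T] by (intro set_plus_intro) auto
    then show ?case by (intro exI[of _ "{0}"]) (simp add: rho_def)
  next
    case (insert f G)
    obtain D where D: "compact D" "\<forall>c. rho G c \<in> D + ?T" using insert by auto
    obtain C where C: "compact C" "\<forall>n. zm n f \<in> C + ?T" using ex[of f] insert.prems by auto
    have "rho (insert f G) c \<in> (C + D) + ?T" for c
    proof -
      have "zm (c f) f \<in> C + ?T" "rho G c \<in> D + ?T" using C D by auto
      then obtain x t y s where xt: "x \<in> C" "t \<in> ?T" "y \<in> D" "s \<in> ?T" "zm (c f) f = x + t" "rho G c = y + s"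
        unfolding set_plus_def by blast
      have "rho (insert f G) c = (x + y) + (t + s)"
        using insert.hyps xt by (simp add: rho_def algebra_simps)
      then show ?thesis using set_plus_intro[OF set_plus_intro[OF xt(1,3)] add_subgroupD(2)[OF T xt(2,4)]] by (simp only:)
    qed
    then show ?case using compact_plus[OF C(1) D(1)] by blast
  qed
  from this[OF subset_refl] obtain D where D: "compact D" "!!c. rho F c \<in> D + ?T" by blast
  show ?thesis
  proof (rule that[OF fI I(2) compact_plus[OF W(4) D(1)]])
    show "?H <= V + D + ?T"
    proof
      fix h assume "h \<in> ?H"
      then have "h \<in> V + ?R" using HV by blast
      then obtain v c where "v \<in> V" "h = v + rho F c" by (auto elim!: set_plus_elim)
      moreover obtain d t where "d \<in> D" "t \<in> ?T" "rho F c = d + t" using D(2) by (rule set_plus_elim)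
      ultimately have "h = (v + d) + t" "v + d \<in> V + D" "t \<in> ?T" by (auto simp: algebra_simps intro: set_plus_intro)
      then show "h \<in> V + D + ?T" using set_plus_intro[of "v + d" "V + D" t ?T] by (simp only:)
    qed
    show "?T <= ?H"
      unfolding rho_def using I(1) FH by (auto intro!: add_subgroup_sum[OF H] add_subgroup_zm[OF H])
  qed
qed

text \<open>Homogenisation: the values \<open>q (zm (2 ^ k) x) / 2 ^ k\<close> change by at most
  \<open>B / 2 ^ Suc k\<close> at each doubling, hence converge within \<open>B\<close> of
  \<open>q x\<close>. The defect of additivity is divided by the same power and disappears in the
  limit, because multiples distribute over sums in an abelian group.\<close>

lemma quasimorphism:
  fixes q :: "'m::ab_group_add => real"
  assumes H: "add_subgroup H" and B: "!!x y. x \<in> H ==> y \<in> H ==> \<bar>q (x + y) - q x - q y\<bar> \<le> B"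
  obtains h where "!!x y. x \<in> H ==> y \<in> H ==> h (x + y) = h x + h y" "!!x. x \<in> H ==> \<bar>h x - q x\<bar> \<le> B"
proof -
  define a where "a x k = q (zm (2 ^ k) x) / 2 ^ k" for x and k :: nat
  have B0: "B \<ge> 0" using B[of 0 0] add_subgroupD(1)[OF H] by linarith
  have zH: "zm k x \<in> H" if "x \<in> H" for k x using add_subgroup_zm[OF H that] .
  have step: "\<bar>a x (Suc k) - a x k\<bar> \<le> B / 2 ^ Suc k" if x: "x \<in> H" for x k
  proof -
    let ?y = "zm (2 ^ k) x"
    have "zm (2 ^ Suc k) x = ?y + ?y" by (simp only: power_Suc mult_2 zm_add)
    then have "a x (Suc k) - a x k = (q (?y + ?y) - q ?y - q ?y) / 2 ^ Suc k"
      unfolding a_def by (simp add: field_simps)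
    then show ?thesis using B[OF zH[OF x] zH[OF x], of "2^k" "2^k"] by (simp add: divide_right_mono abs_divide)
  qed
  have far: "\<bar>a x (m + j) - a x m\<bar> \<le> B * (1 / 2 ^ m - 1 / 2 ^ (m + j))" if x: "x \<in> H" for x m j
  proof (induction j)
    case (Suc j)
    have "\<bar>a x (m + Suc j) - a x m\<bar> \<le> B * (1 / 2 ^ m - 1 / 2 ^ (m + j)) + B / 2 ^ Suc (m + j)"
      using Suc step[OF x, of "m + j"] by simp
    also have "\<dots> = B * (1 / 2 ^ m - 1 / 2 ^ (m + Suc j))" by (simp add: field_simps)
    finally show ?case .
  qed simp
  have far': "\<bar>a x n - a x m\<bar> \<le> B * (1 / 2) ^ m" if x: "x \<in> H" and "m \<le> n" for x m n
  proof -
    obtain j where n: "n = m + j" using \<open>m \<le> n\<close> le_Suc_ex by blast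
    have "B * (1 / 2 ^ m - 1 / 2 ^ (m + j)) \<le> B * (1 / 2 ^ m)" using B0 by (intro mult_left_mono) auto
    then show ?thesis using far[OF x, of m j] unfolding n by (simp add: power_one_over)
  qed
  have lim: "convergent (a x)" if x: "x \<in> H" for x
  proof (rule Cauchy_convergent, rule metric_CauchyI)
    fix e :: real assume "e > 0"
    have "(%m. B * (1 / 2) ^ m) \<longlonglongrightarrow> B * 0" by (intro tendsto_intros LIMSEQ_realpow_zero) auto
    then have "\<forall>\<^sub>F m in sequentially. B * (1 / 2) ^ m < e / 2"
      using \<open>e > 0\<close> by (intro order_tendstoD(2)) auto
    then obtain M where M: "B * (1 / 2) ^ M < e / 2" using eventually_happens by force
    show "\<exists>M. \<forall>m\<ge>M. \<forall>n\<ge>M. dist (a x m) (a x n) < e"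
    proof (intro exI allI impI)
      fix m n assume "M \<le> m" "M \<le> n"
      then have "\<bar>a x m - a x M\<bar> < e / 2" "\<bar>a x n - a x M\<bar> < e / 2" using far'[OF x, of M] M by fastforce+
      then show "dist (a x m) (a x n) < e" unfolding dist_real_def by linarith
    qed
  qed
  define h where "h x = lim (a x)" for x
  have hlim: "a x \<longlonglongrightarrow> h x" if "x \<in> H" for x using lim[OF that] unfolding h_def by (simp add: convergent_LIMSEQ_iff)
  have "\<bar>h x - q x\<bar> \<le> B" if x: "x \<in> H" for x
  proof -
    have "(%n. \<bar>a x n - a x 0\<bar>) \<longlonglongrightarrow> \<bar>h x - a x 0\<bar>" by (intro tendsto_intros hlim x)
    moreover have "\<bar>a x n - a x 0\<bar> \<le> B" for n using far'[OF x, of 0 n] by simp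
    ultimately have "\<bar>h x - a x 0\<bar> \<le> B" by (intro LIMSEQ_le_const2) auto
    then show ?thesis unfolding a_def by simp
  qed
  moreover have "h (x + y) = h x + h y" if x: "x \<in> H" and y: "y \<in> H" for x y
  proof -
    have xy: "x + y \<in> H" using add_subgroupD(2)[OF H x y] .
    have "(%n. a (x + y) n - a x n - a y n) \<longlonglongrightarrow> h (x + y) - h x - h y"
      by (intro tendsto_intros hlim x y xy)
    moreover have "(%n. a (x + y) n - a x n - a y n) \<longlonglongrightarrow> 0"
    proof (rule Lim_null_comparison)
      show "(%n. B * (1 / 2) ^ n) \<longlonglongrightarrow> 0"
      proof -
        have "(%n. B * (1 / 2) ^ n) \<longlonglongrightarrow> B * 0" by (intro tendsto_intros LIMSEQ_realpow_zero) auto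
        then show ?thesis by simp
      qed
      have "norm (a (x + y) n - a x n - a y n) \<le> B * (1 / 2) ^ n" for n
      proof -
        have "a (x + y) n - a x n - a y n = (q (zm (2^n) x + zm (2^n) y) - q (zm (2^n) x) - q (zm (2^n) y)) / 2 ^ n"
          unfolding a_def zm_add_right by (simp add: diff_divide_distrib)
        then have "norm (a (x + y) n - a x n - a y n) \<le> B / 2 ^ n"
          using B[OF zH[OF x] zH[OF y], of "2^n" "2^n"] by (simp add: divide_right_mono abs_divide)
        then show ?thesis by (simp add: power_one_over)
      qed
      then show "\<forall>\<^sub>F n in sequentially. norm (a (x + y) n - a x n - a y n) \<le> B * (1 / 2) ^ n" by simp
    qed
    ultimately have "h (x + y) - h x - h y = 0" by (rule LIMSEQ_unique)
    then show ?thesis by simp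
  qed
  ultimately show ?thesis using that by blast
qed

text \<open>If the \<open>m\<close>-fold multiple of \<open>x\<close> still lies in
  \<open>W\<close>, then \<open>h x\<close> is at most \<open>M / m\<close> in absolute value; the
  preimage of \<open>W\<close> under multiplication by a large \<open>m\<close> is the neighbourhood
  needed at 0.\<close>

lemma bounded_additive_continuous:
  fixes h :: "'m::topological_ab_group_add => real"
  assumes H: "add_subgroup H" and add: "!!x y. x \<in> H ==> y \<in> H ==> h (x + y) = h x + h y"
    and W: "open W" "0 \<in> W" "!!x. x \<in> W Int H ==> \<bar>h x\<bar> \<le> M"
  shows "continuous_on H h"
proof (rule additive_continuous[OF H add])
  fix U :: "real set" assume "open U" "0 \<in> U"
  then obtain e where e: "e > 0" "ball 0 e <= U" using openE by blast
  obtain m :: nat where m: "real m > \<bar>M\<bar> / e" using reals_Archimedean2 by blast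
  have "open {x. zm (int m) x \<in> W}" by (rule open_vimage_UNIV[OF continuous_zm W(1)])
  moreover have "h x \<in> U" if "x \<in> {x. zm (int m) x \<in> W} Int H" for x
  proof -
    have "\<bar>h (zm (int m) x)\<bar> \<le> M" using that W(3) add_subgroup_zm[OF H] by simp
    then have "\<bar>real m * h x\<bar> \<le> M" using additive_on_zm(4)[OF H add, of x "int m"] that by (simp add: zm_real)
    then have "real m * \<bar>h x\<bar> \<le> M" by (simp add: abs_mult)
    moreover have "\<bar>M\<bar> < real m * e" using m e(1) by (simp add: field_simps)
    ultimately have "real m * \<bar>h x\<bar> < real m * e" by linarith
    then have "\<bar>h x\<bar> < e" by (simp add: mult_less_cancel_left)
    then show ?thesis using e(2) by auto
  qed
  ultimately show "\<exists>W. open W & 0 \<in> W & (\<forall>y\<in>W Int H. h y \<in> U)"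
    using W(2) by (intro exI[of _ "{x. zm (int m) x \<in> W}"]) auto
qed

text \<open>Each \<open>h\<close> in \<open>H\<close> is approximated modulo the compact
  \<open>D\<close> by the lattice vector with coefficients \<open>cc h\<close>. The vector
  \<open>cc x + cc y - cc (x + y)\<close> is sent by \<open>rho I\<close> into a fixed compact set,
  so properness bounds its coordinates and each coordinate of \<open>cc\<close> is a quasimorphism.
  The homogenised coordinates are the characters; staying within \<open>B\<close> of the
  coordinates, they inherit properness.\<close>

lemma proper_characters:
  assumes "LCA_group TYPE('m::{topological_ab_group_add,t2_space})"
  obtains H :: "'m::{topological_ab_group_add,t2_space} set" and n :: nat and chi where "open H" "add_subgroup H"
    "!!i x y. i < n ==> x \<in> H ==> y \<in> H ==> chi i (x + y) = chi i x + (chi i y :: real)"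
    "!!i. i < n ==> continuous_on H (chi i)"
    "!!r. \<exists>C. compact C & {x \<in> H. \<forall>i<n. \<bar>chi i x\<bar> \<le> r} <= C"
proof -
  obtain W V where W: "open W" "(0::'m) \<in> W" "W <= V" "compact V" and sym: "!!x. x \<in> V ==> - x \<in> V"
    using nbhd_compact[OF assms open_UNIV UNIV_I] by metis
  define H where "H = generated_subgroup V"
  have H: "add_subgroup H" unfolding H_def by (rule add_subgroup_generated)
  have VH: "V <= H" unfolding H_def by (rule generated_subset)
  have oH: "open H" using open_subgroup[OF H W(1,2)] W(3) VH by blast
  obtain I D where I: "finite I" "lattice_proper I" "compact D" "H <= D + range (rho I)"
    using cocompact_lattice[OF W sym] unfolding H_def by metis
  have "\<exists>c. c \<in> zfun I & h - rho I c \<in> D" if h: "h \<in> H" for h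
  proof -
    have "h \<in> D + rho I ` zfun I" using I(4) h unfolding rho_range by blast
    then obtain d c where "d \<in> D" "c \<in> zfun I" "h = d + rho I c" by (auto elim!: set_plus_elim)
    then show ?thesis by (intro exI[of _ c]) simp
  qed
  then obtain cc where cc: "!!h. h \<in> H ==> cc h \<in> zfun I" "!!h. h \<in> H ==> h - rho I (cc h) \<in> D" by metis
  have bd: "\<exists>B. \<forall>c\<in>zfun I. rho I c \<in> C --> (\<forall>e\<in>I. \<bar>real_of_int (c e)\<bar> \<le> B)" if C: "compact C" for C
  proof -
    have fin: "finite {c \<in> zfun I. rho I c \<in> C}" using I(2) C unfolding lattice_proper_def by blast
    define B where "B = (\<Sum>c\<in>{c \<in> zfun I. rho I c \<in> C}. \<Sum>e\<in>I. \<bar>real_of_int (c e)\<bar>)"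
    have "\<bar>real_of_int (c e)\<bar> \<le> B" if c: "c \<in> zfun I" "rho I c \<in> C" and e: "e \<in> I" for c e
    proof -
      have "\<bar>real_of_int (c e)\<bar> \<le> (\<Sum>e\<in>I. \<bar>real_of_int (c e)\<bar>)" using e I(1) by (intro member_le_sum) auto
      also have "\<dots> \<le> B" unfolding B_def using c fin
        by (intro member_le_sum[of c _ "%c. \<Sum>e\<in>I. \<bar>real_of_int (c e)\<bar>"]) (auto intro: sum_nonneg)
      finally show ?thesis .
    qed
    then show ?thesis by blast
  qed
  obtain B where B: "\<forall>c\<in>zfun I. rho I c \<in> D + (uminus ` D + uminus ` D) --> (\<forall>e\<in>I. \<bar>real_of_int (c e)\<bar> \<le> B)"
    using bd[OF compact_plus[OF I(3) compact_plus[OF compact_uminus[OF I(3)] compact_uminus[OF I(3)]]]] by blast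
  have quasi: "\<bar>real_of_int (cc (x + y) e) - real_of_int (cc x e) - real_of_int (cc y e)\<bar> \<le> B"
    if x: "x \<in> H" and y: "y \<in> H" and e: "e \<in> I" for x y e
  proof -
    define c where "c f = cc x f + (cc y f + - cc (x + y) f)" for f
    have xy: "x + y \<in> H" using add_subgroupD(2)[OF H x y] .
    have "rho I c = rho I (cc x) + (rho I (cc y) - rho I (cc (x + y)))"
      unfolding c_def using rho_add[of I "cc x" "%f. cc y f + - cc (x + y) f"]
        rho_add[of I "cc y" "%f. - cc (x + y) f"] rho_minus[of I "cc (x + y)"] by simp
    also have "\<dots> = ((x + y) - rho I (cc (x + y))) + (- (x - rho I (cc x)) + - (y - rho I (cc y)))"
      by (simp add: algebra_simps)
    also have "\<dots> \<in> D + (uminus ` D + uminus ` D)" using cc(2) x y xy by (intro set_plus_intro imageI)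
    finally have "rho I c \<in> D + (uminus ` D + uminus ` D)" .
    moreover have "c \<in> zfun I" using cc(1)[OF x] cc(1)[OF y] cc(1)[OF xy] unfolding zfun_def c_def by simp
    ultimately have "\<bar>real_of_int (c e)\<bar> \<le> B" using B e by blast
    then show ?thesis unfolding c_def by simp
  qed
  have "\<exists>h. (\<forall>x\<in>H. \<forall>y\<in>H. h (x + y) = h x + h y) & (\<forall>x\<in>H. \<bar>h x - real_of_int (cc x e)\<bar> \<le> B)" if e: "e \<in> I" for e
    using quasimorphism[OF H, of "%x. real_of_int (cc x e)" B] quasi[OF _ _ e] by metis
  then obtain h where h: "!!e x y. e \<in> I ==> x \<in> H ==> y \<in> H ==> h e (x + y) = h e x + (h e y :: real)"
    "!!e x. e \<in> I ==> x \<in> H ==> \<bar>h e x - real_of_int (cc x e)\<bar> \<le> B" by metis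
  obtain f where f: "bij_betw f {..<card I} I" using bij_betw_from_nat_into_finite[OF I(1)] by blast
  have fI: "f i \<in> I" if "i < card I" for i using f that unfolding bij_betw_def by blast
  show ?thesis
  proof (rule that[OF oH H, of "card I" "%i. h (f i)"])
    show "h (f i) (x + y) = h (f i) x + h (f i) y" if "i < card I" "x \<in> H" "y \<in> H" for i x y
      using h(1) fI that by blast
    show "continuous_on H (h (f i))" if i: "i < card I" for i
    proof -
      obtain B' where B': "\<forall>c\<in>zfun I. rho I c \<in> V + uminus ` D --> (\<forall>e\<in>I. \<bar>real_of_int (c e)\<bar> \<le> B')"
        using bd[OF compact_plus[OF W(4) compact_uminus[OF I(3)]]] by blast
      have "\<bar>h (f i) x\<bar> \<le> B + B'" if "x \<in> W Int H" for x
      proof -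
        have x: "x \<in> H" "x \<in> V" using that W(3) by auto
        have "x + - (x - rho I (cc x)) \<in> V + uminus ` D" using x cc(2) by (intro set_plus_intro imageI)
        then have "rho I (cc x) \<in> V + uminus ` D" by simp
        then have "\<bar>real_of_int (cc x (f i))\<bar> \<le> B'" using B' cc(1)[OF x(1)] fI[OF i] by blast
        then show ?thesis using h(2)[OF fI[OF i] x(1)] by linarith
      qed
      then show ?thesis using bounded_additive_continuous[OF H h(1)[OF fI[OF i]] W(1,2)] by blast
    qed
    show "\<exists>C. compact C & {x \<in> H. \<forall>i<card I. \<bar>h (f i) x\<bar> \<le> r} <= C" for r
    proof -
      define X where "X = {c \<in> zfun I. \<forall>e\<in>I. \<bar>real_of_int (c e)\<bar> \<le> r + B}"
      have "X <= {c. \<forall>e. (e \<in> I --> c e \<in> {- \<lceil>r + B\<rceil> .. \<lceil>r + B\<rceil>}) & (e \<notin> I --> c e = 0)}"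
      proof
        fix c assume c: "c \<in> X"
        have "c e \<in> {- \<lceil>r + B\<rceil> .. \<lceil>r + B\<rceil>}" if "e \<in> I" for e
        proof -
          have "\<bar>real_of_int (c e)\<bar> \<le> r + B" using c that unfolding X_def by blast
          then show ?thesis unfolding abs_le_iff atLeastAtMost_iff by linarith
        qed
        then show "c \<in> {c. \<forall>e. (e \<in> I --> c e \<in> {- \<lceil>r + B\<rceil> .. \<lceil>r + B\<rceil>}) & (e \<notin> I --> c e = 0)}"
          using c unfolding X_def zfun_def by blast
      qed
      moreover have "finite {c. \<forall>e. (e \<in> I --> c e \<in> {- \<lceil>r + B\<rceil> .. \<lceil>r + B\<rceil>}) & (e \<notin> I --> c e = 0)}"
        by (rule finite_set_of_finite_funs[OF I(1)]) simp
      ultimately have "finite X" by (rule finite_subset)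
      then have "compact (D + rho I ` X)" by (intro compact_plus[OF I(3) finite_imp_compact]) simp
      moreover have "x \<in> D + rho I ` X" if x: "x \<in> H" "\<forall>i<card I. \<bar>h (f i) x\<bar> \<le> r" for x
      proof -
        have "\<bar>real_of_int (cc x e)\<bar> \<le> r + B" if e: "e \<in> I" for e
        proof -
          obtain i where "i < card I" "f i = e" using f e unfolding bij_betw_def by (metis imageE lessThan_iff)
          then show ?thesis using h(2)[OF e x(1)] x(2) by force
        qed
        then have "cc x \<in> X" unfolding X_def using cc(1)[OF x(1)] by simp
        then have "(x - rho I (cc x)) + rho I (cc x) \<in> D + rho I ` X" using cc(2)[OF x(1)] by (intro set_plus_intro imageI)
        then show ?thesis by simp
      qed
      ultimately show ?thesis by blast
    qed
  qed
qed

subsection \<open>One-parameter subgroups and the Euclidean part\<close>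

text \<open>Gaussian elimination: the pivot \<open>p\<close> of one equation is solved for and
  removed. It carries the dimension arguments wherever vectors are only families of real
  coordinates.\<close>

lemma homogeneous_system:
  fixes v :: "'k => 'j => real"
  assumes "finite J" "finite K" "card J < card K"
  shows "\<exists>c. (\<exists>k\<in>K. c k ~= 0) & (\<forall>i\<in>J. (\<Sum>k\<in>K. c k * v k i) = 0)"
  using assms
proof (induction J arbitrary: K v rule: finite_induct)
  case empty
  then have "K ~= {}" by auto
  then show ?case by (intro exI[of _ "%_. 1"]) auto
next
  case (insert j J)
  show ?case
  proof (cases "\<forall>k\<in>K. v k j = 0")
    case True
    have "card J < card K" using insert by simp
    from insert.IH[OF insert.prems(1) this, of v] obtain c where
      c: "\<exists>k\<in>K. c k ~= 0" "\<forall>i\<in>J. (\<Sum>k\<in>K. c k * v k i) = 0" by blast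
    have "(\<Sum>k\<in>K. c k * v k j) = 0" using True by (intro sum.neutral) simp
    then show ?thesis using c by (intro exI[of _ c]) simp
  next
    case False
    then obtain p where p: "p \<in> K" "v p j ~= 0" by blast
    define K' where "K' = K - {p}"
    have K': "finite K'" "card J < card K'" using insert p unfolding K'_def by auto
    from insert.IH[OF this, of "%k i. v k i - v k j / v p j * v p i"] obtain c' where
      c': "\<exists>k\<in>K'. c' k ~= 0" "\<forall>i\<in>J. (\<Sum>k\<in>K'. c' k * (v k i - v k j / v p j * v p i)) = 0" by blast
    define s where "s = (\<Sum>k\<in>K'. c' k * v k j) / v p j"
    define c where "c = c'(p := - s)"
    have eq: "(\<Sum>k\<in>K. c k * v k i) = (\<Sum>k\<in>K'. c' k * v k i) - s * v p i" for i
    proof -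
      have "(\<Sum>k\<in>K. c k * v k i) = c p * v p i + (\<Sum>k\<in>K'. c k * v k i)"
        unfolding K'_def using insert.prems(1) p(1) by (rule sum.remove)
      also have "(\<Sum>k\<in>K'. c k * v k i) = (\<Sum>k\<in>K'. c' k * v k i)"
        by (rule sum.cong) (auto simp: c_def K'_def)
      finally show ?thesis by (simp add: c_def)
    qed
    have "(\<Sum>k\<in>K. c k * v k i) = 0" if "i \<in> insert j J" for i
    proof (cases "i = j")
      case True
      then show ?thesis unfolding eq s_def using p(2) by simp
    next
      case False
      then have "(\<Sum>k\<in>K'. c' k * (v k i - v k j / v p j * v p i)) = 0" using c'(2) that by blast
      moreover have "(\<Sum>k\<in>K'. c' k * (v k i - v k j / v p j * v p i)) = (\<Sum>k\<in>K'. c' k * v k i) - s * v p i"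
        unfolding s_def by (simp add: right_diff_distrib sum_subtractf sum_divide_distrib sum_distrib_right mult.assoc)
      ultimately show ?thesis unfolding eq by simp
    qed
    moreover have "\<exists>k\<in>K. c k ~= 0" using c'(1) unfolding c_def K'_def by auto
    ultimately show ?thesis by blast
  qed
qed

text \<open>The difference from the linear map vanishes on the integers and is bounded on the unit
  interval, hence bounded everywhere; a bounded additive function is zero.\<close>

lemma additive_real_linear:
  fixes f :: "real => real"
  assumes add: "!!x y. f (x + y) = f x + f y" and cont: "continuous_on UNIV f"
  shows "f r = r * f 1"
proof -
  define g where "g r = f r - r * f 1" for r
  have gadd: "g (x + y) = g x + g y" for x y unfolding g_def add by (simp add: algebra_simps)
  have gz: "g (zm k x) = zm k (g x)" for k x by (rule zm_hom) (rule gadd)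
  have gint: "g (real_of_int k) = 0" for k
    using gz[of k 1] unfolding zm_real by (simp add: g_def)
  have "continuous_on {0..1} g" unfolding g_def by (intro continuous_intros continuous_on_subset[OF cont]) auto
  then have "bounded (g ` {0..1})" using compact_continuous_image compact_Icc compact_imp_bounded by blast
  then obtain B where B: "!!x. x \<in> {0..1} ==> \<bar>g x\<bar> \<le> B" unfolding bounded_iff by (metis imageI real_norm_def)
  have bd: "\<bar>g x\<bar> \<le> B" for x
  proof -
    have "g x = g (frac x) + g (real_of_int \<lfloor>x\<rfloor>)" unfolding gadd[symmetric] frac_def by simp
    moreover have "frac x \<in> {0..1}" using frac_ge_0[of x] frac_lt_1[of x] by simp
    ultimately show ?thesis using B[of "frac x"] gint by simp
  qed
  have "g r = 0"
  proof (rule ccontr)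
    assume nz: "g r ~= 0"
    obtain m :: nat where m: "real m > B / \<bar>g r\<bar>" using reals_Archimedean2 by blast
    have "\<bar>real m * g r\<bar> \<le> B" using bd[of "zm (int m) r"] unfolding gz by (simp add: zm_real)
    then show False using m nz by (simp add: abs_mult field_simps)
  qed
  then show ?thesis unfolding g_def by simp
qed

definition oneparam :: "(real => 'm::{topological_ab_group_add,t2_space}) => bool" where
  "oneparam \<phi> \<longleftrightarrow> continuous_on UNIV \<phi> & (\<forall>r s. \<phi> (r + s) = \<phi> r + \<phi> s)"

lemma oneparamD:
  assumes "oneparam \<phi>"
  shows "continuous_on S \<phi>" "\<phi> (r + s) = \<phi> r + \<phi> s" "\<phi> 0 = 0" "\<phi> (- r) = - \<phi> r" "\<phi> (r - s) = \<phi> r - \<phi> s"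
    "\<phi> (real_of_int k * r) = zm k (\<phi> r)"
proof -
  show "continuous_on S \<phi>" using assms continuous_on_subset unfolding oneparam_def by blast
  show a: "\<phi> (r + s) = \<phi> r + \<phi> s" for r s using assms unfolding oneparam_def by blast
  show z: "\<phi> 0 = 0" using a[of 0 0] by simp
  show "\<phi> (- r) = - \<phi> r" using a[of "-r" r] z by (simp add: eq_neg_iff_add_eq_0)
  show "\<phi> (r - s) = \<phi> r - \<phi> s" using a[of "r - s" s] by (simp add: algebra_simps)
  show "\<phi> (real_of_int k * r) = zm k (\<phi> r)" using zm_hom[of \<phi> k r] a unfolding zm_real by blast
qed

lemma oneparam_scale: "oneparam \<phi> ==> oneparam (%r. \<phi> (c * r))"
  unfolding oneparam_def by (auto simp: distrib_left intro!: continuous_on_compose2[of UNIV \<phi>] continuous_intros)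

lemma oneparam_diff: "oneparam \<phi> ==> oneparam \<psi> ==> oneparam (%r. \<phi> r - \<psi> r)"
  unfolding oneparam_def by (auto intro!: continuous_intros)

lemma oneparam_zero: "oneparam (%_. 0)"
  unfolding oneparam_def by (auto intro!: continuous_intros)

lemma oneparam_hom:
  fixes h :: "'m::{topological_ab_group_add,t2_space} => 'n::{topological_ab_group_add,t2_space}"
  assumes "oneparam \<phi>" "continuous_on UNIV h" "!!x y. h (x + y) = h x + h y" shows "oneparam (%r. h (\<phi> r))"
  using assms unfolding oneparam_def by (auto intro: continuous_on_compose2[of UNIV h])

text \<open>Divisibility of a path: each value is a multiple of arbitrarily small values. This
  pushes the whole path into any subgroup that contains its small values.\<close>

lemma oneparam_small:
  assumes "oneparam \<phi>" "open W" "0 \<in> W"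
  obtains m :: nat where "m > 0" "\<phi> (r / real m) \<in> W" "zm (int m) (\<phi> (r / real m)) = \<phi> r"
proof -
  have "(%m. r / real m) \<longlonglongrightarrow> 0" by (rule lim_const_over_n)
  moreover have "isCont \<phi> 0" using oneparamD(1)[OF assms(1), of UNIV] by (simp add: continuous_on_eq_continuous_at)
  ultimately have "(%m. \<phi> (r / real m)) \<longlonglongrightarrow> \<phi> 0" using isCont_tendsto_compose by blast
  then have "\<forall>\<^sub>F m in sequentially. \<phi> (r / real m) \<in> W"
    using assms(2,3) oneparamD(3)[OF assms(1)] topological_tendstoD by fastforce
  then have "\<forall>\<^sub>F m in sequentially. \<phi> (r / real m) \<in> W & m > 0" using eventually_gt_at_top[of 0] by (rule eventually_conj)
  then obtain m where "\<phi> (r / real m) \<in> W" "m > 0" using eventually_happens by fastforce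
  moreover have "zm (int m) (\<phi> (r / real m)) = \<phi> r" using oneparamD(6)[OF assms(1), of "int m" "r / real m"] \<open>m > 0\<close> by simp
  ultimately show ?thesis using that by blast
qed

lemma closure_plus_mem:
  fixes A B :: "'m::topological_ab_group_add set"
  assumes "x \<in> closure A" "y \<in> closure B" shows "x + y \<in> closure (A + B)"
proof -
  have "(%p. fst p + snd p) ` closure (A \<times> B) <= closure ((%p. fst p + snd p) ` (A \<times> B))"
    by (rule continuous_image_closure_subset[of UNIV]) (auto intro!: continuous_intros)
  also have "\<dots> <= closure (A + B)" by (rule closure_mono) (auto intro: set_plus_intro)
  finally show ?thesis using assms by (auto simp: closure_Times image_subset_iff)
qed

lemma closure_uminus_mem:
  fixes A :: "'m::topological_ab_group_add set"
  assumes "x \<in> closure A" shows "- x \<in> closure (uminus ` A)"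
proof -
  have "uminus ` closure A <= closure (uminus ` A)"
    by (rule continuous_image_closure_subset[of UNIV]) (auto intro!: continuous_intros)
  then show ?thesis using assms by blast
qed

lemma compact_fun_space:
  fixes C :: "'i => 'b::topological_space set"
  assumes "!!i. compact (C i)" shows "compact {g. \<forall>i. g i \<in> C i}"
proof -
  have "compactin (product_topology (%_. euclidean) UNIV) (PiE UNIV C)"
    unfolding compactin_PiE using assms by simp
  moreover have "PiE UNIV C = {g. \<forall>i. g i \<in> C i}" by auto
  ultimately show ?thesis by (simp add: euclidean_product_topology)
qed

section \<open>Characters on an open subgroup: length, compact kernel, short chains\<close>

locale char_module = pfree_module +
  fixes H :: "'b set" and n :: nat and chi :: "nat => 'b => real"
  assumes oH: "open H" and sH: "add_subgroup H"
    and chi_add: "!!i x y. i < n ==> x \<in> H ==> y \<in> H ==> chi i (x + y) = chi i x + chi i y"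
    and chi_cont: "!!i. i < n ==> continuous_on H (chi i)"
    and chi_proper: "!!r. \<exists>C. compact C & {x \<in> H. \<forall>i<n. \<bar>chi i x\<bar> \<le> r} <= C"
begin

text \<open>The sum norm of the vector of characters: a length on \<open>H\<close> that grows
  linearly along multiples and whose balls are compact by \<open>chi_proper\<close>.\<close>

definition N :: "'b => real" where "N x = (\<Sum>i<n. \<bar>chi i x\<bar>)"

lemma cH: "closed H" by (rule closed_open_subgroup[OF sH oH])

lemma N_nonneg: "N x \<ge> 0" unfolding N_def by (rule sum_nonneg) simp

lemma chi_le_N: "i < n ==> \<bar>chi i x\<bar> \<le> N x"
  unfolding N_def by (rule member_le_sum) auto

lemma N_zm: "x \<in> H ==> N (zm k x) = \<bar>real_of_int k\<bar> * N x"
proof -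
  assume x: "x \<in> H"
  have "chi i (zm k x) = real_of_int k * chi i x" if "i < n" for i
    using additive_on_zm(4)[OF sH chi_add[OF that] x] by (simp add: zm_real)
  then show ?thesis unfolding N_def by (simp add: abs_mult sum_distrib_left)
qed

lemma N_uminus: "x \<in> H ==> N (- x) = N x" using N_zm[of x "-1"] by simp

lemma N_zero: "N 0 = 0" using N_zm[OF add_subgroupD(1)[OF sH], of 0] by simp

lemma N_add: assumes "x \<in> H" "y \<in> H" shows "N (x + y) \<le> N x + N y"
proof -
  have "N (x + y) \<le> (\<Sum>i<n. \<bar>chi i x\<bar> + \<bar>chi i y\<bar>)"
    unfolding N_def using chi_add assms by (intro sum_mono) auto
  then show ?thesis unfolding N_def by (simp add: sum.distrib)
qed

lemma N_cont: "continuous_on H N"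
  unfolding N_def using chi_cont by (intro continuous_intros) auto

lemma N_tendsto: assumes "x \<in> H" shows "(N \<longlongrightarrow> N x) (nhds x)"
proof -
  have "isCont N x" using N_cont assms oH by (simp add: continuous_on_eq_continuous_at)
  then show ?thesis unfolding isCont_def tendsto_at_iff_tendsto_nhds .
qed

lemma N_ball_compact: "compact {x \<in> H. N x \<le> r}"
proof -
  obtain C where C: "compact C" "{x \<in> H. \<forall>i<n. \<bar>chi i x\<bar> \<le> r} <= C" using chi_proper by blast
  have "closed (H Int N -` {..r})" by (rule continuous_closed_preimage[OF N_cont cH]) simp
  moreover have "H Int N -` {..r} <= C"
  proof
    fix x assume "x \<in> H Int N -` {..r}"
    then have x: "x \<in> H" "N x \<le> r" by auto
    have "\<forall>i<n. \<bar>chi i x\<bar> \<le> r" using x(2) order_trans[OF chi_le_N] by blast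
    then show "x \<in> C" using C(2) x(1) by blast
  qed
  ultimately have "compact (C Int (H Int N -` {..r}))" using C(1) by (intro compact_Int_closed)
  moreover have "C Int (H Int N -` {..r}) = {x \<in> H. N x \<le> r}" using \<open>H Int N -` {..r} <= C\<close> by auto
  ultimately show ?thesis by simp
qed

text \<open>Not only compact but the largest compact subgroup of \<open>H\<close>: \<open>N\<close>
  is bounded on a compact subgroup and grows linearly along multiples.\<close>

definition K0 :: "'b set" where "K0 = {x \<in> H. N x = 0}"

lemma K0_compact: "compact K0"
proof -
  have "N x \<le> 0 \<longleftrightarrow> N x = 0" for x using N_nonneg[of x] by linarith
  then have "K0 = {x \<in> H. N x \<le> 0}" unfolding K0_def by simp
  then show ?thesis using N_ball_compact by simp
qed

lemma K0_subgroup: "add_subgroup K0"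
  unfolding add_subgroup_def K0_def
proof (intro conjI ballI)
  show "0 \<in> {x \<in> H. N x = 0}" using N_zero add_subgroupD(1)[OF sH] by simp
  show "x + y \<in> {x \<in> H. N x = 0}" if "x \<in> {x \<in> H. N x = 0}" "y \<in> {x \<in> H. N x = 0}" for x y
    using N_add[of x y] N_nonneg[of "x + y"] add_subgroupD(2)[OF sH, of x y] that by simp
  show "- x \<in> {x \<in> H. N x = 0}" if "x \<in> {x \<in> H. N x = 0}" for x
    using N_uminus[of x] add_subgroupD(3)[OF sH, of x] that by simp
qed

lemma compact_subgroup_K0:
  assumes "compact Y" "add_subgroup Y" "Y <= H" shows "Y <= K0"
proof
  fix x assume x: "x \<in> Y"
  have "compact (N ` Y)" using compact_continuous_image[OF continuous_on_subset[OF N_cont assms(3)] assms(1)] .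
  then have "bounded (N ` Y)" by (rule compact_imp_bounded)
  then obtain b where b: "!!y. y \<in> Y ==> \<bar>N y\<bar> \<le> b" unfolding bounded_iff by auto
  have "N x = 0"
  proof (rule ccontr)
    assume nz: "N x ~= 0"
    then have pos: "N x > 0" using N_nonneg[of x] by simp
    obtain m :: nat where m: "real m > b / N x" using reals_Archimedean2 by blast
    have "\<bar>N (zm (int m) x)\<bar> \<le> b" using b[OF add_subgroup_zm[OF assms(2) x]] .
    then have "real m * N x \<le> b" using N_zm[of x "int m"] x assms(3) N_nonneg[of x] by auto
    then show False using m pos by (simp add: field_simps)
  qed
  then show "x \<in> K0" unfolding K0_def using x assms(3) by blast
qed

text \<open>The intersection with the open subgroup \<open>H\<close> has finite index in
  \<open>Y\<close>, so \<open>Y\<close> lies in \<open>H\<close> and hence in \<open>K0\<close>;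
  this compact group is the common bound that \<open>pfin_trivial\<close> asks for.\<close>

lemma no_connected: assumes "pfin {} Y" shows "Y = {0}"
proof (rule pfin_trivial[OF K0_compact _ K0_subgroup assms])
  fix Y assume Y: "pfin {} Y"
  have cY: "compact Y" "add_subgroup Y" using Y unfolding pfin_def by auto
  have aL: "add_subgroup (Y Int H)" using add_subgroup_Int[OF cY(2) sH] .
  have "finite (cosets Y (Y Int H))"
    by (rule finite_cosets_compact[OF cY aL oH add_subgroupD(1)[OF sH]]) blast
  moreover have "closed (Y Int H)" using compact_imp_closed[OF cY(1)] cH by (rule closed_Int)
  ultimately have "Y Int H = Y" using Y aL unfolding pfin_def by simp
  then have "Y <= H" by blast
  then show "Y <= K0" using compact_subgroup_K0[OF cY] by blast
qed

text \<open>Finite sums of steps from \<open>W\<close>, with the first index accumulating the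
  lengths of the steps. In the limit of small \<open>W\<close> and small cost the reachable points
  form a compact group without proper closed subgroups of finite index, which is how connectedness
  is brought to bear.\<close>

inductive chain :: "'b set => real => 'b => bool" for W where
  chain_0: "chain W 0 0"
| chain_Suc: "chain W t x ==> y \<in> W ==> chain W (t + N y) (x + y)"

definition good :: "'b set => bool" where
  "good W \<longleftrightarrow> open W & 0 \<in> W & (\<forall>x\<in>W. - x \<in> W) & W <= H"

definition S :: "'b set => real => 'b set" where "S W e = {x. \<exists>t\<le>e. chain W t x}"

lemma good_Int: "good W ==> good W' ==> good (W Int W')"
  unfolding good_def by auto

lemma chain_add: "chain W s y ==> chain W t x ==> chain W (t + s) (x + y)"
proof (induction rule: chain.induct)
  case chain_0 then show ?case by simp
next
  case (chain_Suc s y z)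
  then show ?case using chain.chain_Suc[of W "t + s" "x + y" z] by (simp add: add.assoc)
qed

lemma chain_uminus: assumes "good W" shows "chain W t x ==> chain W t (- x)"
proof (induction rule: chain.induct)
  case chain_0 then show ?case using chain.chain_0 by simp
next
  case (chain_Suc t x y)
  have "- y \<in> W" "N (- y) = N y" using chain_Suc assms N_uminus unfolding good_def by auto
  then show ?case using chain.chain_Suc[OF chain_Suc.IH, of "- y"] by (simp add: algebra_simps)
qed

lemma chain_H: assumes "good W" shows "chain W t x ==> x \<in> H & N x \<le> t & 0 \<le> t"
proof (induction rule: chain.induct)
  case chain_0 then show ?case using N_zero add_subgroupD(1)[OF sH] by simp
next
  case (chain_Suc t x y)
  have "y \<in> H" using chain_Suc assms unfolding good_def by auto
  then show ?case using chain_Suc N_add[of x y] N_nonneg[of y] add_subgroupD(2)[OF sH, of x y] by auto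
qed

lemma chain_mono: assumes "W <= W'" shows "chain W t x ==> chain W' t x"
  by (induction rule: chain.induct) (use assms in \<open>auto intro: chain.intros\<close>)

lemma chain_zm: "x \<in> W ==> chain W (real k * N x) (zm (int k) x)"
proof (induction k)
  case 0 then show ?case using chain_0 by simp
next
  case (Suc k)
  have "zm (int (Suc k)) x = zm (int k) x + x" using zm_succ[of "int k" x] by (simp add: add.commute)
  moreover have "real (Suc k) * N x = real k * N x + N x" by (simp add: algebra_simps)
  ultimately show ?case using chain_Suc[OF Suc.IH[OF Suc.prems] Suc.prems] by simp
qed

lemma good_nbhd: assumes "open W" "0 \<in> W" obtains W' where "good W'" "W' <= W"
proof -
  obtain W' where "open W'" "0 \<in> W'" "!!x. x \<in> W' ==> - x \<in> W'" "W' <= W Int H"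
    using nbhd_halve[of "W Int H"] assms oH add_subgroupD(1)[OF sH] by (metis IntI open_Int)
  then show ?thesis using that[of W'] unfolding good_def by blast
qed

lemma S_mono: "W <= W' ==> e \<le> e' ==> S W e <= S W' e'"
  unfolding S_def using chain_mono[of W W'] by (smt (verit) Collect_mono)

lemma S_subset: "good W ==> S W e <= {x \<in> H. N x \<le> e}"
  unfolding S_def using chain_H[of W] by (smt (verit) Collect_mono)

lemma closure_S_compact: assumes "good W" shows "compact (closure (S W e))"
proof -
  have "closure (S W e) <= {x \<in> H. N x \<le> e}"
    by (rule closure_minimal[OF S_subset[OF assms] compact_imp_closed[OF N_ball_compact]])
  then have "closure (S W e) = {x \<in> H. N x \<le> e} Int closure (S W e)" by blast
  then show ?thesis using compact_Int_closed[OF N_ball_compact closed_closure] by metis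
qed

text \<open>The limit of the \<open>W\<close>-chains of small total cost is a compact connected subgroup, hence trivial.\<close>

lemma small_chains:
  assumes U: "open U" "0 \<in> U" obtains W e where "good W" "e > 0" "S W e <= U"
proof -
  define CC where "CC = {closure (S W e) | W e. good W & e > 0}"
  define La where "La = \<Inter>CC"
  obtain W0 where W0: "good W0" using good_nbhd[of UNIV] by auto
  have ne: "CC ~= {}" unfolding CC_def using W0 zero_less_one by blast
  have cpt: "compact A" if "A \<in> CC" for A using that closure_S_compact unfolding CC_def by blast
  have dir: "\<exists>D\<in>CC. D <= A Int B" if AB: "A \<in> CC" "B \<in> CC" for A B
  proof -
    obtain W e W' e' where *: "A = closure (S W e)" "good W" "e > 0" "B = closure (S W' e')" "good W'" "e' > 0"
      using AB unfolding CC_def by blast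
    let ?D = "closure (S (W Int W') (min e e'))"
    have "?D \<in> CC" unfolding CC_def using good_Int[OF *(2,5)] *(3,6) by (intro CollectI exI[of _ "W Int W'"] exI[of _ "min e e'"]) simp
    moreover have "?D <= A" unfolding *(1) by (intro closure_mono S_mono) auto
    moreover have "?D <= B" unfolding *(4) by (intro closure_mono S_mono) auto
    ultimately show ?thesis by blast
  qed
  have memLa: "x \<in> closure (S W e)" if "x \<in> La" "good W" "e > 0" for x W e
    using that unfolding La_def CC_def by blast
  have LaI: "x \<in> La" if "!!W e. good W ==> e > 0 ==> x \<in> closure (S W e)" for x
    using that unfolding La_def CC_def by blast
  have sLa: "add_subgroup La" unfolding add_subgroup_def
  proof (intro conjI ballI)
    show "0 \<in> La"
    proof (rule LaI)
      fix W e assume "good W" "(e::real) > 0"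
      then have "0 \<in> S W e" unfolding S_def using chain_0 by (intro CollectI exI[of _ 0]) simp
      then show "0 \<in> closure (S W e)" using closure_subset[of "S W e"] by blast
    qed
    show "x + y \<in> La" if xy: "x \<in> La" "y \<in> La" for x y
    proof (rule LaI)
      fix W e assume g: "good W" "(e::real) > 0"
      have "x + y \<in> closure (S W (e/2) + S W (e/2))"
        using memLa[OF xy(1) g(1)] memLa[OF xy(2) g(1)] g(2) by (intro closure_plus_mem) auto
      moreover have "S W (e/2) + S W (e/2) <= S W e"
      proof
        fix z assume "z \<in> S W (e/2) + S W (e/2)"
        then obtain x y where xy: "x \<in> S W (e/2)" "y \<in> S W (e/2)" "z = x + y" by (rule set_plus_elim)
        then obtain t s where "t \<le> e/2" "chain W t x" "s \<le> e/2" "chain W s y" unfolding S_def by blast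
        then show "z \<in> S W e" unfolding S_def xy(3) using chain_add[of W s y t x] by (intro CollectI exI[of _ "t + s"]) simp
      qed
      ultimately show "x + y \<in> closure (S W e)" using closure_mono by blast
    qed
    show "- x \<in> La" if x: "x \<in> La" for x
    proof (rule LaI)
      fix W e assume g: "good W" "(e::real) > 0"
      have "- x \<in> closure (uminus ` S W e)" by (rule closure_uminus_mem[OF memLa[OF x g]])
      moreover have "uminus ` S W e <= S W e" unfolding S_def using chain_uminus[OF g(1)] by auto
      ultimately show "- x \<in> closure (S W e)" using closure_mono by blast
    qed
  qed
  have cLa: "compact La"
  proof -
    obtain A where "A \<in> CC" using ne by blast
    then have "La = A Int La" unfolding La_def by blast
    moreover have "closed La" unfolding La_def using cpt compact_imp_closed by (intro closed_Inter) blast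
    ultimately show ?thesis using compact_Int_closed[OF cpt[OF \<open>A \<in> CC\<close>]] by metis
  qed
  have "pfin {} La" unfolding pfin_def
  proof (intro conjI allI impI)
    fix L assume "add_subgroup L & closed L & L <= La & (\<forall>b\<in>{}. \<forall>x\<in>L. act b x \<in> L) & finite (cosets La L)"
    then have L: "add_subgroup L" "closed L" "L <= La" "finite (cosets La L)" by auto
    obtain W1 where W1: "open W1" "0 \<in> W1" "W1 Int La <= L" by (rule finite_cosets_open[OF L(1,2,4)])
    obtain W2 where W2: "open W2" "0 \<in> W2" "!!x. x \<in> W2 ==> - x \<in> W2" "!!x y. x \<in> W2 ==> y \<in> W2 ==> x + y \<in> W1" "W2 <= W1"
      using nbhd_halve[OF W1(1,2)] by metis
    obtain W3 where W3: "open W3" "0 \<in> W3" "!!x. x \<in> W3 ==> - x \<in> W3" "!!x y. x \<in> W3 ==> y \<in> W3 ==> x + y \<in> W2" "W3 <= W2"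
      using nbhd_halve[OF W2(1,2)] by metis
    let ?A = "L + W3" and ?B = "(La - L) + W3"
    have "La <= ?A \<union> ?B" using set_plus_left[OF W3(2), of L] set_plus_left[OF W3(2), of "La - L"] by blast
    moreover have "open (?A \<union> ?B)" by (intro open_Un open_plus W3)
    ultimately have "\<exists>A\<in>CC. A <= ?A \<union> ?B"
      using directed_compact[OF ne cpt dir] unfolding La_def by blast
    then obtain W e where We: "good W" "e > 0" "closure (S W e) <= ?A \<union> ?B" unfolding CC_def by blast
    obtain W4 where W4: "good W4" "W4 <= W3" by (rule good_nbhd[OF W3(1,2)])
    define W' where "W' = W Int W4"
    have gW': "good W'" unfolding W'_def by (rule good_Int[OF We(1) W4(1)])
    have W'3: "W' <= W3" "W' <= W" unfolding W'_def using W4 by auto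
    have SAB: "S W' e <= ?A \<union> ?B" using S_mono[OF W'3(2), of e e] We(3) closure_subset[of "S W e"] by auto
    \<comment> \<open>A chain that starts near \<open>L\<close> cannot reach the vicinity of
      \<open>La - L\<close>: its steps lie in \<open>W3\<close>, while elements of \<open>La\<close>
      differing by an element of \<open>W1\<close> are in the same coset of \<open>L\<close>, and
      \<open>W1\<close> contains sums of four elements of \<open>W3\<close>.\<close>
    have inA: "t \<le> e --> x \<in> ?A" if "chain W' t x" for t x
      using that
    proof (induction rule: chain.induct)
      case chain_0
      then show ?case using set_plus_intro[OF add_subgroupD(1)[OF L(1)] W3(2)] by simp
    next
      case (chain_Suc t x y)
      show ?case
      proof
        assume te: "t + N y \<le> e"
        then have "t \<le> e" using N_nonneg[of y] by linarith
        then have "x \<in> ?A" using chain_Suc.IH by blast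
        then obtain l w where lw: "l \<in> L" "w \<in> W3" "x = l + w" by (rule set_plus_elim)
        have "x + y \<in> S W' e" unfolding S_def using chain.chain_Suc[OF chain_Suc.hyps] te by blast
        then consider "x + y \<in> ?A" | "x + y \<in> ?B" using SAB by blast
        then show "x + y \<in> ?A"
        proof cases
          case 2
          then obtain b w' where bw: "b \<in> La - L" "w' \<in> W3" "x + y = b + w'" by (rule set_plus_elim)
          have "b - l = (w + y) + (- w' + 0)" using lw(3) bw(3) by (simp add: algebra_simps)
          moreover have "y \<in> W3" using chain_Suc.hyps W'3 by blast
          ultimately have "b - l \<in> W1"
            using W2(4)[OF W3(4)[OF lw(2) \<open>y \<in> W3\<close>] W3(4)[OF W3(3)[OF bw(2)] W3(2)]] by simp
          moreover have "b - l \<in> La" using bw(1) lw(1) L(3) by (intro add_subgroupD(4)[OF sLa]) auto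
          ultimately have "b - l \<in> L" using W1(3) by blast
          then have "b \<in> L" using add_subgroup_absorb(3)[OF L(1) lw(1)] by blast
          then show ?thesis using bw(1) by blast
        qed
      qed
    qed
    have "La <= L"
    proof
      fix b assume b: "b \<in> La"
      obtain s w where sw: "s \<in> S W' e" "w \<in> W3" "s = b + w"
        by (rule closure_translate_meet[OF memLa[OF b gW' We(2)] W3(1,2)])
      have "s \<in> ?A" using sw(1) inA unfolding S_def by blast
      then obtain l w' where lw: "l \<in> L" "w' \<in> W3" "s = l + w'" by (rule set_plus_elim)
      have "b - l = w' + - w" using sw(3) lw(3) by (simp add: algebra_simps)
      then have "b - l \<in> W1" using W3(4)[OF lw(2) W3(3)[OF sw(2)]] W2(5) by auto
      moreover have "b - l \<in> La" using b lw(1) L(3) by (intro add_subgroupD(4)[OF sLa]) auto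
      ultimately have "b - l \<in> L" using W1(3) by blast
      then show "b \<in> L" using add_subgroup_absorb(3)[OF L(1) lw(1)] by blast
    qed
    then show "L = La" using L(3) by blast
  qed (use cLa sLa in auto)
  then have "La = {0}" by (rule no_connected)
  then have "\<Inter>CC <= U" using U(2) unfolding La_def by simp
  then have "\<exists>A\<in>CC. A <= U" using directed_compact[OF ne cpt dir U(1)] by blast
  then obtain W e where "good W" "e > 0" "closure (S W e) <= U" unfolding CC_def by blast
  then show ?thesis using that[of W e] closure_subset[of "S W e"] by blast
qed

text \<open>\<open>Psi x r\<close>, the multiple of \<open>x\<close> by the integer part of
  \<open>r / N x\<close>, is a discrete path of speed about 1. For each \<open>r\<close> its value
  stays in a compact ball, so by Tychonoff's theorem these paths have a cluster point as
  \<open>x\<close> tends to 0. It is additive because integer parts are additive up to 1, it has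
  length 1 at time 1, and it is continuous because the discrete paths are short chains.\<close>

lemma exists_oneparam:
  assumes G: "closed G" "add_subgroup G" "G <= H"
    and small: "!!W. open W ==> 0 \<in> W ==> \<exists>x\<in>W Int G. N x ~= 0"
  obtains \<phi> where "oneparam \<phi>" "range \<phi> <= G" "N (\<phi> 1) = 1"
proof -
  define A where "A = {x \<in> G. N x ~= 0}"
  define F where "F = inf (nhds 0) (principal A)"
  define Psi where "Psi x r = zm \<lfloor>r / N x\<rfloor> x" for x and r :: real
  have evF: "\<forall>\<^sub>F x in F. P x" if "open W" "0 \<in> W" "!!x. x \<in> W ==> x \<in> A ==> P x" for P W
    unfolding F_def eventually_inf_principal eventually_nhds using that by blast
  have Fne: "F ~= bot"
  proof
    assume "F = bot"
    then have "\<forall>\<^sub>F x in F. False" by simp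
    then obtain W where "open W" "0 \<in> W" "\<forall>x\<in>W. x \<notin> A" unfolding F_def eventually_inf_principal eventually_nhds by blast
    then show False using small[of W] unfolding A_def by blast
  qed
  have N0: "(N \<longlongrightarrow> 0) F"
    using N_tendsto[OF add_subgroupD(1)[OF sH]] unfolding N_zero F_def by (rule tendsto_mono[OF inf_le1])
  have evN: "\<forall>\<^sub>F x in F. N x < e" if "e > 0" for e using order_tendstoD(2)[OF N0 that] .
  have evA: "\<forall>\<^sub>F x in F. x \<in> A" by (rule evF[of UNIV]) auto
  have Apos: "N x > 0" "x \<in> H" "x \<in> G" if "x \<in> A" for x
    using that N_nonneg[of x] G(3) unfolding A_def by auto
  have Nk: "\<bar>real_of_int \<lfloor>r / N x\<rfloor>\<bar> * N x \<le> \<bar>r\<bar> + N x" if x: "x \<in> A" for r x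
  proof -
    have "\<bar>real_of_int \<lfloor>r / N x\<rfloor>\<bar> \<le> \<bar>r / N x\<bar> + 1" by linarith
    then have "\<bar>real_of_int \<lfloor>r / N x\<rfloor>\<bar> * N x \<le> (\<bar>r / N x\<bar> + 1) * N x" using N_nonneg by (rule mult_right_mono)
    also have "\<dots> = \<bar>r\<bar> + N x" using Apos[OF x] by (simp add: abs_divide field_simps)
    finally show ?thesis .
  qed
  define C where "C r = {x \<in> H. N x \<le> \<bar>r\<bar> + 1}" for r :: real
  have "\<forall>\<^sub>F x in F. Psi x \<in> {g. \<forall>r. g r \<in> C r}"
    using evA evN[OF zero_less_one]
  proof eventually_elim
    case (elim x)
    have "Psi x r \<in> C r" for r
      unfolding Psi_def C_def using N_zm[OF Apos(2)[OF elim(1)]] Nk[OF elim(1), of r] elim(2)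
        add_subgroup_zm[OF sH Apos(2)[OF elim(1)]] by simp
    then show ?case by simp
  qed
  then have ev: "\<forall>\<^sub>F g in filtermap Psi F. g \<in> {g. \<forall>r. g r \<in> C r}" by (simp add: eventually_filtermap)
  have "compact {g. \<forall>r. g r \<in> C r}" by (rule compact_fun_space) (simp add: C_def N_ball_compact)
  moreover have "filtermap Psi F ~= bot" using Fne by (simp add: filtermap_bot_iff)
  ultimately obtain \<phi> where \<phi>: "\<phi> \<in> {g. \<forall>r. g r \<in> C r}" "inf (nhds \<phi>) (filtermap Psi F) ~= bot"
    using ev unfolding compact_filter by blast
  \<comment> \<open>A proper filter finer than both the neighbourhoods of the cluster point and the
    image of small \<open>x\<close>; limits taken along either can be compared on it.\<close>
  define F2 where "F2 = inf (nhds \<phi>) (filtermap Psi F)"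
  have F2: "F2 ~= bot" "F2 \<le> nhds \<phi>" "F2 \<le> filtermap Psi F" using \<phi>(2) unfolding F2_def by auto
  have lim_unique: "g \<phi> = l" if "(g \<longlongrightarrow> g \<phi>) (nhds \<phi>)" "((%x. g (Psi x)) \<longlongrightarrow> l) F" for g and l :: "'x::t2_space"
  proof (rule tendsto_unique[OF F2(1)])
    show "(g \<longlongrightarrow> g \<phi>) F2" by (rule tendsto_mono[OF F2(2) that(1)])
    have "(g \<longlongrightarrow> l) (filtermap Psi F)" using that(2) by (simp add: filterlim_filtermap)
    then show "(g \<longlongrightarrow> l) F2" by (rule tendsto_mono[OF F2(3)])
  qed
  have coord: "((%g. g r) \<longlongrightarrow> \<phi> r) (nhds \<phi>)" for r
  proof -
    have "((%g. g r) \<longlongrightarrow> \<phi> r) (at \<phi>)"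
      using continuous_on_product_coordinates[of r] unfolding continuous_on_def by blast
    then show ?thesis by (simp add: tendsto_at_iff_tendsto_nhds[of "%g. g r" \<phi>])
  qed
  have closed_mem: "\<phi> r \<in> T" if "closed T" "\<forall>\<^sub>F x in F. Psi x r \<in> T" for r T
  proof (rule Lim_in_closed_set[OF that(1) _ F2(1)])
    show "((%g. g r) \<longlongrightarrow> \<phi> r) F2" by (rule tendsto_mono[OF F2(2) coord])
    have "\<forall>\<^sub>F g in filtermap Psi F. g r \<in> T" using that(2) by (simp add: eventually_filtermap)
    then show "\<forall>\<^sub>F g in F2. g r \<in> T" by (rule filter_leD[OF F2(3)])
  qed
  have add: "\<phi> (r + s) = \<phi> r + \<phi> s" for r s
  proof -
    have "\<phi> (r + s) - \<phi> r - \<phi> s = 0"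
    proof (rule lim_unique[of "%g. g (r + s) - g r - g s"])
      show "((%g. g (r + s) - g r - g s) \<longlongrightarrow> \<phi> (r + s) - \<phi> r - \<phi> s) (nhds \<phi>)"
        by (intro tendsto_diff coord)
      show "((%x. Psi x (r + s) - Psi x r - Psi x s) \<longlongrightarrow> 0) F"
      proof (rule topological_tendstoI)
        fix U :: "'b set" assume U: "open U" "0 \<in> U"
        show "\<forall>\<^sub>F x in F. Psi x (r + s) - Psi x r - Psi x s \<in> U"
        proof (rule evF[OF U])
          fix x assume "x \<in> U"
          define k where "k = \<lfloor>(r + s) / N x\<rfloor> - \<lfloor>r / N x\<rfloor> - \<lfloor>s / N x\<rfloor>"
          have "k = 0 \<or> k = 1" unfolding k_def add_divide_distrib by linarith
          moreover have "Psi x (r + s) - Psi x r - Psi x s = zm k x" unfolding Psi_def k_def zm_diff ..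
          ultimately show "Psi x (r + s) - Psi x r - Psi x s \<in> U" using U(2) \<open>x \<in> U\<close> by auto
        qed
      qed
    qed
    then show ?thesis by (simp add: algebra_simps)
  qed
  have inG: "\<phi> r \<in> G" for r
  proof (rule closed_mem[OF G(1)])
    show "\<forall>\<^sub>F x in F. Psi x r \<in> G" using evA
      by eventually_elim (simp add: Psi_def add_subgroup_zm[OF G(2)] Apos(3))
  qed
  have N1: "N (\<phi> 1) = 1"
  proof (rule lim_unique[of "%g. N (g 1)"])
    have "\<phi> 1 \<in> H" using inG G(3) by blast
    then show "((%g. N (g 1)) \<longlongrightarrow> N (\<phi> 1)) (nhds \<phi>)" by (rule filterlim_compose[OF N_tendsto coord])
    have *: "N (Psi x 1) = real_of_int \<lfloor>1 / N x\<rfloor> * N x" if "x \<in> A" for x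
      unfolding Psi_def N_zm[OF Apos(2)[OF that]] using Apos(1)[OF that] by simp
    have lo: "1 - N x \<le> N (Psi x 1)" if "x \<in> A" for x
    proof -
      have "1 / N x - 1 \<le> real_of_int \<lfloor>1 / N x\<rfloor>" by linarith
      then have "(1 / N x - 1) * N x \<le> real_of_int \<lfloor>1 / N x\<rfloor> * N x" using N_nonneg by (rule mult_right_mono)
      moreover have "(1 / N x - 1) * N x = 1 - N x" using Apos(1)[OF that] by (simp add: left_diff_distrib)
      ultimately show ?thesis unfolding *[OF that] by simp
    qed
    have hi: "N (Psi x 1) \<le> 1" if "x \<in> A" for x
    proof -
      have "real_of_int \<lfloor>1 / N x\<rfloor> \<le> 1 / N x" by linarith
      then have "real_of_int \<lfloor>1 / N x\<rfloor> * N x \<le> 1 / N x * N x" using N_nonneg by (rule mult_right_mono)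
      then show ?thesis unfolding *[OF that] using Apos(1)[OF that] by simp
    qed
    have "((%x. 1 - N x) \<longlongrightarrow> 1 - 0) F" by (intro tendsto_intros N0)
    then have "((%x. 1 - N x) \<longlongrightarrow> 1) F" by simp
    then show "((%x. N (Psi x 1)) \<longlongrightarrow> 1) F"
    proof (rule tendsto_sandwich[rotated 2])
      show "\<forall>\<^sub>F x in F. 1 - N x \<le> N (Psi x 1)" using evA by eventually_elim (rule lo)
      show "\<forall>\<^sub>F x in F. N (Psi x 1) \<le> 1" using evA by eventually_elim (rule hi)
    qed (rule tendsto_const)
  qed
  have "continuous_on UNIV \<phi>"
  proof (rule additive_continuous)
    fix U :: "'b set" assume U: "open U" "0 \<in> U"
    obtain W1 where W1: "open W1" "0 \<in> W1" "closure W1 <= U" using nbhd_closure[OF U] by metis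
    obtain W e where We: "good W" "e > 0" "S W e <= W1" by (rule small_chains[OF W1(1,2)])
    have oW: "open W" "0 \<in> W" using We(1) unfolding good_def by auto
    \<comment> \<open>With \<open>\<bar>r\<bar>\<close> and \<open>N x\<close> both below
      \<open>e / 2\<close>, the discrete path up to \<open>r\<close> is a chain in \<open>W\<close>
      of cost at most \<open>e\<close>, so it ends in \<open>W1\<close> and the limit lies in the
      closure of \<open>W1\<close>.\<close>
    have "\<phi> r \<in> U" if r: "\<bar>r\<bar> < e / 2" for r
    proof -
      have evW: "\<forall>\<^sub>F x in F. x \<in> W" by (rule evF[OF oW])
      have "\<forall>\<^sub>F x in F. N x < e / 2" by (rule evN) (use We(2) in simp)
      then have "\<forall>\<^sub>F x in F. Psi x r \<in> closure W1" using evW evA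
      proof eventually_elim
        case (elim x)
        define k where "k = \<lfloor>r / N x\<rfloor>"
        have kN: "\<bar>real_of_int k\<bar> * N x \<le> e" using Nk[OF elim(3), of r] r elim(1) unfolding k_def by linarith
        have "chain W (\<bar>real_of_int k\<bar> * N x) (zm k x)"
        proof (cases "k \<ge> 0")
          case True
          then show ?thesis using chain_zm[OF elim(2), of "nat k"] by simp
        next
          case False
          have "- x \<in> W" "N (- x) = N x" using We(1) elim(2) N_uminus unfolding good_def by auto
          then show ?thesis using chain_zm[of "- x" W "nat (- k)"] False by simp
        qed
        then have "Psi x r \<in> S W e" unfolding S_def Psi_def k_def[symmetric] using kN by blast
        then show ?case using We(3) closure_subset[of W1] by blast
      qed
      then show ?thesis using closed_mem[OF closed_closure] W1(3) by blast
    qed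
    then show "\<exists>W. open W & 0 \<in> W & (\<forall>y\<in>W Int UNIV. \<phi> y \<in> U)"
      using We(2) by (intro exI[of _ "ball 0 (e / 2)"]) (auto simp: dist_real_def)
  qed (use add in auto)
  then have "oneparam \<phi>" unfolding oneparam_def using add by blast
  then show ?thesis using that inG N1 by blast
qed

lemma oneparam_H: assumes "oneparam \<phi>" shows "\<phi> r \<in> H"
proof -
  obtain m :: nat where "m > 0" "\<phi> (r / real m) \<in> H" "zm (int m) (\<phi> (r / real m)) = \<phi> r"
    by (rule oneparam_small[OF assms oH add_subgroupD(1)[OF sH]])
  then show ?thesis using add_subgroup_zm[OF sH] by metis
qed

lemma chi_oneparam: assumes "oneparam \<phi>" "i < n" shows "chi i (\<phi> r) = r * chi i (\<phi> 1)"
proof (rule additive_real_linear)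
  show "chi i (\<phi> (x + y)) = chi i (\<phi> x) + chi i (\<phi> y)" for x y
    unfolding oneparamD(2)[OF assms(1)] using assms oneparam_H by (intro chi_add)
  show "continuous_on UNIV (%r. chi i (\<phi> r))"
    using oneparam_H[OF assms(1)] by (intro continuous_on_compose2[OF chi_cont[OF assms(2)] oneparamD(1)[OF assms(1)]]) auto
qed

text \<open>Such a path lies in \<open>K0\<close>, so its closure is compact. A closed subgroup of
  finite index contains a neighbourhood of 0 in this closure, hence, by divisibility, the whole
  path; so the closure is parafinite for the empty set and vanishes.\<close>

lemma oneparam_trivial:
  assumes \<phi>: "oneparam \<phi>" and z: "!!i. i < n ==> chi i (\<phi> 1) = 0" shows "\<phi> r = 0"
proof -
  have "range \<phi> <= K0"
  proof
    fix x assume "x \<in> range \<phi>"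
    then obtain r where r: "x = \<phi> r" by blast
    have "N x = 0" unfolding N_def r using chi_oneparam[OF \<phi>, of _ r] z by simp
    then show "x \<in> K0" unfolding K0_def using oneparam_H[OF \<phi>] r by blast
  qed
  define Y where "Y = closure (range \<phi>)"
  have "Y <= K0" unfolding Y_def by (rule closure_minimal[OF \<open>range \<phi> <= K0\<close> compact_imp_closed[OF K0_compact]])
  then have "Y = K0 Int closure (range \<phi>)" unfolding Y_def by blast
  then have cY: "compact Y" using compact_Int_closed[OF K0_compact closed_closure] by metis
  have "add_subgroup (range \<phi>)" unfolding add_subgroup_def
    using oneparamD(2,3,4)[OF \<phi>, symmetric] by (metis (no_types, lifting) rangeE rangeI)
  then have sY: "add_subgroup Y" unfolding Y_def by (rule add_subgroup_closure)
  have "pfin {} Y" unfolding pfin_def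
  proof (intro conjI allI impI cY sY)
    fix L assume "add_subgroup L & closed L & L <= Y & (\<forall>b\<in>{}. \<forall>x\<in>L. act b x \<in> L) & finite (cosets Y L)"
    then have L: "add_subgroup L" "closed L" "L <= Y" "finite (cosets Y L)" by auto
    obtain W1 where W1: "open W1" "0 \<in> W1" "W1 Int Y <= L" by (rule finite_cosets_open[OF L(1,2,4)])
    have "\<phi> r \<in> L" for r
    proof -
      obtain m :: nat where m: "m > 0" "\<phi> (r / real m) \<in> W1" "zm (int m) (\<phi> (r / real m)) = \<phi> r"
        by (rule oneparam_small[OF \<phi> W1(1,2)])
      have "\<phi> (r / real m) \<in> Y" unfolding Y_def by (rule subsetD[OF closure_subset]) simp
      then have "\<phi> (r / real m) \<in> L" using m(2) W1(3) by blast
      from add_subgroup_zm[OF L(1) this, of "int m"] show ?thesis unfolding m(3) .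
    qed
    then have "Y <= L" unfolding Y_def by (intro closure_minimal[OF _ L(2)]) blast
    then show "L = Y" using L(3) by blast
  qed simp
  then have "Y = {0}" by (rule no_connected)
  moreover have "\<phi> r \<in> Y" unfolding Y_def by (rule subsetD[OF closure_subset]) simp
  ultimately show ?thesis by blast
qed

section \<open>Bases of spaces of one-parameter subgroups\<close>

definition lc :: "(nat => real) => 'b => real" where "lc t x = (\<Sum>i<n. t i * chi i x)"

lemma lc_add: "x \<in> H ==> y \<in> H ==> lc t (x + y) = lc t x + lc t y"
  unfolding lc_def by (simp add: chi_add sum.distrib distrib_left)

lemma lc_zero: "lc t 0 = 0"
  using lc_add[of 0 0 t] add_subgroupD(1)[OF sH] by simp

lemma lc_diff: "x \<in> H ==> y \<in> H ==> lc t (x - y) = lc t x - lc t y"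
  using lc_add[of "x - y" y t] add_subgroupD(4)[OF sH, of x y] by simp

lemma lc_cont: "continuous_on H (lc t)"
  unfolding lc_def using chi_cont by (intro continuous_intros) auto

lemma lc_oneparam: "oneparam \<phi> ==> lc t (\<phi> r) = r * lc t (\<phi> 1)"
  unfolding lc_def using chi_oneparam[of \<phi> _ r] by (simp add: sum_distrib_left mult.left_commute)

lemma lc_sum: "(!!j. j \<in> J ==> f j \<in> H) ==> lc t (sum f J) = (\<Sum>j\<in>J. lc t (f j))"
proof (induction J rule: infinite_finite_induct)
  case (insert x F)
  then show ?case using lc_add[of "f x" "sum f F"] add_subgroup_sum[OF sH, of F f] by simp
qed (simp_all add: lc_zero)

text \<open>A biorthogonal system: paths from \<open>LL\<close> together with functionals dual to
  them at time 1. The dual functionals certify linear independence without a vector space structure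
  on the paths.\<close>

definition pos_system :: "(real => 'b) set => nat => (nat => real => 'b) => (nat => nat => real) => bool" where
  "pos_system LL d ph t \<longleftrightarrow> (\<forall>j<d. ph j \<in> LL) & (\<forall>i<d. \<forall>j<d. lc (t i) (ph j 1) = (if i = j then 1 else 0))"

text \<open>A biorthogonal system of maximal size is a basis. Its size is at most \<open>n\<close>,
  since more than \<open>n\<close> paths admit a nontrivial combination killed by all characters,
  which \<open>oneparam_trivial\<close> makes 0. Were the remainder of an expansion nonzero, a
  character seeing it would extend the system.\<close>

lemma dual_basis:
  assumes one: "!!\<phi>. \<phi> \<in> LL ==> oneparam \<phi>" and zero: "(%_. 0) \<in> LL"
    and scale: "!!\<phi> c. \<phi> \<in> LL ==> (%r. \<phi> (c * r)) \<in> LL"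
    and diff: "!!\<phi> \<psi>. \<phi> \<in> LL ==> \<psi> \<in> LL ==> (%r. \<phi> r - \<psi> r) \<in> LL"
  obtains d ph t where "pos_system LL d ph t" "!!\<phi>. \<phi> \<in> LL ==> \<phi> 1 = (\<Sum>j<d. ph j (lc (t j) (\<phi> 1)))"
proof -
  have sum: "(%r. \<Sum>j\<in>J. ph j (c j * r)) \<in> LL" if "finite J" "!!j. j \<in> J ==> ph j \<in> LL" for J :: "nat set" and ph c
    using that
  proof (induction J rule: finite_induct)
    case empty then show ?case using zero by simp
  next
    case (insert x F)
    have 1: "(%r. \<Sum>j\<in>F. ph j (c j * r)) \<in> LL" using insert by simp
    have "(%r. ph x (- c x * r)) \<in> LL" by (rule scale) (use insert in simp)
    from diff[OF 1 this] have "(%r. (\<Sum>j\<in>F. ph j (c j * r)) - ph x (- c x * r)) \<in> LL" .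
    moreover have "ph x (- c x * r) = - ph x (c x * r)" for r using oneparamD(4)[OF one[of "ph x"], of "c x * r"] insert by simp
    ultimately show ?case using insert by (simp add: add.commute)
  qed
  define P where "P d \<longleftrightarrow> (\<exists>ph t. pos_system LL d ph t)" for d
  have "P 0" unfolding P_def pos_system_def by simp
  moreover have "d \<le> n" if Pd: "P d" for d
  proof (rule ccontr)
    assume "\<not> d \<le> n"
    obtain ph t where sys: "pos_system LL d ph t" using Pd unfolding P_def by blast
    have phL: "ph j \<in> LL" if "j < d" for j using sys that unfolding pos_system_def by blast
    obtain c where c: "\<exists>k\<in>{..<d}. c k ~= 0" "\<forall>i\<in>{..<n}. (\<Sum>k<d. c k * chi i (ph k 1)) = 0"
      using homogeneous_system[of "{..<n}" "{..<d}" "%k i. chi i (ph k 1)"] \<open>\<not> d \<le> n\<close> by (simp only: finite_lessThan card_lessThan not_le) blast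
    define psi where "psi r = (\<Sum>j<d. ph j (c j * r))" for r
    have psiL: "psi \<in> LL" using sum[of "{..<d}" ph c] phL unfolding psi_def[abs_def] by simp
    have lcpsi: "lc s (psi 1) = (\<Sum>j<d. c j * lc s (ph j 1))" for s
    proof -
      have "lc s (psi 1) = (\<Sum>j<d. lc s (ph j (c j * 1)))" unfolding psi_def
        using oneparam_H[OF one[OF phL]] by (intro lc_sum) auto
      also have "\<dots> = (\<Sum>j<d. c j * lc s (ph j 1))"
      proof (rule sum.cong[OF refl])
        fix j assume "j \<in> {..<d}"
        then show "lc s (ph j (c j * 1)) = c j * lc s (ph j 1)" using lc_oneparam[OF one[OF phL[of j]], of s "c j * 1"] by simp
      qed
      finally show ?thesis .
    qed
    have "chi i (psi 1) = 0" if i: "i < n" for i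
    proof -
      have unit: "lc (%k. if k = i then 1 else 0) x = chi i x" for x unfolding lc_def using i by (simp add: if_distrib[of "%a. a * _"] cong: if_cong)
      show ?thesis using lcpsi[of "%k. if k = i then 1 else 0"] c(2) i unfolding unit by simp
    qed
    from oneparam_trivial[OF one[OF psiL] this] have p0: "psi 1 = 0" .
    have "c k = 0" if k: "k < d" for k
    proof -
      have "(\<Sum>j<d. c j * lc (t k) (ph j 1)) = 0" using lcpsi[of "t k"] p0 lc_zero by simp
      moreover have "(\<Sum>j<d. c j * lc (t k) (ph j 1)) = (\<Sum>j<d. if j = k then c j else 0)"
        using sys k unfolding pos_system_def by (intro sum.cong) auto
      ultimately show ?thesis using k by simp
    qed
    then show False using c(1) by blast
  qed
  ultimately obtain d where d: "P d" "!!e. P e ==> e \<le> d"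
    using Nat.ex_has_greatest_nat[of P 0 n] by blast
  obtain ph t where sys: "pos_system LL d ph t" using d(1) unfolding P_def by blast
  have phL: "ph j \<in> LL" if "j < d" for j using sys that unfolding pos_system_def by blast
  have dual: "lc (t i) (ph j 1) = (if i = j then 1 else 0)" if "i < d" "j < d" for i j
    using sys that unfolding pos_system_def by blast
  show ?thesis
  proof (rule that[OF sys])
    fix \<phi> assume \<phi>: "\<phi> \<in> LL"
    define psi where "psi r = \<phi> r - (\<Sum>j<d. ph j (lc (t j) (\<phi> 1) * r))" for r
    have psiL: "psi \<in> LL" using diff[OF \<phi> sum[of "{..<d}" ph "%j. lc (t j) (\<phi> 1)"]] phL unfolding psi_def[abs_def] by simp
    have lcpsi: "lc s (psi 1) = lc s (\<phi> 1) - (\<Sum>j<d. lc (t j) (\<phi> 1) * lc s (ph j 1))" for s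
    proof -
      have "lc s (\<Sum>j<d. ph j (lc (t j) (\<phi> 1) * 1)) = (\<Sum>j<d. lc s (ph j (lc (t j) (\<phi> 1) * 1)))"
        using oneparam_H[OF one[OF phL]] by (intro lc_sum) auto
      also have "\<dots> = (\<Sum>j<d. lc (t j) (\<phi> 1) * lc s (ph j 1))"
      proof (rule sum.cong[OF refl])
        fix j assume "j \<in> {..<d}"
        then show "lc s (ph j (lc (t j) (\<phi> 1) * 1)) = lc (t j) (\<phi> 1) * lc s (ph j 1)"
          using lc_oneparam[OF one[OF phL[of j]], of s "lc (t j) (\<phi> 1) * 1"] by simp
      qed
      finally have "lc s (\<Sum>j<d. ph j (lc (t j) (\<phi> 1) * 1)) = (\<Sum>j<d. lc (t j) (\<phi> 1) * lc s (ph j 1))" .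
      moreover have "(\<Sum>j<d. ph j (lc (t j) (\<phi> 1) * 1)) \<in> H"
        using oneparam_H[OF one[OF phL]] by (intro add_subgroup_sum[OF sH]) auto
      ultimately show ?thesis unfolding psi_def using lc_diff[OF oneparam_H[OF one[OF \<phi>], of 1]] by simp
    qed
    have tpsi: "lc (t k) (psi 1) = 0" if k: "k < d" for k
    proof -
      have "(\<Sum>j<d. lc (t j) (\<phi> 1) * lc (t k) (ph j 1)) = (\<Sum>j<d. if j = k then lc (t j) (\<phi> 1) else 0)"
        using dual k by (intro sum.cong) auto
      then show ?thesis unfolding lcpsi using k by simp
    qed
    have "psi 1 = 0"
    proof (rule ccontr)
      assume nz: "psi 1 ~= 0"
      then obtain i where i: "i < n" "chi i (psi 1) ~= 0" using oneparam_trivial[OF one[OF psiL]] by blast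
      \<comment> \<open>The character \<open>chi i\<close> corrected by the dual functionals so as
        to vanish on the paths already chosen.\<close>
      define s where "s k = (if k = i then 1 else 0) - (\<Sum>j<d. chi i (ph j 1) * t j k)" for k
      have lcs: "lc s x = chi i x - (\<Sum>j<d. chi i (ph j 1) * lc (t j) x)" for x
      proof -
        have "lc s x = (\<Sum>k<n. (if k = i then chi k x else 0)) - (\<Sum>k<n. \<Sum>j<d. chi i (ph j 1) * (t j k * chi k x))"
          unfolding lc_def s_def sum_subtractf[symmetric] by (intro sum.cong) (auto simp: left_diff_distrib sum_distrib_right mult.assoc)
        also have "(\<Sum>k<n. \<Sum>j<d. chi i (ph j 1) * (t j k * chi k x)) = (\<Sum>j<d. chi i (ph j 1) * lc (t j) x)"
          unfolding lc_def sum_distrib_left by (rule sum.swap)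
        finally show ?thesis using i(1) by simp
      qed
      define v where "v = chi i (psi 1)"
      define ph' where "ph' = ph(d := (%r. psi (1 / v * r)))"
      define t' where "t' = t(d := s)"
      have sv: "lc s (psi 1) = v" unfolding lcs v_def using tpsi by simp
      have sph: "lc s (ph k 1) = 0" if k: "k < d" for k
      proof -
        have "(\<Sum>j<d. chi i (ph j 1) * lc (t j) (ph k 1)) = (\<Sum>j<d. if j = k then chi i (ph j 1) else 0)"
          using dual k by (intro sum.cong) auto
        then show ?thesis unfolding lcs using k by simp
      qed
      have phd: "lc u (psi (1 / v * 1)) = lc u (psi 1) / v" for u using lc_oneparam[OF one[OF psiL], of u "1 / v"] by simp
      have "pos_system LL (Suc d) ph' t'" unfolding pos_system_def
      proof (intro conjI allI impI)
        fix j assume "j < Suc d"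
        then show "ph' j \<in> LL" unfolding ph'_def using phL scale[OF psiL, of "1 / v"] by (cases "j = d") auto
      next
        fix k j assume "k < Suc d" "j < Suc d"
        then show "lc (t' k) (ph' j 1) = (if k = j then 1 else 0)"
          unfolding ph'_def t'_def using dual sph tpsi sv phd i(2)
          by (cases "k = d"; cases "j = d") (auto simp: v_def)
      qed
      then have "P (Suc d)" unfolding P_def by blast
      then show False using d(2) by fastforce
    qed
    then show "\<phi> 1 = (\<Sum>j<d. ph j (lc (t j) (\<phi> 1)))" unfolding psi_def by simp
  qed
qed

text \<open>If the remainders \<open>x - p x\<close> left \<open>K0\<close> arbitrarily close to 0,
  the kernel \<open>G\<close> of the projection \<open>p\<close> would contain elements of nonzero
  length near 0, hence a path of length 1 at time 1 by \<open>exists_oneparam\<close>; but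
  \<open>p\<close> fixes every path.\<close>

lemma euclidean_part:
  obtains d ph t W where "pos_system {\<phi>. oneparam \<phi>} d ph t"
    "!!\<phi>. oneparam \<phi> ==> \<phi> 1 = (\<Sum>j<d. ph j (lc (t j) (\<phi> 1)))"
    "open W" "0 \<in> W" "W <= H" "!!x. x \<in> W ==> x - (\<Sum>j<d. ph j (lc (t j) x)) \<in> K0"
proof -
  have "\<exists>d ph t. pos_system {\<phi>. oneparam \<phi>} d ph t & (\<forall>\<phi>. oneparam \<phi> --> \<phi> 1 = (\<Sum>j<d. ph j (lc (t j) (\<phi> 1))))"
  proof (rule dual_basis[of "{\<phi>. oneparam \<phi>}"])
    fix d ph t assume "pos_system {\<phi>. oneparam \<phi>} d ph t"
      "!!\<phi>. \<phi> \<in> {\<phi>. oneparam \<phi>} ==> \<phi> 1 = (\<Sum>j<d. ph j (lc (t j) (\<phi> 1)))"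
    then show ?thesis by (intro exI[of _ d] exI[of _ ph] exI[of _ t]) simp
  qed (simp_all add: oneparam_zero oneparam_scale oneparam_diff)
  then obtain d ph t where sys: "pos_system {\<phi>. oneparam \<phi>} d ph t"
    and rep: "!!\<phi>. oneparam \<phi> ==> \<phi> 1 = (\<Sum>j<d. ph j (lc (t j) (\<phi> 1)))" by blast
  have one: "oneparam (ph j)" if "j < d" for j using sys that unfolding pos_system_def by blast
  define p where "p x = (\<Sum>j<d. ph j (lc (t j) x))" for x
  have pH: "p x \<in> H" for x unfolding p_def using oneparam_H[OF one] by (intro add_subgroup_sum[OF sH]) auto
  have padd: "p (x + y) = p x + p y" if "x \<in> H" "y \<in> H" for x y
    unfolding p_def using lc_add that oneparamD(2)[OF one] by (simp add: sum.distrib)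
  have pcont: "continuous_on H p" unfolding p_def
    by (intro continuous_on_sum continuous_on_compose2[OF oneparamD(1)[OF one] lc_cont]) auto
  have pdiff: "p (x - y) = p x - p y" if "x \<in> H" "y \<in> H" for x y using additive_on_zm(3)[OF sH padd] that by blast
  have pone: "p x = x" if "oneparam \<phi>" "x = \<phi> 1" for x \<phi> using rep[OF that(1)] that(2) unfolding p_def by simp
  have pp: "p (p x) = p x" for x
  proof -
    have "oneparam (%r. \<Sum>j<d. ph j (lc (t j) x * r))" unfolding oneparam_def
    proof (intro conjI allI)
      show "continuous_on UNIV (%r. \<Sum>j<d. ph j (lc (t j) x * r))"
        by (intro continuous_on_sum oneparamD(1)[OF oneparam_scale[OF one]]) simp
      show "(\<Sum>j<d. ph j (lc (t j) x * (r + s))) = (\<Sum>j<d. ph j (lc (t j) x * r)) + (\<Sum>j<d. ph j (lc (t j) x * s))" for r s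
        using oneparamD(2)[OF one] by (simp add: distrib_left sum.distrib)
    qed
    then show ?thesis by (rule pone) (simp add: p_def)
  qed
  have "\<exists>W. open W & 0 \<in> W & W <= H & (\<forall>x\<in>W. x - p x \<in> K0)"
  proof (rule ccontr)
    assume no: "\<not> ?thesis"
    define G where "G = {x \<in> H. p x = 0}"
    have "closed (H Int p -` {0})" by (rule continuous_closed_preimage[OF pcont cH]) simp
    moreover have "H Int p -` {0} = G" unfolding G_def by blast
    ultimately have cG: "closed G" by simp
    have p0: "p 0 = 0" using additive_on_zm(1)[OF sH padd] by blast
    have sG: "add_subgroup G" unfolding G_def add_subgroup_def
      using padd p0 additive_on_zm(2)[OF sH padd] add_subgroupD[OF sH] by auto
    have GH: "G <= H" unfolding G_def by blast
    have small: "\<exists>x\<in>W Int G. N x ~= 0" if W: "open W" "0 \<in> W" for W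
    proof -
      have "continuous_on H (%x. x - p x)" by (intro continuous_intros pcont)
      then have "open (H Int (%x. x - p x) -` W)" using continuous_open_preimage oH W(1) by blast
      moreover have "0 \<in> H Int (%x. x - p x) -` W" using W(2) p0 add_subgroupD(1)[OF sH] by simp
      ultimately obtain x where x: "x \<in> H" "x - p x \<in> W" "x - p x \<notin> K0" using no by blast
      have "x - p x \<in> H" using x(1) pH by (intro add_subgroupD(4)[OF sH])
      moreover have "p (x - p x) = 0" using pdiff[OF x(1) pH] pp by simp
      ultimately have "x - p x \<in> W Int G" "N (x - p x) ~= 0" using x unfolding G_def K0_def by auto
      then show ?thesis by blast
    qed
    obtain \<phi> where \<phi>: "oneparam \<phi>" "range \<phi> <= G" "N (\<phi> 1) = 1"
      by (rule exists_oneparam[OF cG sG GH small])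
    have "p (\<phi> 1) = 0" using \<phi>(2) unfolding G_def by blast
    then have "\<phi> 1 = 0" using pone[OF \<phi>(1) refl] by simp
    then show False using \<phi>(3) N_zero by simp
  qed
  then obtain W where W: "open W" "0 \<in> W" "W <= H" "!!x. x \<in> W ==> x - p x \<in> K0" by blast
  show ?thesis
  proof (rule that[of d ph t W])
    show "\<phi> 1 = (\<Sum>j<d. ph j (lc (t j) (\<phi> 1)))" if "oneparam \<phi>" for \<phi> by (rule rep[OF that])
    show "x - (\<Sum>j<d. ph j (lc (t j) x)) \<in> K0" if "x \<in> W" for x using W(4)[OF that] unfolding p_def .
  qed (use sys W in auto)
qed

end

subsection \<open>Splitting off the Euclidean part\<close>

context lc_module
begin

definition V0 :: "'m set" where "V0 = {\<phi> 1 | \<phi>. oneparam \<phi>}"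

definition Mell :: "'m set" where "Mell = {x. \<exists>C. compact C & add_subgroup C & x \<in> C}"

text \<open>The working form of a topological direct summand. Range and kernel are closed
  complementary submodules, and refining a decomposition becomes arithmetic with functions on the
  whole module.\<close>

definition eqproj :: "('m => 'm) => bool" where
  "eqproj p \<longleftrightarrow> (\<forall>x y. p (x + y) = p x + p y) & continuous_on UNIV p &
     (\<forall>a x. p (act a x) = act a (p x)) & (\<forall>x. p (p x) = p x)"

lemma V0_mem: "oneparam \<phi> ==> \<phi> r \<in> V0"
proof -
  assume "oneparam \<phi>"
  then have "oneparam (%s. \<phi> (r * s))" "(%s. \<phi> (r * s)) 1 = \<phi> r" by (auto intro: oneparam_scale)
  then show ?thesis unfolding V0_def by (metis (mono_tags, lifting) mem_Collect_eq)
qed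

lemma V0_E: assumes "x \<in> V0" obtains \<phi> where "oneparam \<phi>" "x = \<phi> 1"
  using assms unfolding V0_def by blast

lemma V0_subgroup: "add_subgroup V0"
  unfolding add_subgroup_def
proof (intro conjI ballI)
  show "0 \<in> V0" using V0_mem[OF oneparam_zero] by simp
  show neg: "- x \<in> V0" if "x \<in> V0" for x
  proof -
    obtain \<phi> where "oneparam \<phi>" "x = \<phi> 1" using \<open>x \<in> V0\<close> by (rule V0_E)
    then show ?thesis using V0_mem[OF \<open>oneparam \<phi>\<close>, where r = "-1"] oneparamD(4)[OF \<open>oneparam \<phi>\<close>, where r = 1] by simp
  qed
  show "x + y \<in> V0" if xy: "x \<in> V0" "y \<in> V0" for x y
  proof -
    obtain \<phi> where 1: "oneparam \<phi>" "x = \<phi> 1" using xy(1) by (rule V0_E)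
    obtain \<psi> where 2: "oneparam \<psi>" "- y = \<psi> 1" using neg[OF xy(2)] by (rule V0_E)
    have "x + y = \<phi> 1 - \<psi> 1" using 1(2) 2(2)[symmetric] by simp
    then show ?thesis using V0_mem[OF oneparam_diff[OF 1(1) 2(1)], of 1] by simp
  qed
qed

lemma oneparam_act: "oneparam \<phi> ==> oneparam (%r. act a (\<phi> r))"
  by (rule oneparam_hom[OF _ act_continuous act_add])

lemma V0_act: "x \<in> V0 ==> act a x \<in> V0"
proof -
  assume "x \<in> V0"
  then obtain \<phi> where "oneparam \<phi>" "x = \<phi> 1" by (rule V0_E)
  then show ?thesis using V0_mem[OF oneparam_act[of \<phi> a], of 1] by simp
qed

lemma V0_divisible: assumes "x \<in> V0" "k > 0" shows "\<exists>y\<in>V0. zm k y = x"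
proof -
  obtain \<phi> where \<phi>: "oneparam \<phi>" "x = \<phi> 1" using assms(1) by (rule V0_E)
  have "zm k (\<phi> (1 / real_of_int k)) = x" using oneparamD(6)[OF \<phi>(1), of k "1 / real_of_int k"] assms(2) \<phi>(2) by simp
  then show ?thesis using V0_mem[OF \<phi>(1)] by blast
qed

lemma Mell_subgroup: "add_subgroup Mell"
  unfolding add_subgroup_def
proof (intro conjI ballI)
  show "0 \<in> Mell" unfolding Mell_def by (intro CollectI exI[of _ "{0}"]) simp
  show "- x \<in> Mell" if "x \<in> Mell" for x using that add_subgroupD(3) unfolding Mell_def by blast
  show "x + y \<in> Mell" if xy: "x \<in> Mell" "y \<in> Mell" for x y
  proof -
    obtain C D where "compact C" "add_subgroup C" "x \<in> C" "compact D" "add_subgroup D" "y \<in> D"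
      using xy unfolding Mell_def by blast
    then show ?thesis unfolding Mell_def
      by (intro CollectI exI[of _ "C + D"] conjI compact_plus add_subgroup_plus set_plus_intro)
  qed
qed

lemma Mell_act: assumes "x \<in> Mell" shows "act a x \<in> Mell"
proof -
  obtain C where "compact C" "add_subgroup C" "x \<in> C" using assms unfolding Mell_def by blast
  then show ?thesis unfolding Mell_def
    by (intro CollectI exI[of _ "act a ` C"] conjI act_image_compact act_image_subgroup imageI)
qed

lemma add_subgroup_zm_range: "add_subgroup (range (%j. zm j x))"
  unfolding add_subgroup_def
proof (intro conjI ballI)
  show "0 \<in> range (%j. zm j x)" by (rule range_eqI[of _ _ 0]) simp
  show "y + z \<in> range (%j. zm j x)" if "y \<in> range (%j. zm j x)" "z \<in> range (%j. zm j x)" for y z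
    using that zm_add[of _ _ x, symmetric] by auto
  show "- y \<in> range (%j. zm j x)" if "y \<in> range (%j. zm j x)" for y
  proof -
    obtain j where "y = zm j x" using \<open>y \<in> range (%j. zm j x)\<close> by blast
    then have "- y = zm (- j) x" by simp
    then show ?thesis by blast
  qed
qed

text \<open>By division with remainder, the subgroup generated by \<open>x\<close> and
  \<open>C\<close> is a union of \<open>k\<close> translates of \<open>C\<close>, hence
  compact.\<close>

lemma Mell_zm: assumes "zm k x \<in> Mell" "k > 0" shows "x \<in> Mell"
proof -
  obtain C where C: "compact C" "add_subgroup C" "zm k x \<in> C" using assms(1) unfolding Mell_def by blast
  define D where "D = range (%j. zm j x) + C"
  have "add_subgroup D" unfolding D_def by (intro add_subgroup_plus add_subgroup_zm_range C(2))
  moreover have "D = (%j. zm j x) ` {0..<k} + C"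
  proof
    show "D <= (%j. zm j x) ` {0..<k} + C"
    proof
      fix y assume "y \<in> D"
      then obtain j c where jc: "c \<in> C" "y = zm j x + c" unfolding D_def by (auto elim!: set_plus_elim)
      have "zm j x = zm (j mod k) x + zm (j div k) (zm k x)"
        unfolding zm_mult[symmetric] zm_add[symmetric] by simp
      then have "y = zm (j mod k) x + (zm (j div k) (zm k x) + c)" using jc by (simp add: add.assoc)
      moreover have "zm (j div k) (zm k x) + c \<in> C" using C jc by (intro add_subgroupD(2)[OF C(2)] add_subgroup_zm[OF C(2) C(3)])
      moreover have "zm (j mod k) x \<in> (%j. zm j x) ` {0..<k}" using assms(2) by simp
      ultimately show "y \<in> (%j. zm j x) ` {0..<k} + C" by (simp only: set_plus_intro)
    qed
    show "(%j. zm j x) ` {0..<k} + C <= D" unfolding D_def by (rule set_plus_mono2) auto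
  qed
  moreover have "compact ((%j. zm j x) ` {0..<k} + C)" by (rule compact_plus[OF finite_imp_compact C(1)]) simp
  moreover have "zm 1 x + 0 \<in> D" unfolding D_def using add_subgroupD(1)[OF C(2)] by (intro set_plus_intro rangeI)
  ultimately show ?thesis unfolding Mell_def by auto
qed

lemma eqprojD:
  assumes "eqproj p"
  shows "p (x + y) = p x + p y" "continuous_on S p" "p (act a x) = act a (p x)" "p (p x) = p x" "p 0 = 0"
    "p (x - y) = p x - p y" "p (- x) = - p x" "p (sum f J) = (\<Sum>j\<in>J. p (f j))"
proof -
  show a: "p (x + y) = p x + p y" for x y using assms unfolding eqproj_def by blast
  show "continuous_on S p" using assms continuous_on_subset unfolding eqproj_def by blast
  show "p (act a x) = act a (p x)" "p (p x) = p x" using assms unfolding eqproj_def by blast+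
  show z: "p 0 = 0" using a[of 0 0] by simp
  show "p (x - y) = p x - p y" using a[of "x - y" y] by simp
  show "p (- x) = - p x" using a[of "-x" x] z by (simp add: eq_neg_iff_add_eq_0)
  show "p (sum f J) = (\<Sum>j\<in>J. p (f j))" by (induction J rule: infinite_finite_induct) (auto simp: a z)
qed

lemma eqproj_range: "eqproj p ==> x \<in> range p \<longleftrightarrow> p x = x"
  using eqprojD(4) by (metis rangeE rangeI)

lemma eqproj_range_closed: assumes "eqproj p" shows "closed (range p)"
proof -
  have "range p = {x. p x - x \<in> {0}}" using eqproj_range[OF assms] by auto
  moreover have "closed {x. p x - x \<in> {0}}"
    by (rule closed_vimage_UNIV) (auto intro!: continuous_intros eqprojD(2)[OF assms])
  ultimately show ?thesis by simp
qed

lemma eqproj_image_subgroup: assumes h: "eqproj h" and C: "add_subgroup C" shows "add_subgroup (h ` C)"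
  unfolding add_subgroup_def
proof (intro conjI ballI)
  show "0 \<in> h ` C" using add_subgroupD(1)[OF C] eqprojD(5)[OF h] by (metis imageI)
  show "u + v \<in> h ` C" if "u \<in> h ` C" "v \<in> h ` C" for u v
    using that eqprojD(1)[OF h, symmetric] add_subgroupD(2)[OF C] by auto
  show "- u \<in> h ` C" if "u \<in> h ` C" for u
    using that eqprojD(7)[OF h, symmetric] add_subgroupD(3)[OF C] by auto
qed

lemma eqproj_range_subgroup: assumes "eqproj p" shows "add_subgroup (range p)"
  unfolding add_subgroup_def
proof (intro conjI ballI)
  show "0 \<in> range p" using eqproj_range[OF assms] eqprojD(5)[OF assms] by simp
  show "x + y \<in> range p" if "x \<in> range p" "y \<in> range p" for x y
    using that unfolding eqproj_range[OF assms] by (simp add: eqprojD(1)[OF assms])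
  show "- x \<in> range p" if "x \<in> range p" for x
    using that unfolding eqproj_range[OF assms] by (simp add: eqprojD(7)[OF assms])
qed

lemma eqproj_range_act: "eqproj p ==> x \<in> range p ==> act a x \<in> range p"
  by (simp add: eqproj_range eqprojD(3))

lemma eqproj_compl: assumes p: "eqproj p" shows "eqproj (%x. x - p x)"
  unfolding eqproj_def
  by (auto simp: eqprojD(1,3,4,6)[OF p] act_diff intro!: continuous_intros eqprojD(2)[OF p])

lemma eqproj_comp:
  assumes p: "eqproj p" and q: "eqproj q" and pq: "!!x. p (q x) = q (p x)"
  shows "eqproj (%x. p (q x))"
  unfolding eqproj_def
proof (intro conjI allI)
  show "continuous_on UNIV (%x. p (q x))" by (rule continuous_on_compose2[OF eqprojD(2)[OF p] eqprojD(2)[OF q]]) auto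
  show "p (q (p (q x))) = p (q x)" for x using pq eqprojD(4)[OF p] eqprojD(4)[OF q] by simp
qed (simp_all add: eqprojD[OF p] eqprojD[OF q])

text \<open>Uniqueness of the component in \<open>A\<close> makes the choice additive and
  equivariant. Continuity is asked for at 0, in \<open>cont\<close>, since an algebraic direct sum
  of closed subgroups need not be a topological one here.\<close>

lemma eqproj_exists:
  assumes A: "add_subgroup A" "!!a x. x \<in> A ==> act a x \<in> A" and B: "add_subgroup B" "!!a x. x \<in> B ==> act a x \<in> B"
    and AB: "A Int B <= {0}" "!!x. \<exists>a\<in>A. x - a \<in> B"
    and cont: "!!U. open U ==> 0 \<in> U ==> \<exists>W. open W & 0 \<in> W & (\<forall>x\<in>W. \<forall>a\<in>A. x - a \<in> B --> a \<in> U)"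
  obtains p where "eqproj p" "range p = A" "!!x. x - p x \<in> B" "!!x. x \<in> B ==> p x = 0"
proof -
  define p where "p x = (SOME a. a \<in> A & x - a \<in> B)" for x
  have p: "p x \<in> A & x - p x \<in> B" for x unfolding p_def using someI_ex[of "%a. a \<in> A & x - a \<in> B"] AB(2)[of x] by blast
  have uniq: "p x = a" if "a \<in> A" "x - a \<in> B" for x a
  proof -
    have "p x - a \<in> A" using p that(1) add_subgroupD(4)[OF A(1)] by blast
    moreover have "(x - a) - (x - p x) \<in> B" using p that(2) add_subgroupD(4)[OF B(1)] by blast
    ultimately have "p x - a \<in> A Int B" by simp
    then have "p x - a = 0" using AB(1) by blast
    then show ?thesis by simp
  qed
  have padd: "p (x + y) = p x + p y" for x y
  proof (rule uniq)
    show "p x + p y \<in> A" using p add_subgroupD(2)[OF A(1)] by blast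
    have "(x - p x) + (y - p y) \<in> B" using p add_subgroupD(2)[OF B(1)] by blast
    then show "x + y - (p x + p y) \<in> B" by (simp add: algebra_simps)
  qed
  have pact: "p (act a x) = act a (p x)" for a x
  proof (rule uniq)
    show "act a (p x) \<in> A" using p A(2) by blast
    have "act a (x - p x) \<in> B" using p B(2) by blast
    then show "act a x - act a (p x) \<in> B" by (simp add: act_diff)
  qed
  have pA: "p x = x" if "x \<in> A" for x using that add_subgroupD(1)[OF B(1)] by (intro uniq) auto
  have pcont: "continuous_on UNIV p"
  proof (rule additive_continuous)
    fix U :: "'m set" assume U: "open U" "0 \<in> U"
    obtain W where W: "open W" "0 \<in> W" "!!x a. x \<in> W ==> a \<in> A ==> x - a \<in> B ==> a \<in> U" using cont[OF U] by blast
    then have "\<forall>y\<in>W Int UNIV. p y \<in> U" using p by blast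
    then show "\<exists>W. open W & 0 \<in> W & (\<forall>y\<in>W Int UNIV. p y \<in> U)" using W(1,2) by blast
  qed (use padd in auto)
  have "eqproj p" unfolding eqproj_def using padd pcont pact p pA by blast
  moreover have "range p = A"
  proof
    show "range p <= A" using p by blast
    show "A <= range p" using pA by (metis rangeI subsetI)
  qed
  moreover have "p x = 0" if "x \<in> B" for x using that add_subgroupD(1)[OF A(1)] by (intro uniq) auto
  ultimately show ?thesis using that p by blast
qed

end

locale sheer_module = pfree_module +
  assumes Om: "!!U. submodule act UNIV U ==> open U ==> purely_discrete_quotient act UNIV U ==> U = UNIV"

context char_module
begin

lemma V0_H: "V0 <= H" unfolding V0_def using oneparam_H by blast

lemma Mell_Int_H: "Mell Int H = K0"
proof
  show "Mell Int H <= K0"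
  proof
    fix x assume x: "x \<in> Mell Int H"
    then obtain C where C: "compact C" "add_subgroup C" "x \<in> C" unfolding Mell_def by blast
    have "C Int H <= K0" by (rule compact_subgroup_K0) (auto intro: compact_Int_closed[OF C(1) cH] add_subgroup_Int C(2) sH)
    then show "x \<in> K0" using C(3) x by blast
  qed
  show "K0 <= Mell Int H" unfolding Mell_def using K0_compact K0_subgroup unfolding K0_def by blast
qed

lemma V0_Int_Mell: "V0 Int Mell <= {0}"
proof
  fix x assume x: "x \<in> V0 Int Mell"
  then obtain \<phi> where \<phi>: "oneparam \<phi>" "x = \<phi> 1" by (auto elim: V0_E)
  have "x \<in> K0" using x V0_H Mell_Int_H by blast
  then have "chi i (\<phi> 1) = 0" if "i < n" for i using chi_le_N[OF that, of "\<phi> 1"] \<phi>(2) unfolding K0_def by simp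
  then show "x \<in> {0}" using oneparam_trivial[OF \<phi>(1)] \<phi>(2) by simp
qed

text \<open>Elements of \<open>W\<close> in \<open>K0\<close> cost nothing as steps, so the group
  they generate stays in \<open>S W e\<close> and is therefore small. This is the total
  disconnectedness of the elliptic part.\<close>

lemma Mell_basis:
  assumes U: "open U" "0 \<in> U"
  obtains O' W where "add_subgroup O'" "compact O'" "O' <= Mell" "O' <= U" "open W" "0 \<in> W" "W Int Mell <= O'"
proof -
  obtain W1 where W1: "open W1" "0 \<in> W1" "closure W1 <= U" using nbhd_closure[OF U] by metis
  obtain W e where We: "good W" "e > 0" "S W e <= W1" by (rule small_chains[OF W1(1,2)])
  have oW: "open W" "0 \<in> W" "W <= H" using We(1) unfolding good_def by auto
  define G where "G = generated_subgroup (W Int K0)"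
  have sG: "add_subgroup G" unfolding G_def by (rule add_subgroup_generated)
  have "add_subgroup {x. chain W 0 x}" unfolding add_subgroup_def
    using chain_0 chain_add[of W 0 _ 0] chain_uminus[OF We(1)] by auto
  moreover have "W Int K0 <= {x. chain W 0 x}"
  proof
    fix x assume x: "x \<in> W Int K0"
    then have "N x = 0" unfolding K0_def by blast
    then show "x \<in> {x. chain W 0 x}" using chain_Suc[OF chain_0, of x W] x by simp
  qed
  ultimately have "G <= {x. chain W 0 x}" unfolding G_def by (rule generated_least)
  then have "G <= S W e" unfolding S_def using We(2) by (auto intro!: exI[of _ 0])
  then have GU: "closure G <= U" using closure_mono[of G W1] We(3) W1(3) by blast
  have "G <= K0" unfolding G_def by (rule generated_least[OF K0_subgroup]) blast
  then have GK: "closure G <= K0" by (rule closure_minimal[OF _ compact_imp_closed[OF K0_compact]])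
  then have "closure G = K0 Int closure G" by blast
  then have "compact (closure G)" using compact_Int_closed[OF K0_compact closed_closure] by metis
  moreover have "W Int Mell <= closure G"
  proof -
    have "W Int Mell <= W Int K0" using oW(3) Mell_Int_H by blast
    also have "\<dots> <= G" unfolding G_def by (rule generated_subset)
    also have "\<dots> <= closure G" by (rule closure_subset)
    finally show ?thesis .
  qed
  moreover have "closure G <= Mell" using GK Mell_Int_H by blast
  ultimately show ?thesis using that[OF add_subgroup_closure[OF sG] _ _ GU oW(1,2)] by blast
qed

end

context sheer_module
begin

lemma char_exists: obtains H n chi where "char_module act H n chi"
proof -
  show ?thesis
  proof (rule proper_characters[OF LCM])
    fix H :: "'b set" and n :: nat and chi :: "nat => 'b => real" assume "open H" "add_subgroup H"
      "!!i x y. i < n ==> x \<in> H ==> y \<in> H ==> chi i (x + y) = chi i x + (chi i y :: real)"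
      "!!i. i < n ==> continuous_on H (chi i)"
      "!!r. \<exists>C. compact C & {x \<in> H. \<forall>i<n. \<bar>chi i x\<bar> \<le> r} <= C"
    then have "char_module act H n chi" by unfold_locales
    then show thesis by (rule that)
  qed
qed

lemma V0_Mell_trivial: "V0 Int Mell <= {0}"
proof -
  obtain H n chi where "char_module act H n chi" by (rule char_exists)
  then interpret char_module act H n chi .
  show ?thesis by (rule V0_Int_Mell)
qed

lemma Mell_open_basis:
  assumes U: "open U" "0 \<in> U"
  obtains O' W where "add_subgroup O'" "compact O'" "O' <= Mell" "O' <= U" "open W" "0 \<in> W" "W Int Mell <= O'"
proof -
  obtain H n chi where "char_module act H n chi" by (rule char_exists)
  then interpret char_module act H n chi .
  show ?thesis by (rule Mell_basis[OF U]) (rule that)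
qed

text \<open>\<open>V0 + Mell\<close> is open by the local projection \<open>p\<close>. If a positive
  multiple of \<open>x\<close> lies in it, so does \<open>x\<close>: the component in
  \<open>V0\<close> can be divided, and \<open>Mell\<close> is closed under roots. Hence there is no
  proper finite extension and \<open>Om\<close> applies; continuity is read off from
  \<open>p\<close> near 0.\<close>

lemma Euclidean_projection:
  obtains pV where "eqproj pV" "range pV = V0" "!!x. x - pV x \<in> Mell" "!!x. x \<in> Mell ==> pV x = 0"
proof -
  obtain H n chi where "char_module act H n chi" by (rule char_exists)
  then interpret char_module act H n chi .
  have "\<exists>d ph t W. pos_system {\<phi>. oneparam \<phi>} d ph t & open W & 0 \<in> W & W <= H & (\<forall>x\<in>W. x - (\<Sum>j<d. ph j (lc (t j) x)) \<in> K0)"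
  proof (rule euclidean_part)
    fix d ph t W assume "pos_system {\<phi>. oneparam \<phi>} d ph t" "open W" "0 \<in> W" "W <= H"
      "!!x. x \<in> W ==> x - (\<Sum>j<d. ph j (lc (t j) x)) \<in> K0"
    then show ?thesis by (intro exI[of _ d] exI[of _ ph] exI[of _ t] exI[of _ W]) simp
  qed
  then obtain d ph t W where sys: "pos_system {\<phi>. oneparam \<phi>} d ph t"
    and W: "open W" "0 \<in> W" "W <= H" "!!x. x \<in> W ==> x - (\<Sum>j<d. ph j (lc (t j) x)) \<in> K0" by blast
  define p where "p x = (\<Sum>j<d. ph j (lc (t j) x))" for x
  have one: "oneparam (ph j)" if "j < d" for j using sys that unfolding pos_system_def by blast
  have pV0: "p x \<in> V0" for x unfolding p_def using V0_mem[OF one] by (intro add_subgroup_sum[OF V0_subgroup]) auto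
  have pcont: "continuous_on H p" unfolding p_def
    by (intro continuous_on_sum continuous_on_compose2[OF oneparamD(1)[OF one] lc_cont]) auto
  have p0: "p 0 = 0" unfolding p_def lc_zero using oneparamD(3)[OF one] by simp
  have pM: "x - p x \<in> Mell" if "x \<in> W" for x using W(4)[OF that] Mell_Int_H unfolding p_def by blast
  let ?U = "V0 + Mell"
  have sU: "add_subgroup ?U" by (rule add_subgroup_plus[OF V0_subgroup Mell_subgroup])
  have "W <= ?U"
  proof
    fix x assume "x \<in> W"
    from set_plus_intro[OF pV0 pM[OF this], of x] show "x \<in> ?U" by simp
  qed
  then have oU: "open ?U" by (rule open_subgroup[OF sU W(1,2)])
  have mU: "submodule act UNIV ?U" unfolding submodule_def
    using sU V0_act Mell_act by (auto simp: act_add elim!: set_plus_elim intro!: set_plus_intro)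
  have "purely_discrete_quotient act UNIV ?U" unfolding purely_discrete_quotient_def
  proof (intro allI impI)
    fix F assume F: "submodule act UNIV F & ?U <= F & finite (cosets F ?U)"
    have "F <= ?U"
    proof
      fix x assume x: "x \<in> F"
      have sF: "add_subgroup F" using F unfolding submodule_def by blast
      obtain i j where ij: "i < j" "zm (int j) x - zm (int i) x \<in> ?U"
        using finite_cosets_pigeonhole[of F ?U "%k. zm (int k) x"] F sU add_subgroup_zm[OF sF x] by blast
      define k where "k = int j - int i"
      have k: "k > 0" "zm k x \<in> ?U" using ij unfolding k_def zm_diff by auto
      obtain v m where vm: "v \<in> V0" "m \<in> Mell" "zm k x = v + m" using k(2) by (rule set_plus_elim)
      obtain w where w: "w \<in> V0" "zm k w = v" using V0_divisible[OF vm(1) k(1)] by blast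
      have "zm k (x - w) = m" using vm w by (simp add: zm_diff_right)
      then have "x - w \<in> Mell" using Mell_zm k(1) vm(2) by blast
      from set_plus_intro[OF w(1) this] show "x \<in> ?U" by simp
    qed
    then show "F = ?U" using F by blast
  qed
  then have all: "?U = UNIV" by (rule Om[OF mU oU])
  show ?thesis
  proof (rule eqproj_exists[OF V0_subgroup V0_act Mell_subgroup Mell_act V0_Int_Mell])
    fix x
    have "x \<in> V0 + Mell" using all by simp
    then obtain v m where "v \<in> V0" "m \<in> Mell" "x = v + m" by (rule set_plus_elim)
    then show "\<exists>a\<in>V0. x - a \<in> Mell" by (intro bexI[of _ v]) simp_all
  next
    fix U :: "'b set" assume U: "open U" "0 \<in> U"
    have "open (H Int p -` U)" using continuous_open_preimage[OF pcont oH U(1)] .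
    then have "open (W Int (H Int p -` U))" using W(1) by blast
    moreover have "0 \<in> W Int (H Int p -` U)" using W(2,3) p0 U(2) by auto
    moreover have "a \<in> U" if x: "x \<in> W Int (H Int p -` U)" "a \<in> V0" "x - a \<in> Mell" for x a
    proof -
      have "x - p x \<in> Mell" using pM x(1) by blast
      then have "(x - p x) - (x - a) \<in> Mell" by (rule add_subgroupD(4)[OF Mell_subgroup _ x(3)])
      then have "a - p x \<in> V0 Int Mell" using add_subgroupD(4)[OF V0_subgroup x(2) pV0, of x] by simp
      then have "a = p x" using V0_Int_Mell by auto
      then show ?thesis using x(1) by blast
    qed
    ultimately show "\<exists>W. open W & 0 \<in> W & (\<forall>x\<in>W. \<forall>a\<in>V0. x - a \<in> Mell --> a \<in> U)" by blast
  next
    fix p assume "eqproj p" "range p = V0" "!!x. x - p x \<in> Mell" "!!x. x \<in> Mell ==> p x = 0"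
    then show thesis by (rule that)
  qed simp_all
qed

text \<open>The combinations \<open>lc\<close> of characters are controlled on \<open>H\<close>
  only; composing them with the projection onto \<open>V0\<close>, which lies in \<open>H\<close>,
  gives functionals on the whole module.\<close>

lemma real_dual_basis:
  fixes LL :: "(real => 'b) set"
  assumes one: "!!\<phi>. \<phi> \<in> LL ==> oneparam \<phi>" and zero: "(%_. 0) \<in> LL"
    and scale: "!!\<phi> c. \<phi> \<in> LL ==> (%r. \<phi> (c * r)) \<in> LL"
    and diff: "!!\<phi> \<psi>. \<phi> \<in> LL ==> \<psi> \<in> LL ==> (%r. \<phi> r - \<psi> r) \<in> LL"
  obtains d :: nat and ph th where "!!j. j < d ==> ph j \<in> LL" "!!j x y. th j (x + y) = th j x + (th j y :: real)"
    "!!j. continuous_on UNIV (th j)" "!!i j r. i < d ==> j < d ==> th i (ph j r) = (if i = j then r else 0)"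
    "!!\<phi>. \<phi> \<in> LL ==> \<phi> 1 = (\<Sum>j<d. ph j (th j (\<phi> 1)))"
proof -
  obtain pV where pV: "eqproj pV" "range pV = V0" "!!x. x - pV x \<in> Mell" "!!x. x \<in> Mell ==> pV x = 0"
    using Euclidean_projection by metis
  obtain H n chi where "char_module act H n chi" by (rule char_exists)
  then interpret char_module act H n chi .
  have pVH: "pV x \<in> H" for x using V0_H pV(2) by blast
  have pV1: "pV x = x" if "x \<in> V0" for x using eqproj_range[OF pV(1)] pV(2) that by blast
  show ?thesis
  proof (rule dual_basis[of LL])
    fix d ph t assume sys: "pos_system LL d ph t" and rep: "!!\<phi>. \<phi> \<in> LL ==> \<phi> 1 = (\<Sum>j<d. ph j (lc (t j) (\<phi> 1)))"
    have phL: "ph j \<in> LL" if "j < d" for j using sys that unfolding pos_system_def by blast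
    show thesis
    proof (rule that[of d ph "%j x. lc (t j) (pV x)"])
      show "lc (t j) (pV (x + y)) = lc (t j) (pV x) + lc (t j) (pV y)" for j x y
        unfolding eqprojD(1)[OF pV(1)] by (rule lc_add[OF pVH pVH])
      show "continuous_on UNIV (%x. lc (t j) (pV x))" for j
        by (rule continuous_on_compose2[OF lc_cont eqprojD(2)[OF pV(1)]]) (use pVH in auto)
      show "lc (t i) (pV (ph j r)) = (if i = j then r else 0)" if ij: "i < d" "j < d" for i j r
      proof -
        have o: "oneparam (ph j)" using one[OF phL[OF ij(2)]] .
        have "lc (t i) (pV (ph j r)) = r * lc (t i) (ph j 1)" unfolding pV1[OF V0_mem[OF o]] by (rule lc_oneparam[OF o])
        then show ?thesis using sys ij unfolding pos_system_def by simp
      qed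
      show "\<phi> 1 = (\<Sum>j<d. ph j (lc (t j) (pV (\<phi> 1))))" if "\<phi> \<in> LL" for \<phi>
        using rep[OF that] unfolding pV1[OF V0_mem[OF one[OF that]]] .
    qed (rule phL)
  qed (use one zero scale diff in auto)
qed

end

subsection \<open>Dynamics of a single element on the elliptic part\<close>

context lc_module
begin

abbreviation pw :: "'a => int => 'm => 'm" where "pw a k x \<equiv> act (zm k a) x"

lemma pw_pw: "pw a k (pw a l x) = pw a (k + l) x"
  by (simp add: zm_add act_act)

lemma pw_uminus: "pw (- a) k x = pw a (- k) x"
  by simp

lemma pw_funpow: "(act a ^^ n) x = pw a (int n) x"
proof (induction n)
  case (Suc n)
  then show ?case using zm_succ[of "int n" a] by (simp add: act_act add.commute)
qed simp

lemma pw_invariant: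
  assumes "!!x. x \<in> L ==> act a x \<in> L" "!!x. x \<in> L ==> act (- a) x \<in> L" "x \<in> L"
  shows "pw a k x \<in> L"
proof (induction k rule: int_induct[where k = 0])
  case (step1 i)
  then show ?case using assms(1) zm_succ[of i a] by (simp add: act_act[symmetric] add.commute)
next
  case (step2 i)
  have "zm (i - 1) a = - a + zm i a" using zm_pred[of i a] by simp
  then show ?case using assms(2)[OF step2(2)] by (simp add: act_act)
qed (use assms in simp)

text \<open>Willis' core with index minus; \<open>mn (- a)\<close> is the core with index plus, and
  \<open>zr\<close> below is the two-sided core.\<close>

definition mn :: "'a => 'm set => 'm set" where "mn a U = {x. \<forall>n::nat. pw a (int n) x \<in> U}"

definition zr :: "'a => 'm set => 'm set" where "zr a U = {x. \<forall>k. pw a k x \<in> U}"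

lemma mn_sub: "mn a U <= U"
proof
  fix x assume "x \<in> mn a U"
  then have "pw a (int 0) x \<in> U" unfolding mn_def by blast
  then show "x \<in> U" by simp
qed

lemma zr_sub: "zr a U <= U"
proof
  fix x assume "x \<in> zr a U"
  then have "pw a 0 x \<in> U" unfolding zr_def by blast
  then show "x \<in> U" by simp
qed

lemma zr_uminus: "zr (- a) U = zr a U"
proof -
  have "(\<forall>k. pw (- a) k x \<in> U) \<longleftrightarrow> (\<forall>k. pw a k x \<in> U)" for x
    by (metis pw_uminus minus_minus)
  then show ?thesis unfolding zr_def by simp
qed

lemma pw_subgroup: "add_subgroup U ==> add_subgroup {x. pw a k x \<in> U}"
  unfolding add_subgroup_def by (simp add: act_add act_uminus)

lemma pw_closed: "closed U ==> closed {x. pw a k x \<in> U}"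
  by (rule closed_vimage_UNIV[OF act_continuous])

lemma pw_open: "open U ==> open {x. pw a k x \<in> U}"
  by (rule open_vimage_UNIV[OF act_continuous])

lemma pw_compact: "compact U ==> compact {x. pw a k x \<in> U}"
  using act_image_compact[of U "- zm k a"] unfolding act_image_eq by simp

lemma mn_subgroup: "add_subgroup U ==> add_subgroup (mn a U)"
  unfolding add_subgroup_def mn_def by (simp add: act_add act_uminus)

lemma zr_subgroup: "add_subgroup U ==> add_subgroup (zr a U)"
  unfolding add_subgroup_def zr_def by (simp add: act_add act_uminus)

lemma compact_subset: "compact U ==> closed V ==> V <= U ==> compact (V :: 'm set)"
  using compact_Int_closed[of U V] by (simp add: Int_absorb1)

lemma mn_compact: assumes "compact U" shows "compact (mn a U)"
proof (rule compact_subset[OF assms _ mn_sub])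
  have "mn a U = (\<Inter>n::nat. {x. pw a (int n) x \<in> U})" unfolding mn_def by blast
  then show "closed (mn a U)" using pw_closed[OF compact_imp_closed[OF assms]] by (simp add: closed_INT)
qed

lemma zr_compact: assumes "compact U" shows "compact (zr a U)"
proof (rule compact_subset[OF assms _ zr_sub])
  have "zr a U = (\<Inter>n. {x. pw a n x \<in> U})" unfolding zr_def by blast
  then show "closed (zr a U)" using pw_closed[OF compact_imp_closed[OF assms]] by (simp add: closed_INT)
qed

lemma mn_pw: assumes "x \<in> mn a U" shows "pw a (int n) x \<in> mn a U"
  unfolding mn_def
proof (intro CollectI allI)
  fix m :: nat
  have "pw a (int (m + n)) x \<in> U" using assms unfolding mn_def by blast
  then show "pw a (int m) (pw a (int n) x) \<in> U" by (simp add: pw_pw)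
qed

lemma zr_pw: "x \<in> zr a U ==> pw a k x \<in> zr a U"
  unfolding zr_def by (simp add: pw_pw)

lemma finite_elliptic:
  assumes "finite X" "!!x. x \<in> X ==> \<exists>C. compact C & add_subgroup C & x \<in> C"
  obtains Q where "compact Q" "add_subgroup Q" "X <= (Q :: 'm set)"
proof -
  have "\<exists>Q. compact Q & add_subgroup Q & X <= Q" using assms
  proof (induction X rule: finite_induct)
    case empty then show ?case by (intro exI[of _ "{0}"]) simp
  next
    case (insert x X)
    have "\<exists>Q. compact Q & add_subgroup Q & X <= Q" by (rule insert.IH) (rule insert.prems, simp)
    then obtain Q where Q: "compact Q" "add_subgroup Q" "X <= Q" by blast
    obtain C where C: "compact C" "add_subgroup C" "x \<in> C" using insert.prems[of x] by blast
    have "X <= C + Q" by (rule subset_trans[OF Q(3) set_plus_right[OF add_subgroupD(1)[OF C(2)]]])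
    moreover have "x \<in> C + Q" by (rule subsetD[OF set_plus_left[OF add_subgroupD(1)[OF Q(2)]] C(3)])
    ultimately have XQ: "insert x X <= C + Q" by blast
    show ?case by (intro exI[of _ "C + Q"] conjI compact_plus[OF C(1) Q(1)] add_subgroup_plus[OF C(2) Q(2)] XQ)
  qed
  then show ?thesis using that by blast
qed

text \<open>Willis' tidying procedure: a finite intersection of translates of \<open>U\<close> is the sum of its
  forward and backward cores.\<close>

lemma tidy:
  assumes Z: "add_subgroup Z" "!!k x. x \<in> Z ==> pw a k x \<in> Z"
    and U: "compact U" "add_subgroup U" "U <= Z" and W: "open W" "0 \<in> W" "W Int Z <= U"
  obtains U' W' where "compact U'" "add_subgroup U'" "U' <= U" "open W'" "0 \<in> W'" "W' Int Z <= U'"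
    "U' <= mn (- a) U' + mn a U'"
proof -
  define On where "On n = {x. \<forall>i\<le>n. pw a (- int i) x \<in> U}" for n
  define Op where "Op = mn (- a) U"
  have OnE: "On n = (\<Inter>i\<in>{..n}. {x. pw a (- int i) x \<in> U})" for n unfolding On_def by auto
  have OnU: "On n <= U" for n
  proof
    fix x assume "x \<in> On n"
    then have "pw a (- int 0) x \<in> U" unfolding On_def by blast
    then show "x \<in> U" by simp
  qed
  have On_closed: "closed (On n)" for n
    unfolding OnE using pw_closed[OF compact_imp_closed[OF U(1)]] by (intro closed_INT) blast
  have On_compact: "compact (On n)" for n by (rule compact_subset[OF U(1) On_closed OnU])
  have On_sub: "add_subgroup (On n)" for n
    unfolding OnE by (rule add_subgroup_Inter) (use pw_subgroup[OF U(2)] in blast)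
  have On_dec: "On (Suc n) <= On n" for n unfolding On_def by auto
  have Op_eq: "(\<Inter>n. On n) = Op" unfolding On_def Op_def mn_def pw_uminus by blast
  have OpOn: "Op <= On n" for n using Op_eq by blast
  have sOp: "add_subgroup Op" unfolding Op_def by (rule mn_subgroup[OF U(2)])
  define W2 where "W2 = W Int {x. act a x \<in> W}"
  have oW2: "open W2" "0 \<in> W2" unfolding W2_def
    using W(1,2) open_vimage_UNIV[OF act_continuous W(1), of a] by auto
  have "Op <= Op + W2" by (rule set_plus_left[OF oW2(2)])
  then have "\<exists>n. On n <= Op + W2"
    using decseq_compact[of On "Op + W2"] On_compact On_dec open_plus[OF oW2(1)] Op_eq by simp
  then obtain n where n: "On n <= Op + W2" by blast
  define U' where "U' = On n"
  have actZ: "act a x \<in> Z" if "x \<in> Z" for x using Z(2)[OF that, of 1] by simp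
  \<comment> \<open>\<open>n\<close> was chosen so that \<open>U'\<close> exceeds the core
    \<open>Op\<close> only by elements of \<open>W2\<close>, whose images under \<open>a\<close>
    stay in \<open>W\<close>. So after subtracting an element of \<open>Op\<close>, one further step
    forward remains in \<open>U'\<close>.\<close>
  have step: "\<exists>p\<in>Op. x - p \<in> U' & act a (x - p) \<in> U'" if x: "x \<in> U'" for x
  proof -
    obtain p w where pw: "p \<in> Op" "w \<in> W2" "x = p + w" using subsetD[OF n, of x] x unfolding U'_def by (auto elim: set_plus_elim)
    have xp: "x - p \<in> U'" using x OpOn[of n] pw(1) unfolding U'_def by (intro add_subgroupD(4)[OF On_sub]) auto
    then have "x - p \<in> Z" using OnU U(3) unfolding U'_def by blast
    then have "w \<in> Z" using pw(3) by simp
    then have "act a (x - p) \<in> U" using W(3) actZ pw unfolding W2_def by auto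
    then have "pw a (- int i) (act a (x - p)) \<in> U" if "i \<le> n" for i
    proof (cases i)
      case (Suc j)
      have "pw a (- int j) (x - p) \<in> U" using xp that Suc unfolding U'_def On_def by auto
      moreover have "zm (- int i) a + a = zm (- int j) a" using zm_succ[of "- int i" a] Suc by simp
      ultimately show ?thesis by (simp add: act_act)
    qed simp
    then show ?thesis using pw(1) xp unfolding U'_def On_def by blast
  qed
  have Op_back: "pw a (- int k) p \<in> Op" if "p \<in> Op" for p k
    using mn_pw[of p "- a" U k] that unfolding Op_def by simp
  \<comment> \<open>The correction \<open>q\<close> found at time \<open>k\<close> is transported
    back to time 0; backward invariance of \<open>Op\<close> and its inclusion in \<open>U'\<close>
    keep the earlier positions in \<open>U'\<close>.\<close>
  have iter: "\<exists>p\<in>Op. \<forall>i\<le>k. pw a (int i) (x - p) \<in> U'" if x: "x \<in> U'" for x k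
  proof (induction k)
    case 0
    show ?case using add_subgroupD(1)[OF sOp] x by (intro bexI[of _ 0]) auto
  next
    case (Suc k)
    then obtain p where p: "p \<in> Op" "!!i. i \<le> k ==> pw a (int i) (x - p) \<in> U'" by blast
    obtain q where q: "q \<in> Op" "pw a (int k) (x - p) - q \<in> U'" "act a (pw a (int k) (x - p) - q) \<in> U'"
      using step[OF p(2)[OF order_refl]] by blast
    define p' where "p' = p + pw a (- int k) q"
    have "p' \<in> Op" unfolding p'_def using p(1) Op_back[OF q(1)] by (rule add_subgroupD(2)[OF sOp])
    moreover have "pw a (int i) (x - p') \<in> U'" if i: "i \<le> Suc k" for i
    proof (cases "i = Suc k")
      case True
      have "pw a (int i) (x - p') = act a (pw a (int k) (x - p) - q)"
      proof -
        have e: "pw a (int i) y = act a (pw a (int k) y)" for y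
          using True zm_succ[of "int k" a] by (simp add: act_act add.commute)
        have "pw a (int k) (x - p') = pw a (int k) (x - p) - q"
          unfolding p'_def by (simp add: act_diff act_add act_act)
        then show ?thesis unfolding e by simp
      qed
      then show ?thesis using q(3) by simp
    next
      case False
      then have ik: "i \<le> k" using i by simp
      have "pw a (int i) (x - p') = pw a (int i) (x - p) - pw a (- int (k - i)) q"
        unfolding p'_def using ik by (simp add: act_diff act_add act_act zm_add[symmetric] of_nat_diff zm_diff)
      moreover have "pw a (- int (k - i)) q \<in> U'" using Op_back[OF q(1)] OpOn unfolding U'_def by blast
      ultimately show ?thesis using p(2)[OF ik] add_subgroupD(4)[OF On_sub[of n]] unfolding U'_def by simp
    qed
    ultimately show ?case by blast
  qed
  have sub: "U' <= Op + mn a U'"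
  proof
    fix x assume x: "x \<in> U'"
    define Mk where "Mk k = {y. \<forall>i\<le>k. pw a (int i) y \<in> U'}" for k
    have MkE: "Mk k = (\<Inter>i\<in>{..k}. {x. pw a (int i) x \<in> U'})" for k unfolding Mk_def by auto
    have "x \<in> Op + (\<Inter>k. Mk k)"
    proof (rule decseq_compact_plus)
      show "compact Op" unfolding Op_def by (rule mn_compact[OF U(1)])
      show "compact (Mk k)" for k
      proof (rule compact_subset[OF On_compact[of n]])
        show "closed (Mk k)" unfolding MkE U'_def using pw_closed[OF On_closed] by (intro closed_INT) blast
        show "Mk k <= On n"
        proof
          fix y assume "y \<in> Mk k"
          then have "pw a (int 0) y \<in> U'" unfolding Mk_def by blast
          then show "y \<in> On n" unfolding U'_def by simp
        qed
      qed
      show "Mk (Suc k) <= Mk k" for k unfolding Mk_def by auto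
      fix k
      obtain p where p: "p \<in> Op" "x - p \<in> Mk k" using iter[OF x, of k] unfolding Mk_def by blast
      from set_plus_intro[OF p] show "x \<in> Op + Mk k" by simp
    qed
    moreover have "(\<Inter>k. Mk k) = mn a U'" unfolding Mk_def mn_def by blast
    ultimately show "x \<in> Op + mn a U'" by simp
  qed
  have "Op <= mn (- a) U'"
  proof
    fix x assume x: "x \<in> Op"
    have "pw (- a) (int m) x \<in> U'" for m using Op_back[OF x, of m] OpOn[of n] unfolding U'_def by auto
    then show "x \<in> mn (- a) U'" unfolding mn_def by blast
  qed
  then have sub': "U' <= mn (- a) U' + mn a U'" using sub set_plus_mono2[of Op "mn (- a) U'" "mn a U'" "mn a U'"] by blast
  define W' where "W' = (\<Inter>i\<in>{..n}. {x. pw a (- int i) x \<in> W})"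
  have "open W'" unfolding W'_def by (intro open_INT finite_atMost ballI pw_open[OF W(1)])
  moreover have "0 \<in> W'" unfolding W'_def using W(2) by simp
  moreover have "W' Int Z <= U'" unfolding W'_def U'_def On_def using W(3) Z(2) by blast
  ultimately show ?thesis using that[of U' W'] On_compact On_sub OnU sub' unfolding U'_def by blast
qed

end

text \<open>\<open>G\<close> stands for the elliptic part or a closed submodule of it: totally
  disconnected in the form of a basis of compact relatively open subgroups, and covered by compact
  subgroups.\<close>

locale td_module = lc_module +
  fixes G :: "'b set"
  assumes sG: "add_subgroup G" and G_act: "!!a x. x \<in> G ==> act a x \<in> G"
    and G_basis: "!!U. open U ==> 0 \<in> U ==> \<exists>O' W. compact O' & add_subgroup O' & O' <= G & O' <= U & open W & 0 \<in> W & W Int G <= O'"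
    and G_ell: "!!x. x \<in> G ==> \<exists>C. compact C & add_subgroup C & x \<in> C"
begin

definition copen :: "'b set => bool" where
  "copen U \<longleftrightarrow> compact U & add_subgroup U & U <= G & (\<exists>W. open W & 0 \<in> W & W Int G <= U)"

lemma copen_basis: assumes "open U" "0 \<in> U" obtains O' where "copen O'" "O' <= U"
  using G_basis[OF assms] unfolding copen_def by blast

lemma copen_tidy:
  assumes "copen U" obtains U' where "copen U'" "U' <= U" "U' <= mn (- a) U' + mn a U'"
proof -
  obtain W where W: "open W" "0 \<in> W" "W Int G <= U" and U: "compact U" "add_subgroup U" "U <= G" using assms unfolding copen_def by blast
  obtain U' W' where "compact U'" "add_subgroup U'" "U' <= U" "open W'" "0 \<in> W'" "W' Int G <= U'"
    "U' <= mn (- a) U' + mn a U'" by (rule tidy[OF sG G_act U W])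
  then show ?thesis using that[of U'] U(3) unfolding copen_def by blast
qed

text \<open>Points whose orbit makes a finite excursion from \<open>U\<close>, of no fixed length;
  the uniform bound on such excursions is what confines the parafinite subgroups of a single
  element.\<close>

definition LL :: "'a => 'b set => 'b set" where
  "LL a U = {x \<in> G. \<exists>N::nat. \<forall>n\<ge>N. pw a (int n) x \<in> U & pw a (- int n) x \<in> U}"

text \<open>The core \<open>Op\<close> has finite index in its image \<open>TO\<close> under
  \<open>a\<close>. An element of \<open>LL a U\<close> is followed forward from a time when it is
  in \<open>Op\<close>; each time it leaves, it is corrected by one of finitely many coset
  representatives. Only finitely many forward positions of these lie outside \<open>U\<close>, and
  together with \<open>U\<close> they are contained in a compact subgroup.\<close>

lemma LL_bounded:
  assumes O: "copen U" obtains Q where "compact Q" "add_subgroup Q" "LL a U <= Q" "U <= Q"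
proof -
  obtain W where W: "open W" "0 \<in> W" "W Int G <= U" and U: "compact U" "add_subgroup U" "U <= G" using O unfolding copen_def by blast
  define Op where "Op = mn (- a) U"
  have Op: "compact Op" "add_subgroup Op" "Op <= U" unfolding Op_def using mn_compact[OF U(1)] mn_subgroup[OF U(2)] mn_sub by auto
  define TO where "TO = {x. act (- a) x \<in> Op}"
  have "TO = act a ` Op" unfolding TO_def act_image_eq ..
  then have TO: "compact TO" "add_subgroup TO" using act_image_compact[OF Op(1)] act_image_subgroup[OF Op(2)] by auto
  have TOG: "TO <= G"
  proof
    fix x assume "x \<in> TO"
    then have "act (- a) x \<in> G" unfolding TO_def using Op(3) U(3) by blast
    from G_act[OF this, of a] show "x \<in> G" by simp
  qed
  have OpTO: "x \<in> TO" if "x \<in> Op" for x using mn_pw[of x "- a" U 1] that unfolding Op_def TO_def by simp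
  have TOOp: "x \<in> Op" if x: "x \<in> TO" "x \<in> U" for x
    unfolding Op_def mn_def
  proof (intro CollectI allI)
    fix n :: nat
    show "pw (- a) (int n) x \<in> U"
    proof (cases n)
      case (Suc m)
      have "pw (- a) (int m) (act (- a) x) \<in> U" using x(1) unfolding TO_def Op_def mn_def by blast
      moreover have "zm (int m) (- a) + - a = zm (int n) (- a)" using zm_succ[of "int m" "- a"] Suc by (simp add: add.commute)
      ultimately show ?thesis by (simp add: act_act)
    qed (use x in simp)
  qed
  have fin: "finite (cosets TO Op)"
    by (rule finite_cosets_compact[OF TO Op(2) W(1,2)]) (use W(3) TOG TOOp in blast)
  have LLs: "add_subgroup (LL a U)" unfolding add_subgroup_def
  proof (intro conjI ballI)
    show "0 \<in> LL a U" unfolding LL_def using add_subgroupD(1)[OF sG] add_subgroupD(1)[OF U(2)] by simp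
    fix x assume "x \<in> LL a U"
    then obtain N where x: "x \<in> G" "!!n. n \<ge> N ==> pw a (int n) x \<in> U" "!!n. n \<ge> N ==> pw a (- int n) x \<in> U" unfolding LL_def by blast
    show "- x \<in> LL a U" unfolding LL_def using add_subgroupD(3)[OF sG x(1)] x(2,3) add_subgroupD(3)[OF U(2)]
      by (intro CollectI conjI exI[of _ N] allI impI) (simp_all add: act_uminus)
    fix y assume "y \<in> LL a U"
    then obtain M where y: "y \<in> G" "!!n. n \<ge> M ==> pw a (int n) y \<in> U" "!!n. n \<ge> M ==> pw a (- int n) y \<in> U" unfolding LL_def by blast
    show "x + y \<in> LL a U" unfolding LL_def
    proof (intro CollectI conjI exI[of _ "max N M"] allI impI)
      show "x + y \<in> G" by (rule add_subgroupD(2)[OF sG x(1) y(1)])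
      fix n assume "max N M \<le> n"
      then have nN: "N \<le> n" "M \<le> n" by auto
      show "pw a (int n) (x + y) \<in> U" unfolding act_add by (rule add_subgroupD(2)[OF U(2) x(2)[OF nN(1)] y(2)[OF nN(2)]])
      show "pw a (- int n) (x + y) \<in> U" unfolding act_add by (rule add_subgroupD(2)[OF U(2) x(3)[OF nN(1)] y(3)[OF nN(2)]])
    qed
  qed
  have LLpw: "pw a k x \<in> LL a U" if x: "x \<in> LL a U" for k x
  proof -
    obtain N where N: "x \<in> G" "!!n. n \<ge> N ==> pw a (int n) x \<in> U" "!!n. n \<ge> N ==> pw a (- int n) x \<in> U" using x unfolding LL_def by blast
    show ?thesis unfolding LL_def
    proof (intro CollectI conjI exI[of _ "N + nat \<bar>k\<bar>"] allI impI)
      show "pw a k x \<in> G" by (rule G_act[OF N(1)])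
      fix n assume n: "N + nat \<bar>k\<bar> \<le> n"
      have nk: "int n + k \<ge> 0" "int n - k \<ge> 0" using n by linarith+
      have "pw a (int n) (pw a k x) = pw a (int (nat (int n + k))) x" using nk by (simp add: pw_pw)
      then show "pw a (int n) (pw a k x) \<in> U" using N(2)[of "nat (int n + k)"] n by auto
      have "pw a (- int n) (pw a k x) = pw a (- int (nat (int n - k))) x" using nk unfolding pw_pw by simp
      then show "pw a (- int n) (pw a k x) \<in> U" using N(3)[of "nat (int n - k)"] n by auto
    qed
  qed
  \<comment> \<open>One representative for each coset that meets \<open>LL a U\<close>, taken inside
    \<open>LL a U\<close> so that its forward orbit returns to \<open>U\<close>.\<close>
  define R where "R = (%C. SOME x. x \<in> C Int LL a U) ` {C \<in> cosets TO Op. C Int LL a U ~= {}}"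
  have finR: "finite R" unfolding R_def using fin by simp
  have RL: "R <= LL a U"
  proof
    fix r assume "r \<in> R"
    then obtain C where "C Int LL a U ~= {}" "r = (SOME x. x \<in> C Int LL a U)" unfolding R_def by blast
    then show "r \<in> LL a U" using someI_ex[of "%x. x \<in> C Int LL a U"] by blast
  qed
  have rep: "\<exists>r\<in>R. y - r \<in> Op" if y: "y \<in> LL a U" "y \<in> TO" for y
  proof -
    define C where "C = (+) y ` Op"
    have C: "C \<in> cosets TO Op" "y \<in> C" unfolding C_def cosets_def using y(2) coset_self[OF add_subgroupD(1)[OF Op(2)]] by blast+
    define r where "r = (SOME x. x \<in> C Int LL a U)"
    have "r \<in> C" unfolding r_def using someI_ex[of "%x. x \<in> C Int LL a U"] C(2) y(1) by blast
    then have "r - y \<in> Op" unfolding C_def translate_eq by simp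
    then have "y - r \<in> Op" using add_subgroupD(3)[OF Op(2), of "r - y"] by simp
    moreover have "r \<in> R" unfolding R_def r_def using C y(1) by blast
    ultimately show ?thesis by blast
  qed
  have "\<exists>N. \<forall>n\<ge>N. pw a (int n) r \<in> U" if "r \<in> R" for r using RL that unfolding LL_def by blast
  then obtain Nr where Nr: "!!r n. r \<in> R ==> n \<ge> Nr r ==> pw a (int n) r \<in> U" by metis
  define N where "N = Max (insert 0 (Nr ` R))"
  have NN: "pw a (int n) r \<in> U" if "r \<in> R" "n \<ge> N" for r n
  proof -
    have "Nr r \<le> N" unfolding N_def using finR that(1) by simp
    then show ?thesis using Nr[OF that(1)] that(2) by simp
  qed
  define X where "X = (%(j, r). pw a (int j) r) ` ({..<N} \<times> R)"
  have "finite X" unfolding X_def using finR by simp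
  moreover have "\<exists>C. compact C & add_subgroup C & x \<in> C" if "x \<in> X" for x
  proof (rule G_ell)
    show "x \<in> G" using that RL G_act unfolding X_def LL_def by auto
  qed
  ultimately obtain Q0 where Q0: "compact Q0" "add_subgroup Q0" "X <= Q0" by (rule finite_elliptic)
  define Q where "Q = U + Q0"
  have Q: "compact Q" "add_subgroup Q" unfolding Q_def using compact_plus[OF U(1) Q0(1)] add_subgroup_plus[OF U(2) Q0(2)] by auto
  have UQ: "U <= Q" "Q0 <= Q" unfolding Q_def
    using set_plus_left[OF add_subgroupD(1)[OF Q0(2)]] set_plus_right[OF add_subgroupD(1)[OF U(2)]] by blast+
  have TR: "pw a (int k) r \<in> Q" if r: "r \<in> R" for k r
  proof (cases "k < N")
    case True
    then have "pw a (int k) r \<in> X" unfolding X_def using r by (intro image_eqI[of _ _ "(k, r)"]) auto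
    then show ?thesis using Q0(3) UQ by blast
  next
    case False
    then show ?thesis using NN[OF r, of k] UQ by auto
  qed
  have main: "y \<in> Q" if "y \<in> LL a U" "pw a (- int k) y \<in> Op" for y k
    using that
  proof (induction k arbitrary: y)
    case 0
    then show ?case using Op(3) UQ by auto
  next
    case (Suc k)
    define z where "z = pw a (- int k) y"
    have "- int (Suc k) = - int k - 1" by simp
    then have "zm (- int (Suc k)) a = - a + zm (- int k) a" using zm_pred[of "- int k" a] by (simp only: diff_conv_add_uminus add.commute)
    then have zTO: "z \<in> TO" unfolding TO_def z_def using Suc.prems(2) by (simp only: act_act mem_Collect_eq)
    have zL: "z \<in> LL a U" unfolding z_def by (rule LLpw[OF Suc.prems(1)])
    obtain r where r: "r \<in> R" "z - r \<in> Op" using rep[OF zL zTO] by blast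
    define y' where "y' = y - pw a (int k) r"
    have "y' \<in> LL a U" unfolding y'_def using add_subgroupD(4)[OF LLs Suc.prems(1) LLpw] RL r(1) by blast
    moreover have "pw a (- int k) y' \<in> Op" using r(2) unfolding y'_def z_def by (simp add: act_diff act_act)
    ultimately have "y' \<in> Q" by (rule Suc.IH)
    from add_subgroupD(2)[OF Q(2) this TR[OF r(1), of k]] show ?case unfolding y'_def by simp
  qed
  have "LL a U <= Q"
  proof
    fix y assume y: "y \<in> LL a U"
    then obtain k where k: "!!n. n \<ge> k ==> pw a (- int n) y \<in> U" unfolding LL_def by blast
    have "pw a (- int k) y \<in> Op" unfolding Op_def mn_def
    proof (intro CollectI allI)
      fix n :: nat
      have "- int (n + k) = - int n + - int k" by simp
      moreover have "pw a (- int (n + k)) y \<in> U" by (rule k) simp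
      ultimately show "pw (- a) (int n) (pw a (- int k) y) \<in> U" unfolding pw_uminus pw_pw by (simp only:)
    qed
    then show "y \<in> Q" by (rule main[OF y])
  qed
  then show ?thesis using that[OF Q] UQ by blast
qed

text \<open>\<open>D\<close>, the core \<open>mn (- a) U\<close> plus the points eventually staying
  in \<open>U\<close>, contains \<open>U\<close> and is mapped into itself by \<open>- a\<close>.
  The union \<open>EE\<close> of its forward images is an invariant, relatively open subgroup of
  \<open>K\<close>, so it has finite index and equals \<open>K\<close>. By compactness one forward
  image is already \<open>K\<close>, and shifting back gives \<open>K = D\<close>.\<close>

lemma parafinite_half:
  assumes K: "pfin {a, - a} K" and U: "compact U" "add_subgroup U" "U <= K" and W: "open W" "0 \<in> W" "W Int K <= U"
    and t: "U <= mn (- a) U + mn a U"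
  shows "K <= U + {x \<in> K. \<exists>N::nat. \<forall>n\<ge>N. pw a (int n) x \<in> U}"
proof -
  have cK: "compact K" and sK: "add_subgroup K" and aK: "!!x. x \<in> K ==> act a x \<in> K" "!!x. x \<in> K ==> act (- a) x \<in> K"
    and pf: "!!L. add_subgroup L ==> closed L ==> L <= K ==> (!!x. x \<in> L ==> act a x \<in> L) ==> (!!x. x \<in> L ==> act (- a) x \<in> L) ==> finite (cosets K L) ==> L = K"
    using K unfolding pfin_def by auto
  have Kpw: "pw a k x \<in> K" if "x \<in> K" for k x by (rule pw_invariant[OF aK that])
  define Mm where "Mm = {x \<in> K. \<exists>N::nat. \<forall>n\<ge>N. pw a (int n) x \<in> U}"
  have sMm: "add_subgroup Mm" unfolding add_subgroup_def
  proof (intro conjI ballI)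
    show "0 \<in> Mm" unfolding Mm_def using add_subgroupD(1)[OF sK] add_subgroupD(1)[OF U(2)] by simp
    fix x assume "x \<in> Mm"
    then obtain N where x: "x \<in> K" "!!n. n \<ge> N ==> pw a (int n) x \<in> U" unfolding Mm_def by blast
    show "- x \<in> Mm" unfolding Mm_def using add_subgroupD(3)[OF sK x(1)] x(2) add_subgroupD(3)[OF U(2)]
      by (intro CollectI conjI exI[of _ N] allI impI) (simp_all add: act_uminus)
    fix y assume "y \<in> Mm"
    then obtain M where y: "y \<in> K" "!!n. n \<ge> M ==> pw a (int n) y \<in> U" unfolding Mm_def by blast
    show "x + y \<in> Mm" unfolding Mm_def
    proof (intro CollectI conjI exI[of _ "max N M"] allI impI)
      show "x + y \<in> K" by (rule add_subgroupD(2)[OF sK x(1) y(1)])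
      fix n assume "max N M \<le> n"
      then show "pw a (int n) (x + y) \<in> U" unfolding act_add by (intro add_subgroupD(2)[OF U(2) x(2) y(2)]) auto
    qed
  qed
  have Mm_inv: "act (- a) x \<in> Mm" if x: "x \<in> Mm" for x
  proof -
    obtain N where N: "x \<in> K" "!!n. n \<ge> N ==> pw a (int n) x \<in> U" using x unfolding Mm_def by blast
    have "pw a (int n) (act (- a) x) \<in> U" if "n \<ge> Suc N" for n
    proof -
      have "zm (int n) a + - a = zm (int (n - 1)) a" using zm_pred[of "int n" a] that by (simp add: of_nat_diff)
      then show ?thesis using N(2)[of "n - 1"] that by (simp add: act_act)
    qed
    then show ?thesis unfolding Mm_def using aK(2)[OF N(1)] by blast
  qed
  define D where "D = mn (- a) U + Mm"
  have sD: "add_subgroup D" unfolding D_def by (rule add_subgroup_plus[OF mn_subgroup[OF U(2)] sMm])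
  have "mn a U <= Mm" unfolding Mm_def using mn_sub[of a U] U(3) unfolding mn_def by blast
  then have UD: "U <= D" using t set_plus_mono2[of "mn (- a) U" "mn (- a) U" "mn a U" Mm] unfolding D_def by blast
  have DK: "D <= K" unfolding D_def by (rule set_plus_sub[OF sK]) (use mn_sub[of "- a" U] U(3) in \<open>auto simp: Mm_def\<close>)
  have Dback: "act (- a) x \<in> D" if x: "x \<in> D" for x
  proof -
    obtain p m where "p \<in> mn (- a) U" "m \<in> Mm" "x = p + m" using x unfolding D_def by (rule set_plus_elim)
    then show ?thesis unfolding D_def using mn_pw[of p "- a" U 1] Mm_inv by (auto simp: act_add intro!: set_plus_intro)
  qed
  have Dback': "pw a (- int n) x \<in> D" if "x \<in> D" for x n
  proof (induction n)
    case (Suc n)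
    have "- int (Suc n) = - int n - 1" by simp
    then have "zm (- int (Suc n)) a = - a + zm (- int n) a" using zm_pred[of "- int n" a] by (simp only: diff_conv_add_uminus add.commute)
    then show ?case using Dback[OF Suc] by (simp add: act_act)
  qed (use that in simp)
  define EE where "EE = {x \<in> K. \<exists>n::nat. pw a (- int n) x \<in> D}"
  have DE: "D <= EE" unfolding EE_def using DK by (auto intro!: exI[of _ 0])
  have up: "pw a (- int m) x \<in> D" if "pw a (- int n) x \<in> D" "n \<le> m" for x n m
  proof -
    have "pw a (- int m) x = pw a (- int (m - n)) (pw a (- int n) x)" using that(2) by (simp only: pw_pw) (simp add: of_nat_diff)
    then show ?thesis using Dback'[OF that(1)] by simp
  qed
  have sE: "add_subgroup EE" unfolding add_subgroup_def
  proof (intro conjI ballI)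
    show "0 \<in> EE" using DE add_subgroupD(1)[OF sD] by blast
    fix x assume "x \<in> EE"
    then obtain n where x: "x \<in> K" "pw a (- int n) x \<in> D" unfolding EE_def by blast
    show "- x \<in> EE" unfolding EE_def using add_subgroupD(3)[OF sK x(1)] add_subgroupD(3)[OF sD x(2)] by (auto simp: act_uminus)
    fix y assume "y \<in> EE"
    then obtain m where y: "y \<in> K" "pw a (- int m) y \<in> D" unfolding EE_def by blast
    have "pw a (- int (max n m)) (x + y) \<in> D" unfolding act_add
      by (rule add_subgroupD(2)[OF sD up[OF x(2)] up[OF y(2)]]) auto
    then show "x + y \<in> EE" unfolding EE_def using add_subgroupD(2)[OF sK x(1) y(1)] by blast
  qed
  have E1: "act a x \<in> EE" if x: "x \<in> EE" for x
  proof -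
    obtain n where n: "x \<in> K" "pw a (- int n) x \<in> D" using x unfolding EE_def by blast
    have "zm (- int (Suc n)) a + a = zm (- int n) a" using zm_succ[of "- int (Suc n)" a] by simp
    then have "pw a (- int (Suc n)) (act a x) \<in> D" using n(2) by (simp only: act_act)
    then show ?thesis unfolding EE_def using aK(1)[OF n(1)] by blast
  qed
  have E2: "act (- a) x \<in> EE" if x: "x \<in> EE" for x
  proof -
    obtain n where n: "x \<in> K" "pw a (- int n) x \<in> D" using x unfolding EE_def by blast
    have "pw a (- int n) (act (- a) x) \<in> D" using Dback[OF n(2)] by (simp only: act_commute[of "zm (- int n) a"])
    then show ?thesis unfolding EE_def using aK(2)[OF n(1)] by blast
  qed
  have WE: "W Int K <= EE" using W(3) UD DE by blast
  have EK: "EE <= K" unfolding EE_def by blast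
  have "closed EE"
  proof -
    have "x \<in> EE" if x: "x \<in> closure EE" for x
    proof -
      have xK: "x \<in> K" using x closure_minimal[OF EK compact_imp_closed[OF cK]] by blast
      obtain s w where sw: "s \<in> EE" "w \<in> W" "s = x + w" by (rule closure_translate_meet[OF x W(1,2)])
      have "w \<in> K" using add_subgroup_absorb(2)[OF sK xK, of w] sw EK by auto
      then have "w \<in> EE" using WE sw(2) by blast
      then show ?thesis using add_subgroup_absorb(1)[OF sE, of w x] sw by simp
    qed
    then show ?thesis using closure_subset_eq[of EE] by blast
  qed
  moreover have "finite (cosets K EE)" by (rule finite_cosets_compact[OF cK sK sE W(1,2) WE])
  ultimately have EEK: "EE = K" using sE EK E1 E2 by (intro pf)
  obtain F where F: "finite F" "F <= K" "K <= F + W" by (rule compact_finite_translates[OF cK W(1,2)])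
  have "\<exists>n. \<forall>x\<in>F. pw a (- int n) x \<in> D" using F(1,2)
  proof (induction F rule: finite_induct)
    case (insert x F)
    then obtain n where n: "\<forall>x\<in>F. pw a (- int n) x \<in> D" by blast
    obtain m where m: "pw a (- int m) x \<in> D" using insert.prems EEK unfolding EE_def by blast
    show ?case using up n m by (intro exI[of _ "max n m"]) (auto intro: up[of n _ "max n m"] up[of m _ "max n m"])
  qed simp
  then obtain n where n: "!!x. x \<in> F ==> pw a (- int n) x \<in> D" by blast
  have all: "pw a (- int n) x \<in> D" if x: "x \<in> K" for x
  proof -
    have "x \<in> F + W" using F(3) x by blast
    then obtain f w where fw: "f \<in> F" "w \<in> W" "x = f + w" by (rule set_plus_elim)
    have "w \<in> K" using add_subgroup_absorb(2)[OF sK, of f w] fw F(2) x by auto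
    then have "w \<in> D" using W(3) fw(2) UD by blast
    then show ?thesis unfolding fw(3) act_add using n[OF fw(1)] Dback' by (intro add_subgroupD(2)[OF sD])
  qed
  have "K <= D"
  proof
    fix x assume x: "x \<in> K"
    from all[OF Kpw[OF x, of "int n"]] show "x \<in> D" by (simp add: act_act)
  qed
  also have "D <= U + Mm" unfolding D_def by (rule set_plus_mono2[OF mn_sub order_refl])
  finally show ?thesis unfolding Mm_def .
qed

text \<open>By \<open>parafinite_half\<close> for \<open>a\<close> and for \<open>- a\<close>, an
  element of \<open>K\<close> agrees modulo \<open>V\<close> with one that ends in \<open>V\<close>
  forward and with one that ends in \<open>V\<close> backward; tidiness of \<open>V\<close> merges
  the two into a point of \<open>LL a U\<close>.\<close>

lemma parafinite_bounded:
  assumes all: "!!C. compact C ==> add_subgroup C ==> C <= G"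
  obtains Q where "compact Q" "add_subgroup Q" "!!K. pfin {a, - a} K ==> K <= Q"
proof -
  obtain U where U: "copen U" using copen_basis[of UNIV] by auto
  obtain Q where Q: "compact Q" "add_subgroup Q" "LL a U <= Q" "U <= Q" by (rule LL_bounded[OF U])
  obtain W where W: "open W" "0 \<in> W" "W Int G <= U" and U': "compact U" "add_subgroup U" "U <= G" using U unfolding copen_def by blast
  have "K <= Q" if K: "pfin {a, - a} K" for K
  proof
    fix x assume x: "x \<in> K"
    have cK: "compact K" "add_subgroup K" "!!x. x \<in> K ==> act a x \<in> K" "!!x. x \<in> K ==> act (- a) x \<in> K"
      using K unfolding pfin_def by auto
    have KG: "K <= G" by (rule all[OF cK(1,2)])
    have Kpw: "pw a k x \<in> K" if "x \<in> K" for k x by (rule pw_invariant[OF cK(3,4) that])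
    have UK: "compact (U Int K)" "add_subgroup (U Int K)" "U Int K <= K"
      using compact_Int_closed[OF U'(1) compact_imp_closed[OF cK(1)]] add_subgroup_Int[OF U'(2) cK(2)] by auto
    have WK: "W Int K <= U Int K" using W(3) KG by blast
    obtain V W' where V: "compact V" "add_subgroup V" "V <= U Int K" "open W'" "0 \<in> W'" "W' Int K <= V"
      "V <= mn (- a) V + mn a V" by (rule tidy[OF cK(2) Kpw UK W(1,2) WK])
    define Mm where "Mm b = {x \<in> K. \<exists>N::nat. \<forall>n\<ge>N. pw b (int n) x \<in> V}" for b
    have VK: "V <= K" using V(3) by blast
    have 1: "K <= V + Mm a" unfolding Mm_def by (rule parafinite_half[OF K V(1,2) VK V(4-7)])
    have K': "pfin {- a, - (- a)} K" using K by (simp add: insert_commute)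
    have "V <= mn (- (- a)) V + mn (- a) V" using V(7) by (simp add: add.commute)
    from parafinite_half[OF K' V(1,2) VK V(4-6) this] have 2: "K <= V + Mm (- a)" unfolding Mm_def .
    obtain u m where um: "u \<in> V" "m \<in> Mm a" "x = u + m" using subsetD[OF 1 x] by (rule set_plus_elim)
    have mK: "m \<in> K" using um(2) unfolding Mm_def by blast
    obtain v y where vy: "v \<in> V" "y \<in> Mm (- a)" "m = v + y" using subsetD[OF 2 mK] by (rule set_plus_elim)
    obtain p q where pq: "p \<in> mn (- a) V" "q \<in> mn a V" "v = p + q" using subsetD[OF V(7) vy(1)] by (rule set_plus_elim)
    have qV: "q \<in> V" using pq(2) mn_sub by blast
    \<comment> \<open>\<open>p\<close> stays in \<open>V\<close> backward and \<open>q\<close>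
      forward, so \<open>p + y = m - q\<close> ends in \<open>V\<close> both ways. \<open>V\<close>
      depends on \<open>K\<close>, but it lies in \<open>U\<close>, for which \<open>Q\<close> was
      chosen beforehand.\<close>
    define z where "z = p + y"
    have z: "z = m - q" unfolding z_def using vy(3) pq(3) by simp
    have "z \<in> K" unfolding z using add_subgroupD(4)[OF cK(2) mK] qV VK by blast
    obtain N1 where N1: "!!n. n \<ge> N1 ==> pw a (int n) m \<in> V" using um(2) unfolding Mm_def by blast
    obtain N2 where N2: "!!n. n \<ge> N2 ==> pw (- a) (int n) y \<in> V" using vy(2) unfolding Mm_def by blast
    have "pw a (int n) z \<in> U & pw a (- int n) z \<in> U" if "n \<ge> max N1 N2" for n
    proof
      have "pw a (int n) q \<in> V" using pq(2) unfolding mn_def by blast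
      then have "pw a (int n) z \<in> V" unfolding z act_diff using N1[of n] that add_subgroupD(4)[OF V(2)] by auto
      then show "pw a (int n) z \<in> U" using V(3) by blast
      have "pw (- a) (int n) p \<in> V" using pq(1) unfolding mn_def by blast
      then have "pw (- a) (int n) z \<in> V" unfolding z_def act_add using N2[of n] that add_subgroupD(2)[OF V(2)] by auto
      then show "pw a (- int n) z \<in> U" using V(3) by auto
    qed
    then have "z \<in> LL a U" unfolding LL_def using \<open>z \<in> K\<close> KG by blast
    then have "z \<in> Q" using Q(3) by blast
    moreover have "u \<in> Q" "q \<in> Q" using um(1) qV V(3) Q(4) by blast+
    moreover have "x = u + (q + z)" using um(3) z by simp
    ultimately show "x \<in> Q" using add_subgroupD(2)[OF Q(2)] by blast
  qed
  then show ?thesis using that[OF Q(1,2)] by blast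
qed

end

section \<open>Contraction groups and bounded orbits of one element\<close>

locale td_free_module = td_module +
  assumes apf: "!!a K. pfin {a, - a} K ==> K = {0}"
begin

definition con :: "'a => 'b set" where
  "con a = {x \<in> G. (%n. pw a (int n) x) \<longlonglongrightarrow> 0}"

definition Mb :: "'a => 'b set" where
  "Mb a = {x \<in> G. \<exists>C. compact C & add_subgroup C & (\<forall>k. pw a k x \<in> C)}"

lemma act_tendsto: assumes "(f \<longlongrightarrow> x) F" shows "((%n. act b (f n)) \<longlongrightarrow> act b x) F"
proof -
  have "isCont (act b) x" using act_continuous[of UNIV b] by (simp add: continuous_on_eq_continuous_at)
  then show ?thesis using assms by (rule isCont_tendsto_compose)
qed

lemma con_subgroup: "add_subgroup (con a)"
  unfolding add_subgroup_def
proof (intro conjI ballI)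
  show "0 \<in> con a" unfolding con_def using add_subgroupD(1)[OF sG] by simp
  fix x assume x: "x \<in> con a"
  then have x': "x \<in> G" "(%n. pw a (int n) x) \<longlonglongrightarrow> 0" unfolding con_def by auto
  have "(%n. - pw a (int n) x) \<longlonglongrightarrow> - 0" by (intro tendsto_intros x'(2))
  then show "- x \<in> con a" unfolding con_def using add_subgroupD(3)[OF sG x'(1)] by (simp add: act_uminus)
  fix y assume "y \<in> con a"
  then have y': "y \<in> G" "(%n. pw a (int n) y) \<longlonglongrightarrow> 0" unfolding con_def by auto
  have "(%n. pw a (int n) x + pw a (int n) y) \<longlonglongrightarrow> 0 + 0" by (intro tendsto_intros x'(2) y'(2))
  then show "x + y \<in> con a" unfolding con_def using add_subgroupD(2)[OF sG x'(1) y'(1)] by (simp add: act_add)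
qed

lemma con_act: assumes "x \<in> con a" shows "act b x \<in> con a"
proof -
  have x': "x \<in> G" "(%n. pw a (int n) x) \<longlonglongrightarrow> 0" using assms unfolding con_def by auto
  have "(%n. act b (pw a (int n) x)) \<longlonglongrightarrow> act b 0" by (rule act_tendsto[OF x'(2)])
  then show ?thesis unfolding con_def using G_act[OF x'(1)] by (simp add: act_commute[of _ b])
qed

lemma con_eventually: "x \<in> con a ==> open U ==> 0 \<in> U ==> \<exists>N::nat. \<forall>n\<ge>N. pw a (int n) x \<in> U"
  unfolding con_def using topological_tendstoD[of "%n. pw a (int n) x" 0 sequentially U] by (auto simp: eventually_sequentially)

lemma Mb_subgroup: "add_subgroup (Mb a)"
  unfolding add_subgroup_def
proof (intro conjI ballI)
  show "0 \<in> Mb a" unfolding Mb_def using add_subgroupD(1)[OF sG] by (auto intro!: exI[of _ "{0}"])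
  fix x assume "x \<in> Mb a"
  then obtain C where C: "x \<in> G" "compact C" "add_subgroup C" "!!k. pw a k x \<in> C" unfolding Mb_def by blast
  show "- x \<in> Mb a" unfolding Mb_def using C add_subgroupD(3)[OF C(3)] add_subgroupD(3)[OF sG C(1)]
    by (intro CollectI conjI exI[of _ C]) (simp_all add: act_uminus)
  fix y assume "y \<in> Mb a"
  then obtain D where D: "y \<in> G" "compact D" "add_subgroup D" "!!k. pw a k y \<in> D" unfolding Mb_def by blast
  have "pw a k (x + y) \<in> C + D" for k unfolding act_add by (rule set_plus_intro[OF C(4) D(4)])
  then show "x + y \<in> Mb a" unfolding Mb_def
    using add_subgroupD(2)[OF sG C(1) D(1)] compact_plus[OF C(2) D(2)] add_subgroup_plus[OF C(3) D(3)] by blast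
qed

lemma Mb_act: assumes "x \<in> Mb a" shows "act b x \<in> Mb a"
proof -
  obtain C where C: "x \<in> G" "compact C" "add_subgroup C" "!!k. pw a k x \<in> C" using assms unfolding Mb_def by blast
  have "pw a k (act b x) \<in> act b ` C" for k using C(4)[of k] by (simp add: act_commute[of _ b])
  then show ?thesis unfolding Mb_def using G_act[OF C(1)] act_image_compact[OF C(2)] act_image_subgroup[OF C(3)] by blast
qed

lemma Mb_uminus: "Mb (- a) = Mb a"
proof -
  have "(\<forall>k. pw (- a) k x \<in> C) \<longleftrightarrow> (\<forall>k. pw a k x \<in> C)" for x C by (metis pw_uminus minus_minus)
  then show ?thesis unfolding Mb_def by simp
qed

lemma con_G: "con a <= G" and Mb_G: "Mb a <= G" unfolding con_def Mb_def by auto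

text \<open>The closed subgroup generated by the orbit of \<open>x\<close> is compact. A closed
  invariant subgroup of finite index contains a neighbourhood of 0 in it, so it catches the orbit at
  a late time and then, by invariance, entirely: the group is parafinite, hence zero.\<close>

lemma con_Int_Mb: "con a Int Mb a <= {0}"
proof
  fix x assume "x \<in> con a Int Mb a"
  then have x: "x \<in> con a" "x \<in> Mb a" by auto
  obtain C where C: "x \<in> G" "compact C" "add_subgroup C" "!!k. pw a k x \<in> C" using x(2) unfolding Mb_def by blast
  define R where "R = generated_subgroup (range (%k. pw a k x))"
  define K where "K = closure R"
  have sR: "add_subgroup R" unfolding R_def by (rule add_subgroup_generated)
  have RC: "R <= C" unfolding R_def by (rule generated_least[OF C(3)]) (use C(4) in blast)
  have KC: "K <= C" unfolding K_def by (rule closure_minimal[OF RC compact_imp_closed[OF C(2)]])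
  have cK: "compact K" by (rule compact_subset[OF C(2) _ KC]) (simp add: K_def)
  have oR: "pw a k x \<in> R" for k unfolding R_def by (rule subsetD[OF generated_subset]) simp
  have Rinv: "pw a l y \<in> R" if y: "y \<in> R" for y l
  proof -
    have "R <= {y. pw a l y \<in> R}" unfolding R_def
      by (rule generated_least[OF pw_subgroup[OF add_subgroup_generated]]) (use oR in \<open>auto simp: pw_pw R_def[symmetric]\<close>)
    then show ?thesis using y by blast
  qed
  have Kinv: "pw a l y \<in> K" if "y \<in> K" for y l using act_closure[OF Rinv] that unfolding K_def by blast
  have sK: "add_subgroup K" unfolding K_def by (rule add_subgroup_closure[OF sR])
  have "pfin {a, - a} K" unfolding pfin_def
  proof (intro conjI allI impI cK sK)
    show "\<forall>b\<in>{a, - a}. \<forall>x\<in>K. act b x \<in> K" using Kinv[of _ 1] Kinv[of _ "-1"] by auto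
    fix L assume L: "add_subgroup L & closed L & L <= K & (\<forall>b\<in>{a, - a}. \<forall>x\<in>L. act b x \<in> L) & finite (cosets K L)"
    then have L': "add_subgroup L" "closed L" "L <= K" "finite (cosets K L)" "!!y. y \<in> L ==> act a y \<in> L" "!!y. y \<in> L ==> act (- a) y \<in> L" by auto
    obtain W where W: "open W" "0 \<in> W" "W Int K <= L" by (rule finite_cosets_open[OF L'(1,2,4)])
    obtain n where n: "pw a (int n) x \<in> W" using con_eventually[OF x(1) W(1,2)] by blast
    have "pw a (int n) x \<in> K" unfolding K_def by (rule subsetD[OF closure_subset oR])
    then have nL: "pw a (int n) x \<in> L" using n W(3) by blast
    have "pw a k x \<in> L" for k
      using pw_invariant[OF L'(5,6) nL, of "k - int n"] unfolding pw_pw by simp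
    then have "R <= L" unfolding R_def by (intro generated_least[OF L'(1)]) blast
    then have "K <= L" unfolding K_def by (rule closure_minimal[OF _ L'(2)])
    then show "L = K" using L'(3) by blast
  qed
  then have "K = {0}" by (rule apf)
  moreover have "pw a 0 x \<in> K" unfolding K_def by (rule subsetD[OF closure_subset oR])
  ultimately show "x \<in> {0}" by simp
qed

text \<open>A minimal closed forward-invariant complement of the two-sided core in the forward core is contracted:
  the intersection of its iterates is parafinite.\<close>

lemma contracted_complement:
  assumes U: "copen U"
  obtains Y where "compact Y" "add_subgroup Y" "Y <= mn a U" "!!x. x \<in> Y ==> act a x \<in> Y" "mn a U <= Y + zr a U"
    "!!x. (!!n::nat. pw a (- int n) x \<in> Y) ==> x = 0"
proof -
  have U': "compact U" "add_subgroup U" "U <= G" using U unfolding copen_def by auto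
  let ?Om = "mn a U" and ?O0 = "zr a U"
  define YY where "YY = {Y. compact Y & add_subgroup Y & Y <= ?Om & (\<forall>x\<in>Y. act a x \<in> Y) & ?Om <= Y + ?O0}"
  have O0: "compact ?O0" "add_subgroup ?O0" using zr_compact[OF U'(1)] zr_subgroup[OF U'(2)] by auto
  have OmY: "?Om \<in> YY" unfolding YY_def
    using mn_compact[OF U'(1)] mn_subgroup[OF U'(2)] mn_pw[of _ a U 1] set_plus_left[OF add_subgroupD(1)[OF O0(2)], of ?Om] by simp
  \<comment> \<open>Zorn's lemma for maximal sets is applied to complements, so that it delivers a
    minimal \<open>Y\<close>.\<close>
  have "\<exists>M\<in>uminus ` YY. \<forall>X\<in>uminus ` YY. M <= X --> X = M"
  proof (rule subset_Zorn_nonempty)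
    show "uminus ` YY ~= {}" using OmY by blast
    fix CC assume CC: "CC ~= {}" "subset.chain (uminus ` YY) CC"
    define DD where "DD = uminus ` CC"
    have DY: "D \<in> YY" if "D \<in> DD" for D using that CC(2) unfolding DD_def subset_chain_def by (auto)
    have ne: "DD ~= {}" unfolding DD_def using CC(1) by blast
    have dir: "\<exists>D\<in>DD. D <= A Int B" if AB0: "A \<in> DD" "B \<in> DD" for A B
    proof -
      obtain A' B' where AB: "A' \<in> CC" "A = - A'" "B' \<in> CC" "B = - B'" using AB0 unfolding DD_def by blast
      then have "A' <= B' \<or> B' <= A'" using CC(2) unfolding subset_chain_def by blast
      then have "A <= B \<or> B <= A" using AB by blast
      then show ?thesis using AB0 by blast
    qed
    have cpt: "compact D" if "D \<in> DD" for D using DY[OF that] unfolding YY_def by blast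
    obtain D0 where D0: "D0 \<in> DD" using ne by blast
    have "\<Inter>DD \<in> YY" unfolding YY_def
    proof (intro CollectI conjI)
      have "closed (\<Inter>DD)" using cpt compact_imp_closed by (intro closed_Inter ballI) blast
      moreover have "\<Inter>DD <= D0" using D0 by blast
      ultimately show "compact (\<Inter>DD)" by (rule compact_subset[OF cpt[OF D0]])
      show "add_subgroup (\<Inter>DD)" by (rule add_subgroup_Inter) (use DY in \<open>auto simp: YY_def\<close>)
      show "\<Inter>DD <= ?Om" using D0 DY unfolding YY_def by blast
      show "\<forall>x\<in>\<Inter>DD. act a x \<in> \<Inter>DD" using DY unfolding YY_def by blast
      show "?Om <= \<Inter>DD + ?O0"
      proof
        fix x assume x: "x \<in> ?Om"
        have "x \<in> ?O0 + \<Inter>DD"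
        proof (rule directed_compact_plus[OF O0(1) ne cpt dir])
          fix D assume "D \<in> DD"
          then have "?Om <= D + ?O0" using DY unfolding YY_def by blast
          then show "x \<in> ?O0 + D" using x by (auto simp: add.commute[of D])
        qed
        then show "x \<in> \<Inter>DD + ?O0" by (simp add: add.commute)
      qed
    qed
    moreover have "\<Union>CC = - \<Inter>DD" unfolding DD_def by auto
    ultimately show "\<Union>CC \<in> uminus ` YY" by blast
  qed
  then obtain Y where Y: "Y \<in> YY" and min: "!!X. X \<in> YY ==> X <= Y ==> X = Y" by auto
  have Y': "compact Y" "add_subgroup Y" "Y <= ?Om" "!!x. x \<in> Y ==> act a x \<in> Y" "?Om <= Y + ?O0" using Y unfolding YY_def by auto
  have Yfw: "pw a (int n) x \<in> Y" if "x \<in> Y" for x n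
  proof (induction n)
    case (Suc n)
    have "zm (int (Suc n)) a = a + zm (int n) a" using zm_succ[of "int n" a] by (simp add: add.commute)
    then show ?case using Y'(4)[OF Suc] by (simp add: act_act)
  qed (use that in simp)
  have YG: "Y <= G" using Y'(3) mn_sub[of a U] U'(3) by blast
  define Yn where "Yn n = {x. pw a (- int n) x \<in> Y}" for n
  define Q where "Q = (\<Inter>n. Yn n)"
  have Yn_compact: "compact (Yn n)" for n unfolding Yn_def by (rule pw_compact[OF Y'(1)])
  have Yn_sub: "add_subgroup (Yn n)" for n unfolding Yn_def by (rule pw_subgroup[OF Y'(2)])
  have Yn_dec: "Yn (Suc n) <= Yn n" for n
  proof
    fix x assume "x \<in> Yn (Suc n)"
    then have "act a (pw a (- int (Suc n)) x) \<in> Y" using Y'(4) unfolding Yn_def by blast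
    moreover have "a + zm (- int (Suc n)) a = zm (- int n) a" using zm_succ[of "- int (Suc n)" a] by (simp add: add.commute)
    ultimately show "x \<in> Yn n" unfolding Yn_def by (simp only: act_act mem_Collect_eq)
  qed
  have Yn_act: "act a x \<in> Yn n" if "x \<in> Yn n" for x n
    using Y'(4)[of "pw a (- int n) x"] that unfolding Yn_def by (simp only: act_commute[of "zm (- int n) a"] mem_Collect_eq)
  have Yn0: "Yn 0 = Y" unfolding Yn_def by simp
  have QY: "Q <= Y" unfolding Q_def using Yn0 by blast
  have Yn_Y: "Yn n <= Y" for n by (induction n) (use Yn0 Yn_dec in auto)
  have sQ: "add_subgroup Q" unfolding Q_def using Yn_sub by (intro add_subgroup_Inter) blast
  have "closed Q" unfolding Q_def using Yn_compact compact_imp_closed by (intro closed_INT ballI) blast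
  then have cQ: "compact Q" by (rule compact_subset[OF Y'(1) _ QY])
  have Q1: "act a x \<in> Q" if "x \<in> Q" for x using Yn_act that unfolding Q_def by blast
  have Q2: "act (- a) x \<in> Q" if x: "x \<in> Q" for x
  proof -
    have "act (- a) x \<in> Yn n" for n
    proof -
      have "x \<in> Yn (Suc n)" using x unfolding Q_def by blast
      moreover have "zm (- int n) a + - a = zm (- int (Suc n)) a" using zm_succ[of "- int (Suc n)" a] by simp
      ultimately show ?thesis unfolding Yn_def by (simp only: act_act mem_Collect_eq)
    qed
    then show ?thesis unfolding Q_def by blast
  qed
  have Qpw: "pw a k x \<in> Q" if "x \<in> Q" for k x by (rule pw_invariant[OF Q1 Q2 that])
  have QO0: "Q <= ?O0" unfolding zr_def using Qpw QY Y'(3) mn_sub[of a U] by blast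
  have "pfin {a, - a} Q" unfolding pfin_def
  proof (intro conjI allI impI cQ sQ)
    show "\<forall>b\<in>{a, - a}. \<forall>x\<in>Q. act b x \<in> Q" using Q1 Q2 by auto
    fix Q' assume "add_subgroup Q' & closed Q' & Q' <= Q & (\<forall>b\<in>{a, - a}. \<forall>x\<in>Q'. act b x \<in> Q') & finite (cosets Q Q')"
    then have Q': "add_subgroup Q'" "closed Q'" "Q' <= Q" "finite (cosets Q Q')" "!!x. x \<in> Q' ==> act a x \<in> Q'" by auto
    obtain W1 where W1: "open W1" "0 \<in> W1" "W1 Int Q <= Q'" by (rule finite_cosets_open[OF Q'(1,2,4)])
    obtain B1 where B1: "copen B1" "B1 <= W1" by (rule copen_basis[OF W1(1,2)])
    then obtain WB where WB: "open WB" "0 \<in> WB" "WB Int G <= B1" and B1': "add_subgroup B1" unfolding copen_def by blast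
    have oU2: "open (WB Int {x. act a x \<in> WB})" using WB(1) open_vimage_UNIV[OF act_continuous WB(1), of a] by blast
    moreover have "0 \<in> WB Int {x. act a x \<in> WB}" using WB(2) by simp
    ultimately obtain B2 where B2: "copen B2" "B2 <= WB Int {x. act a x \<in> WB}" by (rule copen_basis)
    obtain W2 where W2: "open W2" "0 \<in> W2" "W2 Int G <= B2" and B2': "add_subgroup B2" "compact B2" "B2 <= G" using B2(1) unfolding copen_def by blast
    have B21: "x \<in> B1" "act a x \<in> B1" if "x \<in> B2" for x
      using that B2(2) B2'(3) WB(3) G_act by blast+
    have "Q <= Q + W2" by (rule set_plus_left[OF W2(2)])
    then have "\<exists>n. Yn n <= Q + W2"
      using decseq_compact[of Yn "Q + W2"] Yn_compact Yn_dec open_plus[OF W2(1)] unfolding Q_def by simp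
    then obtain n where n: "Yn n <= Q + W2" by blast
    have QYn: "Q <= Yn n" unfolding Q_def by blast
    have dec: "\<exists>q w. q \<in> Q & w \<in> B2 & w \<in> Yn n & x = q + w" if x: "x \<in> Yn n" for x
    proof -
      have "x \<in> Q + W2" using n x by blast
      then obtain q w where qw: "q \<in> Q" "w \<in> W2" "x = q + w" by (rule set_plus_elim)
      have "w = x - q" using qw(3) by simp
      then have wYn: "w \<in> Yn n" using add_subgroupD(4)[OF Yn_sub x] QYn qw(1) by blast
      then have "w \<in> G" using Yn_Y YG by blast
      then have "w \<in> B2" using W2(3) qw(2) by blast
      then show ?thesis using qw wYn by blast
    qed
    \<comment> \<open>The forward image \<open>Yn n\<close> is cut down by replacing
      \<open>Q\<close> with its finite-index part \<open>Q'\<close>, up to the small group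
      \<open>B2\<close>. Pulled back by \<open>n\<close> steps, the result competes with the minimal
      \<open>Y\<close>, which forces \<open>Q <= Q'\<close>.\<close>
    define Z where "Z = Yn n Int (B2 + Q')"
    have cQ': "compact Q'" by (rule compact_subset[OF cQ Q'(2,3)])
    have cZ: "compact Z" unfolding Z_def by (rule compact_Int_closed[OF Yn_compact compact_imp_closed[OF compact_plus[OF B2'(2) cQ']]])
    have sZ: "add_subgroup Z" unfolding Z_def by (rule add_subgroup_Int[OF Yn_sub add_subgroup_plus[OF B2'(1) Q'(1)]])
    have aZ: "act a z \<in> Z" if z: "z \<in> Z" for z
    proof -
      have az: "act a z \<in> Yn n" using Yn_act z unfolding Z_def by blast
      obtain q w where qw: "q \<in> Q" "w \<in> B2" "act a z = q + w" using dec[OF az] by blast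
      have "z \<in> B2 + Q'" using z unfolding Z_def by blast
      then obtain b q' where bq: "b \<in> B2" "q' \<in> Q'" "z = b + q'" by (rule set_plus_elim)
      have "q - act a q' = act a b - w"
      proof -
        have "q + w = act a b + act a q'" using qw(3) bq(3) by (simp add: act_add)
        then show ?thesis by (metis add.commute add_diff_cancel_right' diff_add_eq diff_diff_eq2)
      qed
      then have "q - act a q' \<in> B1" using add_subgroupD(4)[OF B1' B21(2)[OF bq(1)] B21(1)[OF qw(2)]] by simp
      moreover have "q - act a q' \<in> Q" using add_subgroupD(4)[OF sQ qw(1)] Q'(3,5) bq(2) by blast
      ultimately have "q - act a q' \<in> Q'" using W1(3) B1(2) by blast
      then have "q \<in> Q'" using add_subgroup_absorb(3)[OF Q'(1) Q'(5)[OF bq(2)]] by blast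
      then have "w + q \<in> B2 + Q'" using qw(2) by (intro set_plus_intro)
      then show ?thesis using az qw(3) unfolding Z_def by (simp add: add.commute)
    qed
    define Y2 where "Y2 = {x. pw a (int n) x \<in> Z}"
    have "Y2 \<in> YY" unfolding YY_def
    proof (intro CollectI conjI)
      show "compact Y2" unfolding Y2_def by (rule pw_compact[OF cZ])
      show "add_subgroup Y2" unfolding Y2_def by (rule pw_subgroup[OF sZ])
      show "Y2 <= ?Om"
      proof
        fix x assume "x \<in> Y2"
        then have "pw a (- int n) (pw a (int n) x) \<in> Y" unfolding Y2_def Z_def Yn_def by blast
        then have "x \<in> Y" unfolding pw_pw by simp
        then show "x \<in> ?Om" using Y'(3) by blast
      qed
      show "\<forall>x\<in>Y2. act a x \<in> Y2" unfolding Y2_def using aZ by (auto simp: act_commute[of _ a])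
      show "?Om <= Y2 + ?O0"
      proof
        fix x assume "x \<in> ?Om"
        then have "x \<in> Y + ?O0" using Y'(5) by blast
        then obtain y o' where yo: "y \<in> Y" "o' \<in> ?O0" "x = y + o'" by (rule set_plus_elim)
        have "pw a (int n) y \<in> Yn n" unfolding Yn_def using yo(1) by (simp only: mem_Collect_eq pw_pw) simp
        then obtain q w where qw: "q \<in> Q" "w \<in> B2" "w \<in> Yn n" "pw a (int n) y = q + w" using dec by blast
        have "w + 0 \<in> B2 + Q'" by (rule set_plus_intro[OF qw(2) add_subgroupD(1)[OF Q'(1)]])
        then have "w \<in> Z" unfolding Z_def using qw(3) by simp
        then have 1: "pw a (- int n) w \<in> Y2" unfolding Y2_def by (simp only: mem_Collect_eq pw_pw) simp
        have "y = pw a (- int n) (pw a (int n) y)" unfolding pw_pw by simp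
        then have "y = pw a (- int n) q + pw a (- int n) w" unfolding qw(4) act_add .
        then have "x = pw a (- int n) w + (pw a (- int n) q + o')" using yo(3) by (simp add: add_ac)
        moreover have "pw a (- int n) q + o' \<in> ?O0" using Qpw[OF qw(1)] QO0 yo(2) by (intro add_subgroupD(2)[OF O0(2)]) blast+
        ultimately show "x \<in> Y2 + ?O0" using set_plus_intro[OF 1] by (simp only:)
      qed
    qed
    moreover have "Y2 <= Y"
    proof
      fix x assume "x \<in> Y2"
      then have "pw a (- int n) (pw a (int n) x) \<in> Y" unfolding Y2_def Z_def Yn_def by blast
      then show "x \<in> Y" unfolding pw_pw by simp
    qed
    ultimately have Y2Y: "Y2 = Y" by (rule min)
    have "Q <= Q'"
    proof
      fix q assume q: "q \<in> Q"
      have "pw a (- int n) q \<in> Y2" using Qpw[OF q] QY Y2Y by blast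
      then have "pw a (int n) (pw a (- int n) q) \<in> Z" unfolding Y2_def by blast
      then have "q \<in> Z" unfolding pw_pw by simp
      then have "q \<in> B2 + Q'" unfolding Z_def by blast
      then obtain b q' where bq: "b \<in> B2" "q' \<in> Q'" "q = b + q'" by (rule set_plus_elim)
      have b: "b = q - q'" using bq(3) by simp
      have "b \<in> Q" unfolding b using add_subgroupD(4)[OF sQ q] Q'(3) bq(2) by blast
      moreover have "b \<in> W1" using B21(1)[OF bq(1)] B1(2) by blast
      ultimately have "b \<in> Q'" using W1(3) by blast
      then show "q \<in> Q'" using add_subgroupD(2)[OF Q'(1) _ bq(2)] bq(3) by blast
    qed
    then show "Q' = Q" using Q'(3) by blast
  qed
  then have Q0: "Q = {0}" by (rule apf)
  have "x = 0" if "!!n::nat. pw a (- int n) x \<in> Y" for x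
  proof -
    have "x \<in> Q" unfolding Q_def Yn_def using that by blast
    then show ?thesis using Q0 by blast
  qed
  then show ?thesis using that[OF Y'] by blast
qed

lemma contracted_decseq:
  assumes Y: "compact Y" "!!x. x \<in> Y ==> act a x \<in> Y" "!!x. (!!n::nat. pw a (- int n) x \<in> Y) ==> x = 0"
    and U: "open U" "0 \<in> U"
  obtains N :: nat where "!!n x. n \<ge> N ==> x \<in> Y ==> pw a (int n) x \<in> U"
proof -
  define Yn where "Yn n = {x. pw a (- int n) x \<in> Y}" for n
  have dec: "Yn (Suc n) <= Yn n" for n
  proof
    fix x assume "x \<in> Yn (Suc n)"
    then have "act a (pw a (- int (Suc n)) x) \<in> Y" using Y(2) unfolding Yn_def by blast
    moreover have "a + zm (- int (Suc n)) a = zm (- int n) a" using zm_succ[of "- int (Suc n)" a] by (simp add: add.commute)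
    ultimately show "x \<in> Yn n" unfolding Yn_def by (simp only: act_act mem_Collect_eq)
  qed
  have "(\<Inter>n. Yn n) <= U" using Y(3) U(2) unfolding Yn_def by blast
  then obtain N where N: "Yn N <= U" using decseq_compact[of Yn U] pw_compact[OF Y(1)] dec U(1) unfolding Yn_def by blast
  have "pw a (int n) x \<in> U" if n: "n \<ge> N" and x: "x \<in> Y" for n x
  proof -
    have "pw a (int n) x \<in> Yn n" unfolding Yn_def using x by (simp only: mem_Collect_eq pw_pw) simp
    moreover have "Yn n <= Yn N" using dec n by (rule lift_Suc_antimono_le)
    ultimately show ?thesis using N by blast
  qed
  then show ?thesis by (rule that)
qed

text \<open>A tidy group is the sum of its two one-sided cores, and the contracted complements for
  \<open>a\<close> and \<open>- a\<close> refine each of them, leaving the two-sided core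
  \<open>Z\<close>. The further conclusions record what is needed for uniqueness, for contraction
  uniform on compact sets and for openness of cores.\<close>

lemma local_split:
  assumes U: "open U" "0 \<in> U"
  obtains W Ym Yp Z where "open W" "0 \<in> W" "W Int G <= Ym + (Yp + Z)" "Ym <= con a" "Yp <= con (- a)" "Z <= Mb a"
    "Ym <= U" "Yp <= U" "Z <= U" "compact Ym" "add_subgroup Ym" "!!x. x \<in> Ym ==> act a x \<in> Ym"
    "!!x. (!!n::nat. pw a (- int n) x \<in> Ym) ==> x = 0"
    "!!x. (!!n::nat. pw a (int n) x \<in> W Int G) ==> x \<in> Ym + Z" "!!k x. x \<in> Z ==> pw a k x \<in> U"
proof -
  obtain O1 where O1: "copen O1" "O1 <= U" by (rule copen_basis[OF U])
  obtain O2 where O2: "copen O2" "O2 <= O1" "O2 <= mn (- a) O2 + mn a O2" by (rule copen_tidy[OF O1(1)])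
  have O2': "compact O2" "add_subgroup O2" "O2 <= G" using O2(1) unfolding copen_def by auto
  obtain W where W: "open W" "0 \<in> W" "W Int G <= O2" using O2(1) unfolding copen_def by blast
  obtain Ym where Ym: "compact Ym" "add_subgroup Ym" "Ym <= mn a O2" "!!x. x \<in> Ym ==> act a x \<in> Ym" "mn a O2 <= Ym + zr a O2"
    "!!x. (!!n::nat. pw a (- int n) x \<in> Ym) ==> x = 0" using contracted_complement[OF O2(1), of a] by blast
  obtain Yp where Yp: "compact Yp" "add_subgroup Yp" "Yp <= mn (- a) O2" "!!x. x \<in> Yp ==> act (- a) x \<in> Yp" "mn (- a) O2 <= Yp + zr (- a) O2"
    "!!x. (!!n::nat. pw (- a) (- int n) x \<in> Yp) ==> x = 0" using contracted_complement[OF O2(1), of "- a"] by blast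
  have conI: "Y <= con b" if Y: "compact Y" "Y <= mn b O2" "!!x. x \<in> Y ==> act b x \<in> Y" "!!x. (!!n::nat. pw b (- int n) x \<in> Y) ==> x = 0" for Y b
  proof
    fix x assume x: "x \<in> Y"
    have "(%n. pw b (int n) x) \<longlonglongrightarrow> 0"
    proof (rule topological_tendstoI)
      fix V :: "'b set" assume V: "open V" "0 \<in> V"
      obtain N :: nat where "!!n x. n \<ge> N ==> x \<in> Y ==> pw b (int n) x \<in> V"
        using contracted_decseq[OF Y(1,3,4) V] by blast
      then show "\<forall>\<^sub>F n in sequentially. pw b (int n) x \<in> V" unfolding eventually_sequentially using x by blast
    qed
    moreover have "x \<in> G" using x Y(2) mn_sub[of b O2] O2'(3) by blast
    ultimately show "x \<in> con b" unfolding con_def by blast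
  qed
  have ZMb: "zr a O2 <= Mb a"
  proof
    fix x assume x: "x \<in> zr a O2"
    then have "\<forall>k. pw a k x \<in> O2" unfolding zr_def by blast
    moreover have "x \<in> G" using x zr_sub[of a O2] O2'(3) by blast
    ultimately show "x \<in> Mb a" unfolding Mb_def using O2'(1,2) by blast
  qed
  have O2U: "O2 <= U" using O1(2) O2(2) by blast
  have sZ: "add_subgroup (zr a O2)" by (rule zr_subgroup[OF O2'(2)])
  show ?thesis
  proof (rule that[of W Ym Yp "zr a O2"])
    show "W Int G <= Ym + (Yp + zr a O2)"
    proof
      fix x assume "x \<in> W Int G"
      then have "x \<in> mn (- a) O2 + mn a O2" using W(3) O2(3) by blast
      then obtain p m where pm: "p \<in> mn (- a) O2" "m \<in> mn a O2" "x = p + m" by (rule set_plus_elim)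
      obtain y z where yz: "y \<in> Ym" "z \<in> zr a O2" "m = y + z" using subsetD[OF Ym(5) pm(2)] by (rule set_plus_elim)
      obtain y' z' where yz': "y' \<in> Yp" "z' \<in> zr (- a) O2" "p = y' + z'" using subsetD[OF Yp(5) pm(1)] by (rule set_plus_elim)
      have "z' + z \<in> zr a O2" using yz(2) yz'(2) unfolding zr_uminus by (intro add_subgroupD(2)[OF sZ])
      then have "y + (y' + (z' + z)) \<in> Ym + (Yp + zr a O2)" using yz(1) yz'(1) by (intro set_plus_intro)
      moreover have "x = y + (y' + (z' + z))" using pm(3) yz(3) yz'(3) by (simp add: add_ac)
      ultimately show "x \<in> Ym + (Yp + zr a O2)" by simp
    qed
    show "Ym <= con a" by (rule conI[OF Ym(1,3,4,6)])
    show "Yp <= con (- a)" by (rule conI[OF Yp(1,3,4,6)])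
    show "Ym <= U" using Ym(3) mn_sub[of a O2] O2U by blast
    show "Yp <= U" using Yp(3) mn_sub[of "- a" O2] O2U by blast
    show "zr a O2 <= U" using zr_sub[of a O2] O2U by blast
    show "x \<in> Ym + zr a O2" if "!!n::nat. pw a (int n) x \<in> W Int G" for x
    proof -
      have "x \<in> mn a O2" unfolding mn_def using that W(3) by blast
      then show ?thesis using Ym(5) by blast
    qed
    show "pw a k x \<in> U" if "x \<in> zr a O2" for k x using that O2U unfolding zr_def by blast
  qed (use W Ym ZMb in auto)
qed

lemma con_forward_bounded:
  assumes "x \<in> con a" obtains C where "compact C" "add_subgroup C" "!!n::nat. pw a (int n) x \<in> C"
proof -
  obtain U where U: "copen U" using copen_basis[of UNIV] by auto
  obtain W where W: "open W" "0 \<in> W" "W Int G <= U" and U': "compact U" "add_subgroup U" using U unfolding copen_def by blast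
  obtain N :: nat where N: "!!n. n \<ge> N ==> pw a (int n) x \<in> W" using con_eventually[OF assms W(1,2)] by blast
  have xG: "pw a k x \<in> G" for k using assms con_G G_act by blast
  obtain Q where Q: "compact Q" "add_subgroup Q" "(%n. pw a (int n) x) ` {..<N} <= Q"
  proof (rule finite_elliptic[of "(%n. pw a (int n) x) ` {..<N}"])
    show "\<exists>C. compact C & add_subgroup C & y \<in> C" if "y \<in> (%n. pw a (int n) x) ` {..<N}" for y
      using that xG by (intro G_ell) auto
  qed auto
  have "pw a (int n) x \<in> U + Q" for n
  proof (cases "n < N")
    case True
    then have "pw a (int n) x \<in> Q" using Q(3) by blast
    then show ?thesis using subsetD[OF set_plus_right[OF add_subgroupD(1)[OF U'(2)]]] by blast
  next
    case False
    then have "pw a (int n) x \<in> U" using N[of n] xG W(3) by auto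
    then show ?thesis using subsetD[OF set_plus_left[OF add_subgroupD(1)[OF Q(2)]]] by blast
  qed
  then show ?thesis by (rule that[OF compact_plus[OF U'(1) Q(1)] add_subgroup_plus[OF U'(2) Q(2)]])
qed

text \<open>The forward orbit of \<open>c\<close> is bounded because it tends to 0, the backward
  orbit because \<open>c = - (c' + m)\<close>. So \<open>c\<close> lies in \<open>con a\<close> and
  in \<open>Mb a\<close>, whence \<open>c = 0\<close>; then \<open>c' = - m\<close> is treated
  likewise with \<open>- a\<close>.\<close>

lemma split_unique:
  assumes "c \<in> con a" "c' \<in> con (- a)" "m \<in> Mb a" "c + (c' + m) = 0" shows "c = 0" "c' = 0" "m = 0"
proof -
  obtain C where C: "compact C" "add_subgroup C" "!!n::nat. pw a (int n) c \<in> C" using con_forward_bounded[OF assms(1)] by blast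
  obtain D where D: "compact D" "add_subgroup D" "!!n::nat. pw (- a) (int n) c' \<in> D" using con_forward_bounded[OF assms(2)] by blast
  obtain E where E: "compact E" "add_subgroup E" "!!k. pw a k m \<in> E" using assms(3) unfolding Mb_def by blast
  let ?Q = "C + (D + E)"
  have cQ: "compact ?Q" by (intro compact_plus C(1) D(1) E(1))
  have sQ: "add_subgroup ?Q" by (intro add_subgroup_plus C(2) D(2) E(2))
  have ceq: "c = - (c' + m)" using assms(4) by (rule eq_neg_iff_add_eq_0[THEN iffD2])
  have "pw a k c \<in> ?Q" for k
  proof (cases "k \<ge> 0")
    case True
    then have "pw a k c \<in> C" using C(3)[of "nat k"] by simp
    then have "pw a k c + (0 + 0) \<in> ?Q" using add_subgroupD(1)[OF D(2)] add_subgroupD(1)[OF E(2)] by (intro set_plus_intro)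
    then show ?thesis by simp
  next
    case False
    then have "pw a k c' \<in> D" using D(3)[of "nat (- k)"] by simp
    then have "0 + (- pw a k c' + - pw a k m) \<in> ?Q"
      using add_subgroupD(1)[OF C(2)] add_subgroupD(3)[OF D(2)] add_subgroupD(3)[OF E(2) E(3)] by (intro set_plus_intro)
    moreover have "pw a k c = 0 + (- pw a k c' + - pw a k m)" unfolding ceq act_uminus act_add by simp
    ultimately show ?thesis by simp
  qed
  then have "c \<in> Mb a" unfolding Mb_def using cQ sQ assms(1) con_G by blast
  then show c0: "c = 0" using con_Int_Mb assms(1) by blast
  then have "c' = - m" using assms(4) by (simp add: eq_neg_iff_add_eq_0)
  then have "c' \<in> Mb (- a)" unfolding Mb_uminus using add_subgroupD(3)[OF Mb_subgroup assms(3)] by simp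
  then show c0': "c' = 0" using con_Int_Mb[of "- a"] assms(2) by blast
  show "m = 0" using assms(4) c0 c0' by simp
qed

text \<open>Near 0 the local splitting provides components inside \<open>U\<close>, and by
  uniqueness they are the given ones. This is the continuity of the three component maps.\<close>

lemma split_small:
  assumes U: "open U" "0 \<in> U"
  obtains W where "open W" "0 \<in> W"
    "!!c c' m. c + (c' + m) \<in> W ==> c \<in> con a ==> c' \<in> con (- a) ==> m \<in> Mb a ==> c \<in> U & c' \<in> U & m \<in> U"
proof -
  obtain W Ym Yp Z where s: "open W" "0 \<in> W" "W Int G <= Ym + (Yp + Z)" "Ym <= con a" "Yp <= con (- a)" "Z <= Mb a"
    "Ym <= U" "Yp <= U" "Z <= U" by (rule local_split[OF U, of a])
  have "c \<in> U & c' \<in> U & m \<in> U" if c: "c + (c' + m) \<in> W" "c \<in> con a" "c' \<in> con (- a)" "m \<in> Mb a" for c c' m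
  proof -
    have "c + (c' + m) \<in> G" using c con_G Mb_G by (intro add_subgroupD(2)[OF sG]) auto
    then have "c + (c' + m) \<in> Ym + (Yp + Z)" using c(1) s(3) by blast
    then obtain y y' z where y: "y \<in> Ym" "y' \<in> Yp" "z \<in> Z" "c + (c' + m) = y + (y' + z)" by (auto elim!: set_plus_elim)
    have h1: "(c - y) + ((c' - y') + (m - z)) = 0" using y(4) by (simp add: algebra_simps)
    have h2: "c - y \<in> con a" using add_subgroupD(4)[OF con_subgroup c(2)] y(1) s(4) by blast
    have h3: "c' - y' \<in> con (- a)" using add_subgroupD(4)[OF con_subgroup c(3)] y(2) s(5) by blast
    have h4: "m - z \<in> Mb a" using add_subgroupD(4)[OF Mb_subgroup c(4)] y(3) s(6) by blast
    have "c - y = 0" "c' - y' = 0" "m - z = 0" using split_unique[OF h2 h3 h4 h1] by simp_all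
    then show ?thesis using y s(7-9) by auto
  qed
  then show ?thesis using that[OF s(1,2)] by blast
qed

text \<open>When all orbits are bounded, both contracted summands of the local splitting vanish, so
  a neighbourhood of 0 consists of points whose whole orbit stays in \<open>U\<close>.\<close>

lemma core_open:
  assumes all: "G <= Mb a" and U: "copen U" shows "copen (zr a U)"
proof -
  have U': "compact U" "add_subgroup U" "U <= G" using U unfolding copen_def by auto
  obtain WU where WU: "open WU" "0 \<in> WU" "WU Int G <= U" using U unfolding copen_def by blast
  obtain W Ym Yp Z where s: "open W" "0 \<in> W" "W Int G <= Ym + (Yp + Z)" "Ym <= con a" "Yp <= con (- a)" "Z <= Mb a"
    and ZU: "!!k x. x \<in> Z ==> pw a k x \<in> WU" using local_split[OF WU(1,2), of a] by metis
  have "W Int G <= zr a U"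
  proof
    fix x assume x: "x \<in> W Int G"
    then have "x \<in> Ym + (Yp + Z)" using s(3) by blast
    then obtain y y' z where y: "y \<in> Ym" "y' \<in> Yp" "z \<in> Z" "x = y + (y' + z)" by (auto elim!: set_plus_elim)
    have "y \<in> con a" "y \<in> Mb a" using y(1) s(4) con_G all by blast+
    then have y0: "y = 0" using con_Int_Mb by blast
    have "y' \<in> con (- a)" "y' \<in> Mb (- a)" using y(2) s(5) con_G all unfolding Mb_uminus by blast+
    then have y'0: "y' = 0" using con_Int_Mb by blast
    have xz: "x = z" using y(4) y0 y'0 by simp
    have "pw a k x \<in> U" for k using ZU[OF y(3), of k] G_act x WU(3) unfolding xz by blast
    then show "x \<in> zr a U" unfolding zr_def by blast
  qed
  then show ?thesis unfolding copen_def using zr_compact[OF U'(1)] zr_subgroup[OF U'(2)] zr_sub[of a U] U'(3) s(1,2) by blast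
qed

lemma con_in_Ym:
  assumes s: "open W" "0 \<in> W" "Ym <= con a" "Z <= Mb a" "!!x. (!!n::nat. pw a (int n) x \<in> W Int G) ==> x \<in> Ym + Z"
    and c: "c \<in> con a" "!!n::nat. pw a (int n) c \<in> W"
  shows "c \<in> Ym"
proof -
  have "pw a (int n) c \<in> W Int G" for n using c con_G G_act by blast
  then have "c \<in> Ym + Z" by (rule s(5))
  then obtain y z where yz: "y \<in> Ym" "z \<in> Z" "c = y + z" by (rule set_plus_elim)
  have "z = c - y" using yz(3) by simp
  then have "z \<in> con a" using add_subgroupD(4)[OF con_subgroup c(1)] yz(1) s(3) by blast
  then have "z = 0" using con_Int_Mb yz(2) s(4) by blast
  then show ?thesis using yz by simp
qed

text \<open>Pointwise convergence is upgraded through the compact group \<open>Ym\<close>, which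
  contains all elements of \<open>con a\<close> near 0. A compact set enters the forward invariant
  \<open>Ym\<close> at a common time, and the iterates of \<open>Ym\<close> decrease to 0.\<close>

lemma con_contracting: "contracting_on (con a) (act a)"
  unfolding contracting_on_def
proof (intro allI impI)
  fix K U :: "'b set" assume K: "K <= con a & compact K" and U: "open U & 0 \<in> U"
  obtain W Ym Z where s: "open W" "0 \<in> W" "Ym <= con a" "Z <= Mb a" "compact Ym" "!!x. x \<in> Ym ==> act a x \<in> Ym" "add_subgroup Ym"
    "!!x. (!!n::nat. pw a (- int n) x \<in> Ym) ==> x = 0" "!!x. (!!n::nat. pw a (int n) x \<in> W Int G) ==> x \<in> Ym + Z"
    using local_split[OF open_UNIV UNIV_I, of a] by metis
  \<comment> \<open>A second splitting inside \<open>W\<close>, so that the forward orbit of a small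
    contracted element is confined to \<open>Ym'\<close> and thereby to \<open>W\<close>.\<close>
  obtain W' Ym' Yp' Z' where s': "open W'" "0 \<in> W'" "W' Int G <= Ym' + (Yp' + Z')" "Ym' <= con a" "Yp' <= con (- a)" "Z' <= Mb a"
    "Ym' <= W" "!!x. x \<in> Ym' ==> act a x \<in> Ym'" using local_split[OF s(1,2), of a] by metis
  have small: "c \<in> Ym" if c: "c \<in> con a" "c \<in> W'" for c
  proof (rule con_in_Ym[OF s(1,2,3,4,9) c(1)])
    have "c \<in> Ym' + (Yp' + Z')" using s'(3) c con_G by blast
    then obtain y y' z where y: "y \<in> Ym'" "y' \<in> Yp'" "z \<in> Z'" "c = y + (y' + z)" by (auto elim!: set_plus_elim)
    have "(y - c) + (y' + z) = 0" using y(4) by (simp add: algebra_simps)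
    moreover have "y - c \<in> con a" using y(1) s'(4) c(1) add_subgroupD(4)[OF con_subgroup] by blast
    ultimately have "y - c = 0" using split_unique(1)[of "y - c" a y' z] y(2,3) s'(5,6) by blast
    then have cy: "c \<in> Ym'" using y(1) by simp
    have "pw a (int n) c \<in> Ym'" for n
    proof (induction n)
      case (Suc n)
      have "zm (int (Suc n)) a = a + zm (int n) a" using zm_succ[of "int n" a] by (simp add: add.commute)
      then show ?case using s'(8)[OF Suc] by (simp add: act_act)
    qed (use cy in simp)
    then show "pw a (int n) c \<in> W" for n using s'(7) by blast
  qed
  have Yfw: "pw a (int n) x \<in> Ym" if "x \<in> Ym" for x n
  proof (induction n)
    case (Suc n)
    have "zm (int (Suc n)) a = a + zm (int n) a" using zm_succ[of "int n" a] by (simp add: add.commute)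
    then show ?case using s(6)[OF Suc] by (simp add: act_act)
  qed (use that in simp)
  have pt: "\<exists>n::nat. pw a (int n) c \<in> W'" if "c \<in> K" for c using con_eventually[of c a W'] s'(1,2) that K by blast
  have cov: "K <= (\<Union>n\<in>(UNIV::nat set). {x. pw a (int n) x \<in> W'})" using pt by blast
  obtain NN where NN: "finite NN" "K <= (\<Union>n\<in>NN. {x. pw a (int n) x \<in> W'})"
    by (rule compactE_image[OF conjunct2[OF K] pw_open[OF s'(1)] cov])
  define N where "N = Max (insert 0 NN)"
  have KN: "pw a (int N) c \<in> Ym" if c: "c \<in> K" for c
  proof -
    obtain n where n: "n \<in> NN" "pw a (int n) c \<in> W'" using NN(2) c by blast
    have "pw a (int n) c \<in> con a" using con_act K c by blast
    then have 1: "pw a (int n) c \<in> Ym" using small n(2) by blast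
    have "n \<le> N" unfolding N_def using NN(1) n(1) by simp
    then have "pw a (int N) c = pw a (int (N - n)) (pw a (int n) c)" unfolding pw_pw by (simp add: of_nat_diff)
    then show ?thesis using Yfw[OF 1] by simp
  qed
  obtain M :: nat where M: "!!n x. n \<ge> M ==> x \<in> Ym ==> pw a (int n) x \<in> U"
    using contracted_decseq[OF s(5,6,8)] U by blast
  have "(act a ^^ n) ` K <= U" if n: "n \<ge> N + M" for n
  proof
    fix y assume "y \<in> (act a ^^ n) ` K"
    then obtain c where c: "c \<in> K" "y = pw a (int n) c" by (auto simp: pw_funpow)
    have "pw a (int n) c = pw a (int (n - N)) (pw a (int N) c)" unfolding pw_pw using n by (simp add: of_nat_diff)
    then show "y \<in> U" using M[OF _ KN[OF c(1)], of "n - N"] n c(2) by simp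
  qed
  then show "\<forall>\<^sub>F n in sequentially. (act a ^^ n) ` K <= U" unfolding eventually_sequentially by blast
qed

text \<open>Formally, \<open>e\<close> is minus the sum of all \<open>pw a (int (k * m)) c\<close>.
  The partial sums telescope, and once the orbit of \<open>c\<close> has entered the compact
  contracted group \<open>Ym\<close>, the remainders vanish in the intersection of the sets
  \<open>Cm\<close>; compactness of the image \<open>X\<close> takes the place of convergence of the
  series.\<close>

lemma con_solve:
  assumes c: "c \<in> con a" and k: "k > (0::nat)" obtains e where "e \<in> con a" "pw a (int k) e - e = c"
proof -
  obtain W Ym Z where s: "open W" "0 \<in> W" "Ym <= con a" "Z <= Mb a" "compact Ym" "!!x. x \<in> Ym ==> act a x \<in> Ym" "add_subgroup Ym"
    "!!x. (!!n::nat. pw a (- int n) x \<in> Ym) ==> x = 0" "!!x. (!!n::nat. pw a (int n) x \<in> W Int G) ==> x \<in> Ym + Z"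
    using local_split[OF open_UNIV UNIV_I, of a] by metis
  obtain N :: nat where N: "!!n. n \<ge> N ==> pw a (int n) c \<in> W" using con_eventually[OF c s(1,2)] by blast
  define y where "y = pw a (int N) c"
  have y: "y \<in> Ym"
  proof (rule con_in_Ym[OF s(1-4,9)])
    show "y \<in> con a" unfolding y_def by (rule con_act[OF c])
    show "pw a (int n) y \<in> W" for n unfolding y_def pw_pw using N[of "n + N"] by simp
  qed
  have Yfw: "pw a (int n) x \<in> Ym" if "x \<in> Ym" for x n
  proof (induction n)
    case (Suc n)
    have "zm (int (Suc n)) a = a + zm (int n) a" using zm_succ[of "int n" a] by (simp add: add.commute)
    then show ?case using s(6)[OF Suc] by (simp add: act_act)
  qed (use that in simp)
  define X where "X = (%x. x - pw a (int k) x) ` Ym"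
  have cX: "compact X" unfolding X_def
    by (rule compact_continuous_image[OF _ s(5)]) (intro continuous_intros act_continuous)
  define Cm where "Cm m = {x. pw a (- int (k * m)) x \<in> Ym}" for m
  have tel: "\<exists>u\<in>Ym. y = (u - pw a (int k) u) + pw a (int (k * m)) y" for m
  proof (induction m)
    case 0
    show ?case using add_subgroupD(1)[OF s(7)] by (intro bexI[of _ 0]) simp_all
  next
    case (Suc m)
    then obtain u where u: "u \<in> Ym" "y = (u - pw a (int k) u) + pw a (int (k * m)) y" by blast
    define v where "v = pw a (int (k * m)) y"
    have v: "v \<in> Ym" unfolding v_def by (rule Yfw[OF y])
    have kv: "pw a (int k) v = pw a (int (k * Suc m)) y" unfolding v_def pw_pw by (simp add: algebra_simps)
    have "y = ((u + v) - pw a (int k) (u + v)) + pw a (int k) v"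
      using u(2) unfolding v_def[symmetric] act_add by (simp add: algebra_simps)
    then show ?case using add_subgroupD(2)[OF s(7) u(1) v] unfolding kv by blast
  qed
  have Cm_dec: "Cm (Suc m) <= Cm m" for m
  proof
    fix x assume "x \<in> Cm (Suc m)"
    then have "pw a (int k) (pw a (- int (k * Suc m)) x) \<in> Ym" unfolding Cm_def using Yfw by blast
    moreover have "int k + - int (k * Suc m) = - int (k * m)" by (simp add: algebra_simps)
    ultimately show "x \<in> Cm m" unfolding Cm_def pw_pw by (simp only: mem_Collect_eq)
  qed
  have "y \<in> X + (\<Inter>m. Cm m)"
  proof (rule decseq_compact_plus[OF cX])
    show "Cm (Suc m) <= Cm m" for m by (rule Cm_dec)
    show "compact (Cm m)" for m unfolding Cm_def by (rule pw_compact[OF s(5)])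
    fix m
    obtain u where u: "u \<in> Ym" "y = (u - pw a (int k) u) + pw a (int (k * m)) y" using tel by blast
    have "pw a (int (k * m)) y \<in> Cm m" unfolding Cm_def using y by (simp only: mem_Collect_eq pw_pw) simp
    moreover have "u - pw a (int k) u \<in> X" unfolding X_def using u(1) by blast
    ultimately have "(u - pw a (int k) u) + pw a (int (k * m)) y \<in> X + Cm m" by (rule set_plus_intro[rotated])
    then show "y \<in> X + Cm m" using u(2) by simp
  qed
  moreover have "(\<Inter>m. Cm m) <= {0}"
  proof
    fix x assume x: "x \<in> (\<Inter>m. Cm m)"
    have "pw a (- int n) x \<in> Ym" for n
    proof -
      have "x \<in> Cm n" using x by blast
      then have "pw a (- int (k * n)) x \<in> Ym" unfolding Cm_def by blast
      then have "pw a (int (k * n - n)) (pw a (- int (k * n)) x) \<in> Ym" by (rule Yfw)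
      moreover have "int (k * n - n) + - int (k * n) = - int n" using k by (simp add: of_nat_diff)
      ultimately show ?thesis unfolding pw_pw by (simp only:)
    qed
    then show "x \<in> {0}" using s(8) by blast
  qed
  ultimately have "y \<in> X" by (auto elim!: set_plus_elim)
  then obtain u where u: "u \<in> Ym" "y = u - pw a (int k) u" unfolding X_def by blast
  define e where "e = - pw a (- int N) u"
  have "e \<in> con a" unfolding e_def using u(1) s(3) con_act by (intro add_subgroupD(3)[OF con_subgroup]) blast
  moreover have "pw a (int k) e - e = c"
  proof -
    have "pw a (int k) e - e = pw a (- int N) (u - pw a (int k) u)"
      unfolding e_def act_uminus act_diff by (simp add: act_commute[of "zm (int k) a"])
    also have "\<dots> = c" unfolding u(2)[symmetric] y_def pw_pw by simp
    finally show ?thesis .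
  qed
  ultimately show ?thesis by (rule that)
qed

text \<open>Telescoping writes the orbit of \<open>x\<close> as finitely many points plus sums of
  orbit points of the difference \<open>d\<close>; the sums stay in the compact \<open>C\<close>
  because it is a subgroup.\<close>

lemma bounded_of_difference:
  assumes x: "x \<in> G" and k: "k > (0::nat)" and m: "pw a (int k) x - x \<in> Mb a" shows "x \<in> Mb a"
proof -
  define d where "d = pw a (int k) x - x"
  obtain C where C: "compact C" "add_subgroup C" "!!i. pw a i d \<in> C" using m unfolding Mb_def d_def by blast
  have step: "pw a (int k * (l + 1) + j) x = pw a (int k * l + j) x + pw a (int k * l + j) d" for l j
  proof -
    have "int k * (l + 1) + j = (int k * l + j) + int k" by (simp add: algebra_simps)
    then have "pw a (int k * (l + 1) + j) x = pw a (int k * l + j) (pw a (int k) x)" by (simp only: pw_pw)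
    then show ?thesis unfolding d_def act_diff by simp
  qed
  have diff: "pw a (int k * l + j) x - pw a j x \<in> C" for l j
  proof (induction l rule: int_induct[where k = 0])
    case base then show ?case using add_subgroupD(1)[OF C(2)] by simp
  next
    case (step1 i)
    have e: "pw a (int k * (i + 1) + j) x - pw a j x = (pw a (int k * i + j) x - pw a j x) + pw a (int k * i + j) d"
      unfolding step by (simp add: algebra_simps)
    show ?case unfolding e by (rule add_subgroupD(2)[OF C(2) step1(2) C(3)])
  next
    case (step2 i)
    have "pw a (int k * i + j) x = pw a (int k * (i - 1) + j) x + pw a (int k * (i - 1) + j) d" using step[of "i - 1" j] by simp
    then have e: "pw a (int k * (i - 1) + j) x - pw a j x = (pw a (int k * i + j) x - pw a j x) - pw a (int k * (i - 1) + j) d"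
      by (simp only: add_diff_cancel_right' diff_add_eq diff_right_commute) simp
    show ?case unfolding e by (rule add_subgroupD(4)[OF C(2) step2(2) C(3)])
  qed
  obtain Q where Q: "compact Q" "add_subgroup Q" "(%j. pw a j x) ` {0..<int k} <= Q"
  proof (rule finite_elliptic[of "(%j. pw a j x) ` {0..<int k}"])
    show "\<exists>C. compact C & add_subgroup C & y \<in> C" if "y \<in> (%j. pw a j x) ` {0..<int k}" for y
      using that G_act[OF x] by (intro G_ell) auto
  qed auto
  have "pw a i x \<in> C + Q" for i
  proof -
    have "pw a (int k * (i div int k) + i mod int k) x - pw a (i mod int k) x \<in> C" by (rule diff)
    then have "pw a i x - pw a (i mod int k) x \<in> C" by simp
    moreover have "pw a (i mod int k) x \<in> Q" using Q(3) k by auto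
    ultimately have "(pw a i x - pw a (i mod int k) x) + pw a (i mod int k) x \<in> C + Q" by (rule set_plus_intro)
    then show ?thesis by simp
  qed
  then show ?thesis unfolding Mb_def using x compact_plus[OF C(1) Q(1)] add_subgroup_plus[OF C(2) Q(2)] by blast
qed

text \<open>The sum of the three pieces is an open submodule, so by \<open>fin\<close> the orbit of
  \<open>x\<close> repeats modulo it and some \<open>pw a (int k) x - x\<close> splits. Its
  contracted components are themselves differences by \<open>con_solve\<close>; after the solutions
  are subtracted, what remains is bounded by \<open>bounded_of_difference\<close>.\<close>

lemma split_all:
  assumes fin: "!!U x. submodule act G U ==> \<exists>W. open W & 0 \<in> W & W Int G <= U ==> x \<in> G ==>
      \<exists>F. submodule act G F & U <= F & finite (cosets F U) & x \<in> F"
  shows "G <= con a + (con (- a) + Mb a)"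
proof
  fix x assume x: "x \<in> G"
  let ?U = "con a + (con (- a) + Mb a)"
  have sU: "add_subgroup ?U" by (intro add_subgroup_plus con_subgroup Mb_subgroup)
  have Uact: "act b y \<in> ?U" if y: "y \<in> ?U" for b y
  proof -
    obtain c c' m where "c \<in> con a" "c' \<in> con (- a)" "m \<in> Mb a" "y = c + (c' + m)" using y by (auto elim!: set_plus_elim)
    then show ?thesis by (auto simp: act_add intro!: set_plus_intro con_act Mb_act)
  qed
  have "?U <= G" by (intro set_plus_sub[OF sG] con_G Mb_G)
  then have "submodule act G ?U" unfolding submodule_def using sU Uact by blast
  moreover have "\<exists>W. open W & 0 \<in> W & W Int G <= ?U"
  proof -
    obtain W Ym Yp Z where s: "open W" "0 \<in> W" "W Int G <= Ym + (Yp + Z)" "Ym <= con a" "Yp <= con (- a)" "Z <= Mb a"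
      by (rule local_split[OF open_UNIV UNIV_I, of a])
    have "Ym + (Yp + Z) <= ?U" by (intro set_plus_mono2 s(4-6))
    then show ?thesis using s(1-3) by blast
  qed
  ultimately obtain F where F: "submodule act G F" "?U <= F" "finite (cosets F ?U)" "x \<in> F" using fin[OF _ _ x] by blast
  have "pw a (int n) x \<in> F" for n using F(1,4) unfolding submodule_def by blast
  then obtain i j :: nat where ij: "i < j" "pw a (int j) x - pw a (int i) x \<in> ?U"
    using finite_cosets_pigeonhole[OF F(3) sU, of "%n. pw a (int n) x"] by blast
  define k where "k = j - i"
  have k: "k > 0" "- int i + int j = int k" unfolding k_def using ij(1) by auto
  have "pw a (- int i) (pw a (int j) x - pw a (int i) x) \<in> ?U" by (rule Uact[OF ij(2)])
  then have "pw a (int k) x - x \<in> ?U" unfolding act_diff pw_pw k(2) by simp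
  then obtain c c' m where c: "c \<in> con a" "c' \<in> con (- a)" "m \<in> Mb a" "pw a (int k) x - x = c + (c' + m)" by (auto elim!: set_plus_elim)
  obtain e where e: "e \<in> con a" "pw a (int k) e - e = c" by (rule con_solve[OF c(1) k(1)])
  have "- pw a (- int k) c' \<in> con (- a)" by (rule add_subgroupD(3)[OF con_subgroup con_act[OF c(2)]])
  then obtain e' where e': "e' \<in> con (- a)" "pw (- a) (int k) e' - e' = - pw a (- int k) c'" by (rule con_solve[OF _ k(1)])
  have "pw a (int k) e' - e' = c'"
  proof -
    have "pw a (int k) (pw a (- int k) e' - e') = pw a (int k) (- pw a (- int k) c')" using e'(2) unfolding pw_uminus by simp
    then have "e' - pw a (int k) e' = - c'" unfolding act_diff act_uminus pw_pw by simp
    then show ?thesis by (metis minus_diff_eq minus_minus)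
  qed
  define y where "y = x - (e + e')"
  have yG: "y \<in> G" unfolding y_def using x e(1) e'(1) con_G by (intro add_subgroupD(4)[OF sG x] add_subgroupD(2)[OF sG]) auto
  have "pw a (int k) y - y = (pw a (int k) x - x) - ((pw a (int k) e - e) + (pw a (int k) e' - e'))"
    unfolding y_def act_diff act_add by (simp add: algebra_simps)
  then have "pw a (int k) y - y = m" unfolding c(4) e(2) \<open>pw a (int k) e' - e' = c'\<close> by simp
  then have "y \<in> Mb a" using bounded_of_difference[OF yG k(1)] c(3) by simp
  then have "e + (e' + y) \<in> ?U" using e(1) e'(1) by (intro set_plus_intro)
  moreover have "x = e + (e' + y)" unfolding y_def by (simp add: algebra_simps)
  ultimately show "x \<in> ?U" by simp
qed

end

subsection \<open>The polycontractable and amorphic parts of the elliptic part\<close>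

lemma finite_cosets_reps:
  assumes "add_subgroup U" "finite (cosets F U)" obtains R where "finite R" "R <= F" "F <= R + U"
proof -
  define g where "g C = (SOME x. x \<in> F & (+) x ` U = C)" for C
  have g: "g C \<in> F & (+) (g C) ` U = C" if C: "C \<in> cosets F U" for C
  proof -
    have "\<exists>x. x \<in> F & (+) x ` U = C" using C unfolding cosets_def by blast
    then show ?thesis unfolding g_def by (rule someI_ex)
  qed
  have "F <= g ` cosets F U + U"
  proof
    fix x assume x: "x \<in> F"
    define C where "C = (+) x ` U"
    have C: "C \<in> cosets F U" unfolding C_def cosets_def using x by blast
    have "x \<in> (+) (g C) ` U" using g[OF C] coset_self[OF add_subgroupD(1)[OF assms(1)], of x] unfolding C_def by simp
    then have "x - g C \<in> U" unfolding translate_eq by simp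
    then have "g C + (x - g C) \<in> g ` cosets F U + U" using C by (intro set_plus_intro imageI)
    then show "x \<in> g ` cosets F U + U" by simp
  qed
  moreover have "g ` cosets F U <= F" using g by blast
  ultimately show ?thesis using that[of "g ` cosets F U"] assms(2) by blast
qed

lemma finite_cosets_of_reps:
  assumes U: "add_subgroup U" and R: "finite R" "F <= R + U" shows "finite (cosets F U)"
proof -
  have "cosets F U <= (%r. (+) r ` U) ` R"
  proof
    fix C assume "C \<in> cosets F U"
    then obtain x where x: "x \<in> F" "C = (+) x ` U" unfolding cosets_def by blast
    have "x \<in> R + U" using R(2) x(1) by blast
    then obtain r u where ru: "r \<in> R" "u \<in> U" "x = r + u" by (rule set_plus_elim)
    have "C = (+) r ` U" unfolding x(2) by (rule coset_eq[OF U]) (use ru in simp)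
    then show "C \<in> (%r. (+) r ` U) ` R" using ru(1) by blast
  qed
  then show ?thesis using R(1) by (meson finite_imageI finite_subset)
qed

context sheer_module
begin

lemma td_Mell: "td_module act Mell"
proof
  show "add_subgroup Mell" by (rule Mell_subgroup)
  show "act a x \<in> Mell" if "x \<in> Mell" for a x using that by (rule Mell_act)
  show "\<exists>O' W. compact O' & add_subgroup O' & O' <= Mell & O' <= U & open W & 0 \<in> W & W Int Mell <= O'" if "open U" "0 \<in> U" for U
    by (rule Mell_open_basis[OF that]) blast
  show "\<exists>C. compact C & add_subgroup C & x \<in> C" if "x \<in> Mell" for x using that unfolding Mell_def by blast
qed

text \<open>\<open>Mell\<close> contains every compact subgroup, so the bound for
  \<open>{a, - a}\<close> covers all candidates and \<open>pfin_trivial\<close> applies.\<close>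

lemma no_parafinite_element: assumes "pfin {a, - a} K" shows "K = {0}"
proof -
  interpret T: td_module act Mell by (rule td_Mell)
  show ?thesis
  proof (rule T.parafinite_bounded[of a])
    show "C <= Mell" if "compact C" "add_subgroup C" for C using that unfolding Mell_def by blast
    fix Q assume Q: "compact Q" "add_subgroup Q" "!!K. pfin {a, - a} K ==> K <= Q"
    show "K = {0}" by (rule pfin_trivial[OF Q(1) Q(3) Q(2) assms])
  qed
qed

text \<open>Stated for closed submodules because the same dynamics is run again on the summand that
  remains after splitting.\<close>

lemma td_free_sub:
  assumes E: "add_subgroup E" "!!a x. x \<in> E ==> act a x \<in> E" "closed E" "E <= Mell" shows "td_free_module act E"
proof
  show "add_subgroup E" by (rule E(1))
  show "act a x \<in> E" if "x \<in> E" for a x using that by (rule E(2))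
  show "\<exists>O' W. compact O' & add_subgroup O' & O' <= E & O' <= U & open W & 0 \<in> W & W Int E <= O'" if U: "open U" "0 \<in> U" for U
  proof -
    obtain O' W where O': "add_subgroup O'" "compact O'" "O' <= Mell" "O' <= U" "open W" "0 \<in> W" "W Int Mell <= O'"
      by (rule Mell_open_basis[OF U])
    have "compact (O' Int E)" by (rule compact_Int_closed[OF O'(2) E(3)])
    moreover have "add_subgroup (O' Int E)" by (rule add_subgroup_Int[OF O'(1) E(1)])
    moreover have "O' Int E <= E" "O' Int E <= U" "W Int E <= O' Int E" using O'(4,7) E(4) by auto
    ultimately show ?thesis using O'(5,6) by blast
  qed
  show "\<exists>C. compact C & add_subgroup C & x \<in> C" if "x \<in> E" for x using that E(4) unfolding Mell_def by blast
  show "K = {0}" if "pfin {a, - a} K" for a K using that by (rule no_parafinite_element)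
qed

lemma Mell_closed: "closed Mell"
proof -
  obtain pV where pV: "eqproj pV" "!!x. x - pV x \<in> Mell" "!!x. x \<in> Mell ==> pV x = 0"
    using Euclidean_projection by metis
  have "x \<in> Mell \<longleftrightarrow> pV x \<in> {0}" for x using pV(2)[of x] pV(3)[of x] by auto
  then have "Mell = {x. pV x \<in> {0}}" by blast
  then show ?thesis using closed_vimage_UNIV[OF eqprojD(2)[OF pV(1)], of "{0}"] by simp
qed

end

sublocale sheer_module < ell: td_free_module act Mell
  by (rule td_free_sub[OF Mell_subgroup Mell_act Mell_closed order_refl])

section \<open>Consequences of compact generation\<close>

locale cg_module = sheer_module +
  assumes cg: "compactly_generated TYPE('a)"
begin

text \<open>The compact generating set is covered by finitely many translates of \<open>Nb\<close>,
  so invariance is checked on \<open>Nb\<close> and a finite set. Inverses are included because the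
  stabiliser has to be a subgroup.\<close>

lemma generation:
  fixes Nb :: "'a set"
  assumes Nb: "open Nb" "0 \<in> Nb"
  obtains S' where "finite S'"
    "!!X. (!!b x. b \<in> Nb ==> x \<in> X ==> act b x \<in> X & act (- b) x \<in> X) ==>
      (!!s x. s \<in> S' ==> x \<in> X ==> act s x \<in> X & act (- s) x \<in> X) ==> (!!a x. x \<in> X ==> act a x \<in> X)"
proof -
  obtain S :: "'a set" where S: "compact S" "generated_subgroup S = UNIV" using cg unfolding compactly_generated_def by blast
  obtain S' where S': "finite S'" "S' <= S" "S <= S' + Nb" by (rule compact_finite_translates[OF S(1) Nb])
  have "act a x \<in> X" if 1: "!!b x. b \<in> Nb ==> x \<in> X ==> act b x \<in> X & act (- b) x \<in> X"
    and 2: "!!s x. s \<in> S' ==> x \<in> X ==> act s x \<in> X & act (- s) x \<in> X" and x: "x \<in> X" for X a x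
  proof -
    define St where "St = {a. \<forall>x\<in>X. act a x \<in> X & act (- a) x \<in> X}"
    have add: "b + c \<in> St" if "b \<in> St" "c \<in> St" for b c
    proof -
      have "act (b + c) y \<in> X & act (- (b + c)) y \<in> X" if y: "y \<in> X" for y
      proof
        show "act (b + c) y \<in> X" using \<open>b \<in> St\<close> \<open>c \<in> St\<close> y unfolding St_def act_act[symmetric] by blast
        have "act (- b) (act (- c) y) \<in> X" using \<open>b \<in> St\<close> \<open>c \<in> St\<close> y unfolding St_def by blast
        then show "act (- (b + c)) y \<in> X" by (simp add: act_act)
      qed
      then show ?thesis unfolding St_def by blast
    qed
    have "add_subgroup St" unfolding add_subgroup_def
      using add by (auto simp: St_def)
    moreover have "S <= St"
    proof
      fix s assume "s \<in> S"
      then have "s \<in> S' + Nb" using S'(3) by blast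
      then obtain t b where tb: "t \<in> S'" "b \<in> Nb" "s = t + b" by (rule set_plus_elim)
      have "t \<in> St" "b \<in> St" unfolding St_def using 1[OF tb(2)] 2[OF tb(1)] by blast+
      then show "s \<in> St" unfolding tb(3) by (rule add)
    qed
    ultimately have "generated_subgroup S <= St" by (rule generated_least)
    then have "a \<in> St" unfolding S(2) by blast
    then show ?thesis unfolding St_def using x by blast
  qed
  then show ?thesis using that[OF S'(1)] by blast
qed

text \<open>\<open>Fi\<close> is the union of all finite extensions of \<open>U\<close>. It suffices
  that \<open>V0 + Fi\<close> has no proper finite extension \<open>F\<close>, for then it is
  everything and its elliptic part is \<open>Fi\<close>. Elliptic representatives of
  \<open>F\<close> lie in a compact subgroup \<open>QF\<close>, which is finite modulo
  \<open>U\<close>. Elements of \<open>A\<close> near 0 move its finitely many representatives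
  within \<open>W\<close>; the finitely many other generators move them into \<open>QF\<close> up to
  elements of \<open>Fi\<close>, which one finite extension \<open>F1\<close> absorbs. Hence
  \<open>QF + F1\<close> is a finite extension of \<open>U\<close> stable under \<open>A\<close>,
  and \<open>QF\<close> lies in \<open>Fi\<close>.\<close>

lemma locally_finite:
  assumes U: "submodule act Mell U" and oU: "\<exists>W. open W & 0 \<in> W & W Int Mell <= U" and x: "x \<in> Mell"
  shows "\<exists>F. submodule act Mell F & U <= F & finite (cosets F U) & x \<in> F"
proof -
  obtain pV where pV: "eqproj pV" "range pV = V0" "!!x. x - pV x \<in> Mell" "!!x. x \<in> Mell ==> pV x = 0"
    using Euclidean_projection by metis
  have U': "add_subgroup U" "U <= Mell" "!!a x. x \<in> U ==> act a x \<in> U" using U unfolding submodule_def by auto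
  obtain W where W: "open W" "0 \<in> W" "W Int Mell <= U" using oU by blast
  define ok where "ok F \<longleftrightarrow> submodule act Mell F & U <= F & finite (cosets F U)" for F
  define Fi where "Fi = {x. \<exists>F. ok F & x \<in> F}"
  have okD: "add_subgroup F" "F <= Mell" "!!a x. x \<in> F ==> act a x \<in> F" "U <= F" "finite (cosets F U)" if "ok F" for F
    using that unfolding ok_def submodule_def by auto
  have okI: "ok F" if "add_subgroup F" "F <= Mell" "!!a x. x \<in> F ==> act a x \<in> F" "U <= F" "finite R" "F <= R + U" for F R
    using that finite_cosets_of_reps[OF U'(1) that(5,6)] unfolding ok_def submodule_def by blast
  have okU: "ok U"
  proof (rule okI[OF U'(1-3)])
    show "U <= {0} + U" by (rule set_plus_right) simp
  qed auto
  have ok_plus: "ok (F + F')" if F: "ok F" and F': "ok F'" for F F'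
  proof -
    obtain R where R: "finite R" "R <= F" "F <= R + U" by (rule finite_cosets_reps[OF U'(1) okD(5)[OF F]])
    obtain R' where R': "finite R'" "R' <= F'" "F' <= R' + U" by (rule finite_cosets_reps[OF U'(1) okD(5)[OF F']])
    show ?thesis
    proof (rule okI)
      show "add_subgroup (F + F')" by (rule add_subgroup_plus[OF okD(1)[OF F] okD(1)[OF F']])
      show "F + F' <= Mell" by (rule set_plus_sub[OF Mell_subgroup okD(2)[OF F] okD(2)[OF F']])
      show "act a x \<in> F + F'" if "x \<in> F + F'" for a x
      proof -
        obtain y z where "y \<in> F" "z \<in> F'" "x = y + z" using \<open>x \<in> F + F'\<close> by (rule set_plus_elim)
        then show ?thesis using okD(3)[OF F] okD(3)[OF F'] by (simp add: act_add set_plus_intro)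
      qed
      show "U <= F + F'" using okD(4)[OF F] set_plus_left[OF add_subgroupD(1)[OF okD(1)[OF F']], of F] by blast
      show "finite (R + R')" using R(1) R'(1) by (rule finite_set_plus)
      show "F + F' <= (R + R') + U"
      proof
        fix x assume "x \<in> F + F'"
        then obtain y z where yz: "y \<in> F" "z \<in> F'" "x = y + z" by (rule set_plus_elim)
        obtain r u where ru: "r \<in> R" "u \<in> U" "y = r + u" using subsetD[OF R(3) yz(1)] by (rule set_plus_elim)
        obtain r' u' where ru': "r' \<in> R'" "u' \<in> U" "z = r' + u'" using subsetD[OF R'(3) yz(2)] by (rule set_plus_elim)
        have "x = (r + r') + (u + u')" using yz ru ru' by (simp add: add_ac)
        then show "x \<in> (R + R') + U"
          using set_plus_intro[OF set_plus_intro[OF ru(1) ru'(1)] add_subgroupD(2)[OF U'(1) ru(2) ru'(2)]] by simp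
      qed
    qed
  qed
  have FiD: "U <= Fi" "Fi <= Mell" unfolding Fi_def using okU okD(2) by blast+
  have sFi: "add_subgroup Fi" unfolding add_subgroup_def
  proof (intro conjI ballI)
    show "0 \<in> Fi" using FiD(1) add_subgroupD(1)[OF U'(1)] by blast
    show "- x \<in> Fi" if "x \<in> Fi" for x using that okD(1) add_subgroupD(3) unfolding Fi_def by blast
    show "x + y \<in> Fi" if xy: "x \<in> Fi" "y \<in> Fi" for x y
    proof -
      obtain F F' where "ok F" "x \<in> F" "ok F'" "y \<in> F'" using xy unfolding Fi_def by blast
      then show ?thesis unfolding Fi_def using ok_plus[of F F'] set_plus_intro[of x F y F'] by blast
    qed
  qed
  have Fiact: "act a x \<in> Fi" if "x \<in> Fi" for a x using that okD(3) unfolding Fi_def by blast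
  let ?V = "V0 + Fi"
  have sV: "add_subgroup ?V" by (rule add_subgroup_plus[OF V0_subgroup sFi])
  have "open {x. x - pV x \<in> W}"
    by (rule open_vimage_UNIV[OF _ W(1)]) (intro continuous_intros eqprojD(2)[OF pV(1)])
  moreover have "0 \<in> {x. x - pV x \<in> W}" using W(2) eqprojD(5)[OF pV(1)] by simp
  moreover have "{x. x - pV x \<in> W} <= ?V"
  proof
    fix x assume "x \<in> {x. x - pV x \<in> W}"
    then have "x - pV x \<in> Fi" using W(3) pV(3)[of x] FiD(1) by blast
    then have "pV x + (x - pV x) \<in> ?V" using pV(2) by (intro set_plus_intro) blast
    then show "x \<in> ?V" by simp
  qed
  ultimately have oV: "open ?V" by (rule open_subgroup[OF sV])
  have "submodule act UNIV ?V" unfolding submodule_def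
    using sV V0_act Fiact by (auto simp: act_add elim!: set_plus_elim intro!: set_plus_intro)
  moreover have "purely_discrete_quotient act UNIV ?V" unfolding purely_discrete_quotient_def
  proof (intro allI impI)
    fix F assume F: "submodule act UNIV F & ?V <= F & finite (cosets F ?V)"
    then have F': "add_subgroup F" "!!a x. x \<in> F ==> act a x \<in> F" "?V <= F" unfolding submodule_def by auto
    have V0F: "V0 <= F" using F'(3) set_plus_left[OF add_subgroupD(1)[OF sFi], of V0] by blast
    have cF: "closed F"
    proof (rule closed_open_subgroup[OF F'(1)])
      show "open F" by (rule open_subgroup[OF F'(1) oV add_subgroupD(1)[OF sV] F'(3)])
    qed
    obtain R where R: "finite R" "R <= F" "F <= R + ?V" using finite_cosets_reps[OF sV] F by blast
    define R1 where "R1 = (%r. r - pV r) ` R"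
    have pVF: "pV r \<in> F" for r using pV(2) V0F by blast
    have R1: "finite R1" "R1 <= F" "R1 <= Mell" unfolding R1_def
      using R(1,2) pV(3) pVF add_subgroupD(4)[OF F'(1)] by auto
    have FR: "\<exists>r\<in>R1. y - r \<in> ?V" if y: "y \<in> F" for y
    proof -
      have "y \<in> R + ?V" using R(3) y by blast
      then obtain r v where rv: "r \<in> R" "v \<in> ?V" "y = r + v" by (rule set_plus_elim)
      have "pV r + 0 \<in> ?V" using pV(2) add_subgroupD(1)[OF sFi] by (intro set_plus_intro) blast+
      then have "v + pV r \<in> ?V" using add_subgroupD(2)[OF sV rv(2)] by simp
      moreover have "y - (r - pV r) = v + pV r" using rv(3) by simp
      ultimately show ?thesis unfolding R1_def using rv(1) by (metis imageI)
    qed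
    obtain Q where Q: "compact Q" "add_subgroup Q" "R1 <= Q"
    proof (rule finite_elliptic[OF R1(1)])
      show "\<exists>C. compact C & add_subgroup C & x \<in> C" if "x \<in> R1" for x using that R1(3) unfolding Mell_def by blast
    qed
    define QF where "QF = Q Int F"
    have QF: "compact QF" "add_subgroup QF" "QF <= F" unfolding QF_def
      using compact_Int_closed[OF Q(1) cF] add_subgroup_Int[OF Q(2) F'(1)] by auto
    have QFM: "QF <= Mell" unfolding QF_def Mell_def using Q(1,2) by blast
    have "finite (cosets QF U)" by (rule finite_cosets_compact[OF QF(1,2) U'(1) W(1,2)]) (use W(3) QFM in blast)
    then obtain R2 where R2: "finite R2" "R2 <= QF" "QF <= R2 + U" using finite_cosets_reps[OF U'(1)] by blast
    have img: "\<exists>f\<in>Fi. act s r - f \<in> QF" if r: "r \<in> R2" for s r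
    proof -
      have rF: "act s r \<in> F" "act s r \<in> Mell" using r R2(2) QF(3) QFM F'(2) Mell_act by blast+
      obtain r1 where r1: "r1 \<in> R1" "act s r - r1 \<in> ?V" using FR[OF rF(1)] by blast
      obtain v f where vf: "v \<in> V0" "f \<in> Fi" "act s r - r1 = v + f" using r1(2) by (rule set_plus_elim)
      have "(act s r - r1) - f \<in> Mell" using rF(2) r1(1) R1(3) vf(2) FiD(2) add_subgroupD(4)[OF Mell_subgroup] by blast
      then have "v \<in> Mell" using vf(3) by simp
      then have "v = 0" using V0_Mell_trivial vf(1) by blast
      then have "act s r - f = r1" using vf(3) by (simp add: algebra_simps)
      moreover have "r1 \<in> QF" unfolding QF_def using r1(1) Q(3) R1(2) by blast
      ultimately show ?thesis using vf(2) by (intro bexI[of _ f]) simp_all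
    qed
    \<comment> \<open>Acting elements so close to 0 that they and their negatives move each of the
      finitely many representatives by an element of \<open>W\<close>.\<close>
    define Nb where "Nb = (\<Inter>r\<in>R2. {b. act b r - r \<in> W}) Int (\<Inter>r\<in>R2. {b. act (- b) r - r \<in> W})"
    have o1: "open {b. act b r - r \<in> W}" for r
      by (rule open_vimage_UNIV[OF _ W(1)]) (intro continuous_intros act_continuous2)
    have o2: "open {b. act (- b) r - r \<in> W}" for r
      using open_vimage_UNIV[OF _ o1[of r], of uminus] by (simp add: continuous_on_minus)
    have oNb: "open Nb" unfolding Nb_def by (intro open_Int open_INT R2(1) ballI o1 o2)
    have "0 \<in> Nb" unfolding Nb_def using W(2) by simp
    then obtain S' where S': "finite S'" and gen:
      "!!X a x. (!!b x. b \<in> Nb ==> x \<in> X ==> act b x \<in> X & act (- b) x \<in> X) ==>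
      (!!s x. s \<in> S' ==> x \<in> X ==> act s x \<in> X & act (- s) x \<in> X) ==> x \<in> X ==> act a x \<in> X"
      using generation[OF oNb] by blast
    define S2 where "S2 = S' \<union> uminus ` S'"
    have S2: "finite S2" unfolding S2_def using S' by simp
    have "\<exists>F1. ok F1 & (\<forall>p\<in>P. \<exists>f\<in>F1. act (fst p) (snd p) - f \<in> QF)" if "finite P" "P <= UNIV \<times> R2" for P
      using that
    proof (induction P rule: finite_induct)
      case empty then show ?case using okU by blast
    next
      case (insert p P)
      then obtain F1 where F1: "ok F1" "\<forall>p\<in>P. \<exists>f\<in>F1. act (fst p) (snd p) - f \<in> QF" by auto
      obtain f where f: "f \<in> Fi" "act (fst p) (snd p) - f \<in> QF" using img[of "snd p" "fst p"] insert.prems by auto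
      obtain F2 where F2: "ok F2" "f \<in> F2" using f(1) unfolding Fi_def by blast
      have "F1 <= F1 + F2" "F2 <= F1 + F2"
        using set_plus_left[OF add_subgroupD(1)[OF okD(1)[OF F2(1)]]] set_plus_right[OF add_subgroupD(1)[OF okD(1)[OF F1(1)]]] by blast+
      then show ?case using ok_plus[OF F1(1) F2(1)] F1(2) f(2) F2(2) by (intro exI[of _ "F1 + F2"]) (auto 0 3)
    qed
    from this[of "S2 \<times> R2"] obtain F1 where F1: "ok F1" "!!s r. s \<in> S2 ==> r \<in> R2 ==> \<exists>f\<in>F1. act s r - f \<in> QF"
      using S2 R2(1) by fastforce
    define X where "X = QF + F1"
    have sX: "add_subgroup X" unfolding X_def by (rule add_subgroup_plus[OF QF(2) okD(1)[OF F1(1)]])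
    have F1X: "F1 <= X" "QF <= X" unfolding X_def
      using set_plus_right[OF add_subgroupD(1)[OF QF(2)]] set_plus_left[OF add_subgroupD(1)[OF okD(1)[OF F1(1)]]] by blast+
    have decX: "\<exists>r\<in>R2. \<exists>f\<in>F1. y = r + f" if y: "y \<in> X" for y
    proof -
      obtain q f where qf: "q \<in> QF" "f \<in> F1" "y = q + f" using y unfolding X_def by (rule set_plus_elim)
      obtain r u where ru: "r \<in> R2" "u \<in> U" "q = r + u" using subsetD[OF R2(3) qf(1)] by (rule set_plus_elim)
      have "u + f \<in> F1" using add_subgroupD(2)[OF okD(1)[OF F1(1)]] okD(4)[OF F1(1)] ru(2) qf(2) by blast
      then show ?thesis using ru(1,3) qf(3) by (intro bexI[of _ r] bexI[of _ "u + f"]) (simp_all add: add.assoc)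
    qed
    have inv_of: "act s y \<in> X" if s: "!!r. r \<in> R2 ==> act s r \<in> X" and y: "y \<in> X" for s y
    proof -
      obtain r f where rf: "r \<in> R2" "f \<in> F1" "y = r + f" using decX[OF y] by blast
      have "act s f \<in> X" using okD(3)[OF F1(1) rf(2)] F1X by blast
      then show ?thesis unfolding rf(3) act_add using s[OF rf(1)] by (intro add_subgroupD(2)[OF sX])
    qed
    have S2X: "act s r \<in> X" if sr: "s \<in> S2" "r \<in> R2" for s r
    proof -
      obtain f where f: "f \<in> F1" "act s r - f \<in> QF" using F1(2)[OF sr] by blast
      have "(act s r - f) + f \<in> X" unfolding X_def by (rule set_plus_intro[OF f(2,1)])
      then show ?thesis by simp
    qed
    have NbX: "act b r \<in> X" if b: "act b r - r \<in> W" and r: "r \<in> R2" for b r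
    proof -
      have "act b r - r \<in> Mell" using r R2(2) QFM Mell_act by (intro add_subgroupD(4)[OF Mell_subgroup]) blast+
      then have "act b r - r \<in> X" using W(3) b okD(4)[OF F1(1)] F1X by blast
      moreover have "r \<in> X" using r R2(2) F1X by blast
      ultimately have "(act b r - r) + r \<in> X" by (rule add_subgroupD(2)[OF sX])
      then show ?thesis by simp
    qed
    have Xinv: "act a y \<in> X" if y: "y \<in> X" for a y
    proof (rule gen[OF _ _ y])
      fix b x assume b: "b \<in> Nb" and x: "x \<in> X"
      show "act b x \<in> X & act (- b) x \<in> X"
      proof
        show "act b x \<in> X" by (rule inv_of[OF NbX x]) (use b in \<open>auto simp: Nb_def\<close>)
        show "act (- b) x \<in> X" by (rule inv_of[OF NbX x]) (use b in \<open>auto simp: Nb_def\<close>)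
      qed
    next
      fix s x assume s: "s \<in> S'" and x: "x \<in> X"
      have "s \<in> S2" "- s \<in> S2" using s unfolding S2_def by auto
      then show "act s x \<in> X & act (- s) x \<in> X" using inv_of[OF S2X x] by blast
    qed
    obtain R3 where R3: "finite R3" "R3 <= F1" "F1 <= R3 + U" by (rule finite_cosets_reps[OF U'(1) okD(5)[OF F1(1)]])
    have "ok X"
    proof (rule okI[OF sX])
      show "X <= Mell" unfolding X_def by (rule set_plus_sub[OF Mell_subgroup QFM okD(2)[OF F1(1)]])
      show "act a x \<in> X" if "x \<in> X" for a x by (rule Xinv[OF that])
      show "U <= X" using okD(4)[OF F1(1)] F1X by blast
      show "finite (R2 + R3)" by (rule finite_set_plus[OF R2(1) R3(1)])
      show "X <= (R2 + R3) + U"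
      proof
        fix y assume "y \<in> X"
        then obtain r f where rf: "r \<in> R2" "f \<in> F1" "y = r + f" using decX by blast
        obtain t u where tu: "t \<in> R3" "u \<in> U" "f = t + u" using subsetD[OF R3(3) rf(2)] by (rule set_plus_elim)
        have "(r + t) + u \<in> (R2 + R3) + U" by (intro set_plus_intro rf(1) tu(1,2))
        then show "y \<in> (R2 + R3) + U" using rf(3) tu(3) by (simp add: add.assoc)
      qed
    qed
    then have R1Fi: "R1 <= Fi" unfolding Fi_def using Q(3) R1(2) F1X unfolding QF_def by blast
    have "F <= ?V"
    proof
      fix y assume "y \<in> F"
      then obtain r where r: "r \<in> R1" "y - r \<in> ?V" using FR by blast
      have "0 + r \<in> ?V" using add_subgroupD(1)[OF V0_subgroup] R1Fi r(1) by (intro set_plus_intro) blast+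
      from add_subgroupD(2)[OF sV r(2) this] show "y \<in> ?V" by simp
    qed
    then show "F = ?V" using F'(3) by blast
  qed
  ultimately have "?V = UNIV" by (rule Om[OF _ oV])
  then have "x \<in> ?V" by simp
  then obtain v f where vf: "v \<in> V0" "f \<in> Fi" "x = v + f" by (rule set_plus_elim)
  have "x - f \<in> Mell" using x vf(2) FiD(2) add_subgroupD(4)[OF Mell_subgroup] by blast
  then have "v \<in> Mell" using vf(3) by simp
  then have "v = 0" using V0_Mell_trivial vf(1) by blast
  then have "x \<in> Fi" using vf by simp
  then show ?thesis unfolding Fi_def ok_def by blast
qed

end

lemma contracting_on_subset: "contracting_on N \<phi> ==> M <= N ==> contracting_on M \<phi>"
  unfolding contracting_on_def by (meson subset_trans)

section \<open>Polycontractable projections\<close>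

context lc_module
begin

text \<open>Polycontractability in terms of mutually orthogonal idempotents, which makes adjoining a
  summand an addition of functions; \<open>polyc_polycontractable\<close> and
  \<open>polycontractable_polyc\<close> translate.\<close>

definition polyc :: "('m => 'm) => bool" where
  "polyc p \<longleftrightarrow> (\<exists>(k::nat) ps. (\<forall>i<k. eqproj (ps i) & contractable act (range (ps i))) &
     (\<forall>i<k. \<forall>j<k. i ~= j --> (\<forall>x. ps i (ps j x) = 0)) & (\<forall>x. p x = (\<Sum>i<k. ps i x)))"

lemma polyc_data:
  assumes "polyc p"
  obtains k :: nat and ps where "!!i. i < k ==> eqproj (ps i)" "!!i. i < k ==> contractable act (range (ps i))"
    "!!i j x. i < k ==> j < k ==> i ~= j ==> ps i (ps j x) = 0" "!!x. p x = (\<Sum>i<k. ps i x)"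
    "!!i x. i < k ==> ps i (p x) = ps i x" "!!i x. i < k ==> p (ps i x) = ps i x"
proof -
  obtain k :: nat and ps where d: "\<forall>i<k. eqproj (ps i) & contractable act (range (ps i))"
    "\<forall>i<k. \<forall>j<k. i ~= j --> (\<forall>x. ps i (ps j x) = 0)" "\<forall>x. p x = (\<Sum>i<k. ps i x)"
    using assms unfolding polyc_def by blast
  have e: "eqproj (ps i)" if "i < k" for i using d(1) that by blast
  have 1: "ps i (p x) = ps i x" if i: "i < k" for i x
  proof -
    have "ps i (p x) = (\<Sum>j<k. ps i (ps j x))" using d(3) eqprojD(8)[OF e[OF i]] by simp
    also have "\<dots> = (\<Sum>j<k. if j = i then ps i x else 0)"
      using d(2) i eqprojD(4)[OF e[OF i]] by (intro sum.cong) auto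
    finally show ?thesis using i by simp
  qed
  have 2: "p (ps i x) = ps i x" if i: "i < k" for i x
  proof -
    have "p (ps i x) = (\<Sum>j<k. ps j (ps i x))" using d(3) by simp
    also have "\<dots> = (\<Sum>j<k. if j = i then ps i x else 0)"
      using d(2) i eqprojD(4)[OF e[OF i]] by (intro sum.cong) auto
    finally show ?thesis using i by simp
  qed
  show ?thesis
  proof (rule that[of k ps])
    show "contractable act (range (ps i))" if "i < k" for i using d(1) that by blast
    show "ps i (ps j x) = 0" if "i < k" "j < k" "i ~= j" for i j x using d(2) that by blast
    show "p x = (\<Sum>i<k. ps i x)" for x using d(3) by blast
  qed (use e 1 2 in auto)
qed

lemma polyc_eqproj: assumes "polyc p" shows "eqproj p"
proof -
  obtain k :: nat and ps where d: "!!i. i < k ==> eqproj (ps i)" "!!x. p x = (\<Sum>i<k. ps i x)"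
    "!!i x. i < k ==> ps i (p x) = ps i x" using polyc_data[OF assms] by metis
  have pe: "p = (%x. \<Sum>i<k. ps i x)" using d(2) by blast
  show ?thesis unfolding eqproj_def
  proof (intro conjI allI)
    show "p (x + y) = p x + p y" for x y unfolding pe using eqprojD(1)[OF d(1)] by (simp add: sum.distrib)
    show "continuous_on UNIV p" unfolding pe using eqprojD(2)[OF d(1)] by (intro continuous_on_sum) auto
    show "p (act a x) = act a (p x)" for a x unfolding pe using eqprojD(3)[OF d(1)] by (simp add: act_sum)
    show "p (p x) = p x" for x
    proof -
      have "p (p x) = (\<Sum>i<k. ps i (p x))" by (rule d(2))
      also have "\<dots> = (\<Sum>i<k. ps i x)" using d(3) by (intro sum.cong) auto
      finally show ?thesis using d(2)[of x] by simp
    qed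
  qed
qed

lemma polyc_zero: "polyc (%_. 0)"
  unfolding polyc_def by (rule exI[of _ 0]) simp

lemma polyc_add:
  assumes p: "polyc p" and r: "eqproj r" "contractable act (range r)" and o: "!!x. p (r x) = 0" "!!x. r (p x) = 0"
  shows "polyc (%x. p x + r x)"
proof -
  obtain k :: nat and ps where d: "!!i. i < k ==> eqproj (ps i)" "!!i. i < k ==> contractable act (range (ps i))"
    "!!i j x. i < k ==> j < k ==> i ~= j ==> ps i (ps j x) = 0" "!!x. p x = (\<Sum>i<k. ps i x)"
    "!!i x. i < k ==> ps i (p x) = ps i x" "!!i x. i < k ==> p (ps i x) = ps i x" using polyc_data[OF p] by blast
  have 1: "ps i (r x) = 0" if "i < k" for i x
    using d(5)[OF that, of "r x"] o(1)[of x] eqprojD(5)[OF d(1)[OF that]] by simp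
  have 2: "r (ps i x) = 0" if "i < k" for i x using o(2)[of "ps i x"] d(6)[OF that] by simp
  define qs where "qs = ps(k := r)"
  have "(\<Sum>i<Suc k. qs i x) = p x + r x" for x
  proof -
    have "(\<Sum>i<k. qs i x) = (\<Sum>i<k. ps i x)" by (rule sum.cong) (auto simp: qs_def)
    then show ?thesis using d(4)[of x] by (simp add: qs_def)
  qed
  moreover have "\<forall>i<Suc k. eqproj (qs i) & contractable act (range (qs i))"
    unfolding qs_def using d(1,2) r by (auto simp: less_Suc_eq)
  moreover have "\<forall>i<Suc k. \<forall>j<Suc k. i ~= j --> (\<forall>x. qs i (qs j x) = 0)"
    unfolding qs_def using d(3) 1 2 by (auto simp: less_Suc_eq)
  ultimately show ?thesis unfolding polyc_def by (intro exI[of _ "Suc k"] exI[of _ qs]) simp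
qed

lemma polyc_add2:
  assumes p: "polyc p" and q: "polyc q" and o: "!!x. p (q x) = 0" "!!x. q (p x) = 0"
  shows "polyc (%x. p x + q x)"
proof -
  obtain k :: nat and ps where d: "!!i. i < k ==> eqproj (ps i)" "!!i. i < k ==> contractable act (range (ps i))"
    "!!i j x. i < k ==> j < k ==> i ~= j ==> ps i (ps j x) = 0" "!!x. q x = (\<Sum>i<k. ps i x)"
    "!!i x. i < k ==> ps i (q x) = ps i x" "!!i x. i < k ==> q (ps i x) = ps i x" using polyc_data[OF q] by blast
  have 1: "ps i (p x) = 0" if "i < k" for i x
    using d(5)[OF that, of "p x"] o(2)[of x] eqprojD(5)[OF d(1)[OF that]] by simp
  have 2: "p (ps i x) = 0" if "i < k" for i x using o(1)[of "ps i x"] d(6)[OF that] by simp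
  have "m \<le> k ==> polyc (%x. p x + (\<Sum>i<m. ps i x))" for m
  proof (induction m)
    case 0 then show ?case using p by simp
  next
    case (Suc m)
    have m: "m < k" using Suc by simp
    have a: "ps m (p x + (\<Sum>i<m. ps i x)) = 0" for x
      unfolding eqprojD(1,8)[OF d(1)[OF m]] using 1[OF m] d(3)[OF m] m by simp
    have b: "p (ps m x) + (\<Sum>i<m. ps i (ps m x)) = 0" for x using 2[OF m] d(3)[OF _ m] m by simp
    have "polyc (%x. (p x + (\<Sum>i<m. ps i x)) + ps m x)"
      by (rule polyc_add[OF Suc.IH d(1)[OF m] d(2)[OF m]]) (use m a b in auto)
    then show ?case by (simp add: add.assoc)
  qed
  from this[OF order_refl] show ?thesis using d(4) by simp
qed

end

section \<open>Naturality of the canonical pieces, and sheerness of summands\<close>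

context sheer_module
begin

text \<open>Compact subgroups are carried along by continuous homomorphisms. The next three facts
  say the same of orbits tending to 0, bounded orbits and paths; together they make projections for
  different elements commute.\<close>

lemma eqproj_Mell: assumes h: "eqproj h" and x: "x \<in> Mell" shows "h x \<in> Mell"
proof -
  obtain C where C: "compact C" "add_subgroup C" "x \<in> C" using x unfolding Mell_def by blast
  have "compact (h ` C)" by (rule compact_continuous_image[OF eqprojD(2)[OF h] C(1)])
  moreover have "add_subgroup (h ` C)" by (rule eqproj_image_subgroup[OF h C(2)])
  ultimately show ?thesis unfolding Mell_def using C(3) by blast
qed

lemma eqproj_con: assumes h: "eqproj h" and x: "x \<in> ell.con a" shows "h x \<in> ell.con a"
proof -
  have x': "x \<in> Mell" "(%n. pw a (int n) x) \<longlonglongrightarrow> 0" using x unfolding ell.con_def by auto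
  have "isCont h 0" using eqprojD(2)[OF h, of UNIV] by (simp add: continuous_on_eq_continuous_at)
  then have "(%n. h (pw a (int n) x)) \<longlonglongrightarrow> h 0" using x'(2) by (rule isCont_tendsto_compose)
  then show ?thesis unfolding ell.con_def using eqproj_Mell[OF h x'(1)] by (simp add: eqprojD(3,5)[OF h])
qed

lemma eqproj_Mb: assumes h: "eqproj h" and x: "x \<in> ell.Mb a" shows "h x \<in> ell.Mb a"
proof -
  obtain C where C: "x \<in> Mell" "compact C" "add_subgroup C" "!!k. pw a k x \<in> C" using x unfolding ell.Mb_def by blast
  have "compact (h ` C)" by (rule compact_continuous_image[OF eqprojD(2)[OF h] C(2)])
  moreover have "add_subgroup (h ` C)" by (rule eqproj_image_subgroup[OF h C(3)])
  moreover have "pw a k (h x) \<in> h ` C" for k using C(4)[of k] by (simp add: eqprojD(3)[OF h, symmetric])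
  ultimately show ?thesis unfolding ell.Mb_def using eqproj_Mell[OF h C(1)] by blast
qed

lemma eqproj_V0: assumes h: "eqproj h" and x: "x \<in> V0" shows "h x \<in> V0"
proof -
  obtain \<phi> where \<phi>: "oneparam \<phi>" "x = \<phi> 1" using x by (rule V0_E)
  from V0_mem[OF oneparam_hom[OF \<phi>(1) eqprojD(2,1)[OF h]], of 1] show ?thesis using \<phi>(2) by simp
qed

text \<open>Pulling an open submodule of the range back along \<open>e\<close> gives an open
  submodule of the whole module with the same quotient, so finite extensions correspond; compact
  submodules of the range are submodules of the whole.\<close>

lemma sheer_summand: assumes e: "eqproj e" shows "sheer act (range e)"
proof -
  let ?E = "range e"
  have sE: "add_subgroup ?E" "!!a x. x \<in> ?E ==> act a x \<in> ?E" using eqproj_range_subgroup[OF e] eqproj_range_act[OF e] by auto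
  have "W_flat act ?E = {0}"
  proof -
    have "K = {0}" if "submodule act ?E K & compact_parafinite act K" for K
      using that W[of K] unfolding submodule_def by blast
    then have "\<Union>{K. submodule act ?E K & compact_parafinite act K} <= {0}" by blast
    then have "W_flat act ?E <= {0}" unfolding W_flat_def by (rule generated_least[OF add_subgroup_singleton])
    moreover have "0 \<in> W_flat act ?E" unfolding W_flat_def by (rule add_subgroupD(1)[OF add_subgroup_generated])
    ultimately show ?thesis by blast
  qed
  moreover have "Omega_sharp act ?E = ?E"
  proof -
    have UE: "U = ?E" if U: "open_submodule act ?E U" "purely_discrete_quotient act ?E U" for U
    proof -
      have U': "U <= ?E" "add_subgroup U" "!!a x. x \<in> U ==> act a x \<in> U" "openin (top_of_set ?E) U"
        using U(1) unfolding open_submodule_def submodule_def by auto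
      obtain T where T: "open T" "U = ?E Int T" using U'(4) unfolding openin_open by blast
      define P where "P = {x. e x \<in> U}"
      have "P = {x. e x \<in> T}" unfolding P_def T(2) by blast
      then have "open P" using open_vimage_UNIV[OF eqprojD(2)[OF e] T(1)] by simp
      moreover have "submodule act UNIV P" unfolding submodule_def add_subgroup_def
      proof (intro conjI ballI allI)
        show "0 \<in> P" unfolding P_def using add_subgroupD(1)[OF U'(2)] by (simp add: eqprojD(5)[OF e])
        show "x + y \<in> P" if "x \<in> P" "y \<in> P" for x y
          using that add_subgroupD(2)[OF U'(2)] unfolding P_def by (simp add: eqprojD(1)[OF e])
        show "- x \<in> P" if "x \<in> P" for x
          using that add_subgroupD(3)[OF U'(2)] unfolding P_def by (simp add: eqprojD(7)[OF e])
        show "act a x \<in> P" if "x \<in> P" for a x using that U'(3) unfolding P_def by (simp add: eqprojD(3)[OF e])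
      qed simp
      moreover have "purely_discrete_quotient act UNIV P" unfolding purely_discrete_quotient_def
      proof (intro allI impI)
        fix F assume F: "submodule act UNIV F & P <= F & finite (cosets F P)"
        then have F': "add_subgroup F" "!!a x. x \<in> F ==> act a x \<in> F" unfolding submodule_def by auto
        have sP: "add_subgroup P" using \<open>submodule act UNIV P\<close> unfolding submodule_def by blast
        have keP: "x - e x \<in> P" for x unfolding P_def using add_subgroupD(1)[OF U'(2)] by (simp add: eqprojD(4,6)[OF e])
        have eF: "e x \<in> F" if x: "x \<in> F" for x
        proof -
          have "x - e x \<in> F" using keP F by blast
          from add_subgroupD(4)[OF F'(1) x this] have "x - (x - e x) \<in> F" .
          then show ?thesis by simp
        qed
        define F2 where "F2 = F Int ?E"
        have UF2: "U <= F2"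
        proof
          fix x assume x: "x \<in> U"
          then have ex: "e x = x" using U'(1) eqproj_range[OF e] by blast
          then have "x \<in> P" unfolding P_def using x by simp
          then show "x \<in> F2" unfolding F2_def using F x U'(1) by blast
        qed
        obtain R where R: "finite R" "R <= F" "F <= R + P" using finite_cosets_reps[OF sP] F by blast
        have "F2 <= e ` R + U"
        proof
          fix x assume x: "x \<in> F2"
          then have "x \<in> R + P" using R(3) unfolding F2_def by blast
          then obtain r p where rp: "r \<in> R" "p \<in> P" "x = r + p" by (rule set_plus_elim)
          have "x = e x" using x eqproj_range[OF e] unfolding F2_def by simp
          then have "x = e r + e p" using rp(3) eqprojD(1)[OF e] by simp
          moreover have "e p \<in> U" using rp(2) unfolding P_def by blast
          ultimately show "x \<in> e ` R + U" using set_plus_intro[OF imageI[OF rp(1), of e], of "e p" U] by simp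
        qed
        then have "finite (cosets F2 U)" using R(1) by (intro finite_cosets_of_reps[OF U'(2), of "e ` R"]) simp_all
        moreover have "submodule act ?E F2" unfolding submodule_def F2_def
          using add_subgroup_Int[OF F'(1) sE(1)] F'(2) sE(2) by blast
        ultimately have "F2 = U" using U(2) UF2 unfolding purely_discrete_quotient_def by blast
        then have "F <= P" using eF unfolding F2_def P_def by blast
        then show "F = P" using F by blast
      qed
      ultimately have "P = UNIV" using Om by blast
      then have "?E <= U" unfolding P_def by blast
      then show ?thesis using U'(1) by blast
    qed
    have "open_submodule act ?E ?E" unfolding open_submodule_def submodule_def using sE by auto
    moreover have "purely_discrete_quotient act ?E ?E" unfolding purely_discrete_quotient_def submodule_def by blast
    ultimately have "{U. open_submodule act ?E U & purely_discrete_quotient act ?E U} = {?E}" using UE by blast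
    then show ?thesis unfolding Omega_sharp_def by simp
  qed
  ultimately show ?thesis unfolding sheer_def by blast
qed

end

section \<open>Splitting the elliptic part along generators\<close>

context cg_module
begin

lemma Mell_split: assumes "x \<in> Mell" obtains c c' m where "c \<in> ell.con a" "c' \<in> ell.con (- a)" "m \<in> ell.Mb a" "x = c + (c' + m)"
proof -
  have "Mell <= ell.con a + (ell.con (- a) + ell.Mb a)" by (rule ell.split_all) (rule locally_finite)
  then have "x \<in> ell.con a + (ell.con (- a) + ell.Mb a)" using assms by blast
  then show ?thesis using that by (auto elim!: set_plus_elim)
qed

text \<open>Both projections come from the global splitting into \<open>V0\<close>, the two
  contraction groups and the bounded part, with continuity from \<open>split_small\<close>. The
  projection onto \<open>ell.con (- a)\<close> is obtained by using the statement for
  \<open>- a\<close>.\<close>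

lemma split_projections:
  obtains q b where "eqproj q" "range q = ell.con a" "!!x. x \<in> V0 ==> q x = 0" "!!x. x \<in> ell.con (- a) ==> q x = 0" "!!x. x \<in> ell.Mb a ==> q x = 0"
    "eqproj b" "range b = ell.Mb a" "!!x. x \<in> V0 ==> b x = 0" "!!x. x \<in> ell.con a ==> b x = 0" "!!x. x \<in> ell.con (- a) ==> b x = 0"
proof -
  obtain pV where pV: "eqproj pV" "range pV = V0" "!!x. x - pV x \<in> Mell" "!!x. x \<in> Mell ==> pV x = 0"
    using Euclidean_projection by metis
  let ?A = "ell.con a" and ?B = "ell.con (- a)" and ?C = "ell.Mb a"
  have sub: "add_subgroup ?A" "add_subgroup ?B" "add_subgroup ?C" by (intro ell.con_subgroup ell.Mb_subgroup)+
  have inM: "?A <= Mell" "?B <= Mell" "?C <= Mell" using ell.con_G ell.Mb_G by blast+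
  have uniq: "c = 0" "c' = 0" "m = 0" "v = 0" if h: "c \<in> ?A" "c' \<in> ?B" "m \<in> ?C" "v \<in> V0" "v + (c + (c' + m)) = 0" for c c' m v
  proof -
    have M: "c + (c' + m) \<in> Mell" using h(1-3) inM by (intro add_subgroupD(2)[OF Mell_subgroup]) auto
    have "v = - (c + (c' + m))" using h(5) by (rule eq_neg_iff_add_eq_0[THEN iffD2])
    then have "v \<in> Mell" using add_subgroupD(3)[OF Mell_subgroup M] by simp
    then show v: "v = 0" using V0_Mell_trivial h(4) by blast
    then have "c + (c' + m) = 0" using h(5) by simp
    then show "c = 0" "c' = 0" "m = 0" using ell.split_unique[OF h(1-3)] by auto
  qed
  have all: "\<exists>c\<in>?A. \<exists>c'\<in>?B. \<exists>m\<in>?C. x - pV x = c + (c' + m)" for x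
    using Mell_split[OF pV(3)[of x], of a] by metis
  have small: "\<exists>W. open W & 0 \<in> W & (\<forall>v c c' m. v \<in> V0 --> c \<in> ?A --> c' \<in> ?B --> m \<in> ?C --> v + (c + (c' + m)) \<in> W --> c \<in> U & m \<in> U)"
    if U: "open U" "0 \<in> U" for U
  proof -
    obtain W where W: "open W" "0 \<in> W"
      "!!c c' m. c + (c' + m) \<in> W ==> c \<in> ?A ==> c' \<in> ?B ==> m \<in> ?C ==> c \<in> U & c' \<in> U & m \<in> U"
      using ell.split_small[OF U, of a] by metis
    have "open {x. x - pV x \<in> W}" by (rule open_vimage_UNIV[OF _ W(1)]) (intro continuous_intros eqprojD(2)[OF pV(1)])
    moreover have "0 \<in> {x. x - pV x \<in> W}" using W(2) eqprojD(5)[OF pV(1)] by simp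
    moreover have "c \<in> U & m \<in> U" if h: "v \<in> V0" "c \<in> ?A" "c' \<in> ?B" "m \<in> ?C" "v + (c + (c' + m)) \<in> {x. x - pV x \<in> W}" for v c c' m
    proof -
      have "c + (c' + m) \<in> Mell" using h(2-4) inM by (intro add_subgroupD(2)[OF Mell_subgroup]) auto
      then have "pV (c + (c' + m)) = 0" by (rule pV(4))
      moreover have "pV v = v" using eqproj_range[OF pV(1)] pV(2) h(1) by blast
      ultimately have "pV (v + (c + (c' + m))) = v" using eqprojD(1)[OF pV(1), of v "c + (c' + m)"] by simp
      then have "c + (c' + m) \<in> W" using h(5) by simp
      then show ?thesis using W(3) h by blast
    qed
    ultimately show ?thesis by blast
  qed
  have q: "\<exists>q. eqproj q & range q = ?A & (\<forall>x\<in>V0 + (?B + ?C). q x = 0)"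
  proof (rule eqproj_exists[of ?A "V0 + (?B + ?C)"])
    show "add_subgroup (V0 + (?B + ?C))" by (intro add_subgroup_plus V0_subgroup sub)
    show "act d x \<in> V0 + (?B + ?C)" if "x \<in> V0 + (?B + ?C)" for d x
      using that V0_act ell.con_act ell.Mb_act by (auto simp: act_add elim!: set_plus_elim intro!: set_plus_intro)
    show "?A Int (V0 + (?B + ?C)) <= {0}"
    proof
      fix x assume x: "x \<in> ?A Int (V0 + (?B + ?C))"
      then obtain v c' m where h: "v \<in> V0" "c' \<in> ?B" "m \<in> ?C" "x = v + (c' + m)" by (auto elim!: set_plus_elim)
      have "v + (- x + (c' + m)) = 0" using h(4) by (simp add: algebra_simps)
      then have "- x = 0" using uniq(1)[OF _ h(2,3,1)] x add_subgroupD(3)[OF sub(1)] by blast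
      then show "x \<in> {0}" by simp
    qed
    show "\<exists>y\<in>?A. x - y \<in> V0 + (?B + ?C)" for x
    proof -
      obtain c c' m where h: "c \<in> ?A" "c' \<in> ?B" "m \<in> ?C" "x - pV x = c + (c' + m)" using all by blast
      have "pV x + (c' + m) \<in> V0 + (?B + ?C)" using h pV(2) by (intro set_plus_intro) blast+
      moreover have "x - c = pV x + (c' + m)" using h(4) by (simp add: algebra_simps)
      ultimately show ?thesis using h(1) by (intro bexI[of _ c]) simp_all
    qed
    show "\<exists>W. open W & 0 \<in> W & (\<forall>x\<in>W. \<forall>y\<in>?A. x - y \<in> V0 + (?B + ?C) --> y \<in> U)" if U: "open U" "0 \<in> U" for U
    proof -
      obtain W where W: "open W" "0 \<in> W" "!!v c c' m. v \<in> V0 ==> c \<in> ?A ==> c' \<in> ?B ==> m \<in> ?C ==> v + (c + (c' + m)) \<in> W ==> c \<in> U & m \<in> U"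
        using small[OF U] by blast
      have "y \<in> U" if xy: "x \<in> W" "y \<in> ?A" "x - y \<in> V0 + (?B + ?C)" for x y
      proof -
        obtain v c' m where h: "v \<in> V0" "c' \<in> ?B" "m \<in> ?C" "x - y = v + (c' + m)" using xy(3) by (auto elim!: set_plus_elim)
        have "v + (y + (c' + m)) = x" using h(4) by (simp add: algebra_simps)
        then show ?thesis using W(3)[OF h(1) xy(2) h(2,3)] xy(1) by simp
      qed
      then show ?thesis using W(1,2) by blast
    qed
    fix p assume "eqproj p" "range p = ?A" "!!x. x \<in> V0 + (?B + ?C) ==> p x = 0"
    then show ?thesis by (intro exI[of _ p]) simp
  qed (use sub ell.con_act in auto)
  have b: "\<exists>b. eqproj b & range b = ?C & (\<forall>x\<in>V0 + (?A + ?B). b x = 0)"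
  proof (rule eqproj_exists[of ?C "V0 + (?A + ?B)"])
    show "add_subgroup (V0 + (?A + ?B))" by (intro add_subgroup_plus V0_subgroup sub)
    show "act d x \<in> V0 + (?A + ?B)" if "x \<in> V0 + (?A + ?B)" for d x
      using that V0_act ell.con_act by (auto simp: act_add elim!: set_plus_elim intro!: set_plus_intro)
    show "?C Int (V0 + (?A + ?B)) <= {0}"
    proof
      fix x assume x: "x \<in> ?C Int (V0 + (?A + ?B))"
      then obtain v c c' where h: "v \<in> V0" "c \<in> ?A" "c' \<in> ?B" "x = v + (c + c')" by (auto elim!: set_plus_elim)
      have "v + (c + (c' + - x)) = 0" using h(4) by (simp add: algebra_simps)
      then have "- x = 0" using uniq(3)[OF h(2,3) _ h(1)] x add_subgroupD(3)[OF sub(3)] by blast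
      then show "x \<in> {0}" by simp
    qed
    show "\<exists>y\<in>?C. x - y \<in> V0 + (?A + ?B)" for x
    proof -
      obtain c c' m where h: "c \<in> ?A" "c' \<in> ?B" "m \<in> ?C" "x - pV x = c + (c' + m)" using all by blast
      have "pV x + (c + c') \<in> V0 + (?A + ?B)" using h pV(2) by (intro set_plus_intro) blast+
      moreover have "x - m = pV x + (c + c')" using h(4) by (simp add: algebra_simps)
      ultimately show ?thesis using h(3) by (intro bexI[of _ m]) simp_all
    qed
    show "\<exists>W. open W & 0 \<in> W & (\<forall>x\<in>W. \<forall>y\<in>?C. x - y \<in> V0 + (?A + ?B) --> y \<in> U)" if U: "open U" "0 \<in> U" for U
    proof -
      obtain W where W: "open W" "0 \<in> W" "!!v c c' m. v \<in> V0 ==> c \<in> ?A ==> c' \<in> ?B ==> m \<in> ?C ==> v + (c + (c' + m)) \<in> W ==> c \<in> U & m \<in> U"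
        using small[OF U] by blast
      have "y \<in> U" if xy: "x \<in> W" "y \<in> ?C" "x - y \<in> V0 + (?A + ?B)" for x y
      proof -
        obtain v c c' where h: "v \<in> V0" "c \<in> ?A" "c' \<in> ?B" "x - y = v + (c + c')" using xy(3) by (auto elim!: set_plus_elim)
        have "v + (c + (c' + y)) = x" using h(4) by (simp add: algebra_simps)
        then show ?thesis using W(3)[OF h(1,2,3) xy(2)] xy(1) by simp
      qed
      then show ?thesis using W(1,2) by blast
    qed
    fix p assume "eqproj p" "range p = ?C" "!!x. x \<in> V0 + (?A + ?B) ==> p x = 0"
    then show ?thesis by (intro exI[of _ p]) simp
  qed (use sub ell.Mb_act in auto)
  obtain q' where q': "eqproj q'" "range q' = ?A" "!!x. x \<in> V0 + (?B + ?C) ==> q' x = 0" using q by blast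
  obtain b' where b': "eqproj b'" "range b' = ?C" "!!x. x \<in> V0 + (?A + ?B) ==> b' x = 0" using b by blast
  have in3: "x \<in> X + (Y + Z)" if "add_subgroup X" "add_subgroup Y" "add_subgroup Z" "x \<in> X \<or> x \<in> Y \<or> x \<in> Z" for X Y Z and x :: 'b
    using that set_plus_left[OF add_subgroupD(1)[OF add_subgroup_plus[OF that(2,3)]], of X]
      set_plus_right[OF add_subgroupD(1)[OF that(1)], of "Y + Z"]
      set_plus_left[OF add_subgroupD(1)[OF that(3)], of Y] set_plus_right[OF add_subgroupD(1)[OF that(2)], of Z] by blast
  show ?thesis
    by (rule that[OF q'(1,2) _ _ _ b'(1,2)])
      (use q'(3)[OF in3[OF V0_subgroup sub(2,3)]] b'(3)[OF in3[OF V0_subgroup sub(1,2)]] in auto)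
qed

text \<open>The summand of \<open>e\<close> is refined by the splitting for \<open>a\<close>: its
  two contracted parts join \<open>p\<close>, its bounded part becomes the new \<open>e'\<close>.
  Orthogonality holds because the splitting projections commute with every equivariant
  projection.\<close>

lemma split_step:
  assumes e: "eqproj e" "range e <= Mell" and p: "polyc p" and o: "!!x. p (e x) = 0" "!!x. e (p x) = 0"
  obtains p' e' where "polyc p'" "eqproj e'" "range e' <= range e" "range e' <= ell.Mb a" "!!x. p' x + e' x = p x + e x"
    "!!x. p' (e' x) = 0" "!!x. e' (p' x) = 0"
proof -
  obtain q b where q: "eqproj q" "range q = ell.con a" "!!x. x \<in> V0 ==> q x = 0" "!!x. x \<in> ell.con (- a) ==> q x = 0" "!!x. x \<in> ell.Mb a ==> q x = 0"
    and b: "eqproj b" "range b = ell.Mb a" "!!x. x \<in> V0 ==> b x = 0" "!!x. x \<in> ell.con a ==> b x = 0" "!!x. x \<in> ell.con (- a) ==> b x = 0"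
  proof (rule split_projections[of a])
    fix q b assume "eqproj q" "range q = ell.con a" "!!x. x \<in> V0 ==> q x = 0" "!!x. x \<in> ell.con (- a) ==> q x = 0" "!!x. x \<in> ell.Mb a ==> q x = 0"
      "eqproj b" "range b = ell.Mb a" "!!x. x \<in> V0 ==> b x = 0" "!!x. x \<in> ell.con a ==> b x = 0" "!!x. x \<in> ell.con (- a) ==> b x = 0"
    then show thesis by (rule that)
  qed
  obtain q' where q': "eqproj q'" "range q' = ell.con (- a)" "!!x. x \<in> V0 ==> q' x = 0" "!!x. x \<in> ell.con a ==> q' x = 0" "!!x. x \<in> ell.Mb a ==> q' x = 0"
  proof (rule split_projections[of "- a"])
    fix q b assume "eqproj q" "range q = ell.con (- a)" "!!x. x \<in> V0 ==> q x = 0" "!!x. x \<in> ell.con (- (- a)) ==> q x = 0" "!!x. x \<in> ell.Mb (- a) ==> q x = 0"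
    then show thesis using that[of q] by (simp add: ell.Mb_uminus)
  qed
  have qx: "q y = y" if "y \<in> ell.con a" for y using that eqproj_range[OF q(1)] q(2) by blast
  have q'x: "q' y = y" if "y \<in> ell.con (- a)" for y using that eqproj_range[OF q'(1)] q'(2) by blast
  have bx: "b y = y" if "y \<in> ell.Mb a" for y using that eqproj_range[OF b(1)] b(2) by blast
  obtain pV where pV: "eqproj pV" "range pV = V0" "!!x. x - pV x \<in> Mell" "!!x. x \<in> Mell ==> pV x = 0"
    using Euclidean_projection by metis
  have dec: "\<exists>v c c' m. v \<in> V0 & c \<in> ell.con a & c' \<in> ell.con (- a) & m \<in> ell.Mb a & x = v + (c + (c' + m))" for x
  proof -
    obtain c c' m where h: "c \<in> ell.con a" "c' \<in> ell.con (- a)" "m \<in> ell.Mb a" "x - pV x = c + (c' + m)"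
      using Mell_split[OF pV(3)[of x], of a] by metis
    have "x = pV x + (c + (c' + m))" using h(4) by (simp add: algebra_simps)
    then show ?thesis using h pV(2) by blast
  qed
  have comp: "q x = c & q' x = c' & b x = m" if "v \<in> V0" "c \<in> ell.con a" "c' \<in> ell.con (- a)" "m \<in> ell.Mb a" "x = v + (c + (c' + m))" for x v c c' m
    using that q(3-5) q'(3-5) b(3-5) qx q'x bx by (simp add: eqprojD(1)[OF q(1)] eqprojD(1)[OF q'(1)] eqprojD(1)[OF b(1)])
  \<comment> \<open>\<open>h\<close> preserves each of the four pieces, so it respects the unique
    decomposition of \<open>x\<close>.\<close>
  have comm: "h (q x) = q (h x) & h (q' x) = q' (h x) & h (b x) = b (h x)" if h: "eqproj h" for h x
  proof -
    obtain v c c' m where d: "v \<in> V0" "c \<in> ell.con a" "c' \<in> ell.con (- a)" "m \<in> ell.Mb a" "x = v + (c + (c' + m))" using dec by blast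
    have "h x = h v + (h c + (h c' + h m))" using d(5) by (simp add: eqprojD(1)[OF h])
    then show ?thesis
      using comp[OF d] comp[OF eqproj_V0[OF h d(1)] eqproj_con[OF h d(2)] eqproj_con[OF h d(3)] eqproj_Mb[OF h d(4)]] by simp
  qed
  have sum: "e x = q (e x) + q' (e x) + b (e x)" for x
  proof -
    have "e x \<in> Mell" using e(2) by blast
    then obtain c c' m where d: "c \<in> ell.con a" "c' \<in> ell.con (- a)" "m \<in> ell.Mb a" "e x = c + (c' + m)" by (rule Mell_split[of _ a])
    then show ?thesis using comp[of 0 c c' m "e x"] add_subgroupD(1)[OF V0_subgroup] by (simp add: add.assoc)
  qed
  have rq: "q x \<in> ell.con a" "q' x \<in> ell.con (- a)" "b x \<in> ell.Mb a" for x
    unfolding q(2)[symmetric] q'(2)[symmetric] b(2)[symmetric] by (rule rangeI)+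
  have qb: "q (b x) = 0" "q' (b x) = 0" "b (q x) = 0" "b (q' x) = 0" "q (q' x) = 0" "q' (q x) = 0" for x
    by (rule q(5)[OF rq(3)] q'(5)[OF rq(3)] b(4)[OF rq(1)] b(5)[OF rq(2)] q(4)[OF rq(2)] q'(4)[OF rq(1)])+
  define r1 where "r1 x = q (e x)" for x
  define r2 where "r2 x = q' (e x)" for x
  define e' where "e' x = b (e x)" for x
  have er: "eqproj r1" "eqproj r2" "eqproj e'"
    unfolding r1_def[abs_def] r2_def[abs_def] e'_def[abs_def]
    by (rule eqproj_comp[OF q(1) e(1)] eqproj_comp[OF q'(1) e(1)] eqproj_comp[OF b(1) e(1)], simp only: comm[OF e(1)])+
  have ctr: "contractable act (range r1)" "contractable act (range r2)"
  proof -
    have "range r1 <= ell.con a" "range r2 <= ell.con (- a)" unfolding r1_def r2_def using q(2) q'(2) by blast+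
    then show "contractable act (range r1)" "contractable act (range r2)" unfolding contractable_def
      using contracting_on_subset[OF ell.con_contracting] by blast+
  qed
  have z: "q 0 = 0" "q' 0 = 0" "b 0 = 0" "e 0 = 0" "p 0 = 0" using eqprojD(5) q(1) q'(1) b(1) e(1) polyc_eqproj[OF p] by auto
  have ee: "e (e x) = e x" for x by (rule eqprojD(4)[OF e(1)])
  have ce: "q (e x) = e (q x)" "q' (e x) = e (q' x)" "b (e x) = e (b x)" for x using comm[OF e(1)] by auto
  have p1: "polyc (%x. p x + r1 x)"
    by (rule polyc_add[OF p er(1) ctr(1)]) (unfold r1_def, simp_all add: o z, simp add: ce o)
  have p2: "polyc (%x. (p x + r1 x) + r2 x)"
  proof (rule polyc_add[OF p1 er(2) ctr(2)])
    show "p (r2 x) + r1 (r2 x) = 0" for x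
    proof -
      have "p (r2 x) = 0" unfolding r2_def ce by (rule o(1))
      moreover have "r1 (r2 x) = 0" unfolding r1_def r2_def ce(2) ee unfolding ce(2)[symmetric] qb(5) by simp
      ultimately show ?thesis by simp
    qed
    show "r2 (p x + r1 x) = 0" for x
    proof -
      have "r2 (p x) = 0" unfolding r2_def o z by simp
      moreover have "r2 (r1 x) = 0" unfolding r1_def r2_def ce(1) ee unfolding ce(1)[symmetric] qb(6) by simp
      ultimately show ?thesis by (simp add: eqprojD(1)[OF er(2)])
    qed
  qed
  show ?thesis
  proof (rule that[OF p2 er(3)])
    show "range e' <= range e" unfolding e'_def ce by blast
    show "range e' <= ell.Mb a" unfolding e'_def using b(2) by blast
    show "p x + r1 x + r2 x + e' x = p x + e x" for x using sum[of x] unfolding r1_def r2_def e'_def by (simp add: add.assoc)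
    show "p (e' x) + r1 (e' x) + r2 (e' x) = 0" for x
    proof -
      have "p (e' x) = 0" unfolding e'_def ce by (rule o(1))
      moreover have "r1 (e' x) = 0" unfolding r1_def e'_def ce(3) ee unfolding ce(3)[symmetric] qb(1) by simp
      moreover have "r2 (e' x) = 0" unfolding r2_def e'_def ce(3) ee unfolding ce(3)[symmetric] qb(2) by simp
      ultimately show ?thesis by simp
    qed
    show "e' (p x + r1 x + r2 x) = 0" for x
    proof -
      have "e' (p x) = 0" unfolding e'_def o z by simp
      moreover have "e' (r1 x) = 0" unfolding r1_def e'_def ce(1) ee unfolding ce(1)[symmetric] qb(3) by simp
      moreover have "e' (r2 x) = 0" unfolding r2_def e'_def ce(2) ee unfolding ce(2)[symmetric] qb(4) by simp
      ultimately show ?thesis by (simp add: eqprojD(1)[OF er(3)])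
    qed
  qed
qed

text \<open>On the residual summand every generator \<open>s\<close> has bounded orbits, so the
  two-sided core for \<open>s\<close> of a compact open subgroup is again compact and open. Cores
  are taken one generator at a time; commutativity keeps the invariance already obtained under the
  neighbourhood \<open>Nb\<close> and the earlier generators.\<close>

lemma elliptic_decomposition:
  obtains p e where "polyc p" "eqproj e" "amorphic act (range e)" "range e <= Mell" "!!x. x \<in> V0 ==> p x = 0" "!!x. x \<in> V0 ==> e x = 0"
    "!!x. x \<in> Mell ==> p x + e x = x" "!!x. p (e x) = 0" "!!x. e (p x) = 0" "range p <= Mell"
proof -
  obtain pV where pV: "eqproj pV" "range pV = V0" "!!x. x - pV x \<in> Mell" "!!x. x \<in> Mell ==> pV x = 0"
    using Euclidean_projection by metis
  define e0 where "e0 x = x - pV x" for x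
  have e0: "eqproj e0" "range e0 <= Mell" unfolding e0_def[abs_def] using eqproj_compl[OF pV(1)] pV(3) by auto
  obtain K where K: "ell.copen K" using ell.copen_basis[of UNIV] by auto
  obtain W where W: "open W" "0 \<in> W" "W Int Mell <= K" and K': "compact K" "add_subgroup K" "K <= Mell" using K unfolding ell.copen_def by blast
  define P where "P = {z::'a \<times> 'b. act (fst z) (snd z) - snd z \<in> W}"
  have "continuous_on UNIV (%z::'a \<times> 'b. act (fst z) (snd z) - snd z)" by (intro continuous_intros act_joint)
  then have "open P" unfolding P_def by (rule open_vimage_UNIV[OF _ W(1)])
  moreover have "{0} \<times> K <= P" unfolding P_def using W(2) by auto
  \<comment> \<open>The tube lemma: compactness of \<open>K\<close> gives one neighbourhood of 0 in
    \<open>A\<close> that moves every point of \<open>K\<close> by an element of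
    \<open>W\<close>.\<close>
  ultimately have "\<exists>X0. 0 \<in> X0 & open X0 & X0 \<times> K <= P" by (rule Elementary_Topology.tube_lemma[OF K'(1)])
  then obtain Nb0 where Nb0: "0 \<in> Nb0" "open Nb0" "Nb0 \<times> K <= P" by (elim exE conjE)
  have stab: "act b x \<in> K" if "b \<in> Nb0" "x \<in> K" for b x
  proof -
    have "act b x - x \<in> W" using Nb0(3) that unfolding P_def by auto
    moreover have "act b x - x \<in> Mell" using Mell_act K'(3) that(2) by (intro add_subgroupD(4)[OF Mell_subgroup]) blast+
    ultimately have "act b x - x \<in> K" using W(3) by blast
    from add_subgroupD(2)[OF K'(2) this that(2)] show ?thesis by simp
  qed
  define Nb where "Nb = Nb0 Int {b. - b \<in> Nb0}"
  have oNb: "open Nb" "0 \<in> Nb" unfolding Nb_def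
    using Nb0 open_vimage_UNIV[OF _ Nb0(2), of uminus] by (auto simp: continuous_on_minus)
  obtain S' where S': "finite S'" and gen:
      "!!X a x. (!!b x. b \<in> Nb ==> x \<in> X ==> act b x \<in> X & act (- b) x \<in> X) ==>
      (!!s x. s \<in> S' ==> x \<in> X ==> act s x \<in> X & act (- s) x \<in> X) ==> x \<in> X ==> act a x \<in> X"
    using generation[OF oNb] by blast
  have "\<exists>p e. polyc p & eqproj e & range e <= Mell & (\<forall>s\<in>S'. range e <= ell.Mb s) & (\<forall>x. p x + e x = e0 x & p (e x) = 0 & e (p x) = 0)"
    using S'
  proof (induction S' rule: finite_induct)
    case empty
    show ?case by (rule exI[of _ "%_. 0"], rule exI[of _ e0]) (use polyc_zero e0 eqprojD(5)[OF e0(1)] in auto)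
  next
    case (insert s S)
    then obtain p e where pe: "polyc p" "eqproj e" "range e <= Mell" "\<forall>s\<in>S. range e <= ell.Mb s"
      "!!x. p x + e x = e0 x" "!!x. p (e x) = 0" "!!x. e (p x) = 0" by blast
    show ?case
    proof (rule split_step[OF pe(2,3,1,6,7), of s])
      fix p' e' assume n: "polyc p'" "eqproj e'" "range e' <= range e" "range e' <= ell.Mb s" "!!x. p' x + e' x = p x + e x"
        "!!x. p' (e' x) = 0" "!!x. e' (p' x) = 0"
      have "range e' <= Mell" by (rule subset_trans[OF n(3) pe(3)])
      moreover have "\<forall>t\<in>insert s S. range e' <= ell.Mb t" using n(3,4) pe(4) by (metis insert_iff subset_trans)
      ultimately have "polyc p' & eqproj e' & range e' <= Mell & (\<forall>t\<in>insert s S. range e' <= ell.Mb t) &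
        (\<forall>x. p' x + e' x = e0 x & p' (e' x) = 0 & e' (p' x) = 0)" using n(1,2,5,6,7) pe(5) by simp
      then show ?thesis by blast
    qed
  qed
  then obtain p e where pe: "polyc p" "eqproj e" "range e <= Mell" "!!s. s \<in> S' ==> range e <= ell.Mb s"
    "!!x. p x + e x = e0 x" "!!x. p (e x) = 0" "!!x. e (p x) = 0" by blast
  let ?E = "range e"
  have sE: "add_subgroup ?E" "!!a x. x \<in> ?E ==> act a x \<in> ?E" "closed ?E"
    using eqproj_range_subgroup[OF pe(2)] eqproj_range_act[OF pe(2)] eqproj_range_closed[OF pe(2)] by auto
  interpret TE: td_free_module act ?E by (rule td_free_sub[OF sE pe(3)])
  have MbE: "?E <= TE.Mb s" if "s \<in> S'" for s using pe(4)[OF that] unfolding TE.Mb_def ell.Mb_def by blast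
  have "\<exists>X. TE.copen X & (\<forall>b\<in>Nb. \<forall>x\<in>X. act b x \<in> X & act (- b) x \<in> X) & (\<forall>s\<in>S'. \<forall>x\<in>X. act s x \<in> X & act (- s) x \<in> X)"
    using S' MbE
  proof (induction S' rule: finite_induct)
    case empty
    have c: "compact (K Int ?E)" "add_subgroup (K Int ?E)" using compact_Int_closed[OF K'(1) sE(3)] add_subgroup_Int[OF K'(2) sE(1)] by auto
    have w: "W Int ?E <= K Int ?E" using W(3) pe(3) by blast
    have "TE.copen (K Int ?E)" unfolding TE.copen_def
      by (intro conjI c Int_lower2 exI[of _ W] W(1,2) w)
    moreover have "\<forall>b\<in>Nb. \<forall>x\<in>K Int ?E. act b x \<in> K Int ?E & act (- b) x \<in> K Int ?E" using stab sE(2) unfolding Nb_def by blast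
    ultimately show ?case by blast
  next
    case (insert s S)
    from insert.IH[OF insert.prems[OF insertI2]] obtain X where X: "TE.copen X" "!!b x. b \<in> Nb ==> x \<in> X ==> act b x \<in> X & act (- b) x \<in> X"
      "!!t x. t \<in> S ==> x \<in> X ==> act t x \<in> X & act (- t) x \<in> X" by blast
    have c: "TE.copen (zr s X)" by (rule TE.core_open[OF insert.prems[OF insertI1] X(1)])
    have inv: "act b x \<in> zr s X" if "!!x. x \<in> X ==> act b x \<in> X" "x \<in> zr s X" for b x
      using that unfolding zr_def by (simp add: act_commute[of _ b])
    have own: "act s x \<in> zr s X & act (- s) x \<in> zr s X" if "x \<in> zr s X" for x
      using zr_pw[OF that, of 1] zr_pw[OF that, of "-1"] by simp
    have "act b x \<in> zr s X & act (- b) x \<in> zr s X" if "b \<in> Nb" "x \<in> zr s X" for b x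
      using inv[OF conjunct1[OF X(2)[OF that(1)]] that(2)] inv[OF conjunct2[OF X(2)[OF that(1)]] that(2)] by simp
    moreover have "act b x \<in> zr s X & act (- b) x \<in> zr s X" if "b \<in> S" "x \<in> zr s X" for b x
      using inv[OF conjunct1[OF X(3)[OF that(1)]] that(2)] inv[OF conjunct2[OF X(3)[OF that(1)]] that(2)] by simp
    ultimately show ?case using c own by (intro exI[of _ "zr s X"]) simp
  qed
  then obtain X where X: "TE.copen X" "!!b x. b \<in> Nb ==> x \<in> X ==> act b x \<in> X & act (- b) x \<in> X"
    "!!t x. t \<in> S' ==> x \<in> X ==> act t x \<in> X & act (- t) x \<in> X" by blast
  have Xinv: "act a x \<in> X" if "x \<in> X" for a x by (rule gen[OF X(2,3) that])
  obtain WX where WX: "open WX" "0 \<in> WX" "WX Int ?E <= X" and X': "compact X" "add_subgroup X" "X <= ?E" using X(1) unfolding TE.copen_def by blast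
  have "openin (top_of_set ?E) X" by (rule relatively_open_subgroup[OF sE(1) X'(2,3) WX])
  moreover have "submodule act ?E X" unfolding submodule_def using X' Xinv by blast
  ultimately have am: "amorphic act ?E" unfolding amorphic_def using sheer_summand[OF pe(2)] X'(1) by blast
  have e0V: "e0 x = 0" if "x \<in> V0" for x using that eqproj_range[OF pV(1)] pV(2) unfolding e0_def by auto
  have zero: "e x = 0" "p x = 0" if x: "x \<in> V0" for x
  proof -
    have s: "p x + e x = 0" using pe(5)[of x] e0V[OF x] by simp
    have "e (p x + e x) = e x" using pe(7) by (simp add: eqprojD(1,4)[OF pe(2)])
    then show 1: "e x = 0" using s eqprojD(5)[OF pe(2)] by simp
    show "p x = 0" using s 1 by simp
  qed
  show ?thesis
  proof (rule that[OF pe(1,2) am pe(3)])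
    show "p x + e x = x" if "x \<in> Mell" for x using pe(5)[of x] pV(4)[OF that] unfolding e0_def by simp
    show "range p <= Mell"
    proof
      fix y assume "y \<in> range p"
      then obtain x where "y = p x" by blast
      then have "y = e0 x - e x" using pe(5)[of x] by (simp add: algebra_simps)
      then show "y \<in> Mell" using e0(2) pe(3) add_subgroupD(4)[OF Mell_subgroup] by blast
    qed
  qed (use zero pe(6,7) in auto)
qed

end

subsection \<open>Decomposition of the Euclidean part\<close>

lemma first_order_recurrence:
  fixes w :: "nat => complex"
  assumes l: "cmod l < 1" and lim: "(%n. w (Suc n) - l * w n) \<longlonglongrightarrow> 0" shows "w \<longlonglongrightarrow> 0"
proof (rule LIMSEQ_I)
  fix r :: real assume r: "0 < r"
  define q where "q = cmod l"
  define e where "e = r / 2"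
  have q: "0 \<le> q" "q < 1" "e > 0" using l r unfolding q_def e_def by auto
  have "e * (1 - q) > 0" using q by simp
  then obtain N where N: "!!n. n \<ge> N ==> cmod (w (Suc n) - l * w n) < e * (1 - q)"
    using LIMSEQ_D[OF lim] by auto
  have step: "cmod (w (Suc n)) - e \<le> q * (cmod (w n) - e)" if "n \<ge> N" for n
  proof -
    have "cmod (w (Suc n)) \<le> cmod (w (Suc n) - l * w n) + cmod (l * w n)" using norm_triangle_ineq[of "w (Suc n) - l * w n" "l * w n"] by simp
    also have "\<dots> \<le> e * (1 - q) + q * cmod (w n)" using N[OF that] unfolding q_def by (simp add: norm_mult)
    finally show ?thesis by (simp add: algebra_simps)
  qed
  have bd: "cmod (w (N + m)) - e \<le> q ^ m * \<bar>cmod (w N) - e\<bar>" for m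
  proof (induction m)
    case (Suc m)
    have "cmod (w (N + Suc m)) - e \<le> q * (cmod (w (N + m)) - e)" using step[of "N + m"] by simp
    also have "\<dots> \<le> q * (q ^ m * \<bar>cmod (w N) - e\<bar>)" using Suc q(1) by (rule mult_left_mono)
    finally show ?case by (simp add: mult.assoc)
  qed simp
  have "(%m. q ^ m * \<bar>cmod (w N) - e\<bar>) \<longlonglongrightarrow> 0 * \<bar>cmod (w N) - e\<bar>"
    by (intro tendsto_mult_right LIMSEQ_realpow_zero q(1,2))
  then have "(%m. q ^ m * \<bar>cmod (w N) - e\<bar>) \<longlonglongrightarrow> 0" by simp
  then obtain M where M: "!!m. m \<ge> M ==> norm (q ^ m * \<bar>cmod (w N) - e\<bar> - 0) < e" using LIMSEQ_D q(3) by blast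
  show "\<exists>no. \<forall>n\<ge>no. norm (w n - 0) < r"
  proof (intro exI allI impI)
    fix n assume n: "N + M \<le> n"
    have "norm (q ^ (n - N) * \<bar>cmod (w N) - e\<bar> - 0) < e" by (rule M) (use n in simp)
    then have "\<bar>q ^ (n - N) * \<bar>cmod (w N) - e\<bar>\<bar> < e" by (simp only: diff_0_right real_norm_def)
    then have "q ^ (n - N) * \<bar>cmod (w N) - e\<bar> < e" by (rule le_less_trans[OF abs_ge_self])
    moreover have "cmod (w n) - e \<le> q ^ (n - N) * \<bar>cmod (w N) - e\<bar>" using bd[of "n - N"] n by simp
    ultimately show "norm (w n - 0) < r" unfolding e_def by simp
  qed
qed

text \<open>The characteristic polynomial has the roots \<open>l\<close> and \<open>cnj l\<close>,
  both of modulus below 1, so the recurrence is a composite of two first-order ones.\<close>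

lemma second_order_recurrence:
  fixes x :: "nat => real"
  assumes l: "al\<^sup>2 + be\<^sup>2 < 1" and lim: "(%n. x (Suc (Suc n)) - 2 * al * x (Suc n) + (al\<^sup>2 + be\<^sup>2) * x n) \<longlonglongrightarrow> 0"
  shows "x \<longlonglongrightarrow> 0"
proof -
  define l where "l = Complex al be"
  have cm: "cmod l < 1" unfolding l_def using l by (simp add: cmod_def)
  define w where "w n = complex_of_real (x (Suc n)) - cnj l * complex_of_real (x n)" for n
  have sum: "l + cnj l = complex_of_real (2 * al)" unfolding l_def by (simp add: complex_eq_iff)
  have prod: "l * cnj l = complex_of_real (al\<^sup>2 + be\<^sup>2)" unfolding l_def by (simp add: complex_eq_iff power2_eq_square)
  have eq: "w (Suc n) - l * w n = complex_of_real (x (Suc (Suc n)) - 2 * al * x (Suc n) + (al\<^sup>2 + be\<^sup>2) * x n)" for n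
  proof -
    have "w (Suc n) - l * w n = complex_of_real (x (Suc (Suc n))) - (l + cnj l) * complex_of_real (x (Suc n)) + (l * cnj l) * complex_of_real (x n)"
      unfolding w_def by (simp add: algebra_simps)
    then show ?thesis unfolding sum prod by simp
  qed
  have "(%n. complex_of_real (x (Suc (Suc n)) - 2 * al * x (Suc n) + (al\<^sup>2 + be\<^sup>2) * x n)) \<longlonglongrightarrow> complex_of_real 0"
    by (rule tendsto_of_real[OF lim])
  then have "(%n. w (Suc n) - l * w n) \<longlonglongrightarrow> 0" unfolding eq by simp
  then have "w \<longlonglongrightarrow> 0" by (rule first_order_recurrence[OF cm])
  then have "(%n. complex_of_real (x (Suc n)) - cnj l * complex_of_real (x n)) \<longlonglongrightarrow> 0" unfolding w_def .
  then have "(%n. complex_of_real (x n)) \<longlonglongrightarrow> 0" by (rule first_order_recurrence[rotated]) (use cm in simp)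
  then have "(%n. Re (complex_of_real (x n))) \<longlonglongrightarrow> Re 0" by (rule tendsto_Re)
  then show ?thesis by simp
qed

lemma oneparam_sum_small:
  fixes d :: nat
  assumes "!!j. j < d ==> oneparam (ph j)" "open U" "0 \<in> U"
  shows "\<exists>e>0. \<forall>s. (\<forall>j<d. \<bar>s j\<bar> < e) --> (\<Sum>j<d. ph j (s j)) \<in> U"
  using assms
proof (induction d arbitrary: U)
  case 0 then show ?case by (intro exI[of _ 1]) simp
next
  case (Suc d)
  obtain W where W: "open W" "0 \<in> W" "!!x y. x \<in> W ==> y \<in> W ==> x + y \<in> U" using nbhd_halve[OF Suc.prems(2,3)] by metis
  obtain e1 where e1: "e1 > 0" "!!s. (\<forall>j<d. \<bar>s j\<bar> < e1) ==> (\<Sum>j<d. ph j (s j)) \<in> W" using Suc.IH[OF _ W(1,2)] Suc.prems(1) by auto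
  have o: "oneparam (ph d)" using Suc.prems(1) by simp
  have "open {r. ph d r \<in> W}" by (rule open_vimage_UNIV[OF oneparamD(1)[OF o] W(1)])
  moreover have "0 \<in> {r. ph d r \<in> W}" using W(2) oneparamD(3)[OF o] by simp
  ultimately obtain e2 where e2: "e2 > 0" "ball 0 e2 <= {r. ph d r \<in> W}" using openE by blast
  show ?case
  proof (intro exI[of _ "min e1 e2"] conjI allI impI)
    fix s :: "nat => real" assume s: "\<forall>j<Suc d. \<bar>s j\<bar> < min e1 e2"
    have "(\<Sum>j<d. ph j (s j)) \<in> W" using s by (intro e1(2)) auto
    moreover have "s d \<in> ball 0 e2" using s by (simp add: dist_real_def)
    then have "ph d (s d) \<in> W" using e2(2) by blast
    ultimately show "(\<Sum>j<Suc d. ph j (s j)) \<in> U" using W(3) by simp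
  qed (use e1(1) e2(1) in simp)
qed

section \<open>The real vector space structure of \<open>V0\<close>\<close>

locale real_part = sheer_module +
  fixes pV :: "'b => 'b" and d :: nat and ph :: "nat => real => 'b" and th :: "nat => 'b => real"
  assumes pV: "eqproj pV" "range pV = V0" "!!x. x - pV x \<in> Mell"
    and ph: "!!j. j < d ==> oneparam (ph j)"
    and th_add: "!!j x y. th j (x + y) = th j x + th j y" and th_cont: "!!j. continuous_on UNIV (th j)"
    and rep: "!!\<phi>. oneparam \<phi> ==> \<phi> 1 = (\<Sum>j<d. ph j (th j (\<phi> 1)))"
begin

text \<open>Scalar multiplication on \<open>V0\<close>, extended to the whole module by projecting
  first; so \<open>sc 1\<close> is \<open>pV\<close> and not the identity. It is written in a basis,
  but \<open>sc_oneparam\<close> identifies it with reparametrisation of paths, which gives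
  equivariance.\<close>

definition sc :: "real => 'b => 'b" where "sc r x = (\<Sum>j<d. ph j (r * th j (pV x)))"

lemma pV_V0: "pV x \<in> V0" using pV(2) by blast
lemma pV_id: "x \<in> V0 ==> pV x = x" using pV(2) eqproj_range[OF pV(1)] by blast
lemma pV_pV [simp]: "pV (pV x) = pV x" by (rule eqprojD(4)[OF pV(1)])

lemma th_oneparam: assumes "oneparam \<phi>" shows "th j (\<phi> r) = r * th j (\<phi> 1)"
proof (rule additive_real_linear)
  show "th j (\<phi> (x + y)) = th j (\<phi> x) + th j (\<phi> y)" for x y by (simp add: oneparamD(2)[OF assms] th_add)
  show "continuous_on UNIV (%r. th j (\<phi> r))" by (rule continuous_on_compose2[OF th_cont oneparamD(1)[OF assms]]) auto
qed

lemma sc_oneparam: assumes "oneparam \<phi>" shows "sc r (\<phi> s) = \<phi> (r * s)"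
proof -
  have o: "oneparam (%t. \<phi> (r * s * t))" by (rule oneparam_scale[OF assms])
  have 1: "th j (\<phi> s) = s * th j (\<phi> 1)" "th j (\<phi> (r * s)) = (r * s) * th j (\<phi> 1)" for j by (rule th_oneparam[OF assms])+
  have "\<phi> (r * s) = (\<Sum>j<d. ph j (th j (\<phi> (r * s))))" using rep[OF o] by simp
  also have "\<dots> = (\<Sum>j<d. ph j (r * th j (\<phi> s)))" unfolding 1 by (simp add: mult.assoc)
  finally show ?thesis unfolding sc_def pV_id[OF V0_mem[OF assms]] by simp
qed

lemma oneparam_through: obtains \<phi> where "oneparam \<phi>" "pV x = \<phi> 1" "!!r. sc r x = \<phi> r"
proof -
  obtain \<phi> where \<phi>: "oneparam \<phi>" "pV x = \<phi> 1" using pV_V0 by (rule V0_E)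
  have "sc r x = sc r (pV x)" for r unfolding sc_def by simp
  then have "sc r x = \<phi> r" for r using sc_oneparam[OF \<phi>(1), of r 1] \<phi>(2) by simp
  then show ?thesis using that \<phi> by blast
qed

lemma sc_V0: "sc r x \<in> V0" by (rule oneparam_through[of x]) (simp add: V0_mem)
lemma sc_add: "sc r (x + y) = sc r x + sc r y"
  unfolding sc_def using oneparamD(2)[OF ph] by (simp add: eqprojD(1)[OF pV(1)] th_add distrib_left sum.distrib)
lemma sc_zero: "sc r 0 = 0" using sc_add[of r 0 0] by simp
lemma sc_uminus: "sc r (- x) = - sc r x" using sc_add[of r x "-x"] sc_zero by (simp add: eq_neg_iff_add_eq_0 add.commute)
lemma sc_diff: "sc r (x - y) = sc r x - sc r y" using sc_add[of r x "-y"] sc_uminus by simp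
lemma sc_sum: "sc r (sum f J) = (\<Sum>j\<in>J. sc r (f j))"
  by (induction J rule: infinite_finite_induct) (auto simp: sc_add sc_zero)
lemma sc_plus: "sc (r + s) x = sc r x + sc s x"
  by (rule oneparam_through[of x]) (simp add: oneparamD(2))
lemma sc_minus: "sc (r - s) x = sc r x - sc s x"
  by (rule oneparam_through[of x]) (simp add: oneparamD(5))
lemma sc_1: "sc 1 x = pV x" by (rule oneparam_through[of x]) simp
lemma sc_0: "sc 0 x = 0" by (rule oneparam_through[of x]) (simp add: oneparamD(3))
lemma sc_sc: "sc r (sc s x) = sc (r * s) x"
  by (rule oneparam_through[of x]) (simp add: sc_oneparam)
lemma sc_cont: "continuous_on UNIV (sc r)"
  unfolding sc_def
  by (intro continuous_on_sum continuous_on_compose2[OF oneparamD(1)[OF ph]] continuous_intros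
      continuous_on_compose2[OF th_cont eqprojD(2)[OF pV(1)]]) auto
lemma sc_act: "sc r (act a x) = act a (sc r x)"
proof -
  obtain \<phi> where \<phi>: "oneparam \<phi>" "pV x = \<phi> 1" "!!r. sc r x = \<phi> r" by (metis oneparam_through)
  have "sc r (act a x) = sc r (act a (pV x))" unfolding sc_def by (simp add: eqprojD(3)[OF pV(1)])
  then show ?thesis unfolding \<phi>(2,3) using sc_oneparam[OF oneparam_act[OF \<phi>(1)], of r a 1] by simp
qed
lemma th_sc: "th i (sc r x) = r * th i (pV x)"
proof -
  obtain \<phi> where \<phi>: "oneparam \<phi>" "pV x = \<phi> 1" "!!r. sc r x = \<phi> r" by (metis oneparam_through)
  show ?thesis unfolding \<phi>(2,3) by (rule th_oneparam[OF \<phi>(1)])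
qed
lemma th_zero: "th i 0 = 0" using th_add[of i 0 0] by simp
lemma th_diff: "th i (x - y) = th i x - th i y" using th_add[of i "x - y" y] by simp
lemma th_sum: "th i (sum f J) = (\<Sum>j\<in>J. th i (f j))"
  by (induction J rule: infinite_finite_induct) (auto simp: th_add th_zero)
lemma V0_rep: "x \<in> V0 ==> x = (\<Sum>j<d. ph j (th j x))" using rep by (auto elim: V0_E)
lemma V0_ext: assumes "x \<in> V0" "!!j. j < d ==> th j x = 0" shows "x = 0"
proof -
  have "(\<Sum>j<d. ph j (th j x)) = 0" using assms(2) oneparamD(3)[OF ph] by simp
  then show ?thesis using V0_rep[OF assms(1)] by simp
qed

text \<open>Equivariant endomorphisms of \<open>V0\<close>, realised on the whole module by
  factoring through \<open>pV\<close>, so that they can be added, composed and compared with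
  projections without a change of carrier.\<close>

definition eqend :: "('b => 'b) => bool" where
  "eqend h \<longleftrightarrow> (\<forall>x y. h (x + y) = h x + h y) & continuous_on UNIV h & (\<forall>a x. h (act a x) = act a (h x)) &
     (\<forall>x. h x \<in> V0) & (\<forall>x. h (pV x) = h x)"

lemma eqendD:
  assumes "eqend h" shows "h (x + y) = h x + h y" "continuous_on S h" "h (act a x) = act a (h x)" "h x \<in> V0" "h (pV x) = h x" "h 0 = 0"
    "h (x - y) = h x - h y" "h (sum f J) = (\<Sum>j\<in>J. h (f j))"
proof -
  show a: "h (x + y) = h x + h y" for x y using assms unfolding eqend_def by blast
  show "continuous_on S h" using assms continuous_on_subset unfolding eqend_def by blast
  show "h (act a x) = act a (h x)" "h x \<in> V0" "h (pV x) = h x" using assms unfolding eqend_def by blast+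
  show z: "h 0 = 0" using a[of 0 0] by simp
  show "h (x - y) = h x - h y" using a[of "x - y" y] by simp
  show "h (sum f J) = (\<Sum>j\<in>J. h (f j))" by (induction J rule: infinite_finite_induct) (auto simp: a z)
qed

lemma eqend_oneparam: "eqend h ==> oneparam \<phi> ==> oneparam (%r. h (\<phi> r))"
  by (rule oneparam_hom[OF _ eqendD(2,1)])

lemma eqend_sc: assumes h: "eqend h" shows "h (sc r x) = sc r (h x)"
proof -
  obtain \<phi> where \<phi>: "oneparam \<phi>" "pV x = \<phi> 1" "!!r. sc r x = \<phi> r" by (metis oneparam_through)
  have "sc r (h x) = sc r (h (\<phi> 1))" using eqendD(5)[OF h, of x] \<phi>(2) by simp
  also have "\<dots> = h (\<phi> r)" using sc_oneparam[OF eqend_oneparam[OF h \<phi>(1)], of r 1] by simp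
  finally show ?thesis using \<phi>(3) by simp
qed

lemma eqend_zero: "eqend (%_. 0)"
  unfolding eqend_def using add_subgroupD(1)[OF V0_subgroup] by auto
lemma eqend_add: "eqend h ==> eqend k ==> eqend (%x. h x + k x)"
  unfolding eqend_def using add_subgroupD(2)[OF V0_subgroup] by (auto simp: act_add intro!: continuous_intros)
lemma eqend_diff: "eqend h ==> eqend k ==> eqend (%x. h x - k x)"
  unfolding eqend_def using add_subgroupD(4)[OF V0_subgroup] by (auto simp: act_diff intro!: continuous_intros)
lemma eqend_sum: "(!!j. j \<in> J ==> eqend (h j)) ==> eqend (%x. \<Sum>j\<in>J. h j x)"
  by (induction J rule: infinite_finite_induct) (auto intro: eqend_add eqend_zero)
lemma eqend_scale: assumes h: "eqend h" shows "eqend (%x. sc r (h x))"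
  unfolding eqend_def
proof (intro conjI allI)
  show "continuous_on UNIV (%x. sc r (h x))" by (rule continuous_on_compose2[OF sc_cont eqendD(2)[OF h]]) auto
qed (simp_all add: eqendD(1,3,5)[OF h] sc_add sc_act sc_V0)
lemma eqend_comp: assumes h: "eqend h" and k: "eqend k" shows "eqend (%x. h (k x))"
  unfolding eqend_def
proof (intro conjI allI)
  show "continuous_on UNIV (%x. h (k x))" by (rule continuous_on_compose2[OF eqendD(2)[OF h] eqendD(2)[OF k]]) auto
qed (simp_all add: eqendD(1,3,4,5)[OF h] eqendD(1,3,5)[OF k])
lemma eqend_act: assumes h: "eqend h" shows "eqend (%x. act a (h x))"
  unfolding eqend_def
proof (intro conjI allI)
  show "continuous_on UNIV (%x. act a (h x))" by (rule continuous_on_compose2[OF act_continuous eqendD(2)[OF h]]) auto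
qed (simp_all add: eqendD(1,5)[OF h] act_add V0_act[OF eqendD(4)[OF h]] eqendD(3)[OF h] act_commute)

text \<open>\<open>v\<close> maps the elliptic component \<open>x - pV x\<close> to an elliptic
  element of \<open>V0\<close>, which is 0.\<close>

lemma eqproj_eqend: assumes v: "eqproj v" "range v <= V0" shows "eqend v"
  unfolding eqend_def
proof (intro conjI allI)
  show vV: "v x \<in> V0" for x using v(2) by blast
  show "v (pV x) = v x" for x
  proof -
    have "v (x - pV x) \<in> V0 Int Mell" using eqproj_Mell[OF v(1) pV(3)] vV by blast
    then have "v (x - pV x) = 0" using V0_Mell_trivial by blast
    then show ?thesis by (simp add: eqprojD(6)[OF v(1)])
  qed
qed (simp_all add: eqprojD[OF v(1)])

lemma eqend_powers:
  assumes v: "eqproj v" "range v <= V0" and h: "eqend h" and hv: "!!x. v (h x) = h x" "!!x. h (v x) = h x"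
  shows "eqend (%x. (h ^^ k) (v x))" "v ((h ^^ k) (v x)) = (h ^^ k) (v x)" "(h ^^ k) (v (v x)) = (h ^^ k) (v x)"
proof -
  show "eqend (%x. (h ^^ k) (v x))"
  proof (induction k)
    case 0 then show ?case using eqproj_eqend[OF v] by simp
  next
    case (Suc k) then show ?case using eqend_comp[OF h] by simp
  qed
  show "v ((h ^^ k) (v x)) = (h ^^ k) (v x)" by (cases k) (simp_all add: hv eqprojD(4)[OF v(1)])
  show "(h ^^ k) (v (v x)) = (h ^^ k) (v x)" by (simp add: eqprojD(4)[OF v(1)])
qed

text \<open>The powers of \<open>Q\<close> on the summand are linearly dependent. Dividing a
  relation by its lowest nonzero coefficient, at exponent \<open>k0\<close>, gives
  \<open>Qp k0 (Wm x) = Qp k0 x\<close>, where \<open>Wm\<close> is \<open>Q\<close> times a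
  polynomial \<open>R\<close> in \<open>Q\<close>. The power \<open>k0\<close> of \<open>Wm\<close>
  factors through \<open>Qp k0\<close>, so \<open>Wm\<close> fixes its values and it is an
  idempotent \<open>e\<close>. \<open>Qp k0\<close> vanishes on the complement, and \<open>e\<close>
  kills the kernel of \<open>Q\<close> through the factor \<open>Q\<close> of
  \<open>Wm\<close>.\<close>

lemma fitting:
  assumes v: "eqproj v" "range v <= V0" and Q: "eqend Q" "!!x. v (Q x) = Q x" "!!x. Q (v x) = Q x"
    and ker: "u \<in> range v" "u ~= 0" "Q u = 0"
  obtains k e where "eqproj e" "!!x. v (e x) = e x" "!!x. e (v x) = e x" "!!x. (Q ^^ k) (v x - e x) = 0"
    "!!y. y \<in> range v ==> Q y = 0 ==> e y = 0"
proof -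
  define Qp where "Qp k x = (Q ^^ k) (v x)" for k x
  have ve: "eqend v" by (rule eqproj_eqend[OF v])
  have Qp_end: "eqend (Qp k)" for k unfolding Qp_def[abs_def] by (rule eqend_powers(1)[OF v Q])
  have vQp: "v (Qp k x) = Qp k x" for k x unfolding Qp_def by (rule eqend_powers(2)[OF v Q])
  have Qpv: "Qp k (v x) = Qp k x" for k x unfolding Qp_def by (rule eqend_powers(3)[OF v Q])
  have Qp_add: "Qp (k + l) x = Qp k (Qp l x)" for k l x
    using vQp[of l x] unfolding Qp_def by (simp add: funpow_add)
  have Qp_1: "Qp 1 x = Q x" for x unfolding Qp_def using Q(3) by simp
  have Qp_0: "Qp 0 x = v x" for x unfolding Qp_def by simp
  have Qp_comm: "Qp k (Qp l x) = Qp l (Qp k x)" for k l x unfolding Qp_add[symmetric] by (simp add: add.commute)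
  \<comment> \<open>The powers with exponents from 0 to \<open>d * d\<close> outnumber the
    \<open>d * d\<close> matrix entries by one.\<close>
  define J where "J = {..<d} \<times> {..<d}"
  have "card J < card {..d * d}" unfolding J_def by (simp add: card_cartesian_product)
  then obtain c where c: "\<exists>k\<in>{..d * d}. c k ~= 0" "\<forall>ij\<in>J. (\<Sum>k\<le>d * d. c k * (%k (i, j). th i (Qp k (ph j 1))) k ij) = 0"
    using homogeneous_system[of J "{..d * d}" "%k (i, j). th i (Qp k (ph j 1))"] unfolding J_def by auto
  define D where "D x = (\<Sum>k\<le>d * d. sc (c k) (Qp k x))" for x
  have D_end: "eqend D" unfolding D_def[abs_def] by (intro eqend_sum eqend_scale Qp_end)
  have Dph: "D (ph j 1) = 0" if j: "j < d" for j
  proof (rule V0_ext[OF eqendD(4)[OF D_end]])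
    fix i assume i: "i < d"
    have "th i (D (ph j 1)) = (\<Sum>k\<le>d * d. c k * th i (Qp k (ph j 1)))"
      unfolding D_def th_sum th_sc pV_id[OF eqendD(4)[OF Qp_end]] ..
    then show "th i (D (ph j 1)) = 0" using c(2) i j unfolding J_def by auto
  qed
  have D0: "D x = 0" for x
  proof -
    have "D x = D (\<Sum>j<d. ph j (th j (pV x)))" using V0_rep[OF pV_V0, of x] eqendD(5)[OF D_end, of x] by simp
    also have "\<dots> = (\<Sum>j<d. D (ph j (th j (pV x))))" by (rule eqendD(8)[OF D_end])
    also have "\<dots> = 0"
    proof (rule sum.neutral, rule ballI)
      fix j assume j: "j \<in> {..<d}"
      have "ph j (th j (pV x)) = sc (th j (pV x)) (ph j 1)" using sc_oneparam[OF ph[of j], of "th j (pV x)" 1] j by simp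
      then show "D (ph j (th j (pV x))) = 0" using eqend_sc[OF D_end] Dph[of j] j by (simp add: sc_zero)
    qed
    finally show ?thesis .
  qed
  define k0 where "k0 = (LEAST k. c k ~= 0)"
  have ck0: "c k0 ~= 0" unfolding k0_def by (rule LeastI_ex) (use c(1) in blast)
  have cl: "c k = 0" if "k < k0" for k using not_less_Least[of k "%k. c k ~= 0"] that unfolding k0_def by blast
  have k0d: "k0 \<le> d * d" using c(1) Least_le[of "%k. c k ~= 0"] unfolding k0_def by force
  define L where "L = {Suc k0..d * d}"
  define b where "b k = - c k / c k0" for k
  define R where "R x = (\<Sum>k\<in>L. sc (b k) (Qp (k - Suc k0) x))" for x
  define Wm where "Wm x = Q (R x)" for x
  have R_end: "eqend R" unfolding R_def[abs_def] by (intro eqend_sum eqend_scale Qp_end)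
  have W_end: "eqend Wm" unfolding Wm_def[abs_def] by (rule eqend_comp[OF Q(1) R_end])
  have RQp: "R (Qp m x) = Qp m (R x)" for m x
    unfolding R_def eqendD(8)[OF Qp_end] eqend_sc[OF Qp_end] by (simp only: Qp_comm[of m])
  have RQ: "R (Q x) = Q (R x)" for x using RQp[of 1 x] unfolding Qp_1 .
  have WQp: "Wm (Qp m x) = Qp m (Wm x)" for m x
    unfolding Wm_def RQp using Qp_comm[of 1 m "R x"] unfolding Qp_1 .
  have W_eq: "Wm x = (\<Sum>k\<in>L. sc (b k) (Qp (k - k0) x))" for x
  proof -
    have "Wm x = (\<Sum>k\<in>L. sc (b k) (Q (Qp (k - Suc k0) x)))" unfolding Wm_def R_def eqendD(8)[OF Q(1)] eqend_sc[OF Q(1)] ..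
    also have "\<dots> = (\<Sum>k\<in>L. sc (b k) (Qp (k - k0) x))"
    proof (rule sum.cong[OF refl])
      fix k assume "k \<in> L"
      then have "k - k0 = 1 + (k - Suc k0)" unfolding L_def by auto
      then have "Qp (k - k0) x = Q (Qp (k - Suc k0) x)" using Qp_add[of 1 "k - Suc k0" x] unfolding Qp_1 by simp
      then show "sc (b k) (Q (Qp (k - Suc k0) x)) = sc (b k) (Qp (k - k0) x)" by simp
    qed
    finally show ?thesis .
  qed
  have QW: "Qp k0 (Wm x) = Qp k0 x" for x
  proof -
    have "{..d * d} = {..<k0} \<union> ({k0} \<union> L)" unfolding L_def using k0d by auto
    then have "D x = (\<Sum>k\<in>{..<k0} \<union> ({k0} \<union> L). sc (c k) (Qp k x))" unfolding D_def by simp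
    also have "\<dots> = (\<Sum>k\<in>{..<k0}. sc (c k) (Qp k x)) + (\<Sum>k\<in>{k0} \<union> L. sc (c k) (Qp k x))"
      by (rule sum.union_disjoint) (auto simp: L_def)
    also have "(\<Sum>k\<in>{..<k0}. sc (c k) (Qp k x)) = 0" by (rule sum.neutral) (simp add: cl sc_0)
    also have "(\<Sum>k\<in>{k0} \<union> L. sc (c k) (Qp k x)) = sc (c k0) (Qp k0 x) + (\<Sum>k\<in>L. sc (c k) (Qp k x))"
      by (subst sum.union_disjoint) (auto simp: L_def)
    finally have "sc (c k0) (Qp k0 x) = - (\<Sum>k\<in>L. sc (c k) (Qp k x))" using D0[of x] by (simp add: eq_neg_iff_add_eq_0)
    then have "sc (1 / c k0) (sc (c k0) (Qp k0 x)) = sc (1 / c k0) (- (\<Sum>k\<in>L. sc (c k) (Qp k x)))" by simp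
    then have "Qp k0 x = - (\<Sum>k\<in>L. sc (1 / c k0) (sc (c k) (Qp k x)))"
      using ck0 by (simp add: sc_sc sc_1 sc_uminus sc_sum pV_id[OF eqendD(4)[OF Qp_end]])
    also have "\<dots> = (\<Sum>k\<in>L. sc (b k) (Qp k x))"
      unfolding sum_negf[symmetric]
    proof (rule sum.cong[OF refl])
      fix k
      have "b k = 0 - 1 / c k0 * c k" unfolding b_def by simp
      then show "- sc (1 / c k0) (sc (c k) (Qp k x)) = sc (b k) (Qp k x)" by (simp only: sc_sc sc_minus sc_0) simp
    qed
    also have "\<dots> = (\<Sum>k\<in>L. sc (b k) (Qp k0 (Qp (k - k0) x)))"
    proof (rule sum.cong[OF refl])
      fix k assume "k \<in> L"
      then have "k = k0 + (k - k0)" unfolding L_def by auto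
      then show "sc (b k) (Qp k x) = sc (b k) (Qp k0 (Qp (k - k0) x))" using Qp_add[of k0 "k - k0" x] by simp
    qed
    also have "\<dots> = Qp k0 (Wm x)" unfolding W_eq eqendD(8)[OF Qp_end] eqend_sc[OF Qp_end] ..
    finally show ?thesis by simp
  qed
  have vW: "v (Wm x) = Wm x" "Wm (v x) = Wm x" for x
    unfolding Wm_def Q(2) R_def Qpv by simp_all
  have vR: "v (R x) = R x" "R (v x) = R x" for x
    unfolding R_def eqendD(8)[OF ve] eqend_sc[OF ve] vQp Qpv by simp_all
  define Wp where "Wp m x = (Wm ^^ m) (v x)" for m x
  define Rp where "Rp m x = (R ^^ m) (v x)" for m x
  have Wp_end: "eqend (Wp m)" for m unfolding Wp_def[abs_def] by (rule eqend_powers(1)[OF v W_end vW])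
  have vWp: "v (Wp m x) = Wp m x" "Wp m (v x) = Wp m x" for m x unfolding Wp_def using eqend_powers(2,3)[OF v W_end vW] by auto
  have Wp_Suc: "Wp (Suc m) x = Wm (Wp m x)" for m x unfolding Wp_def by simp
  have WpQR: "Wp m x = Qp m (Rp m x)" for m x
  proof (induction m)
    case 0 then show ?case unfolding Wp_def Rp_def Qp_0 by (simp add: eqprojD(4)[OF v(1)])
  next
    case (Suc m)
    have "Wp (Suc m) x = Q (Qp m (R (Rp m x)))" unfolding Wp_Suc Suc Wm_def RQp ..
    also have "\<dots> = Qp (1 + m) (R (Rp m x))" using Qp_add[of 1 m "R (Rp m x)"] unfolding Qp_1 by simp
    also have "\<dots> = Qp (Suc m) (Rp (Suc m) x)" unfolding Rp_def by simp
    finally show ?case .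
  qed
  define e where "e = Wp k0"
  have We: "Wm (e x) = e x" for x
    unfolding e_def WpQR WQp QW ..
  have "(Wm ^^ m) (e x) = e x" for m x by (induction m) (simp_all add: We)
  then have ee: "e (e x) = e x" for x using vWp(1)[of k0 x] unfolding e_def Wp_def by simp
  have e_end: "eqend e" unfolding e_def by (rule Wp_end)
  have 1: "eqproj e" unfolding eqproj_def using ee eqendD(1,2,3)[OF e_end] by blast
  have 2: "v (e x) = e x" "e (v x) = e x" for x unfolding e_def using vWp by auto
  have "Qp k0 (Wp m x) = Qp k0 x" for m x
  proof (induction m)
    case 0 show ?case unfolding Wp_def by (simp add: Qpv)
  next
    case (Suc m) then show ?case unfolding Wp_Suc QW by simp
  qed
  then have "Qp k0 (v x - e x) = 0" for x unfolding e_def by (simp add: eqendD(7)[OF Qp_end] Qpv)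
  moreover have "Qp k0 (v x - e x) = (Q ^^ k0) (v x - e x)" for x
    unfolding Qp_def by (simp add: eqprojD(6)[OF v(1)] eqprojD(4)[OF v(1)] 2)
  ultimately have 3: "(Q ^^ k0) (v x - e x) = 0" for x by simp
  have W0: "Wm y = 0" if "Q y = 0" for y
  proof -
    have "R (Q y) = 0" using that eqendD(6)[OF R_end] by simp
    then show ?thesis unfolding Wm_def RQ[symmetric] .
  qed
  \<comment> \<open>Exponent 0 would make \<open>Wm\<close> the identity of the summand, although it
    kills the nonzero kernel vector \<open>u\<close>.\<close>
  have "k0 ~= 0"
  proof
    assume "k0 = 0"
    then have "v (Wm u) = v u" using QW[of u] by (simp add: Qp_0)
    then have "v u = 0" using W0[OF ker(3)] eqprojD(5)[OF v(1)] by simp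
    then show False using ker(1,2) eqproj_range[OF v(1)] by simp
  qed
  then obtain m where m: "k0 = Suc m" using not0_implies_Suc by blast
  have "e y = 0" if "y \<in> range v" "Q y = 0" for y
  proof -
    have vy: "v y = y" using that(1) eqproj_range[OF v(1)] by simp
    have "e y = (Wm ^^ m) (Wm y)" unfolding e_def Wp_def m vy by (simp add: funpow_swap1)
    moreover have "(Wm ^^ m) 0 = 0" by (induction m) (simp_all add: eqendD(6)[OF W_end])
    ultimately show ?thesis using W0[OF that(2)] by simp
  qed
  then show ?thesis using that[OF 1 2 3] by blast
qed

text \<open>On vectors killed by a power of \<open>Q\<close>, the coordinates of the orbit satisfy
  the second-order recurrence of the eigenvalue up to an error tending to 0, by induction on the
  power. Uniformity follows because compact sets have bounded coordinates in a finite basis.\<close>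

lemma quadratic_contracting:
  assumes r: "eqproj r" "range r <= V0" and l: "al\<^sup>2 + be\<^sup>2 < 1"
    and Q: "!!x. x \<in> range v ==> Q x = act b (act b x) - sc (2 * al) (act b x) + sc (al\<^sup>2 + be\<^sup>2) x"
    and v: "eqproj v" "range v <= V0" "range r <= range v" and k: "!!x. (Q ^^ k) (r x) = 0"
  shows "contracting_on (range r) (act b)"
proof -
  have rv: "eqend v" by (rule eqproj_eqend[OF v(1,2)])
  have sv: "add_subgroup (range v)" by (rule eqproj_range_subgroup[OF v(1)])
  have scv: "sc s x \<in> range v" if "x \<in> range v" for s x
    using that eqend_sc[OF rv, of s x] unfolding eqproj_range[OF v(1)] by simp
  have Qv: "Q x \<in> range v" if "x \<in> range v" for x
    unfolding Q[OF that] using that by (intro add_subgroupD(2,4)[OF sv] scv eqproj_range_act[OF v(1)])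
  have pt: "(%n. th i (pw b (int n) x)) \<longlonglongrightarrow> 0" if "(Q ^^ m) x = 0" "x \<in> range v" for m x i
    using that
  proof (induction m arbitrary: x)
    case 0 then show ?case by (simp add: th_zero)
  next
    case (Suc m)
    have "(Q ^^ m) (Q x) = 0" using Suc.prems(1) by (simp add: funpow_swap1)
    then have lim: "(%n. th i (pw b (int n) (Q x))) \<longlonglongrightarrow> 0" using Qv[OF Suc.prems(2)] by (rule Suc.IH)
    define y where "y n = th i (pw b (int n) x)" for n
    have pwV: "pw b k x \<in> V0" for k using Suc.prems(2) v(2) V0_act by blast
    have "th i (pw b (int n) (Q x)) = y (Suc (Suc n)) - 2 * al * y (Suc n) + (al\<^sup>2 + be\<^sup>2) * y n" for n
    proof -
      have a1: "pw b (int n) (act b x) = pw b (int (Suc n)) x" using zm_succ[of "int n" b] by (simp add: act_act add.commute)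
      have a2: "pw b (int n) (act b (act b x)) = pw b (int (Suc (Suc n))) x"
      proof -
        have "zm (int (Suc (Suc n))) b = zm (int n) b + (b + b)" using zm_add[of "int n" 2 b] zm_add[of 1 1 b] by (simp add: add.commute)
        then show ?thesis by (simp add: act_act add.assoc)
      qed
      have "pw b (int n) (Q x) = pw b (int (Suc (Suc n))) x - sc (2 * al) (pw b (int (Suc n)) x) + sc (al\<^sup>2 + be\<^sup>2) (pw b (int n) x)"
        unfolding Q[OF Suc.prems(2)] act_add act_diff sc_act[symmetric] a1 a2 ..
      then show ?thesis unfolding y_def by (simp only: th_add th_diff th_sc pV_id[OF pwV])
    qed
    then have "(%n. y (Suc (Suc n)) - 2 * al * y (Suc n) + (al\<^sup>2 + be\<^sup>2) * y n) \<longlonglongrightarrow> 0" using lim by simp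
    then have "y \<longlonglongrightarrow> 0" by (rule second_order_recurrence[OF l])
    then show ?case unfolding y_def .
  qed
  show ?thesis unfolding contracting_on_def
  proof (intro allI impI)
    fix K U :: "'b set" assume K: "K <= range r & compact K" and U: "open U & 0 \<in> U"
    obtain e where e: "e > 0" "!!s. (\<forall>j<d. \<bar>s j\<bar> < e) ==> (\<Sum>j<d. ph j (s j)) \<in> U"
      using oneparam_sum_small[of d ph U] ph U by blast
    have "compact ((%x. \<Sum>j<d. \<bar>th j x\<bar>) ` K)"
      using K by (intro compact_continuous_image continuous_intros continuous_on_subset[OF th_cont]) auto
    then have "bounded ((%x. \<Sum>j<d. \<bar>th j x\<bar>) ` K)" by (rule compact_imp_bounded)
    then obtain B where B: "!!x. x \<in> K ==> \<bar>\<Sum>j<d. \<bar>th j x\<bar>\<bar> \<le> B" unfolding bounded_iff by auto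
    define M where "M = \<bar>B\<bar> + 1"
    have M: "M > 0" "!!x. x \<in> K ==> (\<Sum>j<d. \<bar>th j x\<bar>) < M" unfolding M_def using B by (auto, fastforce)
    have "\<forall>i\<in>{..<d}. \<forall>j\<in>{..<d}. \<forall>\<^sub>F n in sequentially. \<bar>th i (pw b (int n) (r (ph j 1)))\<bar> < e / M"
    proof (intro ballI)
      fix i j
      have "(%n. th i (pw b (int n) (r (ph j 1)))) \<longlonglongrightarrow> 0" by (rule pt[OF k]) (use v(3) in blast)
      then have "\<forall>\<^sub>F n in sequentially. dist (th i (pw b (int n) (r (ph j 1)))) 0 < e / M" using e(1) M(1) by (intro tendstoD) auto
      then show "\<forall>\<^sub>F n in sequentially. \<bar>th i (pw b (int n) (r (ph j 1)))\<bar> < e / M" by (simp add: dist_real_def)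
    qed
    then have "\<forall>\<^sub>F n in sequentially. \<forall>i\<in>{..<d}. \<forall>j\<in>{..<d}. \<bar>th i (pw b (int n) (r (ph j 1)))\<bar> < e / M"
      by (intro eventually_ball_finite ballI finite_lessThan) blast
    then show "\<forall>\<^sub>F n in sequentially. (act b ^^ n) ` K <= U"
    proof eventually_elim
      case (elim n)
      show ?case
      proof
        fix y assume "y \<in> (act b ^^ n) ` K"
        then obtain x where x: "x \<in> K" "y = pw b (int n) x" by (auto simp: pw_funpow)
        have xr: "x \<in> range r" using x(1) K by blast
        have xV: "x \<in> V0" using xr r(2) by blast
        have re: "eqend r" by (rule eqproj_eqend[OF r])
        have "x = r x" using xr eqproj_range[OF r(1)] by simp
        also have "\<dots> = r (\<Sum>j<d. ph j (th j x))" using V0_rep[OF xV] by simp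
        also have "\<dots> = (\<Sum>j<d. r (ph j (th j x)))" by (rule eqendD(8)[OF re])
        also have "\<dots> = (\<Sum>j<d. sc (th j x) (r (ph j 1)))"
        proof (rule sum.cong[OF refl])
          fix j assume "j \<in> {..<d}"
          then have "ph j (th j x) = sc (th j x) (ph j 1)" using sc_oneparam[OF ph[of j], of "th j x" 1] by simp
          then show "r (ph j (th j x)) = sc (th j x) (r (ph j 1))" using eqend_sc[OF re] by simp
        qed
        finally have xe: "x = (\<Sum>j<d. sc (th j x) (r (ph j 1)))" .
        have yV: "y \<in> V0" unfolding x(2) using V0_act[OF xV] .
        have "\<bar>th i y\<bar> < e" if i: "i < d" for i
        proof -
          have V: "pw b (int n) (r (ph j 1)) \<in> V0" for j using V0_act eqendD(4)[OF re] by blast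
          have "y = pw b (int n) (\<Sum>j<d. sc (th j x) (r (ph j 1)))" unfolding x(2) by (rule arg_cong[OF xe])
          also have "\<dots> = (\<Sum>j<d. sc (th j x) (pw b (int n) (r (ph j 1))))" unfolding act_sum sc_act ..
          finally have "y = (\<Sum>j<d. sc (th j x) (pw b (int n) (r (ph j 1))))" .
          then have "th i y = (\<Sum>j<d. th j x * th i (pw b (int n) (r (ph j 1))))" by (simp only: th_sum th_sc pV_id[OF V])
          then have "\<bar>th i y\<bar> \<le> (\<Sum>j<d. \<bar>th j x\<bar> * \<bar>th i (pw b (int n) (r (ph j 1)))\<bar>)" by (simp add: abs_mult[symmetric])
          also have "\<dots> \<le> (\<Sum>j<d. \<bar>th j x\<bar> * (e / M))"
            using elim i by (intro sum_mono mult_left_mono) (auto intro: less_imp_le)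
          also have "\<dots> = (\<Sum>j<d. \<bar>th j x\<bar>) * (e / M)" by (rule sum_distrib_right[symmetric])
          also have "\<dots> < M * (e / M)" using M(2)[OF x(1)] e(1) M(1) by (intro mult_strict_right_mono) auto
          also have "\<dots> = e" using M(1) by simp
          finally show ?thesis .
        qed
        then have "(\<Sum>j<d. ph j (th j y)) \<in> U" by (intro e(2)) blast
        then show "y \<in> U" using V0_rep[OF yV] by simp
      qed
    qed
  qed
qed

end

subsection \<open>Distal linear maps\<close>

text \<open>The polynomial \<open>p\<close> evaluated at the shift operator and applied to
  \<open>s\<close>; its vanishing for all \<open>n\<close> is a linear recurrence.\<close>

definition shift_poly :: "complex poly => (nat => complex) => nat => complex" where
  "shift_poly p s n = (\<Sum>k\<le>degree p. coeff p k * s (n + k))"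

lemma shift_poly_0 [simp]: "shift_poly 0 s n = 0" by (simp add: shift_poly_def)

lemma shift_poly_pCons: "shift_poly (pCons a p) s n = a * s n + shift_poly p s (Suc n)"
proof (cases "p = 0")
  case True then show ?thesis by (simp add: shift_poly_def)
next
  case False
  then have "degree (pCons a p) = Suc (degree p)" by simp
  then show ?thesis unfolding shift_poly_def by (simp add: sum.atMost_Suc_shift del: sum.atMost_Suc)
qed

lemma shift_poly_smult: "shift_poly (smult c p) s n = c * shift_poly p s n"
  by (induction p arbitrary: n) (simp_all add: shift_poly_pCons algebra_simps)

lemma shift_poly_add: "shift_poly (p + q) s n = shift_poly p s n + shift_poly q s n"
  by (induction p q arbitrary: n rule: poly_induct2) (simp_all add: shift_poly_pCons algebra_simps)

lemma shift_poly_monom: "shift_poly (monom a k) s n = a * s (n + k)"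
  by (induction k arbitrary: n) (simp_all add: monom_0 monom_Suc shift_poly_pCons)

lemma shift_poly_sum: "shift_poly (\<Sum>k\<in>J. p k) s n = (\<Sum>k\<in>J. shift_poly (p k) s n)"
  by (induction J rule: infinite_finite_induct) (simp_all add: shift_poly_add)

lemma shift_poly_factor: "shift_poly ([:- l, 1:] * q) s n = shift_poly q s (Suc n) - l * shift_poly q s n"
proof -
  have "[:- l, 1:] * q = smult (- l) q + pCons 0 q" by simp
  then show ?thesis by (simp only: shift_poly_add shift_poly_smult shift_poly_pCons) simp
qed

lemma shift_poly_diff: "shift_poly q (%m. s (Suc m) - l * s m) n = shift_poly q s (Suc n) - l * shift_poly q s n"
  unfolding shift_poly_def by (simp add: sum_subtractf sum_distrib_left algebra_simps)

lemma shift_poly_lincomb: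
  "shift_poly q (%m. \<Sum>j\<in>J. c j * s j m) n = (\<Sum>j\<in>J. c j * shift_poly q (s j) n)"
proof -
  have "shift_poly q (%m. \<Sum>j\<in>J. c j * s j m) n = (\<Sum>k\<le>degree q. \<Sum>j\<in>J. c j * (coeff q k * s j (n + k)))"
    unfolding shift_poly_def by (simp add: sum_distrib_left mult.left_commute)
  also have "\<dots> = (\<Sum>j\<in>J. \<Sum>k\<le>degree q. c j * (coeff q k * s j (n + k)))" by (rule sum.swap)
  finally show ?thesis unfolding shift_poly_def by (simp add: sum_distrib_left)
qed

text \<open>A recurrence operator in factored form: the composite of the operators shift minus
  \<open>l\<close> over the list, from which factors can be removed singly.\<close>

primrec root_ops :: "complex list => (nat => complex) => nat => complex" where
  "root_ops [] s = s"
| "root_ops (l # ls) s = root_ops ls (%n. s (Suc n) - l * s n)"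

lemma root_ops_lincomb: "root_ops ls (%n. \<Sum>j\<in>J. c j * s j n) = (%n. \<Sum>j\<in>J. c j * root_ops ls (s j) n)"
proof (induction ls arbitrary: s)
  case (Cons l ls)
  have "(%n. (\<Sum>j\<in>J. c j * s j (Suc n)) - l * (\<Sum>j\<in>J. c j * s j n)) = (%n. \<Sum>j\<in>J. c j * (s j (Suc n) - l * s j n))"
    by (simp add: sum_distrib_left sum_subtractf algebra_simps)
  then show ?case using Cons[of "%j n. s j (Suc n) - l * s j n"] by simp
qed simp

text \<open>One factor at a time: a null sequence with \<open>s (Suc n) = l * s n\<close> and
  \<open>l\<close> of modulus 1 has constant modulus, so it is 0.\<close>

lemma root_ops_null:
  assumes "s \<longlonglongrightarrow> 0" "root_ops ls s = (%_. 0)" "\<forall>l\<in>set ls. cmod l = 1" shows "s = (%_. 0)"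
  using assms
proof (induction ls arbitrary: s)
  case (Cons l ls)
  have "(%n. s (Suc n) - l * s n) \<longlonglongrightarrow> 0 - l * 0"
    by (rule tendsto_diff[OF LIMSEQ_Suc[OF Cons.prems(1)] tendsto_mult_left[OF Cons.prems(1)]])
  then have "(%n. s (Suc n) - l * s n) \<longlonglongrightarrow> 0" by simp
  moreover have "root_ops ls (%n. s (Suc n) - l * s n) = (%_. 0)" using Cons.prems(2) by (simp only: root_ops.simps)
  moreover have "\<forall>l\<in>set ls. cmod l = 1" using Cons.prems(3) by simp
  ultimately have "(%n. s (Suc n) - l * s n) = (%_. 0)" by (rule Cons.IH)
  then have st: "s (Suc n) = l * s n" for n by (metis eq_iff_diff_eq_0)
  have c: "cmod (s n) = cmod (s m)" for n m
  proof -
    have "cmod (s k) = cmod (s 0)" for k by (induction k) (use Cons.prems(3) in \<open>simp_all add: st norm_mult\<close>)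
    from this[of n] this[of m] show ?thesis by simp
  qed
  show ?case
  proof
    fix m
    have "(%n. cmod (s n)) \<longlonglongrightarrow> cmod 0" by (rule tendsto_norm[OF Cons.prems(1)])
    moreover have "(%n. cmod (s n)) = (%n. cmod (s m))" using c by (rule ext)
    ultimately have "(%n::nat. cmod (s m)) \<longlonglongrightarrow> 0" by simp
    then show "s m = 0" by (simp add: LIMSEQ_const_iff)
  qed
qed simp

text \<open>Roots \<open>l\<close> of \<open>p\<close> are stripped one by one. If the cofactor
  \<open>q\<close> leaves a nonzero vector at time 0, that vector is an eigenvector of
  \<open>A\<close> for \<open>l\<close>, so \<open>l\<close> has modulus 1 and is kept; otherwise
  \<open>q\<close> already annihilates the sequences and \<open>l\<close> is dropped.\<close>

lemma unimodular_annihilator: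
  fixes A :: "nat => nat => complex"
  assumes eig: "!!l z. (\<exists>i<d. z i ~= 0) ==> (\<forall>i<d. (\<Sum>j<d. A i j * z j) = l * z i) ==> cmod l = 1"
  shows "p ~= 0 ==> (\<forall>i<d. \<forall>n. s i (Suc n) = (\<Sum>j<d. A i j * s j n)) ==> (\<forall>i<d. \<forall>n. shift_poly p (s i) n = 0) ==>
    \<exists>ls. (\<forall>l\<in>set ls. cmod l = 1) & (\<forall>i<d. root_ops ls (s i) = (%_. 0))"
proof (induction "degree p" arbitrary: p s rule: less_induct)
  case less
  note rec = less.prems(2) and ann = less.prems(3)
  show ?case
  proof (cases "degree p = 0")
    case True
    then obtain c where c: "p = [:c:]" using degree_eq_zeroE by blast
    then have "c ~= 0" using less.prems(1) by simp
    then have "s i n = 0" if "i < d" for i n using ann that unfolding c by (simp add: shift_poly_pCons)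
    then show ?thesis by (intro exI[of _ "[]"]) auto
  next
    case False
    then have "\<not> constant (poly p)" by (simp add: constant_degree)
    then obtain l where "poly p l = 0" using fundamental_theorem_of_algebra by blast
    then obtain q where q: "p = [:- l, 1:] * q" unfolding poly_eq_0_iff_dvd by (elim dvdE)
    have q0: "q ~= 0" using less.prems(1) q by auto
    then have "degree p = degree [:- l, 1:] + degree q" unfolding q by (intro degree_mult_eq) auto
    then have dq: "degree q < degree p" by simp
    have step: "shift_poly q (s i) (Suc n) = l * shift_poly q (s i) n" if "i < d" for i n
      using ann that unfolding q shift_poly_factor by simp
    show ?thesis
    proof (cases "\<exists>i<d. shift_poly q (s i) 0 ~= 0")
      case True
      have "(\<Sum>j<d. A i j * shift_poly q (s j) 0) = l * shift_poly q (s i) 0" if i: "i < d" for i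
      proof -
        have "(\<Sum>j<d. A i j * shift_poly q (s j) 0) = shift_poly q (%m. s i (Suc m)) 0"
          using rec i unfolding shift_poly_lincomb[symmetric] by simp
        also have "\<dots> = shift_poly q (s i) (Suc 0)" unfolding shift_poly_def by simp
        finally show ?thesis using step[OF i] by simp
      qed
      then have l1: "cmod l = 1" using True by (intro eig[of "%i. shift_poly q (s i) 0"]) auto
      define s' where "s' i n = s i (Suc n) - l * s i n" for i n
      have "s' i (Suc n) = (\<Sum>j<d. A i j * s' j n)" if "i < d" for i n
        using rec that unfolding s'_def by (simp add: sum_distrib_left sum_subtractf algebra_simps)
      moreover have "shift_poly q (s' i) n = 0" if "i < d" for i n
        using step[OF that] unfolding s'_def shift_poly_diff by simp
      ultimately have "\<exists>ls. (\<forall>l\<in>set ls. cmod l = 1) & (\<forall>i<d. root_ops ls (s' i) = (%_. 0))"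
        by (intro less.hyps[OF dq q0]) auto
      then obtain ls where "\<forall>l\<in>set ls. cmod l = 1" "\<forall>i<d. root_ops ls (s' i) = (%_. 0)" by blast
      then show ?thesis using l1 by (intro exI[of _ "l # ls"]) (simp add: s'_def[abs_def])
    next
      case False
      have "shift_poly q (s i) n = 0" if i: "i < d" for i n
        by (induction n) (use False i step[OF i] in auto)
      then show ?thesis using rec by (intro less.hyps[OF dq q0]) auto
    qed
  qed
qed

section \<open>Continuous functionals on Euclidean groups\<close>

lemma Rd_line: "w \<in> Rd d ==> (%i. r * w i) \<in> Rd d" unfolding Rd_def by simp

lemma Euclidean_isoD:
  fixes V :: "'m::{topological_ab_group_add,t2_space} set"
  assumes iso: "Euclidean_iso V d f g" and V: "add_subgroup V"
  shows "x \<in> V ==> g (f x) = x" "w \<in> Rd d ==> f (g w) = w" "x \<in> V ==> f x \<in> Rd d" "w \<in> Rd d ==> g w \<in> V"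
    "continuous_on V f" "continuous_on (Rd d) g" "x \<in> V ==> y \<in> V ==> f (x + y) i = f x i + f y i"
    "w \<in> Rd d ==> w' \<in> Rd d ==> g (%i. w i + w' i) = g w + g w'" "f 0 = (%_. 0)"
proof -
  have h: "homeomorphism V (Rd d) f g" and add: "!!x y. x \<in> V ==> y \<in> V ==> f (x + y) = (%i. f x i + f y i)"
    using iso unfolding Euclidean_iso_def by auto
  show gf: "g (f x) = x" if "x \<in> V" for x using homeomorphism_apply1[OF h that] .
  show fg: "f (g w) = w" if "w \<in> Rd d" for w using homeomorphism_apply2[OF h that] .
  show fV: "f x \<in> Rd d" if "x \<in> V" for x using homeomorphism_image1[OF h] that by blast
  show gV: "g w \<in> V" if "w \<in> Rd d" for w using homeomorphism_image2[OF h] that by blast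
  show "continuous_on V f" "continuous_on (Rd d) g" using homeomorphism_cont1[OF h] homeomorphism_cont2[OF h] by auto
  show "f (x + y) i = f x i + f y i" if "x \<in> V" "y \<in> V" for x y using add[OF that] by simp
  show "g (%i. w i + w' i) = g w + g w'" if "w \<in> Rd d" "w' \<in> Rd d"
    using gf[OF add_subgroupD(2)[OF V gV[OF that(1)] gV[OF that(2)]]] add[OF gV[OF that(1)] gV[OF that(2)]] fg that by simp
  have "f (0 + 0) = (%i. f 0 i + f 0 i)" by (rule add) (rule add_subgroupD(1)[OF V])+
  then have "f 0 i = f 0 i + f 0 i" for i by (metis add_0)
  then show "f 0 = (%_. 0)" by auto
qed

lemma Euclidean_oneparam:
  fixes V :: "'m::{topological_ab_group_add,t2_space} set"
  assumes iso: "Euclidean_iso V d f g" and V: "add_subgroup V" and w: "w \<in> Rd d"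
  shows "oneparam (%r. g (%i. r * w i))"
  unfolding oneparam_def
proof (intro conjI allI)
  note E = Euclidean_isoD[OF iso V]
  have "continuous_on UNIV (%r. (%i. r * w i))" by (intro continuous_on_coordinatewise_then_product continuous_intros)
  then show "continuous_on UNIV (%r. g (%i. r * w i))" by (rule continuous_on_compose2[OF E(6)]) (use Rd_line[OF w] in auto)
  show "g (%i. (r + s) * w i) = g (%i. r * w i) + g (%i. s * w i)" for r s
    using E(8)[OF Rd_line[OF w] Rd_line[OF w], of r s] by (simp add: distrib_right)
qed

text \<open>Along each coordinate line the functional is a continuous additive function of one real
  variable, hence linear; the truncations \<open>tr m\<close> add one coordinate at a time.\<close>

lemma Euclidean_functional:
  fixes V :: "'m::{topological_ab_group_add,t2_space} set" and ps :: "'m => real"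
  assumes iso: "Euclidean_iso V d f g" and V: "add_subgroup V"
    and add: "!!x y. x \<in> V ==> y \<in> V ==> ps (x + y) = ps x + ps y" and cont: "continuous_on V ps" and w: "w \<in> Rd d"
  shows "ps (g w) = (\<Sum>j<d. w j * ps (g (%l. if l = j then 1 else 0)))"
proof -
  note E = Euclidean_isoD[OF iso V]
  define tr where "tr m = (%l. if l < m then w l else 0)" for m
  have tr: "tr m \<in> Rd d" for m using w unfolding tr_def Rd_def by auto
  have trs: "m \<le> d ==> ps (g (tr m)) = (\<Sum>j<m. w j * ps (g (%l. if l = j then 1 else 0)))" for m
  proof (induction m)
    case 0
    have "(%i. tr 0 i + tr 0 i) = tr 0" unfolding tr_def by auto
    then have "ps (g (tr 0)) = ps (g (tr 0)) + ps (g (tr 0))" using E(8)[OF tr[of 0] tr[of 0]] add[OF E(4)[OF tr[of 0]] E(4)[OF tr[of 0]]] by simp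
    then show ?case by simp
  next
    case (Suc m)
    define u where "u = (%l. if l = m then 1 else (0::real))"
    have u: "u \<in> Rd d" using Suc.prems unfolding u_def Rd_def by auto
    have o: "oneparam (%r. g (%i. r * u i))" by (rule Euclidean_oneparam[OF iso V u])
    have "continuous_on UNIV (%r. ps (g (%i. r * u i)))"
      by (rule continuous_on_compose2[OF cont oneparamD(1)[OF o]]) (use E(4)[OF Rd_line[OF u]] in auto)
    moreover have "ps (g (%i. (r + s) * u i)) = ps (g (%i. r * u i)) + ps (g (%i. s * u i))" for r s
      using oneparamD(2)[OF o, of r s] add E(4)[OF Rd_line[OF u]] by simp
    ultimately have lin: "ps (g (%i. w m * u i)) = w m * ps (g (%i. 1 * u i))" by (intro additive_real_linear)
    have "tr (Suc m) = (%i. tr m i + w m * u i)" unfolding tr_def u_def by (auto simp: less_Suc_eq)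
    then have "g (tr (Suc m)) = g (tr m) + g (%i. w m * u i)" using E(8)[OF tr Rd_line[OF u]] by simp
    then have "ps (g (tr (Suc m))) = ps (g (tr m)) + w m * ps (g u)" using add[OF E(4)[OF tr] E(4)[OF Rd_line[OF u]]] lin by simp
    then show ?case using Suc unfolding u_def by simp
  qed
  have trd: "tr d = w" using w unfolding tr_def Rd_def by (auto simp: not_less)
  show ?thesis using trs[OF order_refl] unfolding trd .
qed

text \<open>The first \<open>d + 1\<close> points of the orbit are linearly dependent and the
  relation propagates, so the coordinate sequences satisfy a common recurrence, which may be taken
  with roots of modulus 1. The values of \<open>ps\<close> along the orbit are a combination of
  coordinates and satisfy it too; a null sequence of this kind is zero.\<close>

lemma distal_functional_zero:
  fixes V :: "'m::{topological_ab_group_add,t2_space} set" and ps :: "'m => real"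
  assumes iso: "Euclidean_iso V d f g" and V: "add_subgroup V"
    and F: "!!x. x \<in> V ==> F x \<in> V" "continuous_on V F" "!!x y. x \<in> V ==> y \<in> V ==> F (x + y) = F x + F y"
    and eig: "!!l. complex_eigenvalue d (%x. f (F (g x))) l ==> cmod l = 1"
    and add: "!!x y. x \<in> V ==> y \<in> V ==> ps (x + y) = ps x + ps y" and cont: "continuous_on V ps" and x: "x \<in> V"
    and lim: "(%n. ps ((F ^^ n) x)) \<longlonglongrightarrow> 0"
  shows "ps x = 0"
proof -
  note E = Euclidean_isoD[OF iso V]
  define A where "A i j = f (F (g (%l. if l = j then 1 else 0))) i" for i j
  define s where "s i n = f ((F ^^ n) x) i" for i n
  have orb: "(F ^^ n) x \<in> V" for n by (induction n) (simp_all add: x F(1))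
  have w: "(%i. s i n) \<in> Rd d" "g (%i. s i n) = (F ^^ n) x" for n using E(3)[OF orb] E(1)[OF orb] unfolding s_def by auto
  have rec: "s i (Suc n) = (\<Sum>j<d. A i j * s j n)" for i n
  proof -
    have "continuous_on V (%y. f (F y))" by (rule continuous_on_compose2[OF E(5) F(2)]) (use F(1) in blast)
    then have c: "continuous_on V (%y. f (F y) i)" by (rule continuous_on_product_then_coordinatewise)
    have a: "f (F (x + y)) i = f (F x) i + f (F y) i" if "x \<in> V" "y \<in> V" for x y
      using E(7)[OF F(1)[OF that(1)] F(1)[OF that(2)]] F(3)[OF that] by simp
    have "f (F (g (%i. s i n))) i = (\<Sum>j<d. s j n * f (F (g (%l. if l = j then 1 else 0))) i)"
      by (rule Euclidean_functional[OF iso V a c w(1)])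
    then show ?thesis unfolding A_def w(2) by (simp add: s_def mult.commute)
  qed
  obtain c where c: "\<exists>k\<in>{..d}. c k ~= 0" "!!i. i < d ==> (\<Sum>k\<le>d. c k * s i k) = 0"
    using homogeneous_system[of "{..<d}" "{..d}" "%k i. s i k"] by auto
  have cn: "(\<Sum>k\<le>d. c k * s i (n + k)) = 0" if "i < d" for i n
    using that
  proof (induction n arbitrary: i)
    case (Suc n)
    have "(\<Sum>k\<le>d. c k * s i (Suc n + k)) = (\<Sum>k\<le>d. \<Sum>j<d. A i j * (c k * s j (n + k)))"
      by (simp add: rec sum_distrib_left mult.left_commute)
    also have "\<dots> = (\<Sum>j<d. \<Sum>k\<le>d. A i j * (c k * s j (n + k)))" by (rule sum.swap)
    also have "\<dots> = 0" using Suc.IH by (simp add: sum_distrib_left[symmetric])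
    finally show ?case .
  qed (simp add: c)
  define p where "p = (\<Sum>k\<le>d. monom (complex_of_real (c k)) k)"
  have "coeff p k = complex_of_real (c k)" if "k \<le> d" for k using that unfolding p_def by (simp add: coeff_sum)
  then have p0: "p ~= 0" using c(1) by (metis atMost_iff coeff_0 of_real_eq_0_iff)
  define S where "S i n = complex_of_real (s i n)" for i n
  have "\<exists>ls. (\<forall>l\<in>set ls. cmod l = 1) & (\<forall>i<d. root_ops ls (S i) = (%_. 0))"
  proof (rule unimodular_annihilator[where A = "%i j. complex_of_real (A i j)", OF _ p0])
    show "cmod l = 1" if "\<exists>i<d. z i ~= 0" "\<forall>i<d. (\<Sum>j<d. complex_of_real (A i j) * z j) = l * z i" for l z
      by (rule eig) (use that in \<open>auto simp: complex_eigenvalue_def A_def\<close>)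
    show "\<forall>i<d. \<forall>n. S i (Suc n) = (\<Sum>j<d. complex_of_real (A i j) * S j n)" unfolding S_def rec by simp
    show "\<forall>i<d. \<forall>n. shift_poly p (S i) n = 0"
    proof (intro allI impI)
      fix i n assume i: "i < d"
      have "shift_poly p (S i) n = complex_of_real (\<Sum>k\<le>d. c k * s i (n + k))"
        unfolding p_def shift_poly_sum shift_poly_monom S_def by simp
      then show "shift_poly p (S i) n = 0" using cn[OF i] by simp
    qed
  qed
  then obtain ls where ls: "\<forall>l\<in>set ls. cmod l = 1" "!!i. i < d ==> root_ops ls (S i) = (%_. 0)" by blast
  define b where "b j = complex_of_real (ps (g (%l. if l = j then 1 else 0)))" for j
  have t: "complex_of_real (ps ((F ^^ n) x)) = (\<Sum>j<d. b j * S j n)" for n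
    using Euclidean_functional[OF iso V add cont w(1), of n] unfolding w(2) b_def S_def by (simp add: mult.commute)
  have "(%n. complex_of_real (ps ((F ^^ n) x))) \<longlonglongrightarrow> complex_of_real 0" by (rule tendsto_of_real[OF lim])
  then have "(%n. \<Sum>j<d. b j * S j n) \<longlonglongrightarrow> 0" unfolding t by simp
  moreover have "root_ops ls (%n. \<Sum>j<d. b j * S j n) = (%_. 0)" unfolding root_ops_lincomb using ls(2) by simp
  ultimately have "(%n. \<Sum>j<d. b j * S j n) = (%_. 0)" using ls(1) by (rule root_ops_null)
  then have "complex_of_real (ps ((F ^^ 0) x)) = 0" unfolding t by metis
  then show ?thesis by simp
qed

section \<open>Splitting off eigenvalues away from the unit circle\<close>

context real_part
begin

lemma functional_sc:
  fixes ps :: "'b => real"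
  assumes add: "!!x y. ps (x + y) = ps x + ps y" and cont: "continuous_on UNIV ps"
  shows "ps (sc r x) = r * ps (pV x)"
proof -
  obtain \<phi> where \<phi>: "oneparam \<phi>" "pV x = \<phi> 1" "!!r. sc r x = \<phi> r" by (metis oneparam_through)
  show ?thesis unfolding \<phi>(2,3)
  proof (rule additive_real_linear)
    show "ps (\<phi> (x + y)) = ps (\<phi> x) + ps (\<phi> y)" for x y by (simp add: oneparamD(2)[OF \<phi>(1)] add)
    show "continuous_on UNIV (%r. ps (\<phi> r))" by (rule continuous_on_compose2[OF cont oneparamD(1)[OF \<phi>(1)]]) auto
  qed
qed

lemma sc_neg: "sc (- r) x = - sc r x" using sc_minus[of 0 r x] by (simp add: sc_0)

lemma eqproj_subtract:
  assumes v: "eqproj v" and e: "eqproj e" and ve: "!!x. v (e x) = e x" "!!x. e (v x) = e x"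
  shows "eqproj (%x. v x - e x)"
proof -
  have "eqproj (%x. v x - e (v x))"
    by (rule eqproj_comp[OF eqproj_compl[OF e] v]) (simp add: ve eqprojD(6)[OF v])
  then show ?thesis unfolding ve .
qed

text \<open>In complex terms \<open>u + i w\<close> is an eigenvector of \<open>act b\<close> for
  \<open>al + i be\<close>. The quadratic polynomial with this root and its conjugate kills
  \<open>u\<close>, so Fitting's lemma cuts out a nonzero summand on which it is nilpotent, and
  there \<open>act b\<close> contracts.\<close>

lemma eigen_split:
  assumes v: "eqproj v" "range v <= V0" and uw: "u \<in> range v" "w \<in> range v" "u ~= 0"
    and a: "act b u = sc al u - sc be w" "act b w = sc be u + sc al w" and l: "al\<^sup>2 + be\<^sup>2 < 1"
  shows "\<exists>r u. eqproj r & contractable act (range r) & (\<forall>x. v (r x) = r x & r (v x) = r x) & u \<in> range r & u ~= 0"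
proof -
  define Q where "Q x = act b (act b (v x)) - sc (2 * al) (act b (v x)) + sc (al\<^sup>2 + be\<^sup>2) (v x)" for x
  have ve: "eqend v" by (rule eqproj_eqend[OF v])
  have Qe: "eqend Q" unfolding Q_def[abs_def]
    by (intro eqend_add eqend_diff eqend_scale eqend_act ve)
  have vQ: "v (Q x) = Q x" "Q (v x) = Q x" for x
    unfolding Q_def by (simp_all add: eqendD(1,3,7)[OF ve] eqend_sc[OF ve] eqprojD(4)[OF v(1)])
  have vu: "v u = u" using uw(1) eqproj_range[OF v(1)] by blast
  have "Q u = 0"
  proof -
    have 1: "act b (act b u) = sc (al * al) u - sc (al * be) w - (sc (be * be) u + sc (al * be) w)"
    proof -
      have "act b (act b u) = sc al (act b u) - sc be (act b w)" unfolding a(1) act_diff sc_act[symmetric] a ..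
      also have "\<dots> = sc (al * al) u - sc (al * be) w - (sc (be * be) u + sc (be * al) w)"
        unfolding a sc_diff sc_add sc_sc ..
      finally show ?thesis by (simp only: mult.commute[of be al])
    qed
    have 2: "sc (2 * al) (act b u) = (sc (al * al) u + sc (al * al) u) - (sc (al * be) w + sc (al * be) w)"
      unfolding a sc_diff sc_sc by (simp add: sc_plus[symmetric] mult.assoc)
    have 3: "sc (al\<^sup>2 + be\<^sup>2) u = sc (al * al) u + sc (be * be) u" by (simp add: sc_plus power2_eq_square)
    show ?thesis unfolding Q_def vu 1 2 3 by simp
  qed
  obtain k e where e: "eqproj e" "!!x. v (e x) = e x" "!!x. e (v x) = e x" "!!x. (Q ^^ k) (v x - e x) = 0"
    "!!y. y \<in> range v ==> Q y = 0 ==> e y = 0"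
    using fitting[OF v Qe vQ uw(1,3) \<open>Q u = 0\<close>] by metis
  define r where "r x = v x - e x" for x
  have r: "eqproj r" unfolding r_def[abs_def] by (rule eqproj_subtract[OF v(1) e(1,2,3)])
  have vr: "v (r x) = r x" "r (v x) = r x" for x
    unfolding r_def by (simp_all add: eqprojD(4,6)[OF v(1)] e)
  have rr: "range r <= range v" using vr(1) by (metis image_subsetI rangeI)
  have "contracting_on (range r) (act b)"
  proof (rule quadratic_contracting[OF r _ l _ v rr])
    show "range r <= V0" using rr v(2) by blast
    show "Q x = act b (act b x) - sc (2 * al) (act b x) + sc (al\<^sup>2 + be\<^sup>2) x" if "x \<in> range v" for x
    proof -
      have "v x = x" using that eqproj_range[OF v(1)] by blast
      then show ?thesis unfolding Q_def by simp
    qed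
    show "(Q ^^ k) (r x) = 0" for x unfolding r_def by (rule e(4))
  qed
  then have "contractable act (range r)" unfolding contractable_def by blast
  moreover have "u \<in> range r"
  proof -
    have "r u = u" unfolding r_def vu e(5)[OF uw(1) \<open>Q u = 0\<close>] by simp
    then show ?thesis by (metis rangeI)
  qed
  ultimately show ?thesis using r vr uw(3) by blast
qed

text \<open>An eigenvalue outside the unit circle becomes one inside for \<open>- b\<close>: the
  inverse of \<open>al + i be\<close> is \<open>(al - i be) / q\<close> with \<open>q\<close> the
  squared modulus, whence the new coefficients.\<close>

lemma eigen_split_ne1:
  assumes v: "eqproj v" "range v <= V0" and uw: "u \<in> range v" "w \<in> range v" "u ~= 0"
    and a: "act b u = sc al u - sc be w" "act b w = sc be u + sc al w" and l: "al\<^sup>2 + be\<^sup>2 ~= 1"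
  shows "\<exists>r u. eqproj r & contractable act (range r) & (\<forall>x. v (r x) = r x & r (v x) = r x) & u \<in> range r & u ~= 0"
proof (cases "al\<^sup>2 + be\<^sup>2 < 1")
  case True then show ?thesis by (rule eigen_split[OF v uw a])
next
  case False
  define q where "q = al\<^sup>2 + be\<^sup>2"
  have q: "q > 1" using False l unfolding q_def by simp
  have V: "u \<in> V0" "w \<in> V0" using uw v(2) by auto
  have undo: "act (- b) x = sc (1 / q) y" if "act b y = sc q x" "x \<in> V0" for x y
  proof -
    have "x = sc (1 / q) (sc q x)" using q that(2) by (simp add: sc_sc sc_1 pV_id)
    also have "\<dots> = act b (sc (1 / q) y)" unfolding sc_act[symmetric] that(1) ..
    finally have "act (- b) x = act (- b) (act b (sc (1 / q) y))" by simp
    then show ?thesis by simp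
  qed
  have qq: "sc q x = sc (al * al) x + sc (be * be) x" for x unfolding q_def by (simp add: sc_plus power2_eq_square)
  have m: "be * al = al * be" by simp
  have "act b (sc al u + sc be w) = sc q u"
    unfolding act_add sc_act[symmetric] a sc_add sc_diff sc_sc qq m by simp
  from undo[OF this V(1)] have 1: "act (- b) u = sc (al / q) u - sc (- be / q) w"
    unfolding sc_add sc_sc by (simp add: sc_neg)
  have "act b (sc al w - sc be u) = sc q w"
    unfolding act_diff sc_act[symmetric] a sc_add sc_diff sc_sc qq m by simp
  from undo[OF this V(2)] have 2: "act (- b) w = sc (- be / q) u + sc (al / q) w"
    unfolding sc_diff sc_sc by (simp add: sc_neg)
  have "(al / q)\<^sup>2 + (- be / q)\<^sup>2 = (al\<^sup>2 + be\<^sup>2) / q\<^sup>2" by (simp add: power_divide add_divide_distrib)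
  also have "\<dots> = 1 / q" using q unfolding q_def[symmetric] by (simp add: power2_eq_square)
  finally have "(al / q)\<^sup>2 + (- be / q)\<^sup>2 < 1" using q by simp
  then show ?thesis by (rule eigen_split[OF v uw 1 2])
qed

lemma range_basis:
  assumes v: "eqproj v" "range v <= V0"
  obtains n :: nat and phi tau where "!!j. j < n ==> oneparam (phi j)" "!!j r. j < n ==> phi j r \<in> range v"
    "!!j x y. tau j (x + y) = tau j x + (tau j y :: real)" "!!j. continuous_on UNIV (tau j)"
    "!!i j r. i < n ==> j < n ==> tau i (phi j r) = (if i = j then r else 0)"
    "!!x. x \<in> range v ==> x = (\<Sum>j<n. phi j (tau j x))"
proof -
  have ve: "eqend v" by (rule eqproj_eqend[OF v])
  have sv: "add_subgroup (range v)" by (rule eqproj_range_subgroup[OF v(1)])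
  define LL where "LL = {\<phi>. oneparam \<phi> & (\<forall>r. \<phi> r \<in> range v)}"
  show ?thesis
  proof (rule real_dual_basis[of LL])
    show "oneparam \<phi>" if "\<phi> \<in> LL" for \<phi> using that unfolding LL_def by blast
    show "(%_. 0) \<in> LL" unfolding LL_def using oneparam_zero add_subgroupD(1)[OF sv] by simp
    show "(%r. \<phi> (c * r)) \<in> LL" if "\<phi> \<in> LL" for \<phi> c using that oneparam_scale[of \<phi> c] unfolding LL_def by simp
    show "(%r. \<phi> r - \<psi> r) \<in> LL" if "\<phi> \<in> LL" "\<psi> \<in> LL" for \<phi> \<psi>
      using that oneparam_diff[of \<phi> \<psi>] add_subgroupD(4)[OF sv] unfolding LL_def by simp
  next
    fix n :: nat and phi tau
    assume B: "!!j. j < n ==> phi j \<in> LL" "!!j x y. tau j (x + y) = tau j x + (tau j y :: real)" "!!j. continuous_on UNIV (tau j)"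
      "!!i j r. i < n ==> j < n ==> tau i (phi j r) = (if i = j then r else 0)"
      "!!\<phi>. \<phi> \<in> LL ==> \<phi> 1 = (\<Sum>j<n. phi j (tau j (\<phi> 1)))"
    have rep': "x = (\<Sum>j<n. phi j (tau j x))" if x: "x \<in> range v" for x
    proof -
      obtain \<phi> where \<phi>: "oneparam \<phi>" "x = \<phi> 1" using x v(2) by (auto elim: V0_E)
      have "(%r. v (\<phi> r)) \<in> LL" unfolding LL_def using eqend_oneparam[OF ve \<phi>(1)] by simp
      from B(5)[OF this] have "v x = (\<Sum>j<n. phi j (tau j (v x)))" unfolding \<phi>(2) .
      moreover have "v x = x" using x eqproj_range[OF v(1)] by blast
      ultimately show ?thesis by simp
    qed
    show thesis by (rule that[OF _ _ B(2,3,4) rep']) (use B(1) in \<open>auto simp: LL_def\<close>)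
  qed
qed

text \<open>Coordinates from a basis of the summand either witness distality, or some element has an
  eigenvalue off the unit circle, and the real and imaginary parts of an eigenvector feed
  \<open>eigen_split_ne1\<close>.\<close>

lemma distal_or_split:
  assumes v: "eqproj v" "range v <= V0"
  shows "distal_Euclidean act (range v) \<or>
    (\<exists>r u. eqproj r & contractable act (range r) & (\<forall>x. v (r x) = r x & r (v x) = r x) & u \<in> range r & u ~= 0)"
proof (rule disjCI)
  assume no: "\<nexists>r u. eqproj r & contractable act (range r) & (\<forall>x. v (r x) = r x & r (v x) = r x) & u \<in> range r & u ~= 0"
  obtain n :: nat and phi tau where B: "!!j. j < n ==> oneparam (phi j)" "!!j r. j < n ==> phi j r \<in> range v"
    "!!j x y. tau j (x + y) = tau j x + (tau j y :: real)" "!!j. continuous_on UNIV (tau j)"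
    "!!i j r. i < n ==> j < n ==> tau i (phi j r) = (if i = j then r else 0)"
    "!!x. x \<in> range v ==> x = (\<Sum>j<n. phi j (tau j x))"
  proof (rule range_basis[OF v])
    fix n :: nat and phi tau assume "!!j. j < n ==> oneparam (phi j)" "!!j r. j < n ==> phi j r \<in> range v"
      "!!j x y. tau j (x + y) = tau j x + (tau j y :: real)" "!!j. continuous_on UNIV (tau j)"
      "!!i j r. i < n ==> j < n ==> tau i (phi j r) = (if i = j then r else 0)"
      "!!x. x \<in> range v ==> x = (\<Sum>j<n. phi j (tau j x))"
    then show thesis by (rule that)
  qed
  have sv: "add_subgroup (range v)" by (rule eqproj_range_subgroup[OF v(1)])
  have ve: "eqend v" by (rule eqproj_eqend[OF v])
  have scv: "sc r x \<in> range v" if "x \<in> range v" for r x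
    using that eqend_sc[OF ve, of r x] unfolding eqproj_range[OF v(1)] by simp
  have actv: "act a x \<in> range v" if "x \<in> range v" for a x using eqproj_range_act[OF v(1) that] .
  have tau0: "tau j 0 = 0" for j using B(3)[of j 0 0] by simp
  have tau_sum: "tau i (sum F J) = (\<Sum>j\<in>J. tau i (F j))" for i F and J :: "nat set"
    by (induction J rule: infinite_finite_induct) (auto simp: B(3) tau0)
  have tau_sc: "tau i (sc r x) = r * tau i x" if "x \<in> range v" for i r x
    using functional_sc[OF B(3,4), of i r x] pV_id v(2) that by auto
  have ext: "x = y" if "x \<in> range v" "y \<in> range v" "!!i. i < n ==> tau i x = tau i y" for x y
  proof -
    have "(\<Sum>j<n. phi j (tau j x)) = (\<Sum>j<n. phi j (tau j y))" using that(3) by simp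
    then show ?thesis using B(6)[OF that(1)] B(6)[OF that(2)] by simp
  qed
  define f where "f x = (%i. if i < n then tau i x else 0)" for x
  define g where "g t = (\<Sum>j<n. phi j (t j))" for t :: "nat => real"
  have gv: "g t \<in> range v" for t unfolding g_def using B(2) by (intro add_subgroup_sum[OF sv]) auto
  have taug: "tau i (g t) = t i" if "i < n" for i t
  proof -
    have "tau i (g t) = (\<Sum>j<n. tau i (phi j (t j)))" unfolding g_def by (rule tau_sum)
    also have "\<dots> = (\<Sum>j<n. if i = j then t j else 0)" using B(5) that by (intro sum.cong) auto
    finally show ?thesis using that by simp
  qed
  have iso: "Euclidean_iso (range v) n f g"
    unfolding Euclidean_iso_def
  proof (intro conjI ballI)
    show "homeomorphism (range v) (Rd n) f g"
    proof (rule homeomorphismI)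
      have "continuous_on UNIV (%x. f x i)" for i unfolding f_def using B(4) by (cases "i < n") auto
      then have "continuous_on UNIV f" by (rule continuous_on_coordinatewise_then_product)
      then show "continuous_on (range v) f" by (rule continuous_on_subset) simp
      show "continuous_on (Rd n) g" unfolding g_def
      proof (rule continuous_on_sum)
        fix j assume "j \<in> {..<n}"
        then have o: "oneparam (phi j)" using B(1) by simp
        have "continuous_on (Rd n) (%t. t j)" by (rule continuous_on_product_coordinates[THEN continuous_on_subset]) simp
        then show "continuous_on (Rd n) (%t. phi j (t j))" by (rule continuous_on_compose2[OF oneparamD(1)[OF o, of UNIV]]) simp
      qed
      show "f ` range v <= Rd n" unfolding f_def Rd_def by auto
      show "g ` Rd n <= range v" using gv by blast
      show "g (f x) = x" if "x \<in> range v" for x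
        using B(6)[OF that] unfolding g_def f_def by simp
      show "f (g t) = t" if "t \<in> Rd n" for t
      proof
        fix i show "f (g t) i = t i" using that taug[of i t] unfolding f_def Rd_def by simp
      qed
    qed
    show "f (x + y) = (%i. f x i + f y i)" for x y unfolding f_def using B(3) by auto
  qed
  have lin: "linear_on_Rd n (%x. f (act a (g x)))" for a
    unfolding linear_on_Rd_def
  proof (intro conjI ballI allI)
    show "f (act a (g x)) \<in> Rd n" for x unfolding f_def Rd_def by simp
    show "f (act a (g (%i. x i + y i))) = (%i. f (act a (g x)) i + f (act a (g y)) i)" for x y
    proof -
      have "g (%i. x i + y i) = g x + g y" unfolding g_def using oneparamD(2)[OF B(1)] by (simp add: sum.distrib)
      then show ?thesis unfolding f_def by (auto simp: act_add B(3))
    qed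
    show "f (act a (g (%i. c * x i))) = (%i. c * f (act a (g x)) i)" for c x
    proof -
      have "g (%i. c * x i) = sc c (g x)" unfolding g_def sc_sum using sc_oneparam[OF B(1)] by simp
      then have "act a (g (%i. c * x i)) = sc c (act a (g x))" by (simp add: sc_act)
      then show ?thesis unfolding f_def using tau_sc[OF actv[OF gv]] by auto
    qed
  qed
  have "cmod lam = 1" if ev: "complex_eigenvalue n (%x. f (act a (g x))) lam" for a lam
  proof (rule ccontr)
    assume n1: "cmod lam ~= 1"
    define A where "A i j = tau i (act a (phi j 1))" for i j
    have ge: "g (%l. if l = j then 1 else 0) = phi j 1" if "j < n" for j
    proof -
      have "g (%l. if l = j then 1 else 0) = (\<Sum>k<n. if k = j then phi j 1 else 0)"
        unfolding g_def using oneparamD(3)[OF B(1)] by (intro sum.cong) auto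
      then show ?thesis using that by simp
    qed
    obtain z where z: "\<exists>i<n. z i ~= 0" "!!i. i < n ==>
      (\<Sum>j<n. complex_of_real (f (act a (g (%l. if l = j then 1 else 0))) i) * z j) = lam * z i"
      using ev unfolding complex_eigenvalue_def by blast
    have z2: "(\<Sum>j<n. complex_of_real (A i j) * z j) = lam * z i" if "i < n" for i
      using z(2)[OF that] that ge unfolding A_def f_def by simp
    have tact: "tau i (act a (g t)) = (\<Sum>j<n. A i j * t j)" if "i < n" for i t
    proof -
      have "act a (g t) = (\<Sum>j<n. act a (phi j (t j)))" unfolding g_def by (rule act_sum)
      also have "\<dots> = (\<Sum>j<n. sc (t j) (act a (phi j 1)))"
        using sc_oneparam[OF B(1), of _ _ 1] by (intro sum.cong) (auto simp: sc_act)
      finally have "tau i (act a (g t)) = (\<Sum>j<n. tau i (sc (t j) (act a (phi j 1))))" using tau_sum by simp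
      also have "\<dots> = (\<Sum>j<n. A i j * t j)" unfolding A_def
        using tau_sc[OF actv[OF B(2)]] by (intro sum.cong) (auto simp: mult.commute)
      finally show ?thesis .
    qed
    define u where "u = g (%j. Re (z j))"
    define w where "w = g (%j. Im (z j))"
    define al where "al = Re lam"
    define be where "be = Im lam"
    have uw: "u \<in> range v" "w \<in> range v" unfolding u_def w_def by (rule gv)+
    have au: "act a u = sc al u - sc be w"
    proof (rule ext)
      fix i assume i: "i < n"
      have "tau i (act a u) = Re (\<Sum>j<n. complex_of_real (A i j) * z j)" unfolding u_def tact[OF i] by simp
      also have "\<dots> = al * Re (z i) - be * Im (z i)" unfolding z2[OF i] al_def be_def by simp
      also have "\<dots> = tau i (sc al u - sc be w)"
      proof -
        have "tau i (x - y) = tau i x - tau i y" for x y using B(3)[of i "x - y" y] by simp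
        then show ?thesis using tau_sc[OF uw(1)] tau_sc[OF uw(2)] taug[OF i] unfolding u_def w_def by simp
      qed
      finally show "tau i (act a u) = tau i (sc al u - sc be w)" .
    qed (use uw actv scv add_subgroupD(4)[OF sv] in auto)
    have aw: "act a w = sc be u + sc al w"
    proof (rule ext)
      fix i assume i: "i < n"
      have "tau i (act a w) = Im (\<Sum>j<n. complex_of_real (A i j) * z j)" unfolding w_def tact[OF i] by simp
      also have "\<dots> = be * Re (z i) + al * Im (z i)" unfolding z2[OF i] al_def be_def by simp
      also have "\<dots> = tau i (sc be u + sc al w)"
        unfolding B(3) using tau_sc[OF uw(1)] tau_sc[OF uw(2)] taug[OF i] unfolding u_def w_def by simp
      finally show "tau i (act a w) = tau i (sc be u + sc al w)" .
    qed (use uw actv scv add_subgroupD(2)[OF sv] in auto)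
    have l: "al\<^sup>2 + be\<^sup>2 ~= 1" using n1 unfolding al_def be_def cmod_def by auto
    have "u ~= 0 \<or> w ~= 0"
    proof -
      obtain i where i: "i < n" "z i ~= 0" using z(1) by blast
      then have "tau i u ~= 0 \<or> tau i w ~= 0" unfolding u_def w_def taug[OF i(1)] by (simp add: complex_eq_iff)
      then show ?thesis using tau0 by metis
    qed
    then show False
    proof
      assume "u ~= 0"
      from eigen_split_ne1[OF v uw this au aw l] show False using no by blast
    next
      \<comment> \<open>Here \<open>u\<close> may vanish, so the roles are exchanged:
        \<open>w + i u\<close> is \<open>i\<close> times the conjugate eigenvector and belongs to
        the conjugate eigenvalue, hence the sign of \<open>be\<close>.\<close>
      assume w0: "w ~= 0"
      have 1: "act a w = sc al w - sc (- be) u" unfolding aw sc_neg by simp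
      have 2: "act a u = sc (- be) w + sc al u" unfolding au sc_neg by simp
      have 3: "al\<^sup>2 + (- be)\<^sup>2 ~= 1" using l by simp
      from eigen_split_ne1[OF v uw(2,1) w0 1 2 3] show False using no by blast
    qed
  qed
  then have "\<forall>a. let T = (%x. f (act a (g x))) in linear_on_Rd n T & (\<forall>lam. complex_eigenvalue n T lam --> cmod lam = 1)"
    using lin by (simp add: Let_def)
  then show "distal_Euclidean act (range v)" unfolding distal_Euclidean_def using iso by blast
qed

text \<open>The state after \<open>n\<close> contractable summands have been split off, with
  remainder \<open>v\<close>. The nonzero witnesses \<open>u i\<close> serve for counting: their
  independence bounds \<open>n\<close> by \<open>d\<close> and ends the process.\<close>

definition splitting :: "nat => (nat => 'b => 'b) => (nat => 'b) => ('b => 'b) => bool" where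
  "splitting n rs u v \<longleftrightarrow> eqproj v & (\<forall>i<n. eqproj (rs i) & contractable act (range (rs i)) & u i \<in> range (rs i) & u i ~= 0) &
     (\<forall>i<n. \<forall>x. v (rs i x) = 0 & rs i (v x) = 0) & (\<forall>i<n. \<forall>j<n. i ~= j --> (\<forall>x. rs i (rs j x) = 0)) &
     (\<forall>x. (\<Sum>i<n. rs i x) + v x = pV x)"

lemma splitting_V0:
  assumes "splitting n rs u v" shows "range v <= V0" "i < n ==> range (rs i) <= V0"
proof -
  note s = assms[unfolded splitting_def]
  have "v x \<in> V0" for x
  proof -
    have "(\<Sum>i<n. rs i (v x)) = 0" using s by (intro sum.neutral) auto
    moreover have "(\<Sum>i<n. rs i (v x)) + v (v x) = pV (v x)" using s by blast
    moreover have "v (v x) = v x" using s by (intro eqprojD(4)) blast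
    ultimately have "pV (v x) = v x" by simp
    then show ?thesis using pV_V0 by metis
  qed
  then show "range v <= V0" by blast
  show "range (rs i) <= V0" if i: "i < n"
  proof
    fix y assume "y \<in> range (rs i)"
    then obtain x where y: "y = rs i x" by blast
    have "(\<Sum>j<n. rs j (rs i x)) = (\<Sum>j<n. if j = i then rs i x else 0)"
      using s i eqprojD(4)[of "rs i"] by (intro sum.cong) auto
    also have "\<dots> = y" using i unfolding y by simp
    finally have "(\<Sum>j<n. rs j y) = y" unfolding y .
    moreover have "(\<Sum>j<n. rs j y) + v y = pV y" using s by blast
    moreover have "v y = 0" using s i unfolding y by blast
    ultimately have "pV y = y" by simp
    then show "y \<in> V0" using pV_V0 by metis
  qed
qed

text \<open>More than \<open>d\<close> witnesses would be linearly dependent; applying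
  \<open>rs k\<close> to the relation isolates a single nonzero term.\<close>

lemma splitting_bound:
  assumes "splitting n rs u v" shows "n \<le> d"
proof (rule ccontr)
  assume "\<not> n \<le> d"
  then have "card {..<d} < card {..<n}" by simp
  then obtain c where c: "\<exists>k\<in>{..<n}. c k ~= 0" "!!i. i < d ==> (\<Sum>k<n. c k * th i (u k)) = 0"
    using homogeneous_system[of "{..<d}" "{..<n}" "%k i. th i (u k)"] by auto
  note s = assms[unfolded splitting_def]
  have uV: "u k \<in> V0" if "k < n" for k using s splitting_V0(2)[OF assms that] that by blast
  define y where "y = (\<Sum>k<n. sc (c k) (u k))"
  have "y = 0"
  proof (rule V0_ext)
    show "y \<in> V0" unfolding y_def by (intro add_subgroup_sum[OF V0_subgroup] sc_V0)
    fix i assume "i < d"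
    have "th i y = (\<Sum>k<n. c k * th i (u k))" unfolding y_def th_sum th_sc by (rule sum.cong) (auto simp: pV_id uV)
    then show "th i y = 0" using c(2)[OF \<open>i < d\<close>] by simp
  qed
  obtain k where k: "k < n" "c k ~= 0" using c(1) by blast
  have ek: "eqproj (rs k)" using s k(1) by blast
  have re: "eqend (rs k)" by (rule eqproj_eqend[OF ek splitting_V0(2)[OF assms k(1)]])
  have ru: "rs k (u j) = (if j = k then u k else 0)" if j: "j < n" for j
  proof (cases "j = k")
    case True
    have "u k \<in> range (rs k)" using s k(1) by blast
    then show ?thesis using eqproj_range[OF ek] True by simp
  next
    case False
    have "u j \<in> range (rs j)" using s j by blast
    then obtain x where "u j = rs j x" by blast
    then show ?thesis using s j k(1) False by metis
  qed
  have "rs k y = (\<Sum>j<n. sc (c j) (rs k (u j)))" unfolding y_def eqendD(8)[OF re] eqend_sc[OF re] ..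
  also have "\<dots> = (\<Sum>j<n. if j = k then sc (c k) (u k) else 0)" using ru sc_zero by (intro sum.cong) auto
  also have "\<dots> = sc (c k) (u k)" using k(1) by simp
  finally have "sc (c k) (u k) = 0" using \<open>y = 0\<close> eqprojD(5)[OF ek] by simp
  then have "sc (1 / c k) (sc (c k) (u k)) = 0" by (simp add: sc_zero)
  then have "u k = 0" using k uV by (simp add: sc_sc sc_1 pV_id)
  then show False using s k(1) by blast
qed

lemma splitting_step:
  assumes S: "splitting n rs u v" and nd: "\<not> distal_Euclidean act (range v)"
  shows "\<exists>rs u v. splitting (Suc n) rs u v"
proof -
  note s = S[unfolded splitting_def]
  have v: "eqproj v" using s by blast
  obtain r u' where r: "eqproj r" "contractable act (range r)" "!!x. v (r x) = r x" "!!x. r (v x) = r x" "u' \<in> range r" "u' ~= 0"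
    using distal_or_split[OF v splitting_V0(1)[OF S]] nd by blast
  have z: "r 0 = 0" "!!i. i < n ==> rs i 0 = 0" using eqprojD(5) r(1) s by blast+
  have o: "v (rs i x) = 0" "rs i (v x) = 0" if "i < n" for i x using s that by blast+
  have ro: "r (rs i x) = 0" "rs i (r x) = 0" if "i < n" for i x
    using r(4)[of "rs i x"] r(3)[of x] o[OF that, of x] o(2)[OF that, of "r x"] z by simp_all
  define v' where "v' x = v x - r x" for x
  have v': "eqproj v'" unfolding v'_def[abs_def] by (rule eqproj_subtract[OF v r(1,3,4)])
  have ei: "eqproj (rs i)" if "i < n" for i using s that by blast
  have "splitting (Suc n) (rs(n := r)) (u(n := u')) v'"
    unfolding splitting_def
  proof (intro conjI allI impI)
    fix i x assume i: "i < Suc n"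
    show "eqproj ((rs(n := r)) i)" "contractable act (range ((rs(n := r)) i))" "(u(n := u')) i \<in> range ((rs(n := r)) i)"
      "(u(n := u')) i ~= 0"
      using i r s by (auto simp: less_Suc_eq)
    show "v' ((rs(n := r)) i x) = 0" using i o ro unfolding v'_def by (auto simp: less_Suc_eq r(3) eqprojD(4)[OF r(1)])
    show "(rs(n := r)) i (v' x) = 0"
      using i o ro unfolding v'_def by (auto simp: less_Suc_eq r(4) eqprojD(4,6)[OF r(1)] eqprojD(6)[OF ei])
    fix j assume "j < Suc n" "i ~= j"
    then show "(rs(n := r)) i ((rs(n := r)) j x) = 0" using i s ro by (auto simp: less_Suc_eq)
  next
    fix x
    have "(\<Sum>i<n. (rs(n := r)) i x) = (\<Sum>i<n. rs i x)" by (rule sum.cong) auto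
    moreover have "(\<Sum>i<n. rs i x) + v x = pV x" using s by blast
    ultimately show "(\<Sum>i<Suc n. (rs(n := r)) i x) + v' x = pV x" unfolding v'_def by simp
  qed (rule v')
  then show ?thesis by blast
qed

lemma Euclidean_decomposition:
  obtains p v where "polyc p" "eqproj v" "distal_Euclidean act (range v)" "!!x. p x + v x = pV x" "!!x. p (v x) = 0" "!!x. v (p x) = 0"
proof -
  have "\<exists>n rs u v. splitting n rs u v & distal_Euclidean act (range v)"
  proof (rule ccontr)
    assume no: "\<nexists>n rs u v. splitting n rs u v & distal_Euclidean act (range v)"
    have "\<exists>rs u v. splitting n rs u v" for n
    proof (induction n)
      case 0
      have "splitting 0 undefined undefined pV" unfolding splitting_def using pV(1) by simp
      then show ?case by blast
    next
      case (Suc n) then show ?case using no splitting_step by blast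
    qed
    from this[of "Suc d"] show False using splitting_bound by (metis Suc_n_not_le_n)
  qed
  then obtain n rs u v where S: "splitting n rs u v" and dv: "distal_Euclidean act (range v)" by blast
  note s = S[unfolded splitting_def]
  have v: "eqproj v" using s by blast
  define p where "p x = (\<Sum>i<n. rs i x)" for x
  have "polyc p" unfolding polyc_def using s by (intro exI[of _ n] exI[of _ rs]) (simp add: p_def)
  moreover have "p x + v x = pV x" for x unfolding p_def using s by blast
  moreover have "p (v x) = 0" for x unfolding p_def using s by simp
  moreover have "v (p x) = 0" for x
    unfolding p_def eqprojD(8)[OF v] using s by simp
  ultimately show ?thesis using v dv that by blast
qed

end

subsection \<open>Projections and direct sums\<close>

context lc_module
begin

lemma eqproj_closed_submodule: assumes "eqproj p" shows "closed_submodule act UNIV (range p)"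
  unfolding closed_submodule_def submodule_def
  using eqproj_range_subgroup[OF assms] eqproj_range_act[OF assms] eqproj_range_closed[OF assms] by simp

lemma polyc_polycontractable: assumes "polyc p" shows "polycontractable act (range p)"
proof -
  obtain k :: nat and ps where d: "!!i. i < k ==> eqproj (ps i)" "!!i. i < k ==> contractable act (range (ps i))"
    "!!i j x. i < k ==> j < k ==> i ~= j ==> ps i (ps j x) = 0" "!!x. p x = (\<Sum>i<k. ps i x)"
    "!!i x. i < k ==> ps i (p x) = ps i x" "!!i x. i < k ==> p (ps i x) = ps i x" using polyc_data[OF assms] by blast
  have pe: "eqproj p" by (rule polyc_eqproj[OF assms])
  have sub: "range (ps i) <= range p" if "i < k" for i using d(6)[OF that] by (metis image_subsetI rangeI)
  have cs: "closed_submodule act (range p) (range (ps i))" if i: "i < k" for i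
    unfolding closed_submodule_def submodule_def
    using sub[OF i] eqproj_range_subgroup[OF d(1)[OF i]] eqproj_range_act[OF d(1)[OF i]] closed_subset[OF sub[OF i] eqproj_range_closed[OF d(1)[OF i]]] by simp
  define g where "g y = (\<lambda>i\<in>{..<k}. ps i y)" for y
  have "homeomorphism (PiE {..<k} (%i. range (ps i))) (range p) (%x. \<Sum>i<k. x i) g"
  proof (rule homeomorphismI)
    show "continuous_on (PiE {..<k} (%i. range (ps i))) (%x. \<Sum>i<k. x i)"
      by (intro continuous_on_sum continuous_on_product_coordinates[THEN continuous_on_subset]) simp
    have "continuous_on (range p) (%y. g y i)" for i
      unfolding g_def using continuous_on_subset[OF eqprojD(2)[OF d(1)[of i]]] by (cases "i < k") (auto simp: continuous_on_const)
    then show "continuous_on (range p) g" by (rule continuous_on_coordinatewise_then_product)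
    show "(%x. \<Sum>i<k. x i) ` PiE {..<k} (%i. range (ps i)) <= range p"
    proof (rule image_subsetI, rule add_subgroup_sum[OF eqproj_range_subgroup[OF pe]])
      fix x i assume "x \<in> PiE {..<k} (%i. range (ps i))" and i: "i \<in> {..<k}"
      then have "x i \<in> range (ps i)" by (rule PiE_mem)
      then show "x i \<in> range p" using sub i by auto
    qed
    show "g ` range p <= PiE {..<k} (%i. range (ps i))" unfolding g_def by (intro image_subsetI restrict_PiE_iff[THEN iffD2]) simp
    show "g (\<Sum>i<k. x i) = x" if x: "x \<in> PiE {..<k} (%i. range (ps i))" for x
    proof
      fix i
      show "g (\<Sum>i<k. x i) i = x i"
      proof (cases "i < k")
        case True
        have "ps i (\<Sum>i<k. x i) = (\<Sum>j<k. ps i (x j))" by (rule eqprojD(8)[OF d(1)[OF True]])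
        also have "\<dots> = (\<Sum>j<k. if j = i then x i else 0)"
        proof (rule sum.cong[OF refl])
          fix j assume j: "j \<in> {..<k}"
          have xj: "x j \<in> range (ps j)" using PiE_mem[OF x j] .
          show "ps i (x j) = (if j = i then x i else 0)"
          proof (cases "j = i")
            case True then show ?thesis using xj eqproj_range[OF d(1)] j by auto
          next
            case False then show ?thesis using xj d(3)[of i j] j \<open>i < k\<close> by auto
          qed
        qed
        finally show ?thesis using True unfolding g_def by simp
      next
        case False then show ?thesis using x unfolding g_def by (auto simp: PiE_def extensional_def)
      qed
    qed
    show "(\<Sum>i<k. g y i) = y" if "y \<in> range p" for y
    proof -
      have "p y = y" using that eqproj_range[OF pe] by blast
      then show ?thesis using d(4)[of y] unfolding g_def by simp
    qed
  qed
  then show ?thesis unfolding polycontractable_def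
    using cs d(2) by (intro exI[of _ k] exI[of _ "%i. range (ps i)"]) blast
qed

text \<open>The component maps of the given sum are additive and equivariant because components are
  unique, and continuous because the sum map is a homeomorphism; preceded by \<open>p\<close> they
  are idempotents of the whole module.\<close>

lemma polycontractable_polyc: assumes p: "eqproj p" and pc: "polycontractable act (range p)" shows "polyc p"
proof -
  obtain k :: nat and Ns g where N: "!!i. i < k ==> closed_submodule act (range p) (Ns i)" "!!i. i < k ==> contractable act (Ns i)"
    and h: "homeomorphism (PiE {..<k} Ns) (range p) (%x. \<Sum>i<k. x i) g"
    using pc unfolding polycontractable_def by blast
  have Ns: "Ns i <= range p" "add_subgroup (Ns i)" "!!a x. x \<in> Ns i ==> act a x \<in> Ns i" if "i < k" for i
    using N(1)[OF that] unfolding closed_submodule_def submodule_def by auto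
  have gN: "g y i \<in> Ns i" if "y \<in> range p" "i < k" for y i
  proof -
    have "g y \<in> PiE {..<k} Ns" using homeomorphism_image2[OF h] that(1) by blast
    then show ?thesis using that(2) by (auto dest: PiE_mem)
  qed
  have gs: "(\<Sum>i<k. g y i) = y" if "y \<in> range p" for y using homeomorphism_apply2[OF h that] .
  have inj: "g y i = z i" if "!!i. i < k ==> z i \<in> Ns i" "(\<Sum>i<k. z i) = y" "i < k" for y z i
  proof -
    have "restrict z {..<k} \<in> PiE {..<k} Ns" using that(1) by auto
    from homeomorphism_apply1[OF h this] have "g (\<Sum>i<k. restrict z {..<k} i) = restrict z {..<k}" .
    moreover have "(\<Sum>i<k. restrict z {..<k} i) = y" using that(2) by simp
    ultimately show ?thesis using that(3) by simp
  qed
  define ps where "ps i x = g (p x) i" for i x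
  have one: "g y j = (if j = i then y else 0)" if "y \<in> Ns i" "i < k" "j < k" for y i j
    by (rule inj[of "%j. if j = i then y else 0"]) (use that add_subgroupD(1)[OF Ns(2)] in auto)
  have psN: "ps i x \<in> Ns i" if "i < k" for i x unfolding ps_def using gN that by blast
  have pp: "p (ps i x) = ps i x" if "i < k" for i x using psN[OF that] Ns(1)[OF that] eqproj_range[OF p] by blast
  have pps: "ps j (ps i x) = (if j = i then ps i x else 0)" if "i < k" "j < k" for i j x
    using one[OF psN[OF that(1)] that, of x] unfolding ps_def[of j "ps i x"] pp[OF that(1)] .
  have e: "eqproj (ps i)" if i: "i < k" for i
    unfolding eqproj_def
  proof (intro conjI allI)
    show "ps i (x + y) = ps i x + ps i y" for x y
    proof -
      have "g (p (x + y)) i = ps i x + ps i y"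
      proof (rule inj[OF _ _ i])
        show "ps i x + ps i y \<in> Ns i" if "i < k" for i using add_subgroupD(2)[OF Ns(2)[OF that] psN[OF that] psN[OF that]] .
        show "(\<Sum>i<k. ps i x + ps i y) = p (x + y)" unfolding ps_def sum.distrib by (simp add: gs eqprojD(1)[OF p])
      qed
      then show ?thesis unfolding ps_def .
    qed
    show "ps i (act a x) = act a (ps i x)" for a x
    proof -
      have "g (p (act a x)) i = act a (ps i x)"
      proof (rule inj[OF _ _ i])
        show "act a (ps i x) \<in> Ns i" if "i < k" for i using Ns(3)[OF that psN[OF that]] .
        show "(\<Sum>i<k. act a (ps i x)) = p (act a x)" unfolding ps_def act_sum[symmetric] by (simp add: gs eqprojD(3)[OF p])
      qed
      then show ?thesis unfolding ps_def .
    qed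
    have "continuous_on UNIV (%x. g (p x))" by (rule continuous_on_compose2[OF homeomorphism_cont2[OF h] eqprojD(2)[OF p]]) simp
    then show "continuous_on UNIV (ps i)" unfolding ps_def by (rule continuous_on_product_then_coordinatewise)
    show "ps i (ps i x) = ps i x" for x using pps[OF i i] by simp
  qed
  have c: "contractable act (range (ps i))" if i: "i < k" for i
  proof -
    obtain a where "contracting_on (Ns i) (act a)" using N(2)[OF i] unfolding contractable_def by blast
    then have "contracting_on (range (ps i)) (act a)" by (rule contracting_on_subset) (use psN[OF i] in blast)
    then show ?thesis unfolding contractable_def by blast
  qed
  have "p x = (\<Sum>i<k. ps i x)" for x unfolding ps_def by (simp add: gs)
  then show ?thesis unfolding polyc_def using e c pps by (intro exI[of _ k] exI[of _ ps]) simp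
qed

lemma direct_sum_projections:
  assumes S: "closed_submodule act UNIV P" "closed_submodule act UNIV E" "closed_submodule act UNIV V" and D: "top_direct_sum3 P E V"
  obtains p e v where "eqproj p" "eqproj e" "eqproj v" "range p = P" "range e = E" "range v = V" "!!x. p x + e x + v x = x"
proof -
  have s: "add_subgroup P" "add_subgroup E" "add_subgroup V" "!!a x. x \<in> P ==> act a x \<in> P" "!!a x. x \<in> E ==> act a x \<in> E" "!!a x. x \<in> V ==> act a x \<in> V"
    using S unfolding closed_submodule_def submodule_def by auto
  obtain g where h: "homeomorphism (P \<times> E \<times> V) UNIV (%(p, e, v). p + e + v) g" using D unfolding top_direct_sum3_def by blast
  define p where "p x = fst (g x)" for x
  define e where "e x = fst (snd (g x))" for x
  define v where "v x = snd (snd (g x))" for x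
  have g: "g x = (p x, e x, v x)" for x unfolding p_def e_def v_def by simp
  have "g x \<in> P \<times> E \<times> V" for x using homeomorphism_image2[OF h] by blast
  then have m: "p x \<in> P" "e x \<in> E" "v x \<in> V" for x unfolding g by auto
  have sum: "p x + e x + v x = x" for x using homeomorphism_apply2[OF h UNIV_I, of x] unfolding g by simp
  have inj: "p (a + b + c) = a & e (a + b + c) = b & v (a + b + c) = c" if "a \<in> P" "b \<in> E" "c \<in> V" for a b c
    using homeomorphism_apply1[OF h, of "(a, b, c)"] that unfolding g by simp
  have gc: "continuous_on UNIV g" by (rule homeomorphism_cont2[OF h])
  have c: "continuous_on UNIV p" "continuous_on UNIV e" "continuous_on UNIV v"
    unfolding p_def e_def v_def by (intro continuous_on_fst continuous_on_snd gc)+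
  have add: "p (x + y) = p x + p y & e (x + y) = e x + e y & v (x + y) = v x + v y" for x y
  proof -
    have "x + y = (p x + p y) + (e x + e y) + (v x + v y)" using sum[of x] sum[of y] by (metis (no_types, lifting) add.assoc add.left_commute)
    then show ?thesis using inj[OF add_subgroupD(2)[OF s(1) m(1) m(1)] add_subgroupD(2)[OF s(2) m(2) m(2)] add_subgroupD(2)[OF s(3) m(3) m(3)], of x y x y x y] by simp
  qed
  have ac: "p (act a x) = act a (p x) & e (act a x) = act a (e x) & v (act a x) = act a (v x)" for a x
  proof -
    have "act a x = act a (p x) + act a (e x) + act a (v x)" unfolding act_add[symmetric] sum ..
    then show ?thesis using inj[OF s(4)[OF m(1)] s(5)[OF m(2)] s(6)[OF m(3)], of a x a x a x] by simp
  qed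
  note z = add_subgroupD(1)[OF s(1)] add_subgroupD(1)[OF s(2)] add_subgroupD(1)[OF s(3)]
  have id: "p x = x" if "x \<in> P" for x using inj[OF that z(2,3)] by simp
  have ide: "e x = x" if "x \<in> E" for x using inj[OF z(1) that z(3)] by simp
  have idv: "v x = x" if "x \<in> V" for x using inj[OF z(1,2) that] by simp
  have "eqproj p" "eqproj e" "eqproj v" unfolding eqproj_def using add ac c id[OF m(1)] ide[OF m(2)] idv[OF m(3)] by blast+
  moreover have "range p = P" "range e = E" "range v = V" using m id ide idv by (metis image_subsetI rangeI subsetI subset_antisym)+
  ultimately show ?thesis using sum that by blast
qed

lemma direct_sum_of_projections:
  assumes e: "eqproj p" "eqproj e" "eqproj v" and sum: "!!x. p x + e x + v x = x"
    and o: "!!x. p (e x) = 0" "!!x. p (v x) = 0" "!!x. e (p x) = 0" "!!x. e (v x) = 0" "!!x. v (p x) = 0" "!!x. v (e x) = 0"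
  shows "top_direct_sum3 (range p) (range e) (range v)"
  unfolding top_direct_sum3_def
proof
  show "homeomorphism (range p \<times> range e \<times> range v) UNIV (%(p, e, v). p + e + v) (%x. (p x, e x, v x))"
  proof (rule homeomorphismI)
    show "continuous_on (range p \<times> range e \<times> range v) (%(p, e, v). p + e + v)"
      by (auto simp: case_prod_beta intro!: continuous_intros)
    show "continuous_on UNIV (%x. (p x, e x, v x))" by (intro continuous_intros eqprojD(2)[OF e(1)] eqprojD(2)[OF e(2)] eqprojD(2)[OF e(3)])
    show "(%x. (p x, e x, v x)) ((%(p, e, v). p + e + v) y) = y" if "y \<in> range p \<times> range e \<times> range v" for y
    proof -
      obtain a b c where "y = (p a, e b, v c)" using \<open>y \<in> _\<close> by auto
      then show ?thesis using o by (simp add: eqprojD(1,4)[OF e(1)] eqprojD(1,4)[OF e(2)] eqprojD(1,4)[OF e(3)])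
    qed
    show "(%(p, e, v). p + e + v) ((%x. (p x, e x, v x)) y) = y" for y using sum by simp
  qed auto
qed

section \<open>Vanishing of homomorphisms between summands of different kinds\<close>

lemma contracting_tendsto: fixes x :: 'm assumes "contracting_on N \<phi>" "x \<in> N" shows "(%n. (\<phi> ^^ n) x) \<longlonglongrightarrow> 0"
proof (rule topological_tendstoI)
  fix S :: "'m set" assume "open S" "0 \<in> S"
  then have "\<forall>\<^sub>F n in sequentially. (\<phi> ^^ n) ` {x} <= S" using assms unfolding contracting_on_def by (metis compact_insert compact_empty empty_subsetI insert_subset)
  then show "\<forall>\<^sub>F n in sequentially. (\<phi> ^^ n) x \<in> S" by simp
qed

lemma eqproj_funpow: assumes "eqproj h" shows "h ((act a ^^ n) x) = (act a ^^ n) (h x)"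
  by (induction n) (simp_all add: eqprojD(3)[OF assms])

lemma funpow_in_submodule: assumes "(act a ^^ n) x \<in> L" "!!a x. x \<in> L ==> act a x \<in> L" shows "x \<in> L"
  using assms(1)
proof (induction n)
  case (Suc n)
  have "act (- a) ((act a ^^ Suc n) x) \<in> L" by (rule assms(2)[OF Suc.prems])
  then show ?case using Suc.IH by simp
qed simp

lemma eqproj_image_act:
  "eqproj h ==> (!!a x. x \<in> C ==> act a x \<in> C) ==> y \<in> h ` C ==> act a y \<in> h ` C"
  by (metis eqprojD(3) imageE imageI)

lemma amorphic_open:
  assumes "amorphic act E"
  obtains U W where "submodule act E U" "compact U" "open W" "0 \<in> W" "W Int E <= U"
proof -
  obtain U where U: "submodule act E U" "compact U" "openin (top_of_set E) U" using assms unfolding amorphic_def by blast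
  obtain W where W: "open W" "U = E Int W" using U(3) unfolding openin_open by blast
  have "0 \<in> W" using U(1) W(2) add_subgroupD(1)[of U] unfolding submodule_def by blast
  then show ?thesis using that[OF U(1,2) W(1)] W(2) by blast
qed

text \<open>\<open>h\<close> maps a compact open submodule of the amorphic part to a compact
  submodule of its range, which is 0; so the kernel \<open>K\<close> is open there. A finite
  extension of \<open>K\<close> has finite, hence compact, image and adds nothing. Thus the quotient
  by \<open>K\<close> is purely discrete, and \<open>Omega_sharp\<close> leaves no room outside
  \<open>K\<close>.\<close>

lemma amorphic_hom_zero:
  assumes e: "eqproj e" "amorphic act (range e)" and h: "eqproj h"
    and nc: "!!C. compact C ==> add_subgroup C ==> (!!a x. x \<in> C ==> act a x \<in> C) ==> C <= range h ==> C <= {0}"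
    and x: "x \<in> range e"
  shows "h x = 0"
proof -
  obtain U W where U0: "submodule act (range e) U" and U1: "compact U" "open W" "0 \<in> W" "W Int range e <= U"
    by (rule amorphic_open[OF e(2)])
  have U: "add_subgroup U" "!!a x. x \<in> U ==> act a x \<in> U" "U <= range e" using U0 unfolding submodule_def by auto
  note U = U U1
  have sE: "add_subgroup (range e)" by (rule eqproj_range_subgroup[OF e(1)])
  have img: "h ` C <= {0}" if "compact C" "add_subgroup C" "!!a x. x \<in> C ==> act a x \<in> C" for C
    by (rule nc[OF compact_continuous_image[OF eqprojD(2)[OF h, THEN continuous_on_subset[OF _ subset_UNIV]] that(1)]
        eqproj_image_subgroup[OF h that(2)] eqproj_image_act[OF h that(3)]]) auto
  define K where "K = {x \<in> range e. h x = 0}"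
  have sK: "add_subgroup K" unfolding K_def add_subgroup_def
    using add_subgroupD(1,2,3)[OF sE] by (simp add: eqprojD(1,5,7)[OF h])
  have KE: "K <= range e" unfolding K_def by blast
  have Kact: "act a x \<in> K" if "x \<in> K" for a x
    using that eqproj_range_act[OF e(1)] unfolding K_def by (simp add: eqprojD(3)[OF h])
  have "h ` U <= {0}" by (rule img[OF U(4,1,2)])
  then have "U <= K" unfolding K_def using U(3) by blast
  then have "openin (top_of_set (range e)) K" using U(7) by (intro relatively_open_subgroup[OF sE sK KE U(5,6)]) blast
  moreover have sub: "submodule act (range e) K" unfolding submodule_def using sK KE Kact by blast
  moreover have "purely_discrete_quotient act (range e) K"
    unfolding purely_discrete_quotient_def
  proof (intro allI impI, elim conjE)
    fix F assume F: "submodule act (range e) F" "K <= F" "finite (cosets F K)"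
    have F': "F <= range e" "add_subgroup F" "!!a x. x \<in> F ==> act a x \<in> F" using F(1) unfolding submodule_def by auto
    have "h ` F <= (%A. the_elem (h ` A)) ` cosets F K"
    proof
      fix y assume "y \<in> h ` F"
      then obtain x where x: "x \<in> F" "y = h x" by blast
      have "h ` ((+) x ` K) = {h x}"
      proof
        show "h ` ((+) x ` K) <= {h x}" unfolding K_def by (auto simp: eqprojD(1)[OF h])
        have "x \<in> (+) x ` K" by (rule coset_self[OF add_subgroupD(1)[OF sK]])
        then show "{h x} <= h ` ((+) x ` K)" by blast
      qed
      then have "y = the_elem (h ` ((+) x ` K))" using x(2) by simp
      then show "y \<in> (%A. the_elem (h ` A)) ` cosets F K" unfolding cosets_def using x(1) by blast
    qed
    then have "finite (h ` F)" by (rule finite_subset[OF _ finite_imageI[OF F(3)]])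
    then have "compact (h ` F)" by (rule finite_imp_compact)
    then have "h ` F <= {0}"
      by (rule nc[OF _ eqproj_image_subgroup[OF h F'(2)] eqproj_image_act[OF h F'(3)]]) auto
    then have "F <= K" unfolding K_def using F'(1) by blast
    then show "F = K" using F(2) by blast
  qed
  ultimately have "K \<in> {U. open_submodule act (range e) U & purely_discrete_quotient act (range e) U}"
    by (simp add: open_submodule_def)
  then have "Omega_sharp act (range e) <= K" unfolding Omega_sharp_def by (rule Inter_lower)
  moreover have "Omega_sharp act (range e) = range e" using e(2) by (simp add: amorphic_def sheer_def)
  ultimately show ?thesis using x unfolding K_def by blast
qed

text \<open>Each \<open>y\<close> in \<open>C\<close> is the \<open>n\<close>-th image of a point of
  \<open>C\<close>, yet for large \<open>n\<close> the \<open>n\<close>-th image of the compact set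
  avoids any given nonzero point.\<close>

lemma contractable_no_compact:
  assumes N: "contractable act N" and C: "compact C" "!!a x. x \<in> C ==> act a x \<in> C" "C <= N" shows "C <= {0}"
proof
  fix y assume y: "y \<in> C"
  obtain a where a: "contracting_on N (act a)" using N unfolding contractable_def by blast
  show "y \<in> {0}"
  proof (rule ccontr)
    assume "y \<notin> {0}"
    then have "open (- {y})" "0 \<in> - {y}" by auto
    then have "\<forall>\<^sub>F n in sequentially. (act a ^^ n) ` C <= - {y}" using a C(1,3) unfolding contracting_on_def by blast
    then obtain n where n: "(act a ^^ n) ` C <= - {y}" using eventually_happens'[OF sequentially_bot] by blast
    define x where "x = (act (- a) ^^ n) y"
    have "x \<in> C" unfolding x_def by (induction n) (simp_all add: y C(2))
    moreover have "(act a ^^ n) ((act (- a) ^^ n) y) = y" for n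
    proof (induction n)
      case (Suc n)
      then show ?case unfolding funpow_Suc_right[of n "act a"] funpow.simps(2)[of n "act (- a)"] o_apply act_inv .
    qed simp
    ultimately show False using n unfolding x_def by blast
  qed
qed

lemma polyc_no_compact:
  assumes p: "polyc p" and C: "compact C" "add_subgroup C" "!!a x. x \<in> C ==> act a x \<in> C" "C <= range p" shows "C <= {0}"
proof
  fix y assume y: "y \<in> C"
  obtain k :: nat and ps where d: "!!i. i < k ==> eqproj (ps i)" "!!i. i < k ==> contractable act (range (ps i))"
    "!!x. p x = (\<Sum>i<k. ps i x)" using polyc_data[OF p] by metis
  have "ps i y = 0" if i: "i < k" for i
  proof -
    have "compact (ps i ` C)" by (rule compact_continuous_image[OF continuous_on_subset[OF eqprojD(2)[OF d(1)[OF i]] subset_UNIV] C(1)])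
    then have "ps i ` C <= {0}"
      by (rule contractable_no_compact[OF d(2)[OF i] _ eqproj_image_act[OF d(1)[OF i] C(3)]]) auto
    then show ?thesis using y by blast
  qed
  then have "p y = 0" unfolding d(3) by simp
  moreover have "p y = y" using y C(4) eqproj_range[OF polyc_eqproj[OF p]] by blast
  ultimately show "y \<in> {0}" by simp
qed

end

context pfree_module
begin

text \<open>The orbit of \<open>e y\<close> tends to 0, so it enters each open submodule, and
  invariance under \<open>A\<close> brings \<open>e y\<close> itself into it. Applied to a compact
  open submodule this bounds the image; applied to finite-index submodules it shows that the closure
  of the image is parafinite, hence 0.\<close>

lemma contractable_amorphic_zero:
  assumes r: "eqproj r" "contractable act (range r)" and e: "eqproj e" "amorphic act (range e)" and x: "x \<in> range r"
  shows "e x = 0"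
proof -
  obtain a where a: "contracting_on (range r) (act a)" using r(2) unfolding contractable_def by blast
  obtain U W0 where U0: "submodule act (range e) U" and U1: "compact U" "open W0" "0 \<in> W0" "W0 Int range e <= U"
    by (rule amorphic_open[OF e(2)])
  have U: "add_subgroup U" "!!a x. x \<in> U ==> act a x \<in> U" "U <= range e" using U0 unfolding submodule_def by auto
  note U = U U1
  have key: "e y \<in> L" if y: "y \<in> range r" and L: "!!a x. x \<in> L ==> act a x \<in> L" "open Wn" "0 \<in> Wn"
    "!!n. (act a ^^ n) (e y) \<in> Wn ==> (act a ^^ n) (e y) \<in> L" for y L Wn
  proof -
    have "(%n. e ((act a ^^ n) y)) \<longlonglongrightarrow> e 0"
      by (rule continuous_on_tendsto_compose[OF eqprojD(2)[OF e(1), of UNIV] contracting_tendsto[OF a y]]) auto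
    then have "(%n. (act a ^^ n) (e y)) \<longlonglongrightarrow> 0" by (simp add: eqproj_funpow[OF e(1)] eqprojD(5)[OF e(1)])
    then have "\<forall>\<^sub>F n in sequentially. (act a ^^ n) (e y) \<in> Wn" using L(2,3) by (rule topological_tendstoD)
    then obtain n where "(act a ^^ n) (e y) \<in> Wn" using eventually_happens'[OF sequentially_bot] by blast
    then have "(act a ^^ n) (e y) \<in> L" by (rule L(4))
    then show ?thesis using L(1) by (rule funpow_in_submodule)
  qed
  define C where "C = closure (e ` range r)"
  note im = eqproj_image_subgroup[OF e(1) eqproj_range_subgroup[OF r(1)]] eqproj_image_act[OF e(1) eqproj_range_act[OF r(1)]]
  have inv: "(act a ^^ n) (e y) \<in> e ` range r" if "y \<in> range r" for y n
  proof -
    have "(act a ^^ n) y \<in> range r" by (induction n) (simp_all add: that eqproj_range_act[OF r(1)])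
    then show ?thesis unfolding eqproj_funpow[OF e(1), symmetric] by blast
  qed
  have "e y \<in> U" if "y \<in> range r" for y
  proof (rule key[OF that U(2,5,6)])
    fix n assume "(act a ^^ n) (e y) \<in> W0"
    moreover have "(act a ^^ n) (e y) \<in> range e" unfolding eqproj_funpow[OF e(1), symmetric] by blast
    ultimately show "(act a ^^ n) (e y) \<in> U" using U(7) by blast
  qed
  then have "e ` range r <= U" by blast
  then have CU: "C <= U" unfolding C_def by (rule closure_minimal[OF _ compact_imp_closed[OF U(4)]])
  have clC: "closed C" unfolding C_def by (rule closed_closure)
  have cC: "compact C" using compact_Int_closed[OF U(4) clC] CU by (simp add: Int_absorb1)
  have sub: "submodule act UNIV C" unfolding submodule_def C_def
    using add_subgroup_closure[OF im(1)] act_closure[OF im(2)] by blast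
  have "compact_parafinite act C" unfolding compact_parafinite_def
  proof (intro conjI cC allI impI, elim conjE)
    fix L assume L: "closed_submodule act C L" "finite (cosets C L)"
    have L': "L <= C" "add_subgroup L" "!!a x. x \<in> L ==> act a x \<in> L" "closed L"
      using L(1) closedin_closed_trans[OF _ clC] unfolding closed_submodule_def submodule_def by auto
    obtain Wn where Wn: "open Wn" "0 \<in> Wn" "Wn Int C <= L" by (rule finite_cosets_open[OF L'(2,4) L(2)])
    have "e y \<in> L" if y: "y \<in> range r" for y
    proof (rule key[OF y L'(3) Wn(1,2)])
      fix n assume "(act a ^^ n) (e y) \<in> Wn"
      moreover have "(act a ^^ n) (e y) \<in> C" unfolding C_def by (rule subsetD[OF closure_subset inv[OF y]])
      ultimately show "(act a ^^ n) (e y) \<in> L" using Wn(3) by blast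
    qed
    then have "e ` range r <= L" by blast
    then have "C <= L" unfolding C_def by (rule closure_minimal[OF _ L'(4)])
    then show "L = C" using L'(1) by blast
  qed
  from W[OF sub this] have "C = {0}" .
  moreover have "e x \<in> C" unfolding C_def by (rule subsetD[OF closure_subset]) (use x in blast)
  ultimately show ?thesis by blast
qed

end

lemma distal_EuclideanE:
  assumes "distal_Euclidean act V"
  obtains d f g where "Euclidean_iso V d f g" "!!a lam. complex_eigenvalue d (%x. f (act a (g x))) lam ==> cmod lam = 1"
  using assms unfolding distal_Euclidean_def Let_def by blast

context real_part
begin

text \<open>The image of a path is a path, and by divisibility it runs inside the compact open
  submodule; so its values are elliptic and lie in \<open>V0\<close> as well.\<close>

lemma Euclidean_amorphic_zero:
  assumes e: "eqproj e" "amorphic act (range e)" and x: "x \<in> V0" shows "e x = 0"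
proof -
  obtain U W0 where U0: "submodule act (range e) U" and U: "compact U" "open W0" "0 \<in> W0" "W0 Int range e <= U"
    by (rule amorphic_open[OF e(2)])
  have sU: "add_subgroup U" using U0 unfolding submodule_def by blast
  obtain \<phi> where \<phi>: "oneparam \<phi>" "x = \<phi> 1" using x by (rule V0_E)
  have o: "oneparam (%r. e (\<phi> r))" by (rule oneparam_hom[OF \<phi>(1) eqprojD(2,1)[OF e(1)]])
  obtain m :: nat where m: "m > 0" "e (\<phi> (1 / real m)) \<in> W0" "zm (int m) (e (\<phi> (1 / real m))) = e (\<phi> 1)"
    by (rule oneparam_small[OF o U(2,3), of 1])
  have "e (\<phi> (1 / real m)) \<in> U" using m(2) U(4) by blast
  then have "e x \<in> U" using add_subgroup_zm[OF sU, of _ "int m"] m(3) \<phi>(2) by metis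
  then have "e x \<in> Mell" unfolding Mell_def using sU U(1) by blast
  moreover have "e x \<in> V0" using V0_mem[OF o, of 1] \<phi>(2) by simp
  ultimately show ?thesis using V0_Mell_trivial by blast
qed

lemma distal_V0: assumes "eqproj v" "distal_Euclidean act (range v)" shows "range v <= V0"
proof
  fix x assume x: "x \<in> range v"
  obtain n f g where iso: "Euclidean_iso (range v) n f g" using assms(2) by (rule distal_EuclideanE)
  have sv: "add_subgroup (range v)" by (rule eqproj_range_subgroup[OF assms(1)])
  note E = Euclidean_isoD[OF iso sv]
  have "(%r. g (%i. r * f x i)) 1 \<in> V0" by (rule V0_mem[OF Euclidean_oneparam[OF iso sv E(3)[OF x]]])
  then show "x \<in> V0" using E(1)[OF x] by simp
qed

text \<open>The coordinates of \<open>v x\<close> in the distal space tend to 0 along the orbit of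
  the contracting element, which \<open>distal_functional_zero\<close> permits only for the value
  0.\<close>

lemma contractable_distal_zero:
  assumes r: "eqproj r" "contractable act (range r)" and v: "eqproj v" "distal_Euclidean act (range v)" and x: "x \<in> range r"
  shows "v x = 0"
proof -
  obtain a where a: "contracting_on (range r) (act a)" using r(2) unfolding contractable_def by blast
  obtain n f g where iso: "Euclidean_iso (range v) n f g"
    and eig: "!!a lam. complex_eigenvalue n (%x. f (act a (g x))) lam ==> cmod lam = 1" using distal_EuclideanE[OF v(2)] by metis
  have sv: "add_subgroup (range v)" by (rule eqproj_range_subgroup[OF v(1)])
  note E = Euclidean_isoD[OF iso sv]
  have "f (v x) i = 0" for i
  proof (rule distal_functional_zero[OF iso sv, where F = "act a" and ps = "%y. f y i"])
    show "continuous_on (range v) (%y. f y i)" by (rule continuous_on_product_then_coordinatewise[OF E(5)])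
    have "continuous_on UNIV (%z. f (v z))" by (rule continuous_on_compose2[OF E(5) eqprojD(2)[OF v(1)]]) simp
    then have "continuous_on UNIV (%z. f (v z) i)" by (rule continuous_on_product_then_coordinatewise)
    then have "(%n. f (v ((act a ^^ n) x)) i) \<longlonglongrightarrow> f (v 0) i"
      by (rule continuous_on_tendsto_compose[OF _ contracting_tendsto[OF a x]]) auto
    then show "(%n. f ((act a ^^ n) (v x)) i) \<longlonglongrightarrow> 0" by (simp add: eqproj_funpow[OF v(1)] eqprojD(5)[OF v(1)] E(9))
  qed (use eig eqproj_range_act[OF v(1)] act_continuous act_add E(7) in auto)
  then have "f (v x) = f 0" unfolding E(9) by blast
  then show ?thesis using E(1)[of "v x"] E(1)[OF add_subgroupD(1)[OF sv]] by simp
qed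

text \<open>Naturality puts \<open>r x\<close> in \<open>V0\<close>, where the coordinates
  \<open>th j\<close> detect 0. Each functional \<open>th j\<close> after \<open>r\<close> is
  considered on the distal space; it tends to 0 along the orbit of \<open>x\<close> since
  \<open>r x\<close> is contracted.\<close>

lemma distal_contractable_zero:
  assumes r: "eqproj r" "contractable act (range r)" and v: "eqproj v" "distal_Euclidean act (range v)" and x: "x \<in> range v"
  shows "r x = 0"
proof -
  obtain a where a: "contracting_on (range r) (act a)" using r(2) unfolding contractable_def by blast
  obtain n f g where iso: "Euclidean_iso (range v) n f g"
    and eig: "!!a lam. complex_eigenvalue n (%x. f (act a (g x))) lam ==> cmod lam = 1" using distal_EuclideanE[OF v(2)] by metis
  have sv: "add_subgroup (range v)" by (rule eqproj_range_subgroup[OF v(1)])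
  have xV: "x \<in> V0" using distal_V0[OF v] x by blast
  show ?thesis
  proof (rule V0_ext[OF eqproj_V0[OF r(1) xV]])
    fix j assume "j < d"
    have c: "continuous_on UNIV (%y. th j (r y))" by (rule continuous_on_compose2[OF th_cont eqprojD(2)[OF r(1)]]) simp
    show "th j (r x) = 0"
    proof (rule distal_functional_zero[OF iso sv, where F = "act a" and ps = "%y. th j (r y)"])
      show "continuous_on (range v) (%y. th j (r y))" by (rule continuous_on_subset[OF c]) simp
      have "(%n. th j ((act a ^^ n) (r x))) \<longlonglongrightarrow> th j 0"
        by (rule continuous_on_tendsto_compose[OF th_cont contracting_tendsto[OF a]]) auto
      then show "(%n. th j (r ((act a ^^ n) x))) \<longlonglongrightarrow> 0" by (simp add: eqproj_funpow[OF r(1)] th_zero)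
    qed (use x eig eqproj_range_act[OF v(1)] act_continuous act_add th_add eqprojD(1)[OF r(1)] in auto)
  qed
qed

text \<open>The two components of an element in summands of a different kind vanish, six cases in
  all. Only inclusions are proved, so that exchanging the two decompositions yields
  equality.\<close>

lemma decomposition_le:
  assumes p: "polyc p" and e: "eqproj e" "amorphic act (range e)" and v: "eqproj v" "distal_Euclidean act (range v)"
    and p': "polyc p'" and e': "eqproj e'" "amorphic act (range e')" and v': "eqproj v'" "distal_Euclidean act (range v')"
    and sum': "!!x. p' x + e' x + v' x = x"
  shows "range p <= range p'" "range e <= range e'" "range v <= range v'"
proof -
  show "range p <= range p'"
  proof
    fix x assume x: "x \<in> range p"
    obtain k :: nat and ps where d: "!!i. i < k ==> eqproj (ps i)" "!!i. i < k ==> contractable act (range (ps i))"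
      "!!x. p x = (\<Sum>i<k. ps i x)" using polyc_data[OF p] by metis
    have xs: "x = (\<Sum>i<k. ps i x)" using x eqproj_range[OF polyc_eqproj[OF p]] d(3)[of x] by simp
    have "e' (\<Sum>i<k. ps i x) = 0" unfolding eqprojD(8)[OF e'(1)]
      by (rule sum.neutral) (use contractable_amorphic_zero[OF d(1,2) e'] in auto)
    moreover have "v' (\<Sum>i<k. ps i x) = 0" unfolding eqprojD(8)[OF v'(1)]
      by (rule sum.neutral) (use contractable_distal_zero[OF d(1,2) v'] in auto)
    ultimately have "p' x = x" using sum'[of x] unfolding xs[symmetric] by simp
    then show "x \<in> range p'" by (metis rangeI)
  qed
  show "range e <= range e'"
  proof
    fix x assume x: "x \<in> range e"
    have "p' x = 0" by (rule amorphic_hom_zero[OF e polyc_eqproj[OF p'] polyc_no_compact[OF p'] x])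
    moreover have "v' x = 0"
    proof (rule amorphic_hom_zero[OF e v'(1) _ x])
      fix C assume "compact C" "add_subgroup C" "C <= range v'"
      then have "C <= Mell" "C <= V0" unfolding Mell_def using distal_V0[OF v'] by blast+
      then show "C <= {0}" using V0_Mell_trivial by blast
    qed
    ultimately have "e' x = x" using sum'[of x] by simp
    then show "x \<in> range e'" by (metis rangeI)
  qed
  show "range v <= range v'"
  proof
    fix x assume x: "x \<in> range v"
    obtain k :: nat and ps where d: "!!i. i < k ==> eqproj (ps i)" "!!i. i < k ==> contractable act (range (ps i))"
      "!!x. p' x = (\<Sum>i<k. ps i x)" using polyc_data[OF p'] by metis
    have "p' x = 0" unfolding d(3) by (rule sum.neutral) (use distal_contractable_zero[OF d(1,2) v x] in auto)
    moreover have "e' x = 0" by (rule Euclidean_amorphic_zero[OF e']) (use distal_V0[OF v] x in blast)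
    ultimately have "v' x = x" using sum'[of x] by simp
    then show "x \<in> range v'" by (metis rangeI)
  qed
qed

end

section \<open>Existence and uniqueness of the decomposition\<close>

lemma (in sheer_module) real_part_exists: obtains pV d ph th where "real_part act pV d ph th"
proof -
  obtain pV where pV: "eqproj pV" "range pV = V0" "!!x. x - pV x \<in> Mell" using Euclidean_projection by metis
  show ?thesis
  proof (rule real_dual_basis[of "{\<phi>. oneparam \<phi>}"])
    fix d :: nat and ph :: "nat => real => 'b" and th :: "nat => 'b => real"
    assume "!!j. j < d ==> ph j \<in> {\<phi>. oneparam \<phi>}" "!!j x y. th j (x + y) = th j x + (th j y :: real)"
      "!!j. continuous_on UNIV (th j)" "!!\<phi>. \<phi> \<in> {\<phi>. oneparam \<phi>} ==> \<phi> 1 = (\<Sum>j<d. ph j (th j (\<phi> 1)))"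
    then have "real_part act pV d ph th" by unfold_locales (use pV in auto)
    then show thesis by (rule that)
  qed (auto intro: oneparam_zero oneparam_scale oneparam_diff)
qed

context cg_module
begin

text \<open>The elliptic and the Euclidean decomposition are put side by side. Cross terms vanish
  because the projections of one take values in \<open>Mell\<close>, those of the other in
  \<open>V0\<close>, and each kills the opposite part.\<close>

lemma decomposition_exists:
  obtains p e v where "polyc p" "eqproj e" "amorphic act (range e)" "eqproj v" "distal_Euclidean act (range v)"
    "top_direct_sum3 (range p) (range e) (range v)"
proof -
  obtain p1 e where p1: "polyc p1" and e: "eqproj e" "amorphic act (range e)" "range e <= Mell"
    and z: "!!x. x \<in> V0 ==> p1 x = 0" "!!x. x \<in> V0 ==> e x = 0"
    and s: "!!x. x \<in> Mell ==> p1 x + e x = x" and o: "!!x. p1 (e x) = 0" "!!x. e (p1 x) = 0" and p1M: "range p1 <= Mell"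
  proof (rule elliptic_decomposition)
    fix p e assume "polyc p" "eqproj e" "amorphic act (range e)" "range e <= Mell" "!!x. x \<in> V0 ==> p x = 0" "!!x. x \<in> V0 ==> e x = 0"
      "!!x. x \<in> Mell ==> p x + e x = x" "!!x. p (e x) = 0" "!!x. e (p x) = 0" "range p <= Mell"
    then show thesis by (rule that)
  qed
  obtain pV d ph th where "real_part act pV d ph th" by (rule real_part_exists)
  then interpret real_part act pV d ph th .
  obtain p2 v where p2: "polyc p2" and v: "eqproj v" "distal_Euclidean act (range v)" and s2: "!!x. p2 x + v x = pV x"
    and o2: "!!x. p2 (v x) = 0" "!!x. v (p2 x) = 0" using Euclidean_decomposition by metis
  have e1: "eqproj p1" "eqproj p2" using polyc_eqproj p1 p2 by auto
  have V: "p2 x \<in> V0" "v x \<in> V0" for x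
  proof -
    have "pV (p2 x) = p2 x" "pV (v x) = v x" using s2[of "p2 x"] s2[of "v x"] by (simp_all add: o2 eqprojD(4)[OF e1(2)] eqprojD(4)[OF v(1)])
    then show "p2 x \<in> V0" "v x \<in> V0" using pV_V0 by metis+
  qed
  have M: "p2 x = 0" "v x = 0" if "x \<in> Mell" for x
  proof -
    have "pV x = 0" using eqproj_Mell[OF pV(1) that] pV_V0[of x] V0_Mell_trivial by blast
    then have "p2 x + v x = 0" using s2[of x] by simp
    then have "p2 (p2 x + v x) = 0" "v (p2 x + v x) = 0" by (simp_all add: eqprojD(5)[OF e1(2)] eqprojD(5)[OF v(1)])
    then show "p2 x = 0" "v x = 0" by (simp_all add: o2 eqprojD(1,4)[OF e1(2)] eqprojD(1,4)[OF v(1)])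
  qed
  have m: "p1 x \<in> Mell" "e x \<in> Mell" for x using p1M e(3) by auto
  define p where "p x = p1 x + p2 x" for x
  have p: "polyc p" unfolding p_def[abs_def] by (rule polyc_add2[OF p1 p2], rule z(1)[OF V(1)], rule M(1)[OF m(1)])
  have sum: "p x + e x + v x = x" for x
  proof -
    have "p1 (x - pV x) = p1 x" "e (x - pV x) = e x" using z pV_V0 by (simp_all add: eqprojD(6)[OF e1(1)] eqprojD(6)[OF e(1)])
    then have "p1 x + e x = x - pV x" using s[OF pV(3), of x] by simp
    moreover have "p x + e x + v x = (p1 x + e x) + (p2 x + v x)" unfolding p_def by (simp add: algebra_simps)
    ultimately show ?thesis unfolding s2 by simp
  qed
  have "top_direct_sum3 (range p) (range e) (range v)"
  proof (rule direct_sum_of_projections[OF polyc_eqproj[OF p] e(1) v(1) sum])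
    show "p (e x) = 0" for x unfolding p_def using o(1) M(1)[OF m(2)] by simp
    show "p (v x) = 0" for x unfolding p_def using z(1) V(2) o2(1) by simp
    show "e (p x) = 0" for x unfolding p_def using o(2) z(2) V(1) by (simp add: eqprojD(1)[OF e(1)])
    show "e (v x) = 0" for x using z(2) V(2) by simp
    show "v (p x) = 0" for x unfolding p_def using M(2)[OF m(1)] o2(2) by (simp add: eqprojD(1)[OF v(1)])
    show "v (e x) = 0" for x by (rule M(2)[OF m(2)])
  qed
  then show ?thesis using that p e(1,2) v by blast
qed

lemma decomposition_unique:
  assumes S: "closed_submodule act UNIV P" "closed_submodule act UNIV E" "closed_submodule act UNIV V" "top_direct_sum3 P E V"
      "polycontractable act P" "amorphic act E" "distal_Euclidean act V"
    and S': "closed_submodule act UNIV P'" "closed_submodule act UNIV E'" "closed_submodule act UNIV V'" "top_direct_sum3 P' E' V'"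
      "polycontractable act P'" "amorphic act E'" "distal_Euclidean act V'"
  shows "P = P'" "E = E'" "V = V'"
proof -
  obtain pV d ph th where "real_part act pV d ph th" by (rule real_part_exists)
  then interpret real_part act pV d ph th .
  obtain p e v where d: "eqproj p" "eqproj e" "eqproj v" "range p = P" "range e = E" "range v = V" "!!x. p x + e x + v x = x"
    using direct_sum_projections[OF S(1-4)] by metis
  obtain p' e' v' where d': "eqproj p'" "eqproj e'" "eqproj v'" "range p' = P'" "range e' = E'" "range v' = V'" "!!x. p' x + e' x + v' x = x"
    using direct_sum_projections[OF S'(1-4)] by metis
  note a = polycontractable_polyc[OF d(1) S(5)[folded d(4)]] d(2) S(6)[folded d(5)] d(3) S(7)[folded d(6)]
  note a' = polycontractable_polyc[OF d'(1) S'(5)[folded d'(4)]] d'(2) S'(6)[folded d'(5)] d'(3) S'(7)[folded d'(6)]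
  show "P = P'" "E = E'" "V = V'"
    using decomposition_le[OF a a' d'(7)] decomposition_le[OF a' a d(7)] unfolding d(4-6) d'(4-6) by auto
qed

end

theorem mainTheorem3:
  fixes act :: "'a::{topological_ab_group_add, t2_space} \<Rightarrow> 'm::{topological_ab_group_add, t2_space} \<Rightarrow> 'm"
  assumes "LCA_group TYPE('a)"
    and "compactly_generated TYPE('a)"
    and "LC_module act"
    and "sheer act (UNIV :: 'm set)"
  shows "\<exists>!(P, E, V). closed_submodule act UNIV P \<and> closed_submodule act UNIV E \<and>
            closed_submodule act UNIV V \<and> top_direct_sum3 P E V \<and>
            polycontractable act P \<and> amorphic act E \<and> distal_Euclidean act V"
proof -
  interpret cg_module act
  proof unfold_locales
    show "LC_module act" "compactly_generated TYPE('a)" by fact+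
    show "K = {0}" if K: "submodule act UNIV K" "compact_parafinite act K" for K
    proof -
      have "K <= \<Union>{K. submodule act UNIV K & compact_parafinite act K}" using K by blast
      also have "\<dots> <= W_flat act UNIV" unfolding W_flat_def by (rule generated_subset)
      also have "\<dots> = {0}" using assms(4) unfolding sheer_def by blast
      finally show ?thesis using K(1) add_subgroupD(1)[of K] unfolding submodule_def by blast
    qed
    show "U = UNIV" if U: "submodule act UNIV U" "open U" "purely_discrete_quotient act UNIV U" for U
    proof -
      have "open_submodule act UNIV U" unfolding open_submodule_def using U(1,2) by simp
      then have "Omega_sharp act UNIV <= U" unfolding Omega_sharp_def using U(3) by blast
      then show ?thesis using assms(4) unfolding sheer_def by blast
    qed
  qed
  show ?thesis
  proof (rule ex_ex1I)
    obtain p e v where d: "polyc p" "eqproj e" "amorphic act (range e)" "eqproj v" "distal_Euclidean act (range v)"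
      "top_direct_sum3 (range p) (range e) (range v)" by (rule decomposition_exists)
    show "\<exists>D. case D of (P, E, V) => closed_submodule act UNIV P & closed_submodule act UNIV E &
        closed_submodule act UNIV V & top_direct_sum3 P E V & polycontractable act P & amorphic act E & distal_Euclidean act V"
      by (rule exI[of _ "(range p, range e, range v)"])
        (simp add: d eqproj_closed_submodule polyc_eqproj polyc_polycontractable)
  next
    fix D D' assume "case D of (P, E, V) => closed_submodule act UNIV P & closed_submodule act UNIV E &
        closed_submodule act UNIV V & top_direct_sum3 P E V & polycontractable act P & amorphic act E & distal_Euclidean act V"
      "case D' of (P, E, V) => closed_submodule act UNIV P & closed_submodule act UNIV E &
        closed_submodule act UNIV V & top_direct_sum3 P E V & polycontractable act P & amorphic act E & distal_Euclidean act V"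
    moreover obtain P E V where "D = (P, E, V)" by (rule prod_cases3)
    moreover obtain P' E' V' where "D' = (P', E', V')" by (rule prod_cases3)
    ultimately show "D = D'" using decomposition_unique[of P E V P' E' V'] by simp
  qed
qed

end
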